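(* Let $w \in \{s,p,l,c\}$ be a weakness, and let $\Psi$ be a class of weights for tight limits. Further let $\mathcal S$ and $\mathcal T$ be $\Psi$-limit $\mathcal F$-sketches and let $\mathbb C$ be a $\Psi$-complete $\mathcal F$-category. Then there is an isomorphism of $\Psi$-complete $\mathcal F$-categories $$\mathbb{M}\mathrm{od}_w(\mathcal S, \mathbb{M}\mathrm{od}_{\overline w}(\mathcal T, \mathbb C)) \cong \mathbb{M}\mathrm{od}_{\overline w}(\mathcal T, \mathbb{M}\mathrm{od}_w(\mathcal S, \mathbb C)),$$ where the objects on either side are the $\mathcal F$-functors sending the specified weighted cones to weighted limit cones.
   Context: **$\mathcal F$-categories.** $\mathcal F$ is the full subcategory of the arrow category $\mathrm{CAT}^{\to}$ of the category of small categories spanned by the full embeddings $A\colon A_\tau \to A_\lambda$ (fully faithful, injective-on-objects functors); it is complete, cocomplete and cartesian closed. An $\mathcal F$-category (enhanced 2-category) $\mathbb C$ is a category enriched in $\mathcal F$; equivalently, a 2-category $\mathbb C_\lambda$, whose 1-cells are called loose morphisms, with a wide, locally full sub-2-category $\mathbb C_\tau$, whose 1-cells are called tight. An $\mathcal F$-functor is a 2-functor $\mathbb C_\lambda\to\mathbb D_\lambda$ preserving tightness. $\mathcal F$ itself is an $\mathcal F$-category $\mathbb F$: loose morphisms $A\to B$ are functors $A_\lambda\to B_\lambda$, the tight ones are those restricting to $A_\tau \to B_\tau$, and 2-cells are natural transformations. All $\mathcal F$-categories and sketches are assumed small. **Weaknesses.** The set of weaknesses is $\{s,p,l,c\}$ (strict,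 pseudo, lax, colax), partially ordered by $s\le p$, $p\le l$, $p\le c$, with involution $\overline{(-)}$ fixing $s,p$ and exchanging $l,c$. For a square with top $f$, left $g$, right $h$, bottom $k$: an $l$-cell is a 2-cell $hf\Rightarrow kg$; a $c$-cell is a 2-cell $kg\Rightarrow hf$; a $p$-cell is an invertible $l$-cell; an $s$-cell is an identity 2-cell. **Functor $\mathcal F$-categories.** For a weakness $w$, $\mathbb{F}\mathrm{un}_{w}(\mathbb S,\mathbb C)$ is the $\mathcal F$-category with objects the $\mathcal F$-functors $\mathbb S\to\mathbb C$; loose morphisms $M\to N$ the $w$-natural transformations $\phi$ between the underlying 2-functors on loose parts (2-natural, pseudonatural, lax natural, colax natural for $w=s,p,l,c$: loose components $\phi_S\colon MS\to NS$, and for each loose $s\colon S\to S'$ a $w$-cell $\phi_s$ in the square with top $\phi_S$, left $M(s)$, right $N(s)$, bottom $\phi_{S'}$, subject to the usual axioms) such that $\phi_s$ is an identity whenever $s$ is tight; such a morphism is tight when every $\phi_S$ is tight and every $\phi_s$ is an identity; 2-cells are modifications. **Sketches and models.** An $\mathcal F$-weight is an $\mathcal F$-functor $W\colon\mathbb J\to\mathbb F$ with $\mathbb J$ small. A $W$-weighted cone over $D\colon\mathbb J\to\mathbb C$ is an object $X\in\mathbb C$ with an $\mathcal F$-natural transformation $\gamma\colon W\Rightarrow\mathbb C(X,D-)$; it is a limit cone when the induced $\mathbb C(C,X)\to[\mathbb J,\mathbb F](W,\mathbb C(C,D-))$ is invertible in $\mathcal F$ for every $C$. A (limit) $\mathcal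 F$-sketch $\mathcal S$ is a small $\mathcal F$-category $\mathbb S$ with a class of weighted cones in it; a $\Psi$-limit $\mathcal F$-sketch is one whose weights all belong to $\Psi$. A sketch morphism is an $\mathcal F$-functor sending specified cones to specified cones. An $\mathcal F$-category is viewed as a sketch by specifying its weighted limit cones, and is $\Psi$-complete if it has all $W$-weighted limits for $W\in\Psi$. A model of $\mathcal S$ in $\mathcal C$ is a sketch morphism $\mathcal S\to\mathcal C$, and $\mathbb{M}\mathrm{od}_{w}(\mathcal S,\mathcal C)$ is the full sub-$\mathcal F$-category of $\mathbb{F}\mathrm{un}_{w}(\mathbb S,\mathbb C)$ on the models. **Tight limits.** For a 2-category $\mathscr J$, let $\mathscr J^+$ be the chordate $\mathcal F$-category on $\mathscr J$ (every morphism is tight). A weight for a tight limit is an $\mathcal F$-weight of the form $W^+\colon\mathscr J^+\to\mathbb F$, where $W\colon\mathscr J\to\mathrm{CAT}$ is a 2-functor with $\mathscr J$ a small 2-category, and $W^+(J)$ is the identity embedding on $W(J)$. Equivalently, $W^+$-weighted limits in $\mathbb C$ are $W$-weighted 2-limits in $\mathbb C_\tau$ preserved by the inclusion $\mathbb C_\tau\to\mathbb C_\lambda$. *)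

theory Defs
  imports "HOL-Library.FuncSet"
begin

text \<open>
  Conventions.  A category (2-category, \<open>F\<close>-category) is a record consisting of carrier sets and
  operations on the ambient types; the operations are only constrained on the carriers.  Maps
  between structures (functors, components of transformations) are \<open>undefined\<close> outside the carriers
  (\<^const>\<open>extensional\<close>), so that HOL equality of maps is equality of mathematical maps.
  All composites are in functional order: \<open>cmp A g f\<close> is \<open>g\<close> after \<open>f\<close>.
\<close>

section \<open>Categories, functors, natural transformations\<close>

record ('o, 'm) cat =
  Ob :: "'o set"
  Ar :: "'m set"
  src :: "'m \<Rightarrow> 'o"
  trg :: "'m \<Rightarrow> 'o"
  idn :: "'o \<Rightarrow> 'm"
  cmp :: "'m \<Rightarrow> 'm \<Rightarrow> 'm"

locale category =
  fixes A :: "('o, 'm) cat"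
  assumes src_Ob: "f \<in> Ar A \<Longrightarrow> src A f \<in> Ob A"
    and trg_Ob: "f \<in> Ar A \<Longrightarrow> trg A f \<in> Ob A"
    and idn_Ar: "x \<in> Ob A \<Longrightarrow> idn A x \<in> Ar A"
    and src_idn: "x \<in> Ob A \<Longrightarrow> src A (idn A x) = x"
    and trg_idn: "x \<in> Ob A \<Longrightarrow> trg A (idn A x) = x"
    and cmp_Ar: "\<lbrakk>f \<in> Ar A; g \<in> Ar A; trg A f = src A g\<rbrakk> \<Longrightarrow> cmp A g f \<in> Ar A"
    and src_cmp: "\<lbrakk>f \<in> Ar A; g \<in> Ar A; trg A f = src A g\<rbrakk> \<Longrightarrow> src A (cmp A g f) = src A f"
    and trg_cmp: "\<lbrakk>f \<in> Ar A; g \<in> Ar A; trg A f = src A g\<rbrakk> \<Longrightarrow> trg A (cmp A g f) = trg A g"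
    and cmp_idn_left: "f \<in> Ar A \<Longrightarrow> cmp A (idn A (trg A f)) f = f"
    and cmp_idn_right: "f \<in> Ar A \<Longrightarrow> cmp A f (idn A (src A f)) = f"
    and cmp_assoc: "\<lbrakk>f \<in> Ar A; g \<in> Ar A; h \<in> Ar A; trg A f = src A g; trg A g = src A h\<rbrakk>
      \<Longrightarrow> cmp A (cmp A h g) f = cmp A h (cmp A g f)"

definition homset :: "('o, 'm) cat \<Rightarrow> 'o \<Rightarrow> 'o \<Rightarrow> 'm set" where
  "homset A x y = {f \<in> Ar A. src A f = x \<and> trg A f = y}"

definition full_subcat :: "('o, 'm) cat \<Rightarrow> 'o set \<Rightarrow> ('o, 'm) cat" where
  "full_subcat A P = A\<lparr>Ob := Ob A \<inter> P, Ar := {f \<in> Ar A. src A f \<in> P \<and> trg A f \<in> P}\<rparr>"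

record ('o1, 'm1, 'o2, 'm2) functr =
  on_ob :: "'o1 \<Rightarrow> 'o2"
  on_ar :: "'m1 \<Rightarrow> 'm2"

definition is_functor ::
  "('o1, 'm1) cat \<Rightarrow> ('o2, 'm2) cat \<Rightarrow> ('o1, 'm1, 'o2, 'm2) functr \<Rightarrow> bool" where
  "is_functor A B F \<longleftrightarrow>
    on_ob F \<in> Ob A \<rightarrow>\<^sub>E Ob B \<and> on_ar F \<in> Ar A \<rightarrow>\<^sub>E Ar B \<and>
    (\<forall>f\<in>Ar A. src B (on_ar F f) = on_ob F (src A f) \<and> trg B (on_ar F f) = on_ob F (trg A f)) \<and>
    (\<forall>x\<in>Ob A. on_ar F (idn A x) = idn B (on_ob F x)) \<and>
    (\<forall>f\<in>Ar A. \<forall>g\<in>Ar A. trg A f = src A g \<longrightarrow>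
      on_ar F (cmp A g f) = cmp B (on_ar F g) (on_ar F f))"

definition id_functor :: "('o, 'm) cat \<Rightarrow> ('o, 'm, 'o, 'm) functr" where
  "id_functor A = \<lparr>on_ob = (\<lambda>x\<in>Ob A. x), on_ar = (\<lambda>f\<in>Ar A. f)\<rparr>"

text \<open>\<open>comp_functor A G F\<close> is \<open>G\<close> after \<open>F\<close>, where \<open>A\<close> is the domain of \<open>F\<close>.\<close>

definition comp_functor :: "('o1, 'm1) cat \<Rightarrow> ('o2, 'm2, 'o3, 'm3) functr \<Rightarrow>
    ('o1, 'm1, 'o2, 'm2) functr \<Rightarrow> ('o1, 'm1, 'o3, 'm3) functr" where
  "comp_functor A G F =
    \<lparr>on_ob = compose (Ob A) (on_ob G) (on_ob F), on_ar = compose (Ar A) (on_ar G) (on_ar F)\<rparr>"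

definition is_nat_trans :: "('o1, 'm1) cat \<Rightarrow> ('o2, 'm2) cat \<Rightarrow> ('o1, 'm1, 'o2, 'm2) functr \<Rightarrow>
    ('o1, 'm1, 'o2, 'm2) functr \<Rightarrow> ('o1 \<Rightarrow> 'm2) \<Rightarrow> bool" where
  "is_nat_trans A B F G t \<longleftrightarrow>
    t \<in> extensional (Ob A) \<and>
    (\<forall>x\<in>Ob A. t x \<in> homset B (on_ob F x) (on_ob G x)) \<and>
    (\<forall>f\<in>Ar A. cmp B (on_ar G f) (t (src A f)) = cmp B (t (trg A f)) (on_ar F f))"

section \<open>2-categories and \<open>F\<close>-categories\<close>

record ('o, 'm, 'c) two_cat =
  Obj :: "'o set"
  Mor :: "'m set"
  Cell :: "'c set"
  dom1 :: "'m \<Rightarrow> 'o"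
  cod1 :: "'m \<Rightarrow> 'o"
  id1 :: "'o \<Rightarrow> 'm"
  cmp1 :: "'m \<Rightarrow> 'm \<Rightarrow> 'm"
  dom2 :: "'c \<Rightarrow> 'm"
  cod2 :: "'c \<Rightarrow> 'm"
  id2 :: "'m \<Rightarrow> 'c"
  vcmp :: "'c \<Rightarrow> 'c \<Rightarrow> 'c"
  hcmp :: "'c \<Rightarrow> 'c \<Rightarrow> 'c"

definition mor_cat :: "('o, 'm, 'c, 'z) two_cat_scheme \<Rightarrow> ('o, 'm) cat" where
  "mor_cat C = \<lparr>Ob = Obj C, Ar = Mor C, src = dom1 C, trg = cod1 C, idn = id1 C, cmp = cmp1 C\<rparr>"

definition vert_cat :: "('o, 'm, 'c, 'z) two_cat_scheme \<Rightarrow> ('m, 'c) cat" where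
  "vert_cat C = \<lparr>Ob = Mor C, Ar = Cell C, src = dom2 C, trg = cod2 C, idn = id2 C, cmp = vcmp C\<rparr>"

definition horiz_cat :: "('o, 'm, 'c, 'z) two_cat_scheme \<Rightarrow> ('o, 'c) cat" where
  "horiz_cat C = \<lparr>Ob = Obj C, Ar = Cell C, src = dom1 C \<circ> dom2 C, trg = cod1 C \<circ> dom2 C,
     idn = id2 C \<circ> id1 C, cmp = hcmp C\<rparr>"

locale two_category =
  fixes C :: "('o, 'm, 'c, 'z) two_cat_scheme"
  assumes mor: "category (mor_cat C)"
    and vert: "category (vert_cat C)"
    and horiz: "category (horiz_cat C)"
    and dom1_cod2: "\<alpha> \<in> Cell C \<Longrightarrow> dom1 C (cod2 C \<alpha>) = dom1 C (dom2 C \<alpha>)"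
    and cod1_cod2: "\<alpha> \<in> Cell C \<Longrightarrow> cod1 C (cod2 C \<alpha>) = cod1 C (dom2 C \<alpha>)"
    and dom2_hcmp: "\<lbrakk>\<alpha> \<in> Cell C; \<beta> \<in> Cell C; cod1 C (dom2 C \<alpha>) = dom1 C (dom2 C \<beta>)\<rbrakk>
      \<Longrightarrow> dom2 C (hcmp C \<beta> \<alpha>) = cmp1 C (dom2 C \<beta>) (dom2 C \<alpha>)"
    and cod2_hcmp: "\<lbrakk>\<alpha> \<in> Cell C; \<beta> \<in> Cell C; cod1 C (dom2 C \<alpha>) = dom1 C (dom2 C \<beta>)\<rbrakk>
      \<Longrightarrow> cod2 C (hcmp C \<beta> \<alpha>) = cmp1 C (cod2 C \<beta>) (cod2 C \<alpha>)"
    and hcmp_id2: "\<lbrakk>f \<in> Mor C; g \<in> Mor C; cod1 C f = dom1 C g\<rbrakk>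
      \<Longrightarrow> hcmp C (id2 C g) (id2 C f) = id2 C (cmp1 C g f)"
    and interchange: "\<lbrakk>\<alpha> \<in> Cell C; \<alpha>' \<in> Cell C; \<beta> \<in> Cell C; \<beta>' \<in> Cell C;
        cod2 C \<alpha> = dom2 C \<alpha>'; cod2 C \<beta> = dom2 C \<beta>'; cod1 C (dom2 C \<alpha>) = dom1 C (dom2 C \<beta>)\<rbrakk>
      \<Longrightarrow> hcmp C (vcmp C \<beta>' \<beta>) (vcmp C \<alpha>' \<alpha>) = vcmp C (hcmp C \<beta>' \<alpha>') (hcmp C \<beta> \<alpha>)"

text \<open>The underlying 2-category of the record is the loose part; the tight part is the wide,
  locally full sub-2-category on the 1-cells in \<open>Tight\<close>.\<close>

record ('o, 'm, 'c) fcat = "('o, 'm, 'c) two_cat" +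
  Tight :: "'m set"

locale fcategory = two_category C for C :: "('o, 'm, 'c) fcat" +
  assumes Tight_Mor: "Tight C \<subseteq> Mor C"
    and Tight_id1: "X \<in> Obj C \<Longrightarrow> id1 C X \<in> Tight C"
    and Tight_cmp1: "\<lbrakk>f \<in> Tight C; g \<in> Tight C; cod1 C f = dom1 C g\<rbrakk> \<Longrightarrow> cmp1 C g f \<in> Tight C"

definition full_subfcat :: "('o, 'm, 'c) fcat \<Rightarrow> 'o set \<Rightarrow> ('o, 'm, 'c) fcat" where
  "full_subfcat C P = C\<lparr>
     Obj := Obj C \<inter> P,
     Mor := {f \<in> Mor C. dom1 C f \<in> P \<and> cod1 C f \<in> P},
     Cell := {\<alpha> \<in> Cell C. dom1 C (dom2 C \<alpha>) \<in> P \<and> cod1 C (dom2 C \<alpha>) \<in> P},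
     Tight := {f \<in> Tight C. dom1 C f \<in> P \<and> cod1 C f \<in> P}\<rparr>"

record ('o1, 'm1, 'c1, 'o2, 'm2, 'c2) two_fun =
  fun0 :: "'o1 \<Rightarrow> 'o2"
  fun1 :: "'m1 \<Rightarrow> 'm2"
  fun2 :: "'c1 \<Rightarrow> 'c2"

definition is_two_functor :: "('o1, 'm1, 'c1, 'y) two_cat_scheme \<Rightarrow>
    ('o2, 'm2, 'c2, 'z) two_cat_scheme \<Rightarrow> ('o1, 'm1, 'c1, 'o2, 'm2, 'c2) two_fun \<Rightarrow> bool" where
  "is_two_functor C D F \<longleftrightarrow>
    is_functor (mor_cat C) (mor_cat D) \<lparr>on_ob = fun0 F, on_ar = fun1 F\<rparr> \<and>
    is_functor (vert_cat C) (vert_cat D) \<lparr>on_ob = fun1 F, on_ar = fun2 F\<rparr> \<and>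
    is_functor (horiz_cat C) (horiz_cat D) \<lparr>on_ob = fun0 F, on_ar = fun2 F\<rparr>"

definition is_ffunctor :: "('o1, 'm1, 'c1) fcat \<Rightarrow> ('o2, 'm2, 'c2) fcat \<Rightarrow>
    ('o1, 'm1, 'c1, 'o2, 'm2, 'c2) two_fun \<Rightarrow> bool" where
  "is_ffunctor C D F \<longleftrightarrow> is_two_functor C D F \<and> (\<forall>f\<in>Tight C. fun1 F f \<in> Tight D)"

definition id_ffunctor :: "('o, 'm, 'c) fcat \<Rightarrow> ('o, 'm, 'c, 'o, 'm, 'c) two_fun" where
  "id_ffunctor C = \<lparr>fun0 = (\<lambda>X\<in>Obj C. X), fun1 = (\<lambda>f\<in>Mor C. f), fun2 = (\<lambda>\<alpha>\<in>Cell C. \<alpha>)\<rparr>"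

definition comp_ffunctor :: "('o1, 'm1, 'c1) fcat \<Rightarrow> ('o2, 'm2, 'c2, 'o3, 'm3, 'c3) two_fun \<Rightarrow>
    ('o1, 'm1, 'c1, 'o2, 'm2, 'c2) two_fun \<Rightarrow> ('o1, 'm1, 'c1, 'o3, 'm3, 'c3) two_fun" where
  "comp_ffunctor C G F = \<lparr>fun0 = compose (Obj C) (fun0 G) (fun0 F),
     fun1 = compose (Mor C) (fun1 G) (fun1 F), fun2 = compose (Cell C) (fun2 G) (fun2 F)\<rparr>"

definition fcat_isomorphic :: "('o1, 'm1, 'c1) fcat \<Rightarrow> ('o2, 'm2, 'c2) fcat \<Rightarrow> bool" where
  "fcat_isomorphic C D \<longleftrightarrow> (\<exists>F G. is_ffunctor C D F \<and> is_ffunctor D C G \<and>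
     comp_ffunctor C G F = id_ffunctor C \<and> comp_ffunctor D F G = id_ffunctor D)"

section \<open>The 2-category of categories and the \<open>F\<close>-category of full embeddings\<close>

text \<open>Morphisms in categories of structured objects carry their domain and codomain.\<close>

datatype ('a, 'f) arr = Arr (adom: 'a) (acod: 'a) (amap: 'f)

text \<open>The 2-category with objects \<open>U\<close>, where the object \<open>a\<close> stands for the category \<open>L a\<close>; 1-cells and
  2-cells are functors and natural transformations between these.  In \<open>hcmp\<close>, for \<open>s : F \<Rightarrow> F'\<close> and
  \<open>t : G \<Rightarrow> G'\<close>, the component at \<open>x\<close> is \<open>t\<^bsub>F' x\<^esub> \<circ> G (s\<^bsub>x\<^esub>)\<close>.\<close>

definition cats_over :: "'a set \<Rightarrow> ('a \<Rightarrow> ('o, 'm) cat) \<Rightarrow>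
    ('a, ('a, ('o, 'm, 'o, 'm) functr) arr,
     (('a, ('o, 'm, 'o, 'm) functr) arr, 'o \<Rightarrow> 'm) arr) two_cat" where
  "cats_over U L = \<lparr>
     Obj = U,
     Mor = {Arr a b F | a b F. a \<in> U \<and> b \<in> U \<and> is_functor (L a) (L b) F},
     Cell = {Arr (Arr a b F) (Arr a b G) t | a b F G t. a \<in> U \<and> b \<in> U \<and>
       is_functor (L a) (L b) F \<and> is_functor (L a) (L b) G \<and> is_nat_trans (L a) (L b) F G t},
     dom1 = adom,
     cod1 = acod,
     id1 = (\<lambda>a. Arr a a (id_functor (L a))),
     cmp1 = (\<lambda>g f. Arr (adom f) (acod g) (comp_functor (L (adom f)) (amap g) (amap f))),
     dom2 = adom,
     cod2 = acod,
     id2 = (\<lambda>f. Arr f f (\<lambda>x\<in>Ob (L (adom f)). idn (L (acod f)) (on_ob (amap f) x))),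
     vcmp = (\<lambda>t s. Arr (adom s) (acod t)
       (\<lambda>x\<in>Ob (L (adom (adom s))). cmp (L (acod (adom s))) (amap t x) (amap s x))),
     hcmp = (\<lambda>t s.
       Arr (Arr (adom (adom s)) (acod (adom t))
              (comp_functor (L (adom (adom s))) (amap (adom t)) (amap (adom s))))
           (Arr (adom (adom s)) (acod (adom t))
              (comp_functor (L (adom (adom s))) (amap (acod t)) (amap (acod s))))
           (\<lambda>x\<in>Ob (L (adom (adom s))). cmp (L (acod (adom t)))
              (amap t (on_ob (amap (acod s)) x)) (on_ar (amap (adom t)) (amap s x))))\<rparr>"

type_synonym ('o, 'm) cat1 = "(('o, 'm) cat, ('o, 'm, 'o, 'm) functr) arr"
type_synonym ('o, 'm) cat2 = "(('o, 'm) cat1, 'o \<Rightarrow> 'm) arr"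

definition CAT :: "(('o, 'm) cat, ('o, 'm) cat1, ('o, 'm) cat2) two_cat" where
  "CAT = cats_over {A. category A} (\<lambda>A. A)"

record ('o, 'm) embedding =
  loose :: "('o, 'm) cat"
  tight :: "('o, 'm) cat"
  emb :: "('o, 'm, 'o, 'm) functr"

definition full_embedding :: "('o, 'm) embedding \<Rightarrow> bool" where
  "full_embedding A \<longleftrightarrow> category (loose A) \<and> category (tight A) \<and>
    is_functor (tight A) (loose A) (emb A) \<and> inj_on (on_ob (emb A)) (Ob (tight A)) \<and>
    (\<forall>x\<in>Ob (tight A). \<forall>y\<in>Ob (tight A). bij_betw (on_ar (emb A))
      (homset (tight A) x y) (homset (loose A) (on_ob (emb A) x) (on_ob (emb A) y)))"

definition id_embedding :: "('o, 'm) cat \<Rightarrow> ('o, 'm) embedding" where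
  "id_embedding A = \<lparr>loose = A, tight = A, emb = id_functor A\<rparr>"

definition sub_embedding :: "('o, 'm) cat \<Rightarrow> 'o set \<Rightarrow> ('o, 'm) embedding" where
  "sub_embedding A P = \<lparr>loose = A, tight = full_subcat A P, emb = id_functor (full_subcat A P)\<rparr>"

definition tight_functor :: "('o1, 'm1) embedding \<Rightarrow> ('o2, 'm2) embedding \<Rightarrow>
    ('o1, 'm1, 'o2, 'm2) functr \<Rightarrow> bool" where
  "tight_functor A B F \<longleftrightarrow> is_functor (loose A) (loose B) F \<and>
    (\<exists>F'. is_functor (tight A) (tight B) F' \<and>
      comp_functor (tight A) (emb B) F' = comp_functor (tight A) F (emb A))"

type_synonym ('o, 'm) emb1 = "(('o, 'm) embedding, ('o, 'm, 'o, 'm) functr) arr"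
type_synonym ('o, 'm) emb2 = "(('o, 'm) emb1, 'o \<Rightarrow> 'm) arr"

definition FF :: "(('o, 'm) embedding, ('o, 'm) emb1, ('o, 'm) emb2) fcat" where
  "FF = two_cat.extend (cats_over {A. full_embedding A} loose)
     (fcat.fields {Arr A B F | A B F. full_embedding A \<and> full_embedding B \<and> tight_functor A B F})"

definition invertible_in_F :: "('o1, 'm1) embedding \<Rightarrow> ('o2, 'm2) embedding \<Rightarrow>
    ('o1, 'm1, 'o2, 'm2) functr \<Rightarrow> bool" where
  "invertible_in_F A B F \<longleftrightarrow> tight_functor A B F \<and> (\<exists>G. tight_functor B A G \<and>
     comp_functor (loose A) G F = id_functor (loose A) \<and>
     comp_functor (loose B) F G = id_functor (loose B))"

section \<open>Weights, weighted cones and limits\<close>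

record ('oj, 'mj, 'cj, 'x, 'y) weight =
  shape :: "('oj, 'mj, 'cj) fcat"
  wt :: "('oj, 'mj, 'cj, ('x, 'y) embedding, ('x, 'y) emb1, ('x, 'y) emb2) two_fun"

definition f_weight :: "('oj, 'mj, 'cj, 'x, 'y) weight \<Rightarrow> bool" where
  "f_weight \<omega> \<longleftrightarrow> fcategory (shape \<omega>) \<and> is_ffunctor (shape \<omega>) FF (wt \<omega>)"

definition chordate :: "('o, 'm, 'c) two_cat \<Rightarrow> ('o, 'm, 'c) fcat" where
  "chordate J = two_cat.extend J (fcat.fields (Mor J))"

definition plus_weight :: "('oj, 'mj, 'cj) two_cat \<Rightarrow>
    ('oj, 'mj, 'cj, ('x, 'y) cat, ('x, 'y) cat1, ('x, 'y) cat2) two_fun \<Rightarrow>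
    ('oj, 'mj, 'cj, 'x, 'y) weight" where
  "plus_weight J W = \<lparr>shape = chordate J,
     wt = \<lparr>fun0 = (\<lambda>j\<in>Obj J. id_embedding (fun0 W j)),
           fun1 = (\<lambda>u\<in>Mor J. map_arr id_embedding id (fun1 W u)),
           fun2 = (\<lambda>\<alpha>\<in>Cell J. map_arr (map_arr id_embedding id) id (fun2 W \<alpha>))\<rparr>\<rparr>"

definition tight_limit_weight :: "('oj, 'mj, 'cj, 'x, 'y) weight \<Rightarrow> bool" where
  "tight_limit_weight \<omega> \<longleftrightarrow>
    (\<exists>J W. two_category J \<and> is_two_functor J CAT W \<and> \<omega> = plus_weight J W)"

definition hom_cat :: "('o, 'm, 'c) fcat \<Rightarrow> 'o \<Rightarrow> 'o \<Rightarrow> ('m, 'c) cat" where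
  "hom_cat C X Y = \<lparr>
     Ob = {f \<in> Mor C. dom1 C f = X \<and> cod1 C f = Y},
     Ar = {\<alpha> \<in> Cell C. dom1 C (dom2 C \<alpha>) = X \<and> cod1 C (dom2 C \<alpha>) = Y},
     src = dom2 C, trg = cod2 C, idn = id2 C, cmp = vcmp C\<rparr>"

definition hom_obj :: "('o, 'm, 'c) fcat \<Rightarrow> 'o \<Rightarrow> 'o \<Rightarrow> ('m, 'c) embedding" where
  "hom_obj C X Y = sub_embedding (hom_cat C X Y) (Tight C)"

definition postcomp :: "('o, 'm, 'c) fcat \<Rightarrow> 'o \<Rightarrow> 'm \<Rightarrow> ('m, 'c) emb1" where
  "postcomp C X u = Arr (hom_obj C X (dom1 C u)) (hom_obj C X (cod1 C u))
     \<lparr>on_ob = (\<lambda>f\<in>Ob (hom_cat C X (dom1 C u)). cmp1 C u f),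
      on_ar = (\<lambda>\<alpha>\<in>Ar (hom_cat C X (dom1 C u)). hcmp C (id2 C u) \<alpha>)\<rparr>"

text \<open>The covariant representable \<open>C(X, -)\<close>.\<close>

definition representable :: "('o, 'm, 'c) fcat \<Rightarrow> 'o \<Rightarrow>
    ('o, 'm, 'c, ('m, 'c) embedding, ('m, 'c) emb1, ('m, 'c) emb2) two_fun" where
  "representable C X = \<lparr>
     fun0 = (\<lambda>Y\<in>Obj C. hom_obj C X Y),
     fun1 = (\<lambda>u\<in>Mor C. postcomp C X u),
     fun2 = (\<lambda>\<beta>\<in>Cell C. Arr (postcomp C X (dom2 C \<beta>)) (postcomp C X (cod2 C \<beta>))
       (\<lambda>f\<in>Ob (hom_cat C X (dom1 C (dom2 C \<beta>))). hcmp C \<beta> (id2 C f)))\<rparr>"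

text \<open>\<open>nat_obj J W K\<close> is the hom-object \<open>[J, FF](W, K)\<close> of the enriched functor category.  Its loose part
  consists of the 2-natural transformations between the loose parts of \<open>W\<close> and \<open>K\<close>, and of the
  modifications between them; its tight part is the full subcategory of the \<open>F\<close>-natural
  transformations, those with all components tight.  The weight and the hom-objects have values over
  different element types, hence the two instances of \<open>FF\<close>.\<close>

definition two_natural :: "('oj, 'mj, 'cj) fcat \<Rightarrow>
    ('oj, 'mj, 'cj, ('x, 'y) embedding, ('x, 'y) emb1, ('x, 'y) emb2) two_fun \<Rightarrow>
    ('oj, 'mj, 'cj, ('p, 'q) embedding, ('p, 'q) emb1, ('p, 'q) emb2) two_fun \<Rightarrow>
    ('oj \<Rightarrow> ('x, 'y, 'p, 'q) functr) \<Rightarrow> bool" where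
  "two_natural J W K \<gamma> \<longleftrightarrow>
    \<gamma> \<in> extensional (Obj J) \<and>
    (\<forall>j\<in>Obj J. is_functor (loose (fun0 W j)) (loose (fun0 K j)) (\<gamma> j)) \<and>
    (\<forall>u\<in>Mor J.
      comp_functor (loose (fun0 W (dom1 J u))) (amap (fun1 K u)) (\<gamma> (dom1 J u)) =
      comp_functor (loose (fun0 W (dom1 J u))) (\<gamma> (cod1 J u)) (amap (fun1 W u))) \<and>
    (\<forall>\<alpha>\<in>Cell J. \<forall>x\<in>Ob (loose (fun0 W (dom1 J (dom2 J \<alpha>)))).
      amap (fun2 K \<alpha>) (on_ob (\<gamma> (dom1 J (dom2 J \<alpha>))) x) =
      on_ar (\<gamma> (cod1 J (dom2 J \<alpha>))) (amap (fun2 W \<alpha>) x))"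

definition f_natural :: "('oj, 'mj, 'cj) fcat \<Rightarrow>
    ('oj, 'mj, 'cj, ('x, 'y) embedding, ('x, 'y) emb1, ('x, 'y) emb2) two_fun \<Rightarrow>
    ('oj, 'mj, 'cj, ('p, 'q) embedding, ('p, 'q) emb1, ('p, 'q) emb2) two_fun \<Rightarrow>
    ('oj \<Rightarrow> ('x, 'y, 'p, 'q) functr) \<Rightarrow> bool" where
  "f_natural J W K \<gamma> \<longleftrightarrow> two_natural J W K \<gamma> \<and>
    (\<forall>j\<in>Obj J. tight_functor (fun0 W j) (fun0 K j) (\<gamma> j))"

definition nat_modification :: "('oj, 'mj, 'cj) fcat \<Rightarrow>
    ('oj, 'mj, 'cj, ('x, 'y) embedding, ('x, 'y) emb1, ('x, 'y) emb2) two_fun \<Rightarrow>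
    ('oj, 'mj, 'cj, ('p, 'q) embedding, ('p, 'q) emb1, ('p, 'q) emb2) two_fun \<Rightarrow>
    ('oj \<Rightarrow> ('x, 'y, 'p, 'q) functr) \<Rightarrow> ('oj \<Rightarrow> ('x, 'y, 'p, 'q) functr) \<Rightarrow>
    ('oj \<Rightarrow> 'x \<Rightarrow> 'q) \<Rightarrow> bool" where
  "nat_modification J W K \<gamma> \<delta> m \<longleftrightarrow>
    m \<in> extensional (Obj J) \<and>
    (\<forall>j\<in>Obj J. is_nat_trans (loose (fun0 W j)) (loose (fun0 K j)) (\<gamma> j) (\<delta> j) (m j)) \<and>
    (\<forall>u\<in>Mor J. \<forall>x\<in>Ob (loose (fun0 W (dom1 J u))).
      on_ar (amap (fun1 K u)) (m (dom1 J u) x) = m (cod1 J u) (on_ob (amap (fun1 W u)) x))"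

definition nat_cat :: "('oj, 'mj, 'cj) fcat \<Rightarrow>
    ('oj, 'mj, 'cj, ('x, 'y) embedding, ('x, 'y) emb1, ('x, 'y) emb2) two_fun \<Rightarrow>
    ('oj, 'mj, 'cj, ('p, 'q) embedding, ('p, 'q) emb1, ('p, 'q) emb2) two_fun \<Rightarrow>
    ('oj \<Rightarrow> ('x, 'y, 'p, 'q) functr, ('oj \<Rightarrow> ('x, 'y, 'p, 'q) functr, 'oj \<Rightarrow> 'x \<Rightarrow> 'q) arr) cat" where
  "nat_cat J W K = \<lparr>
     Ob = {\<gamma>. two_natural J W K \<gamma>},
     Ar = {Arr \<gamma> \<delta> m | \<gamma> \<delta> m. two_natural J W K \<gamma> \<and> two_natural J W K \<delta> \<and>
       nat_modification J W K \<gamma> \<delta> m},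
     src = adom,
     trg = acod,
     idn = (\<lambda>\<gamma>. Arr \<gamma> \<gamma>
       (\<lambda>j\<in>Obj J. \<lambda>x\<in>Ob (loose (fun0 W j)). idn (loose (fun0 K j)) (on_ob (\<gamma> j) x))),
     cmp = (\<lambda>n m. Arr (adom m) (acod n)
       (\<lambda>j\<in>Obj J. \<lambda>x\<in>Ob (loose (fun0 W j)). cmp (loose (fun0 K j)) (amap n j x) (amap m j x)))\<rparr>"

definition nat_obj :: "('oj, 'mj, 'cj) fcat \<Rightarrow>
    ('oj, 'mj, 'cj, ('x, 'y) embedding, ('x, 'y) emb1, ('x, 'y) emb2) two_fun \<Rightarrow>
    ('oj, 'mj, 'cj, ('p, 'q) embedding, ('p, 'q) emb1, ('p, 'q) emb2) two_fun \<Rightarrow>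
    ('oj \<Rightarrow> ('x, 'y, 'p, 'q) functr,
      ('oj \<Rightarrow> ('x, 'y, 'p, 'q) functr, 'oj \<Rightarrow> 'x \<Rightarrow> 'q) arr) embedding" where
  "nat_obj J W K = sub_embedding (nat_cat J W K) {\<gamma>. f_natural J W K \<gamma>}"

record ('oj, 'mj, 'cj, 'x, 'y, 'o, 'm, 'c) cone =
  wgt :: "('oj, 'mj, 'cj, 'x, 'y) weight"
  dgm :: "('oj, 'mj, 'cj, 'o, 'm, 'c) two_fun"
  apex :: "'o"
  legs :: "'oj \<Rightarrow> ('x, 'y, 'm, 'c) functr"

definition weighted_cone ::
  "('o, 'm, 'c) fcat \<Rightarrow> ('oj, 'mj, 'cj, 'x, 'y, 'o, 'm, 'c) cone \<Rightarrow> bool" where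
  "weighted_cone C \<kappa> \<longleftrightarrow>
    f_weight (wgt \<kappa>) \<and> is_ffunctor (shape (wgt \<kappa>)) C (dgm \<kappa>) \<and> apex \<kappa> \<in> Obj C \<and>
    f_natural (shape (wgt \<kappa>)) (wt (wgt \<kappa>))
      (comp_ffunctor (shape (wgt \<kappa>)) (representable C (apex \<kappa>)) (dgm \<kappa>)) (legs \<kappa>)"

text \<open>The functor \<open>C(Y, X) \<rightarrow> [J, FF](W, C(Y, D-))\<close> induced by a cone with apex \<open>X\<close>, acting by
  precomposition of the legs with 1-cells and 2-cells \<open>Y \<rightarrow> X\<close>.\<close>

definition cone_precomp :: "('o, 'm, 'c) fcat \<Rightarrow> ('oj, 'mj, 'cj, 'x, 'y, 'o, 'm, 'c) cone \<Rightarrow>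
    'm \<Rightarrow> 'oj \<Rightarrow> ('x, 'y, 'm, 'c) functr" where
  "cone_precomp C \<kappa> f = (\<lambda>j\<in>Obj (shape (wgt \<kappa>)).
     \<lparr>on_ob = (\<lambda>x\<in>Ob (loose (fun0 (wt (wgt \<kappa>)) j)). cmp1 C (on_ob (legs \<kappa> j) x) f),
      on_ar = (\<lambda>a\<in>Ar (loose (fun0 (wt (wgt \<kappa>)) j)). hcmp C (on_ar (legs \<kappa> j) a) (id2 C f))\<rparr>)"

definition induced_functor ::
  "('o, 'm, 'c) fcat \<Rightarrow> ('oj, 'mj, 'cj, 'x, 'y, 'o, 'm, 'c) cone \<Rightarrow> 'o \<Rightarrow>
    ('m, 'c, 'oj \<Rightarrow> ('x, 'y, 'm, 'c) functr,
      ('oj \<Rightarrow> ('x, 'y, 'm, 'c) functr, 'oj \<Rightarrow> 'x \<Rightarrow> 'c) arr) functr" where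
  "induced_functor C \<kappa> Y = \<lparr>
     on_ob = (\<lambda>f\<in>Ob (hom_cat C Y (apex \<kappa>)). cone_precomp C \<kappa> f),
     on_ar = (\<lambda>\<alpha>\<in>Ar (hom_cat C Y (apex \<kappa>)).
       Arr (cone_precomp C \<kappa> (dom2 C \<alpha>)) (cone_precomp C \<kappa> (cod2 C \<alpha>))
         (\<lambda>j\<in>Obj (shape (wgt \<kappa>)). \<lambda>x\<in>Ob (loose (fun0 (wt (wgt \<kappa>)) j)).
           hcmp C (id2 C (on_ob (legs \<kappa> j) x)) \<alpha>))\<rparr>"

definition limit_cone ::
  "('o, 'm, 'c) fcat \<Rightarrow> ('oj, 'mj, 'cj, 'x, 'y, 'o, 'm, 'c) cone \<Rightarrow> bool" where
  "limit_cone C \<kappa> \<longleftrightarrow> weighted_cone C \<kappa> \<and>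
    (\<forall>Y\<in>Obj C. invertible_in_F (hom_obj C Y (apex \<kappa>))
      (nat_obj (shape (wgt \<kappa>)) (wt (wgt \<kappa>))
        (comp_ffunctor (shape (wgt \<kappa>)) (representable C Y) (dgm \<kappa>)))
      (induced_functor C \<kappa> Y))"

definition complete_fcat ::
  "('oj, 'mj, 'cj, 'x, 'y) weight set \<Rightarrow> ('o, 'm, 'c) fcat \<Rightarrow> bool" where
  "complete_fcat \<Psi> C \<longleftrightarrow> fcategory C \<and>
    (\<forall>\<omega>\<in>\<Psi>. \<forall>D. is_ffunctor (shape \<omega>) C D \<longrightarrow>
      (\<exists>\<kappa>. limit_cone C \<kappa> \<and> wgt \<kappa> = \<omega> \<and> dgm \<kappa> = D))"

section \<open>Sketches\<close>

record ('oj, 'mj, 'cj, 'x, 'y, 'o, 'm, 'c) sketch =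
  ground :: "('o, 'm, 'c) fcat"
  cones :: "('oj, 'mj, 'cj, 'x, 'y, 'o, 'm, 'c) cone set"

definition is_sketch :: "('oj, 'mj, 'cj, 'x, 'y, 'o, 'm, 'c) sketch \<Rightarrow> bool" where
  "is_sketch S \<longleftrightarrow> fcategory (ground S) \<and> (\<forall>\<kappa>\<in>cones S. weighted_cone (ground S) \<kappa>)"

definition limit_sketch :: "('oj, 'mj, 'cj, 'x, 'y) weight set \<Rightarrow>
    ('oj, 'mj, 'cj, 'x, 'y, 'o, 'm, 'c) sketch \<Rightarrow> bool" where
  "limit_sketch \<Psi> S \<longleftrightarrow> is_sketch S \<and> (\<forall>\<kappa>\<in>cones S. wgt \<kappa> \<in> \<Psi>)"

definition image_cone :: "('o1, 'm1, 'c1, 'o2, 'm2, 'c2) two_fun \<Rightarrow>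
    ('oj, 'mj, 'cj, 'x, 'y, 'o1, 'm1, 'c1) cone \<Rightarrow> ('oj, 'mj, 'cj, 'x, 'y, 'o2, 'm2, 'c2) cone" where
  "image_cone F \<kappa> = \<lparr>
     wgt = wgt \<kappa>,
     dgm = comp_ffunctor (shape (wgt \<kappa>)) F (dgm \<kappa>),
     apex = fun0 F (apex \<kappa>),
     legs = (\<lambda>j\<in>Obj (shape (wgt \<kappa>)). comp_functor (loose (fun0 (wt (wgt \<kappa>)) j))
       \<lparr>on_ob = fun1 F, on_ar = fun2 F\<rparr> (legs \<kappa> j))\<rparr>"

definition sketch_morphism :: "('oj, 'mj, 'cj, 'x, 'y, 'o1, 'm1, 'c1) sketch \<Rightarrow>
    ('oj, 'mj, 'cj, 'x, 'y, 'o2, 'm2, 'c2) sketch \<Rightarrow>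
    ('o1, 'm1, 'c1, 'o2, 'm2, 'c2) two_fun \<Rightarrow> bool" where
  "sketch_morphism S T F \<longleftrightarrow>
    is_ffunctor (ground S) (ground T) F \<and> (\<forall>\<kappa>\<in>cones S. image_cone F \<kappa> \<in> cones T)"

definition limit_cone_sketch ::
  "('o, 'm, 'c) fcat \<Rightarrow> ('oj, 'mj, 'cj, 'x, 'y, 'o, 'm, 'c) sketch" where
  "limit_cone_sketch C = \<lparr>ground = C, cones = {\<kappa>. limit_cone C \<kappa>}\<rparr>"

section \<open>Weaknesses, functor \<open>F\<close>-categories and models\<close>

datatype weakness = Strict | Pseudo | Lax | Colax

fun dual :: "weakness \<Rightarrow> weakness" where
  "dual Strict = Strict"
| "dual Pseudo = Pseudo"
| "dual Lax = Colax"
| "dual Colax = Lax"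

definition identity_cell :: "('o, 'm, 'c) fcat \<Rightarrow> 'c \<Rightarrow> bool" where
  "identity_cell C \<alpha> \<longleftrightarrow> (\<exists>f\<in>Mor C. \<alpha> = id2 C f)"

definition invertible_cell :: "('o, 'm, 'c) fcat \<Rightarrow> 'c \<Rightarrow> bool" where
  "invertible_cell C \<alpha> \<longleftrightarrow> (\<exists>\<beta>\<in>Cell C. dom2 C \<beta> = cod2 C \<alpha> \<and> cod2 C \<beta> = dom2 C \<alpha> \<and>
     vcmp C \<beta> \<alpha> = id2 C (dom2 C \<alpha>) \<and> vcmp C \<alpha> \<beta> = id2 C (cod2 C \<alpha>))"

definition cell_between :: "('o, 'm, 'c) fcat \<Rightarrow> 'm \<Rightarrow> 'm \<Rightarrow> 'c \<Rightarrow> bool" where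
  "cell_between C f g \<alpha> \<longleftrightarrow> \<alpha> \<in> Cell C \<and> dom2 C \<alpha> = f \<and> cod2 C \<alpha> = g"

text \<open>\<open>w_cell w C f g h k \<alpha>\<close>: \<open>\<alpha>\<close> is a \<open>w\<close>-cell in the square with top \<open>f\<close>, left \<open>g\<close>, right \<open>h\<close>,
  bottom \<open>k\<close>.\<close>

fun w_cell :: "weakness \<Rightarrow> ('o, 'm, 'c) fcat \<Rightarrow> 'm \<Rightarrow> 'm \<Rightarrow> 'm \<Rightarrow> 'm \<Rightarrow> 'c \<Rightarrow> bool" where
  "w_cell Lax C f g h k \<alpha> \<longleftrightarrow> cell_between C (cmp1 C h f) (cmp1 C k g) \<alpha>"
| "w_cell Colax C f g h k \<alpha> \<longleftrightarrow> cell_between C (cmp1 C k g) (cmp1 C h f) \<alpha>"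
| "w_cell Pseudo C f g h k \<alpha> \<longleftrightarrow>
     cell_between C (cmp1 C h f) (cmp1 C k g) \<alpha> \<and> invertible_cell C \<alpha>"
| "w_cell Strict C f g h k \<alpha> \<longleftrightarrow>
     cell_between C (cmp1 C h f) (cmp1 C k g) \<alpha> \<and> identity_cell C \<alpha>"

text \<open>Vertical composition in which the order of the factors is the lax one, reversed for
  \<^const>\<open>Colax\<close>.\<close>

definition vpaste :: "weakness \<Rightarrow> ('o, 'm, 'c) fcat \<Rightarrow> 'c \<Rightarrow> 'c \<Rightarrow> 'c" where
  "vpaste w C \<beta> \<alpha> = (if w = Colax then vcmp C \<alpha> \<beta> else vcmp C \<beta> \<alpha>)"

text \<open>\<open>slides w C \<phi> \<psi> \<nu> \<mu>\<close>: for \<open>\<phi>\<close>, \<open>\<psi>\<close> parallel-sided \<open>w\<close>-cells, \<open>\<nu>\<close> a 2-cell between the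
  \<open>right \<circ> top\<close> sides and \<open>\<mu>\<close> a 2-cell between the \<open>bottom \<circ> left\<close> sides, the square of 2-cells
  formed by \<open>\<phi>\<close>, \<open>\<psi>\<close>, \<open>\<nu>\<close>, \<open>\<mu>\<close> commutes.\<close>

definition slides :: "weakness \<Rightarrow> ('o, 'm, 'c) fcat \<Rightarrow> 'c \<Rightarrow> 'c \<Rightarrow> 'c \<Rightarrow> 'c \<Rightarrow> bool" where
  "slides w C \<phi> \<psi> \<nu> \<mu> \<longleftrightarrow>
    (if w = Colax then vcmp C \<nu> \<phi> = vcmp C \<psi> \<mu> else vcmp C \<mu> \<phi> = vcmp C \<psi> \<nu>)"

record ('os, 'ms, 'm, 'c) transf =
  at_ob :: "'os \<Rightarrow> 'm"
  at_mor :: "'ms \<Rightarrow> 'c"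

definition w_natural :: "weakness \<Rightarrow> ('os, 'ms, 'cs) fcat \<Rightarrow> ('o, 'm, 'c) fcat \<Rightarrow>
    ('os, 'ms, 'cs, 'o, 'm, 'c) two_fun \<Rightarrow> ('os, 'ms, 'cs, 'o, 'm, 'c) two_fun \<Rightarrow>
    ('os, 'ms, 'm, 'c) transf \<Rightarrow> bool" where
  "w_natural w S C M N \<phi> \<longleftrightarrow>
    at_ob \<phi> \<in> extensional (Obj S) \<and> at_mor \<phi> \<in> extensional (Mor S) \<and>
    (\<forall>X\<in>Obj S. at_ob \<phi> X \<in> Mor C \<and>
      dom1 C (at_ob \<phi> X) = fun0 M X \<and> cod1 C (at_ob \<phi> X) = fun0 N X) \<and>
    (\<forall>s\<in>Mor S. w_cell w C (at_ob \<phi> (dom1 S s)) (fun1 M s) (fun1 N s) (at_ob \<phi> (cod1 S s))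
      (at_mor \<phi> s)) \<and>
    (\<forall>\<sigma>\<in>Cell S. slides w C (at_mor \<phi> (dom2 S \<sigma>)) (at_mor \<phi> (cod2 S \<sigma>))
      (hcmp C (fun2 N \<sigma>) (id2 C (at_ob \<phi> (dom1 S (dom2 S \<sigma>)))))
      (hcmp C (id2 C (at_ob \<phi> (cod1 S (dom2 S \<sigma>)))) (fun2 M \<sigma>))) \<and>
    (\<forall>X\<in>Obj S. at_mor \<phi> (id1 S X) = id2 C (at_ob \<phi> X)) \<and>
    (\<forall>s\<in>Mor S. \<forall>t\<in>Mor S. cod1 S s = dom1 S t \<longrightarrow>
      at_mor \<phi> (cmp1 S t s) = vpaste w C
        (hcmp C (at_mor \<phi> t) (id2 C (fun1 M s)))
        (hcmp C (id2 C (fun1 N t)) (at_mor \<phi> s))) \<and>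
    (\<forall>s\<in>Tight S. identity_cell C (at_mor \<phi> s))"

definition modification :: "weakness \<Rightarrow> ('os, 'ms, 'cs) fcat \<Rightarrow> ('o, 'm, 'c) fcat \<Rightarrow>
    ('os, 'ms, 'cs, 'o, 'm, 'c) two_fun \<Rightarrow> ('os, 'ms, 'cs, 'o, 'm, 'c) two_fun \<Rightarrow>
    ('os, 'ms, 'm, 'c) transf \<Rightarrow> ('os, 'ms, 'm, 'c) transf \<Rightarrow> ('os \<Rightarrow> 'c) \<Rightarrow> bool" where
  "modification w S C M N \<phi> \<psi> m \<longleftrightarrow>
    m \<in> extensional (Obj S) \<and>
    (\<forall>X\<in>Obj S. cell_between C (at_ob \<phi> X) (at_ob \<psi> X) (m X)) \<and>
    (\<forall>s\<in>Mor S. slides w C (at_mor \<phi> s) (at_mor \<psi> s)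
      (hcmp C (id2 C (fun1 N s)) (m (dom1 S s)))
      (hcmp C (m (cod1 S s)) (id2 C (fun1 M s))))"

type_synonym ('os, 'ms, 'cs, 'o, 'm, 'c) fun1c =
  "(('os, 'ms, 'cs, 'o, 'm, 'c) two_fun, ('os, 'ms, 'm, 'c) transf) arr"
type_synonym ('os, 'ms, 'cs, 'o, 'm, 'c) fun2c =
  "(('os, 'ms, 'cs, 'o, 'm, 'c) fun1c, 'os \<Rightarrow> 'c) arr"

definition id_transf :: "('os, 'ms, 'cs) fcat \<Rightarrow> ('o, 'm, 'c) fcat \<Rightarrow>
    ('os, 'ms, 'cs, 'o, 'm, 'c) two_fun \<Rightarrow> ('os, 'ms, 'm, 'c) transf" where
  "id_transf S C M = \<lparr>at_ob = (\<lambda>X\<in>Obj S. id1 C (fun0 M X)), at_mor = (\<lambda>s\<in>Mor S. id2 C (fun1 M s))\<rparr>"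

definition comp_transf :: "weakness \<Rightarrow> ('os, 'ms, 'cs) fcat \<Rightarrow> ('o, 'm, 'c) fcat \<Rightarrow>
    ('os, 'ms, 'm, 'c) transf \<Rightarrow> ('os, 'ms, 'm, 'c) transf \<Rightarrow> ('os, 'ms, 'm, 'c) transf" where
  "comp_transf w S C \<psi> \<phi> = \<lparr>
     at_ob = (\<lambda>X\<in>Obj S. cmp1 C (at_ob \<psi> X) (at_ob \<phi> X)),
     at_mor = (\<lambda>s\<in>Mor S. vpaste w C
       (hcmp C (id2 C (at_ob \<psi> (cod1 S s))) (at_mor \<phi> s))
       (hcmp C (at_mor \<psi> s) (id2 C (at_ob \<phi> (dom1 S s)))))\<rparr>"

definition Fun :: "weakness \<Rightarrow> ('os, 'ms, 'cs) fcat \<Rightarrow> ('o, 'm, 'c) fcat \<Rightarrow>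
    (('os, 'ms, 'cs, 'o, 'm, 'c) two_fun, ('os, 'ms, 'cs, 'o, 'm, 'c) fun1c,
     ('os, 'ms, 'cs, 'o, 'm, 'c) fun2c) fcat" where
  "Fun w S C = \<lparr>
     Obj = {M. is_ffunctor S C M},
     Mor = {Arr M N \<phi> | M N \<phi>. is_ffunctor S C M \<and> is_ffunctor S C N \<and> w_natural w S C M N \<phi>},
     Cell = {Arr (Arr M N \<phi>) (Arr M N \<psi>) m | M N \<phi> \<psi> m. is_ffunctor S C M \<and> is_ffunctor S C N \<and>
       w_natural w S C M N \<phi> \<and> w_natural w S C M N \<psi> \<and> modification w S C M N \<phi> \<psi> m},
     dom1 = adom,
     cod1 = acod,
     id1 = (\<lambda>M. Arr M M (id_transf S C M)),
     cmp1 = (\<lambda>g f. Arr (adom f) (acod g) (comp_transf w S C (amap g) (amap f))),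
     dom2 = adom,
     cod2 = acod,
     id2 = (\<lambda>f. Arr f f (\<lambda>X\<in>Obj S. id2 C (at_ob (amap f) X))),
     vcmp = (\<lambda>n m. Arr (adom m) (acod n) (\<lambda>X\<in>Obj S. vcmp C (amap n X) (amap m X))),
     hcmp = (\<lambda>n m.
       Arr (Arr (adom (adom m)) (acod (adom n)) (comp_transf w S C (amap (adom n)) (amap (adom m))))
           (Arr (adom (adom m)) (acod (adom n)) (comp_transf w S C (amap (acod n)) (amap (acod m))))
           (\<lambda>X\<in>Obj S. hcmp C (amap n X) (amap m X))),
     Tight = {Arr M N \<phi> | M N \<phi>. is_ffunctor S C M \<and> is_ffunctor S C N \<and> w_natural w S C M N \<phi> \<and>
       (\<forall>X\<in>Obj S. at_ob \<phi> X \<in> Tight C) \<and> (\<forall>s\<in>Mor S. identity_cell C (at_mor \<phi> s))}\<rparr>"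

definition Mod :: "weakness \<Rightarrow> ('oj, 'mj, 'cj, 'x, 'y, 'os, 'ms, 'cs) sketch \<Rightarrow>
    ('oj, 'mj, 'cj, 'x, 'y, 'o, 'm, 'c) sketch \<Rightarrow>
    (('os, 'ms, 'cs, 'o, 'm, 'c) two_fun, ('os, 'ms, 'cs, 'o, 'm, 'c) fun1c,
     ('os, 'ms, 'cs, 'o, 'm, 'c) fun2c) fcat" where
  "Mod w S T = full_subfcat (Fun w (ground S) (ground T)) {M. sketch_morphism S T M}"

end

theory Submission
 imports Defs
begin

text \<open>For a tight weight the cones have tight legs, and a tight 1-cell of \<^term>\<open>Fun w S C\<close> is strictly
natural.  Hence limits in \<^term>\<open>Fun w S C\<close> are formed pointwise: the 2-dimensional universal property in \<open>C\<close>
supplies the structure 2-cells of a mediating \<open>w\<close>-natural transformation.  Limits commute with limits, so a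
pointwise limit of models is a model, and a cone in a category of models is a limit cone iff all its evaluations are.
Therefore an F-functor \<open>F : S \<rightarrow> Mod (dual w) T C\<close> is a model iff \<open>F (-) Y\<close> is a model for each \<open>Y\<close>, which is
symmetric in \<open>S\<close> and \<open>T\<close>.  The isomorphism exchanges the two variables.  The structure 2-cell of \<open>F s\<close> at \<open>t\<close> is a
\<open>dual w\<close>-cell in a square whose transpose carries the \<open>w\<close>-cell required of \<open>F (-) t\<close> at \<open>s\<close>; in the axioms, modifications
and naturality trade places.\<close>

text \<open>What makes the argument run is that a weight in \<open>\<Psi>\<close> has a chordate
  shape and identity embeddings as values, so that diagrams and legs are tight. Projecting a
  transformation along a leg with nontrivial structure cells would paste those cells in; along a
  tight leg its structure cells are merely whiskered in \<open>C\<close>, so they can be produced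
  and compared by the universal property of a limit in \<open>C\<close>.

  An l-cell fills a square from right-after-top to bottom-after-left, and transposition exchanges
  these composites. A lax cell therefore becomes a colax one without being changed and a strict cell
  has equal composites, but a pseudo cell is recorded in one direction and must be inverted.

  A further obstacle is that the outer models take values in a category of models. As that is a full
  sub-\<open>F\<close>-category, the functor \<open>F\<close>-category into it equals, as a record,
  a full sub-\<open>F\<close>-category of the one into the ambient functor
  \<open>F\<close>-category. Both sides of the isomorphism are thereby cut out of iterated functor
  \<open>F\<close>-categories over \<open>C\<close>, where transposition is explicit.\<close>

abbreviation (input) whl :: "('o, 'm, 'c, 'z) two_cat_scheme => 'm => 'c => 'c" where
 "whl C f \<alpha> == hcmp C (id2 C f) \<alpha>"

abbreviation (input) whr :: "('o, 'm, 'c, 'z) two_cat_scheme => 'c => 'm => 'c" where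
 "whr C \<alpha> f == hcmp C \<alpha> (id2 C f)"

lemmas (in fcategory) fcat = fcategory_axioms

section \<open>2-categories and 2-functors\<close>

context two_category
begin

lemma dom1_Obj [simp]: "f \<in> Mor C ==> dom1 C f \<in> Obj C"
 and cod1_Obj [simp]: "f \<in> Mor C ==> cod1 C f \<in> Obj C"
 and id1_Mor [simp]: "X \<in> Obj C ==> id1 C X \<in> Mor C"
 and dom1_id1 [simp]: "X \<in> Obj C ==> dom1 C (id1 C X) = X"
 and cod1_id1 [simp]: "X \<in> Obj C ==> cod1 C (id1 C X) = X"
 and cmp1_Mor [simp]: "[|f \<in> Mor C; g \<in> Mor C; cod1 C f = dom1 C g|] ==> cmp1 C g f \<in> Mor C"
 and dom1_cmp1 [simp]: "[|f \<in> Mor C; g \<in> Mor C; cod1 C f = dom1 C g|] ==> dom1 C (cmp1 C g f) = dom1 C f"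
 and cod1_cmp1 [simp]: "[|f \<in> Mor C; g \<in> Mor C; cod1 C f = dom1 C g|] ==> cod1 C (cmp1 C g f) = cod1 C g"
 and cmp1_id_left [simp]: "[|f \<in> Mor C; cod1 C f = X|] ==> cmp1 C (id1 C X) f = f"
 and cmp1_id_right [simp]: "[|f \<in> Mor C; dom1 C f = X|] ==> cmp1 C f (id1 C X) = f"
 and cmp1_assoc [simp]: "[|f \<in> Mor C; g \<in> Mor C; h \<in> Mor C; cod1 C f = dom1 C g; cod1 C g = dom1 C h|]
   ==> cmp1 C (cmp1 C h g) f = cmp1 C h (cmp1 C g f)"
 using mor by (auto simp: category_def mor_cat_def)

lemma dom2_Mor [simp]: "a \<in> Cell C ==> dom2 C a \<in> Mor C"
 and cod2_Mor [simp]: "a \<in> Cell C ==> cod2 C a \<in> Mor C"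
 and id2_Cell [simp]: "f \<in> Mor C ==> id2 C f \<in> Cell C"
 and dom2_id2 [simp]: "f \<in> Mor C ==> dom2 C (id2 C f) = f"
 and cod2_id2 [simp]: "f \<in> Mor C ==> cod2 C (id2 C f) = f"
 and vcmp_Cell [simp]: "[|a \<in> Cell C; b \<in> Cell C; cod2 C a = dom2 C b|] ==> vcmp C b a \<in> Cell C"
 and dom2_vcmp [simp]: "[|a \<in> Cell C; b \<in> Cell C; cod2 C a = dom2 C b|] ==> dom2 C (vcmp C b a) = dom2 C a"
 and cod2_vcmp [simp]: "[|a \<in> Cell C; b \<in> Cell C; cod2 C a = dom2 C b|] ==> cod2 C (vcmp C b a) = cod2 C b"
 and vcmp_id_left [simp]: "[|a \<in> Cell C; cod2 C a = f|] ==> vcmp C (id2 C f) a = a"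
 and vcmp_id_right [simp]: "[|a \<in> Cell C; dom2 C a = f|] ==> vcmp C a (id2 C f) = a"
 and vcmp_assoc [simp]: "[|a \<in> Cell C; b \<in> Cell C; c \<in> Cell C; cod2 C a = dom2 C b; cod2 C b = dom2 C c|]
   ==> vcmp C (vcmp C c b) a = vcmp C c (vcmp C b a)"
 using vert by (auto simp: category_def vert_cat_def)

lemma dom1_cod2_simp [simp]: "a \<in> Cell C ==> dom1 C (cod2 C a) = dom1 C (dom2 C a)"
 and cod1_cod2_simp [simp]: "a \<in> Cell C ==> cod1 C (cod2 C a) = cod1 C (dom2 C a)"
 by (simp_all add: dom1_cod2 cod1_cod2)

lemma hcmp_Cell [simp]: "[|a \<in> Cell C; b \<in> Cell C; cod1 C (dom2 C a) = dom1 C (dom2 C b)|] ==> hcmp C b a \<in> Cell C"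
 and hcmp_id_left [simp]: "[|a \<in> Cell C; cod1 C (dom2 C a) = X|] ==> whl C (id1 C X) a = a"
 and hcmp_id_right [simp]: "[|a \<in> Cell C; dom1 C (dom2 C a) = X|] ==> whr C a (id1 C X) = a"
 and hcmp_assoc [simp]: "[|a \<in> Cell C; b \<in> Cell C; c \<in> Cell C; cod1 C (dom2 C a) = dom1 C (dom2 C b);
   cod1 C (dom2 C b) = dom1 C (dom2 C c)|]
   ==> hcmp C (hcmp C c b) a = hcmp C c (hcmp C b a)"
 using horiz by (auto simp: category_def horiz_cat_def)

lemmas [simp] = dom2_hcmp cod2_hcmp hcmp_id2

lemma hcmp_id2_id2 [simp]:
 "[|a \<in> Cell C; f \<in> Mor C; g \<in> Mor C; cod1 C f = dom1 C g; cod1 C (dom2 C a) = dom1 C f|]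
  ==> whl C g (whl C f a) = whl C (cmp1 C g f) a"
 by (subst hcmp_assoc [symmetric]) auto

lemma hcmp_vcmp_left [simp]:
 "[|a \<in> Cell C; b \<in> Cell C; f \<in> Mor C; cod2 C a = dom2 C b; cod1 C (dom2 C a) = dom1 C f|]
  ==> whl C f (vcmp C b a) = vcmp C (whl C f b) (whl C f a)"
 by (subst interchange [symmetric]) auto

lemma hcmp_vcmp_right [simp]:
 "[|a \<in> Cell C; b \<in> Cell C; f \<in> Mor C; cod2 C a = dom2 C b; cod1 C f = dom1 C (dom2 C a)|]
  ==> whr C (vcmp C b a) f = vcmp C (whr C b f) (whr C a f)"
 by (subst interchange [symmetric]) auto

lemma hcmp_eq1:
 "[|a \<in> Cell C; b \<in> Cell C; cod1 C (dom2 C a) = dom1 C (dom2 C b)|]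
  ==> vcmp C (whr C b (cod2 C a)) (whl C (dom2 C b) a) = hcmp C b a"
 by (subst interchange [symmetric]) auto

lemma hcmp_eq2:
 "[|a \<in> Cell C; b \<in> Cell C; cod1 C (dom2 C a) = dom1 C (dom2 C b)|]
  ==> vcmp C (whl C (cod2 C b) a) (whr C b (dom2 C a)) = hcmp C b a"
 by (subst interchange [symmetric]) auto

text \<open>By interchange with identities both sides equal \<open>hcmp C b a\<close>. The four ends
  are given by separate equations so that the rule applies to whiskerings whose 1-cells agree with
  these ends only up to rewriting.\<close>

lemma exchange:
 "[|a \<in> Cell C; b \<in> Cell C; cod1 C (dom2 C a) = dom1 C (dom2 C b);
   dom2 C a = f; cod2 C a = f'; dom2 C b = g; cod2 C b = g'|]
  ==> vcmp C (whr C b f') (whl C g a) =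
    vcmp C (whl C g' a) (whr C b f)"
 using hcmp_eq1 hcmp_eq2 by metis

end

lemma two_categoryI:
 fixes C :: "('o, 'm, 'c, 'z) two_cat_scheme"
 assumes "!!f. f \<in> Mor C ==> dom1 C f \<in> Obj C & cod1 C f \<in> Obj C"
  and "!!X. X \<in> Obj C ==> id1 C X \<in> Mor C & dom1 C (id1 C X) = X & cod1 C (id1 C X) = X"
  and "!!f g. [|f \<in> Mor C; g \<in> Mor C; cod1 C f = dom1 C g|] ==>
   cmp1 C g f \<in> Mor C & dom1 C (cmp1 C g f) = dom1 C f & cod1 C (cmp1 C g f) = cod1 C g"
  and "!!f. f \<in> Mor C ==> cmp1 C (id1 C (cod1 C f)) f = f & cmp1 C f (id1 C (dom1 C f)) = f"
  and "!!f g h. [|f \<in> Mor C; g \<in> Mor C; h \<in> Mor C; cod1 C f = dom1 C g; cod1 C g = dom1 C h|]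
   ==> cmp1 C (cmp1 C h g) f = cmp1 C h (cmp1 C g f)"
  and "!!a. a \<in> Cell C ==> dom2 C a \<in> Mor C & cod2 C a \<in> Mor C &
    dom1 C (cod2 C a) = dom1 C (dom2 C a) & cod1 C (cod2 C a) = cod1 C (dom2 C a)"
  and "!!f. f \<in> Mor C ==> id2 C f \<in> Cell C & dom2 C (id2 C f) = f & cod2 C (id2 C f) = f"
  and "!!a b. [|a \<in> Cell C; b \<in> Cell C; cod2 C a = dom2 C b|] ==> vcmp C b a \<in> Cell C &
    dom2 C (vcmp C b a) = dom2 C a & cod2 C (vcmp C b a) = cod2 C b"
  and "!!a. a \<in> Cell C ==> vcmp C (id2 C (cod2 C a)) a = a & vcmp C a (id2 C (dom2 C a)) = a"
  and "!!a b c. [|a \<in> Cell C; b \<in> Cell C; c \<in> Cell C; cod2 C a = dom2 C b; cod2 C b = dom2 C c|]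
   ==> vcmp C (vcmp C c b) a = vcmp C c (vcmp C b a)"
  and "!!a b. [|a \<in> Cell C; b \<in> Cell C; cod1 C (dom2 C a) = dom1 C (dom2 C b)|] ==> hcmp C b a \<in> Cell C &
    dom2 C (hcmp C b a) = cmp1 C (dom2 C b) (dom2 C a) & cod2 C (hcmp C b a) = cmp1 C (cod2 C b) (cod2 C a)"
  and "!!a. a \<in> Cell C ==> whl C (id1 C (cod1 C (dom2 C a))) a = a &
    whr C a (id1 C (dom1 C (dom2 C a))) = a"
  and "!!a b c. [|a \<in> Cell C; b \<in> Cell C; c \<in> Cell C; cod1 C (dom2 C a) = dom1 C (dom2 C b);
   cod1 C (dom2 C b) = dom1 C (dom2 C c)|]
   ==> hcmp C (hcmp C c b) a = hcmp C c (hcmp C b a)"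
  and "!!f g. [|f \<in> Mor C; g \<in> Mor C; cod1 C f = dom1 C g|]
   ==> whl C g (id2 C f) = id2 C (cmp1 C g f)"
  and "!!a a' b b'. [|a \<in> Cell C; a' \<in> Cell C; b \<in> Cell C; b' \<in> Cell C;
    cod2 C a = dom2 C a'; cod2 C b = dom2 C b'; cod1 C (dom2 C a) = dom1 C (dom2 C b)|]
   ==> hcmp C (vcmp C b' b) (vcmp C a' a) = vcmp C (hcmp C b' a') (hcmp C b a)"
 shows "two_category C"
proof (rule two_category.intro)
 show "category (mor_cat C)"
  by unfold_locales (simp_all add: mor_cat_def assms(1-5))
 show "category (vert_cat C)"
  by unfold_locales (simp_all add: vert_cat_def assms(6-10))
 show "category (horiz_cat C)"
  by unfold_locales (simp_all add: horiz_cat_def assms(1-3,6,7,11-13))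
qed (use assms in auto)

text \<open>The dual usually written C^co. A colax transformation is a lax one between the same
  assignments read from \<open>co S\<close> to \<open>co C\<close>.\<close>

definition co :: "('o, 'm, 'c) fcat => ('o, 'm, 'c) fcat" where
 "co C = C\<lparr>dom2 := cod2 C, cod2 := dom2 C, vcmp := (%\<beta> \<alpha>. vcmp C \<alpha> \<beta>)\<rparr>"

lemma co_simps [simp]:
 "Obj (co C) = Obj C" "Mor (co C) = Mor C" "Cell (co C) = Cell C" "dom1 (co C) = dom1 C"
 "cod1 (co C) = cod1 C" "id1 (co C) = id1 C" "cmp1 (co C) = cmp1 C" "dom2 (co C) = cod2 C"
 "cod2 (co C) = dom2 C" "id2 (co C) = id2 C" "vcmp (co C) b a = vcmp C a b" "hcmp (co C) = hcmp C"
 "Tight (co C) = Tight C"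
 by (simp_all add: co_def)

context fcategory begin
lemma Tight_in_Mor [simp]: "f \<in> Tight C ==> f \<in> Mor C" using Tight_Mor by auto
lemmas [simp] = Tight_id1 Tight_cmp1
end

lemma fcategory_co: "fcategory C ==> fcategory (co C)"
proof -
 assume "fcategory C" then interpret fcategory C .
 have "two_category (co C)"
  by (rule two_categoryI) (simp_all, (subst interchange; simp)?)
 then show ?thesis
  by (auto simp: fcategory_def fcategory_axioms_def)
qed

lemma fcategory_two [dest]: "fcategory C ==> two_category C" by (simp add: fcategory_def)

lemma is_two_functorI:
 assumes C: "two_category C" and D: "two_category D"
  and "fun0 F \<in> Obj C \<rightarrow>\<^sub>E Obj D" "fun1 F \<in> Mor C \<rightarrow>\<^sub>E Mor D" "fun2 F \<in> Cell C \<rightarrow>\<^sub>E Cell D"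
  and "!!f. f \<in> Mor C ==> dom1 D (fun1 F f) = fun0 F (dom1 C f) & cod1 D (fun1 F f) = fun0 F (cod1 C f)"
  and "!!a. a \<in> Cell C ==> dom2 D (fun2 F a) = fun1 F (dom2 C a) & cod2 D (fun2 F a) = fun1 F (cod2 C a)"
  and "!!X. X \<in> Obj C ==> fun1 F (id1 C X) = id1 D (fun0 F X)"
  and "!!f. f \<in> Mor C ==> fun2 F (id2 C f) = id2 D (fun1 F f)"
  and "!!f g. [|f \<in> Mor C; g \<in> Mor C; cod1 C f = dom1 C g|] ==> fun1 F (cmp1 C g f) = cmp1 D (fun1 F g) (fun1 F f)"
  and "!!a b. [|a \<in> Cell C; b \<in> Cell C; cod2 C a = dom2 C b|] ==> fun2 F (vcmp C b a) = vcmp D (fun2 F b) (fun2 F a)"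
  and "!!a b. [|a \<in> Cell C; b \<in> Cell C; cod1 C (dom2 C a) = dom1 C (dom2 C b)|] ==> fun2 F (hcmp C b a) = hcmp D (fun2 F b) (fun2 F a)"
 shows "is_two_functor C D F"
proof -
 interpret C: two_category C by (rule C)
 interpret D: two_category D by (rule D)
 show ?thesis unfolding is_two_functor_def is_functor_def mor_cat_def vert_cat_def horiz_cat_def
  using assms by auto
qed

locale two_functor = A: two_category A + B: two_category B
 for A :: "('o1, 'm1, 'c1, 'y) two_cat_scheme" and B :: "('o2, 'm2, 'c2, 'z) two_cat_scheme" +
 fixes F :: "('o1, 'm1, 'c1, 'o2, 'm2, 'c2) two_fun"
 assumes is_two_functor: "is_two_functor A B F"
begin

lemma fun0_Obj [simp]: "X \<in> Obj A ==> fun0 F X \<in> Obj B"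
 and fun1_Mor [simp]: "f \<in> Mor A ==> fun1 F f \<in> Mor B"
 and fun2_Cell [simp]: "a \<in> Cell A ==> fun2 F a \<in> Cell B"
 and fun0_ext: "fun0 F \<in> extensional (Obj A)"
 and fun1_ext: "fun1 F \<in> extensional (Mor A)"
 and fun2_ext: "fun2 F \<in> extensional (Cell A)"
 and dom1_fun1 [simp]: "f \<in> Mor A ==> dom1 B (fun1 F f) = fun0 F (dom1 A f)"
 and cod1_fun1 [simp]: "f \<in> Mor A ==> cod1 B (fun1 F f) = fun0 F (cod1 A f)"
 and dom2_fun2 [simp]: "a \<in> Cell A ==> dom2 B (fun2 F a) = fun1 F (dom2 A a)"
 and cod2_fun2 [simp]: "a \<in> Cell A ==> cod2 B (fun2 F a) = fun1 F (cod2 A a)"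
 and fun1_id1 [simp]: "X \<in> Obj A ==> fun1 F (id1 A X) = id1 B (fun0 F X)"
 and fun2_id2 [simp]: "f \<in> Mor A ==> fun2 F (id2 A f) = id2 B (fun1 F f)"
 and fun1_cmp1 [simp]: "[|f \<in> Mor A; g \<in> Mor A; cod1 A f = dom1 A g|] ==> fun1 F (cmp1 A g f) = cmp1 B (fun1 F g) (fun1 F f)"
 and fun2_vcmp [simp]: "[|a \<in> Cell A; b \<in> Cell A; cod2 A a = dom2 A b|] ==> fun2 F (vcmp A b a) = vcmp B (fun2 F b) (fun2 F a)"
 and fun2_hcmp [simp]: "[|a \<in> Cell A; b \<in> Cell A; cod1 A (dom2 A a) = dom1 A (dom2 A b)|] ==> fun2 F (hcmp A b a) = hcmp B (fun2 F b) (fun2 F a)"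
 using is_two_functor unfolding is_two_functor_def is_functor_def mor_cat_def vert_cat_def horiz_cat_def
 by (auto simp: PiE_iff)

end

locale ffunctor = A: fcategory A + B: fcategory B
 for A :: "('o1, 'm1, 'c1) fcat" and B :: "('o2, 'm2, 'c2) fcat" +
 fixes F :: "('o1, 'm1, 'c1, 'o2, 'm2, 'c2) two_fun"
 assumes is_ffunctor: "is_ffunctor A B F"

sublocale ffunctor \<subseteq> two_functor A B F
 using is_ffunctor by unfold_locales (simp add: is_ffunctor_def)

lemma (in ffunctor) fun1_Tight [simp]: "f \<in> Tight A ==> fun1 F f \<in> Tight B"
 using is_ffunctor by (simp add: is_ffunctor_def)

lemma ffunctorI: "[|fcategory A; fcategory B; is_ffunctor A B F|] ==> ffunctor A B F"
 by (simp add: ffunctor_def ffunctor_axioms_def)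

lemma is_ffunctor_co:
 assumes "fcategory A" "fcategory B" "is_ffunctor A B F" shows "is_ffunctor (co A) (co B) F"
proof -
 interpret ffunctor A B F using assms by (rule ffunctorI)
 show ?thesis unfolding is_ffunctor_def
  using fun0_ext fun1_ext fun2_ext
  by (auto intro!: is_two_functorI fcategory_two fcategory_co assms simp: PiE_iff extensional_def)
qed

section \<open>Transformations and modifications\<close>

text \<open>The simplifier nests vertical composites to the right, which hides a known equation
  between binary composites as soon as another cell stands behind them. This form applies the
  equation inside such a nest.\<close>

lemma (in two_category) vcmp_swap:
 assumes "vcmp C b c = vcmp C b' c'"
  and "b \<in> Cell C" "c \<in> Cell C" "b' \<in> Cell C" "c' \<in> Cell C" "d \<in> Cell C"
  and "cod2 C c = dom2 C b" "cod2 C c' = dom2 C b'" "cod2 C d = dom2 C c" "dom2 C c' = dom2 C c"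
 shows "vcmp C b (vcmp C c d) = vcmp C b' (vcmp C c' d)"
 using assms by (metis vcmp_assoc)

locale lax_nat = M: ffunctor S C M + N: ffunctor S C N
 for S :: "('os, 'ms, 'cs) fcat" and C :: "('o, 'm, 'c) fcat"
  and M N :: "('os, 'ms, 'cs, 'o, 'm, 'c) two_fun" +
 fixes \<phi> :: "('os, 'ms, 'm, 'c) transf"
 assumes w_natural: "w_natural Lax S C M N \<phi>"
begin

lemma at_ob_ext: "at_ob \<phi> \<in> extensional (Obj S)"
 and at_mor_ext: "at_mor \<phi> \<in> extensional (Mor S)"
 and at_ob_Mor [simp]: "X \<in> Obj S ==> at_ob \<phi> X \<in> Mor C"
 and dom1_at_ob [simp]: "X \<in> Obj S ==> dom1 C (at_ob \<phi> X) = fun0 M X"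
 and cod1_at_ob [simp]: "X \<in> Obj S ==> cod1 C (at_ob \<phi> X) = fun0 N X"
 and at_mor_Cell [simp]: "s \<in> Mor S ==> at_mor \<phi> s \<in> Cell C"
 and dom2_at_mor [simp]: "s \<in> Mor S ==> dom2 C (at_mor \<phi> s) = cmp1 C (fun1 N s) (at_ob \<phi> (dom1 S s))"
 and cod2_at_mor [simp]: "s \<in> Mor S ==> cod2 C (at_mor \<phi> s) = cmp1 C (at_ob \<phi> (cod1 S s)) (fun1 M s)"
 and at_mor_id1 [simp]: "X \<in> Obj S ==> at_mor \<phi> (id1 S X) = id2 C (at_ob \<phi> X)"
 and at_mor_cmp1 [simp]: "[|s \<in> Mor S; t \<in> Mor S; cod1 S s = dom1 S t|] ==>
   at_mor \<phi> (cmp1 S t s) = vcmp C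
    (whr C (at_mor \<phi> t) (fun1 M s))
    (whl C (fun1 N t) (at_mor \<phi> s))"
 and at_mor_slide: "z \<in> Cell S ==> vcmp C (whl C (at_ob \<phi> (cod1 S (dom2 S z))) (fun2 M z)) (at_mor \<phi> (dom2 S z))
   = vcmp C (at_mor \<phi> (cod2 S z)) (whr C (fun2 N z) (at_ob \<phi> (dom1 S (dom2 S z))))"
 and at_mor_Tight: "s \<in> Tight S ==> identity_cell C (at_mor \<phi> s)"
 using w_natural unfolding w_natural_def cell_between_def slides_def vpaste_def w_cell.simps by auto

end

section \<open>Closure of identity and invertible 2-cells under composition\<close>

context fcategory begin

lemma identity_cell_id2 [simp]: "f \<in> Mor C ==> identity_cell C (id2 C f)"
 by (auto simp: identity_cell_def)

lemma identity_cell_hcmp: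
 "[|identity_cell C a; identity_cell C b; cod1 C (dom2 C a) = dom1 C (dom2 C b)|] ==> identity_cell C (hcmp C b a)"
 unfolding identity_cell_def by (auto intro!: bexI)

lemma identity_cell_vcmp:
 "[|identity_cell C a; identity_cell C b; cod2 C a = dom2 C b|] ==> identity_cell C (vcmp C b a)"
 unfolding identity_cell_def by auto

lemma identity_cell_eq:
 "identity_cell C a ==> a = id2 C (dom2 C a) & cod2 C a = dom2 C a"
 unfolding identity_cell_def by auto

lemma invertible_cell_identity: "identity_cell C a ==> invertible_cell C a"
 unfolding identity_cell_def invertible_cell_def by (auto intro!: bexI[of _ a])

lemma invertible_cell_hcmp:
 assumes "invertible_cell C e" "invertible_cell C n" "e \<in> Cell C" "n \<in> Cell C"
  "cod1 C (dom2 C e) = dom1 C (dom2 C n)"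
 shows "invertible_cell C (hcmp C n e)"
proof -
 obtain e' where a: "e' \<in> Cell C" "dom2 C e' = cod2 C e" "cod2 C e' = dom2 C e"
  "vcmp C e' e = id2 C (dom2 C e)" "vcmp C e e' = id2 C (cod2 C e)"
  using assms(1) by (auto simp: invertible_cell_def)
 obtain n' where b: "n' \<in> Cell C" "dom2 C n' = cod2 C n" "cod2 C n' = dom2 C n"
  "vcmp C n' n = id2 C (dom2 C n)" "vcmp C n n' = id2 C (cod2 C n)"
  using assms(2) by (auto simp: invertible_cell_def)
 have "vcmp C (hcmp C n' e') (hcmp C n e) = id2 C (dom2 C (hcmp C n e))"
  using a b assms by (subst interchange [symmetric]) auto
 moreover have "vcmp C (hcmp C n e) (hcmp C n' e') = id2 C (cod2 C (hcmp C n e))"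
  using a b assms by (subst interchange [symmetric]) auto
 ultimately show ?thesis unfolding invertible_cell_def
  using a b assms by (intro bexI[of _ "hcmp C n' e'"]) auto
qed

lemma invertible_cell_vcmp:
 assumes "invertible_cell C e" "invertible_cell C n" "e \<in> Cell C" "n \<in> Cell C"
  "cod2 C e = dom2 C n"
 shows "invertible_cell C (vcmp C n e)"
proof -
 obtain e' where a: "e' \<in> Cell C" "dom2 C e' = cod2 C e" "cod2 C e' = dom2 C e"
  "vcmp C e' e = id2 C (dom2 C e)" "vcmp C e e' = id2 C (cod2 C e)"
  using assms(1) by (auto simp: invertible_cell_def)
 obtain n' where b: "n' \<in> Cell C" "dom2 C n' = cod2 C n" "cod2 C n' = dom2 C n"
  "vcmp C n' n = id2 C (dom2 C n)" "vcmp C n n' = id2 C (cod2 C n)"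
  using assms(2) by (auto simp: invertible_cell_def)
 have "vcmp C (vcmp C e' n') (vcmp C n e) = id2 C (dom2 C (vcmp C n e))"
  using a b assms vcmp_assoc[of "vcmp C n e" "n'" "e'"] vcmp_assoc[of e n n', symmetric] by auto
 moreover have "vcmp C (vcmp C n e) (vcmp C e' n') = id2 C (cod2 C (vcmp C n e))"
  using a b assms vcmp_assoc[of "vcmp C e' n'" "e" "n"] vcmp_assoc[of n' e' e, symmetric] by auto
 ultimately show ?thesis unfolding invertible_cell_def
  using a b assms by (intro bexI[of _ "vcmp C e' n'"]) auto
qed

end

text \<open>The part of being a \<open>w\<close>-cell that does not mention the ends of the cell.
  Splitting it from the orientation lets one lax computation serve all four weaknesses.\<close>

definition wgood :: "weakness => ('o, 'm, 'c) fcat => 'c => bool" where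
 "wgood w C \<alpha> \<longleftrightarrow> (w = Pseudo --> invertible_cell C \<alpha>) & (w = Strict --> identity_cell C \<alpha>)"

context fcategory begin

lemma wgood_identity: "identity_cell C a ==> wgood w C a"
 by (auto simp: wgood_def invertible_cell_identity)

lemma wgood_hcmp:
 "[|wgood w C a; wgood w C b; a \<in> Cell C; b \<in> Cell C; cod1 C (dom2 C a) = dom1 C (dom2 C b)|]
  ==> wgood w C (hcmp C b a)"
 by (auto simp: wgood_def intro: invertible_cell_hcmp identity_cell_hcmp)

lemma wgood_vcmp:
 "[|wgood w C a; wgood w C b; a \<in> Cell C; b \<in> Cell C; cod2 C a = dom2 C b|]
  ==> wgood w C (vcmp C b a)"
 by (auto simp: wgood_def intro: invertible_cell_vcmp identity_cell_vcmp)

end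

lemma identity_cell_co [simp]: "identity_cell (co C) = identity_cell C"
 by (auto simp: identity_cell_def fun_eq_iff)

lemma invertible_cell_co [simp]: "invertible_cell (co C) = invertible_cell C"
 by (auto simp: invertible_cell_def fun_eq_iff)

lemma wgood_co [simp]: "wgood w (co C) = wgood w C"
 by (simp add: wgood_def fun_eq_iff)

text \<open>Reversing the 2-cells for \<^const>\<open>Colax\<close> reduces every weakness to \<^const>\<open>Lax\<close>.\<close>

definition orient :: "weakness => ('o, 'm, 'c) fcat => ('o, 'm, 'c) fcat" where
 "orient w C = (if w = Colax then co C else C)"

lemma orient_simps [simp]:
 "Obj (orient w C) = Obj C" "Mor (orient w C) = Mor C" "Cell (orient w C) = Cell C"
 "dom1 (orient w C) = dom1 C" "cod1 (orient w C) = cod1 C" "id1 (orient w C) = id1 C"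
 "cmp1 (orient w C) = cmp1 C" "id2 (orient w C) = id2 C" "hcmp (orient w C) = hcmp C"
 "Tight (orient w C) = Tight C" "identity_cell (orient w C) = identity_cell C"
 "invertible_cell (orient w C) = invertible_cell C" "wgood w' (orient w C) = wgood w' C"
 "vcmp (orient w C) b a = vpaste w C b a"
 by (simp_all add: orient_def vpaste_def)

lemma fcategory_orient: "fcategory C ==> fcategory (orient w C)"
 by (simp add: orient_def fcategory_co)

lemma is_ffunctor_orient:
 "[|fcategory A; fcategory B; is_ffunctor A B F|] ==> is_ffunctor (orient w A) (orient w B) F"
 by (simp add: orient_def is_ffunctor_co)

text \<open>A pseudo or strict cell is an l-cell with an additional property, and a colax cell is an
  l-cell for reversed 2-cells. The source is oriented as well, because naturality in the 2-cells of
  \<open>S\<close> involves their images under \<open>M\<close> and \<open>N\<close>.\<close>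

lemma w_natural_orient:
 assumes "fcategory S" "fcategory C"
 shows "w_natural w S C M N \<phi> \<longleftrightarrow>
  w_natural Lax (orient w S) (orient w C) M N \<phi> & (\<forall>s\<in>Mor S. wgood w C (at_mor \<phi> s))"
proof -
 interpret S: fcategory S by fact
 interpret C: fcategory C by fact
 have sl: "slides Colax C a b \<nu> \<mu> \<longleftrightarrow> slides Lax (co C) b a \<nu> \<mu>" for a b \<nu> \<mu>
  by (auto simp: slides_def)
 have sl': "slides Pseudo C = slides Lax C" "slides Strict C = slides Lax C"
  by (auto simp: slides_def fun_eq_iff)
 have cb: "cell_between (co C) f g a \<longleftrightarrow> cell_between C g f a" for f g a
  by (auto simp: cell_between_def)
 show ?thesis
  by (cases w) (auto simp: w_natural_def wgood_def orient_def sl sl' vpaste_def cb cong: ball_cong)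
qed

lemma comp_transf_orient: "comp_transf w S C = comp_transf Lax (orient w S) (orient w C)"
 by (simp add: comp_transf_def vpaste_def orient_def fun_eq_iff)

text \<open>The components of a modification are themselves 2-cells, so reversing 2-cells also
  exchanges the two transformations between which it runs.\<close>

lemma modification_orient:
 "modification w S C M N \<phi> q m \<longleftrightarrow> (if w = Colax then modification Lax (co S) (co C) M N q \<phi> m
   else modification Lax S C M N \<phi> q m)"
 by (auto simp: modification_def cell_between_def slides_def)

lemma lax_natI: "[|fcategory S; fcategory C; is_ffunctor S C M; is_ffunctor S C N; w_natural Lax S C M N \<phi>|]
 ==> lax_nat S C M N \<phi>"
 by (simp add: lax_nat_def lax_nat_axioms_def ffunctorI)

lemma lax_naturalI:
 assumes "at_ob \<phi> \<in> extensional (Obj S)" "at_mor \<phi> \<in> extensional (Mor S)"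
  and "!!X. X \<in> Obj S ==> at_ob \<phi> X \<in> Mor C & dom1 C (at_ob \<phi> X) = fun0 M X & cod1 C (at_ob \<phi> X) = fun0 N X"
  and "!!s. s \<in> Mor S ==> at_mor \<phi> s \<in> Cell C"
  and "!!s. s \<in> Mor S ==> dom2 C (at_mor \<phi> s) = cmp1 C (fun1 N s) (at_ob \<phi> (dom1 S s))"
  and "!!s. s \<in> Mor S ==> cod2 C (at_mor \<phi> s) = cmp1 C (at_ob \<phi> (cod1 S s)) (fun1 M s)"
  and "!!z. z \<in> Cell S ==> vcmp C (whl C (at_ob \<phi> (cod1 S (dom2 S z))) (fun2 M z)) (at_mor \<phi> (dom2 S z))
   = vcmp C (at_mor \<phi> (cod2 S z)) (whr C (fun2 N z) (at_ob \<phi> (dom1 S (dom2 S z))))"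
  and "!!X. X \<in> Obj S ==> at_mor \<phi> (id1 S X) = id2 C (at_ob \<phi> X)"
  and "!!s t. [|s \<in> Mor S; t \<in> Mor S; cod1 S s = dom1 S t|] ==>
   at_mor \<phi> (cmp1 S t s) = vcmp C (whr C (at_mor \<phi> t) (fun1 M s)) (whl C (fun1 N t) (at_mor \<phi> s))"
  and "!!s. s \<in> Tight S ==> identity_cell C (at_mor \<phi> s)"
 shows "w_natural Lax S C M N \<phi>"
 unfolding w_natural_def cell_between_def slides_def vpaste_def w_cell.simps
 by (intro conjI ballI impI) (simp_all only: assms weakness.simps if_False)

text \<open>The structure cells of the two factors are pasted side by side. Naturality in a 2-cell
  \<open>z\<close> is passed through one factor at a time; the composition axiom needs in addition
  that the cell of \<open>\<phi>\<close> at \<open>s\<close> and that of \<open>q\<close> at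
  \<open>t\<close> slide past each other.\<close>

lemma lax_nat_comp:
 assumes "lax_nat S C M N \<phi>" "lax_nat S C N P q"
 shows "w_natural Lax S C M P (comp_transf Lax S C q \<phi>)"
proof -
 interpret f: lax_nat S C M N \<phi> by fact
 interpret g: lax_nat S C N P q by fact
 let ?c = "comp_transf Lax S C q \<phi>"
 let ?v = "vcmp C" and ?h = "hcmp C" and ?i = "id2 C"
 have slide: "?v (?h (?i (at_ob ?c (cod1 S (dom2 S z)))) (fun2 M z)) (at_mor ?c (dom2 S z))
   = ?v (at_mor ?c (cod2 S z)) (?h (fun2 P z) (?i (at_ob ?c (dom1 S (dom2 S z)))))"
  if z: "z \<in> Cell S" for z
 proof -
  let ?X = "dom1 S (dom2 S z)" and ?Y = "cod1 S (dom2 S z)"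
  have 1: "?v (?h (?i (cmp1 C (at_ob q ?Y) (at_ob \<phi> ?Y))) (fun2 M z)) (?h (?i (at_ob q ?Y)) (at_mor \<phi> (dom2 S z)))
   = ?v (?h (?i (at_ob q ?Y)) (at_mor \<phi> (cod2 S z))) (?h (?i (at_ob q ?Y)) (?h (fun2 N z) (?i (at_ob \<phi> ?X))))"
   using arg_cong[OF f.at_mor_slide[OF z], of "?h (?i (at_ob q ?Y))"] z by simp
  have 2: "?v (?h (?i (at_ob q ?Y)) (?h (fun2 N z) (?i (at_ob \<phi> ?X)))) (?h (at_mor q (dom2 S z)) (?i (at_ob \<phi> ?X)))
    = ?v (?h (at_mor q (cod2 S z)) (?i (at_ob \<phi> ?X))) (?h (fun2 P z) (?i (cmp1 C (at_ob q ?X) (at_ob \<phi> ?X))))"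
   using arg_cong[OF g.at_mor_slide[OF z], of "%x. ?h x (?i (at_ob \<phi> ?X))"] z by simp
  show ?thesis
   using z f.M.B.vcmp_swap[OF 1, of "?h (at_mor q (dom2 S z)) (?i (at_ob \<phi> ?X))"]
   by (simp add: comp_transf_def vpaste_def 2)
 qed
 have comp: "at_mor ?c (cmp1 S t s) = ?v (?h (at_mor ?c t) (?i (fun1 M s))) (?h (?i (fun1 P t)) (at_mor ?c s))"
  if st: "s \<in> Mor S" "t \<in> Mor S" "cod1 S s = dom1 S t" for s t
 proof -
  let ?X = "dom1 S s" and ?Y = "cod1 S s" and ?Z = "cod1 S t"
  \<comment> \<open>The pastings for \<open>s\<close> and for \<open>t\<close> meet in these two
    cells, which are horizontally composable; interchange brings them into the other order.\<close>
  have 1: "?v (?h (?i (cmp1 C (at_ob q ?Z) (fun1 N t))) (at_mor \<phi> s)) (?h (at_mor q t) (?i (cmp1 C (fun1 N s) (at_ob \<phi> ?X))))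
   = ?v (?h (at_mor q t) (?i (cmp1 C (at_ob \<phi> ?Y) (fun1 M s)))) (?h (?i (cmp1 C (fun1 P t) (at_ob q ?Y))) (at_mor \<phi> s))"
   using st by (intro f.M.B.exchange[symmetric]) auto
  show ?thesis using st
   by (simp add: comp_transf_def vpaste_def)
    (subst f.M.B.vcmp_swap[OF 1[unfolded st(3)]]; simp)
 qed
 have c0: "at_ob ?c X = cmp1 C (at_ob q X) (at_ob \<phi> X)" if "X \<in> Obj S" for X
  using that by (simp add: comp_transf_def)
 have c1: "at_mor ?c s = ?v (?h (?i (at_ob q (cod1 S s))) (at_mor \<phi> s)) (?h (at_mor q s) (?i (at_ob \<phi> (dom1 S s))))"
  if "s \<in> Mor S" for s
  using that by (simp add: comp_transf_def vpaste_def)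
 have ext: "at_ob ?c \<in> extensional (Obj S)" "at_mor ?c \<in> extensional (Mor S)"
  by (simp_all add: comp_transf_def)
 have tight: "identity_cell C (at_mor ?c s)" if "s \<in> Tight S" for s
 proof -
  have s: "s \<in> Mor S" using that by simp
  note i = f.M.B.identity_cell_eq[OF f.at_mor_Tight[OF that]] f.M.B.identity_cell_eq[OF g.at_mor_Tight[OF that]]
  show ?thesis unfolding c1[OF s]
   using s that
   by (intro f.M.B.identity_cell_hcmp f.M.B.identity_cell_vcmp f.at_mor_Tight g.at_mor_Tight) auto
 qed
 show ?thesis
 proof (rule lax_naturalI[OF ext _ _ _ _ slide _ comp tight])
  show "at_mor ?c (id1 S X) = id2 C (at_ob ?c X)" if "X \<in> Obj S" for X
   using that by (simp add: c0 c1)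
  show "at_mor ?c s \<in> Cell C" "dom2 C (at_mor ?c s) = cmp1 C (fun1 P s) (at_ob ?c (dom1 S s))"
   "cod2 C (at_mor ?c s) = cmp1 C (at_ob ?c (cod1 S s)) (fun1 M s)" if "s \<in> Mor S" for s
   using that by (simp_all add: c0 c1)
  show "at_ob ?c X \<in> Mor C & dom1 C (at_ob ?c X) = fun0 M X & cod1 C (at_ob ?c X) = fun0 P X" if "X \<in> Obj S" for X
   using that by (simp add: c0)
 qed
qed

lemma lax_nat_id:
 assumes "ffunctor S C M" shows "w_natural Lax S C M M (id_transf S C M)"
proof -
 interpret ffunctor S C M by fact
 show ?thesis by (rule lax_naturalI) (auto simp: id_transf_def)
qed

lemma modification_vcmp:
 assumes "lax_nat S C M N \<phi>" "lax_nat S C M N q" "lax_nat S C M N r"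
  and m: "modification Lax S C M N \<phi> q m" and n: "modification Lax S C M N q r n"
 shows "modification Lax S C M N \<phi> r (\<lambda>X\<in>Obj S. vcmp C (n X) (m X))"
proof -
 interpret a: lax_nat S C M N \<phi> by fact
 interpret b: lax_nat S C M N q by fact
 interpret c: lax_nat S C M N r by fact
 have [simp]: "m X \<in> Cell C & dom2 C (m X) = at_ob \<phi> X & cod2 C (m X) = at_ob q X"
  "n X \<in> Cell C & dom2 C (n X) = at_ob q X & cod2 C (n X) = at_ob r X" if "X \<in> Obj S" for X
  using m n that unfolding modification_def cell_between_def by auto
 have ms: "vcmp C (whr C (m (cod1 S s)) (fun1 M s)) (at_mor \<phi> s) =
   vcmp C (at_mor q s) (whl C (fun1 N s) (m (dom1 S s)))" if "s \<in> Mor S" for s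
  using m that unfolding modification_def slides_def by auto
 have ns: "vcmp C (whr C (n (cod1 S s)) (fun1 M s)) (at_mor q s) =
   vcmp C (at_mor r s) (whl C (fun1 N s) (n (dom1 S s)))" if "s \<in> Mor S" for s
  using n that unfolding modification_def slides_def by auto
 show ?thesis
  unfolding modification_def slides_def cell_between_def
  by (auto simp: ms a.M.B.vcmp_swap[OF ns])
qed

text \<open>Each horizontal composite is split into two whiskerings by \<open>hcmp_eq1\<close>. The
  required square is then tiled by four smaller ones: the whiskered modification squares
  \<open>ms\<close> and \<open>ns\<close>, and the interchanges \<open>x1\<close> and
  \<open>x2\<close>.\<close>

lemma modification_hcmp:
 assumes "lax_nat S C M N \<phi>" "lax_nat S C M N \<phi>'" "lax_nat S C N P q" "lax_nat S C N P q'"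
  and m: "modification Lax S C M N \<phi> \<phi>' m" and n: "modification Lax S C N P q q' n"
 shows "modification Lax S C M P (comp_transf Lax S C q \<phi>) (comp_transf Lax S C q' \<phi>')
  (\<lambda>X\<in>Obj S. hcmp C (n X) (m X))"
proof -
 interpret f: lax_nat S C M N \<phi> by fact
 interpret f': lax_nat S C M N \<phi>' by fact
 interpret g: lax_nat S C N P q by fact
 interpret g': lax_nat S C N P q' by fact
 have [simp]: "m X \<in> Cell C & dom2 C (m X) = at_ob \<phi> X & cod2 C (m X) = at_ob \<phi>' X"
  "n X \<in> Cell C & dom2 C (n X) = at_ob q X & cod2 C (n X) = at_ob q' X" if "X \<in> Obj S" for X
  using m n that unfolding modification_def cell_between_def by auto
 let ?v = "vcmp C" and ?h = "hcmp C" and ?i = "id2 C"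
 have "?v (?h (?h (n (cod1 S s)) (m (cod1 S s))) (?i (fun1 M s))) (at_mor (comp_transf Lax S C q \<phi>) s)
  = ?v (at_mor (comp_transf Lax S C q' \<phi>') s) (?h (?i (fun1 P s)) (?h (n (dom1 S s)) (m (dom1 S s))))"
  if s: "s \<in> Mor S" for s
 proof -
  let ?X = "dom1 S s" and ?Y = "cod1 S s"
  have m0: "?v (?h (m ?Y) (?i (fun1 M s))) (at_mor \<phi> s) = ?v (at_mor \<phi>' s) (?h (?i (fun1 N s)) (m ?X))"
   using m s unfolding modification_def slides_def by auto
  have n0: "?v (?h (n ?Y) (?i (fun1 N s))) (at_mor q s) = ?v (at_mor q' s) (?h (?i (fun1 P s)) (n ?X))"
   using n s unfolding modification_def slides_def by auto
  have ms: "?v (?h (?i (at_ob q ?Y)) (?h (m ?Y) (?i (fun1 M s)))) (?h (?i (at_ob q ?Y)) (at_mor \<phi> s)) =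
    ?v (?h (?i (at_ob q ?Y)) (at_mor \<phi>' s)) (?h (?i (cmp1 C (at_ob q ?Y) (fun1 N s))) (m ?X))"
   using s arg_cong[OF m0, of "?h (?i (at_ob q ?Y))"] by simp
  have ns: "?v (?h (n ?Y) (?i (cmp1 C (fun1 N s) (at_ob \<phi>' ?X)))) (?h (at_mor q s) (?i (at_ob \<phi>' ?X))) =
    ?v (?h (at_mor q' s) (?i (at_ob \<phi>' ?X))) (?h (?i (fun1 P s)) (?h (n ?X) (?i (at_ob \<phi>' ?X))))"
   using s arg_cong[OF n0, of "%x. ?h x (?i (at_ob \<phi>' ?X))"] by simp
  have x1: "?v (?h (?i (cmp1 C (at_ob q ?Y) (fun1 N s))) (m ?X)) (?h (at_mor q s) (?i (at_ob \<phi> ?X))) =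
    ?v (?h (at_mor q s) (?i (at_ob \<phi>' ?X))) (?h (?i (cmp1 C (fun1 P s) (at_ob q ?X))) (m ?X))"
   using s by (intro f.M.B.exchange[symmetric]) auto
  have x2: "?v (?h (n ?Y) (?i (cmp1 C (at_ob \<phi>' ?Y) (fun1 M s)))) (?h (?i (at_ob q ?Y)) (at_mor \<phi>' s)) =
    ?v (?h (?i (at_ob q' ?Y)) (at_mor \<phi>' s)) (?h (n ?Y) (?i (cmp1 C (fun1 N s) (at_ob \<phi>' ?X))))"
   using s by (intro f.M.B.exchange) auto
  have n: "?h (n ?Y) (m ?Y) = ?v (?h (n ?Y) (?i (at_ob \<phi>' ?Y))) (?h (?i (at_ob q ?Y)) (m ?Y))"
   "?h (n ?X) (m ?X) = ?v (?h (n ?X) (?i (at_ob \<phi>' ?X))) (?h (?i (at_ob q ?X)) (m ?X))"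
   using s f.M.B.hcmp_eq1[of "m ?Y" "n ?Y"] f.M.B.hcmp_eq1[of "m ?X" "n ?X"] by auto
  have "?v (?h (?h (n ?Y) (m ?Y)) (?i (fun1 M s))) (at_mor (comp_transf Lax S C q \<phi>) s)
   = ?v (?h (n ?Y) (?i (cmp1 C (at_ob \<phi>' ?Y) (fun1 M s)))) (?v (?h (?i (at_ob q ?Y)) (?h (m ?Y) (?i (fun1 M s))))
     (?v (?h (?i (at_ob q ?Y)) (at_mor \<phi> s)) (?h (at_mor q s) (?i (at_ob \<phi> ?X)))))"
   using s unfolding n by (simp add: comp_transf_def vpaste_def)
  also have "\<dots> = ?v (?h (n ?Y) (?i (cmp1 C (at_ob \<phi>' ?Y) (fun1 M s))))
    (?v (?h (?i (at_ob q ?Y)) (at_mor \<phi>' s))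
    (?v (?h (at_mor q s) (?i (at_ob \<phi>' ?X))) (?h (?i (cmp1 C (fun1 P s) (at_ob q ?X))) (m ?X))))"
   using s by (subst f.M.B.vcmp_swap[OF ms]) (simp_all add: x1)
  also have "\<dots> = ?v (?h (?i (at_ob q' ?Y)) (at_mor \<phi>' s)) (?v (?h (at_mor q' s) (?i (at_ob \<phi>' ?X)))
    (?v (?h (?i (fun1 P s)) (?h (n ?X) (?i (at_ob \<phi>' ?X)))) (?h (?i (cmp1 C (fun1 P s) (at_ob q ?X))) (m ?X))))"
   using s by (subst f.M.B.vcmp_swap[OF x2]) (simp_all add: f.M.B.vcmp_swap[OF ns])
  also have "\<dots> = ?v (at_mor (comp_transf Lax S C q' \<phi>') s) (?h (?i (fun1 P s)) (?h (n ?X) (m ?X)))"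
   using s unfolding n by (simp add: comp_transf_def vpaste_def)
  finally show ?thesis .
 qed
 then show ?thesis
  unfolding modification_def slides_def cell_between_def
  by (simp add: comp_transf_def)
qed

section \<open>The functor F-category\<close>

lemma (in fcategory) wgood_id2 [simp]: "f \<in> Mor C ==> wgood w C (id2 C f)"
 by (simp add: wgood_identity)

locale w_nat = M: ffunctor S C M + N: ffunctor S C N
 for S :: "('os, 'ms, 'cs) fcat" and C :: "('o, 'm, 'c) fcat"
  and M N :: "('os, 'ms, 'cs, 'o, 'm, 'c) two_fun" +
 fixes w :: weakness and \<phi> :: "('os, 'ms, 'm, 'c) transf"
 assumes w_natural: "w_natural w S C M N \<phi>"
begin

lemma lax_nat: "lax_nat (orient w S) (orient w C) M N \<phi>"
 using w_natural M.is_ffunctor N.is_ffunctor M.A.fcat M.B.fcat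
 by (auto intro!: lax_natI fcategory_orient is_ffunctor_orient simp: w_natural_orient)

lemma at_ob_ext: "at_ob \<phi> \<in> extensional (Obj S)"
 and at_mor_ext: "at_mor \<phi> \<in> extensional (Mor S)"
 and at_ob_Mor [simp]: "X \<in> Obj S ==> at_ob \<phi> X \<in> Mor C"
 and dom1_at_ob [simp]: "X \<in> Obj S ==> dom1 C (at_ob \<phi> X) = fun0 M X"
 and cod1_at_ob [simp]: "X \<in> Obj S ==> cod1 C (at_ob \<phi> X) = fun0 N X"
 and at_mor_Cell [simp]: "s \<in> Mor S ==> at_mor \<phi> s \<in> Cell C"
 and dom2_at_mor: "[|s \<in> Mor S; w \<noteq> Colax|] ==> dom2 C (at_mor \<phi> s) = cmp1 C (fun1 N s) (at_ob \<phi> (dom1 S s))"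
 and cod2_at_mor: "[|s \<in> Mor S; w \<noteq> Colax|] ==> cod2 C (at_mor \<phi> s) = cmp1 C (at_ob \<phi> (cod1 S s)) (fun1 M s)"
 and dom2_at_mor': "[|s \<in> Mor S; w = Colax|] ==> dom2 C (at_mor \<phi> s) = cmp1 C (at_ob \<phi> (cod1 S s)) (fun1 M s)"
 and cod2_at_mor': "[|s \<in> Mor S; w = Colax|] ==> cod2 C (at_mor \<phi> s) = cmp1 C (fun1 N s) (at_ob \<phi> (dom1 S s))"
 and at_mor_id1 [simp]: "X \<in> Obj S ==> at_mor \<phi> (id1 S X) = id2 C (at_ob \<phi> X)"
 and at_mor_cmp1: "[|s \<in> Mor S; t \<in> Mor S; cod1 S s = dom1 S t|] ==>
   at_mor \<phi> (cmp1 S t s) = vpaste w C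
    (whr C (at_mor \<phi> t) (fun1 M s))
    (whl C (fun1 N t) (at_mor \<phi> s))"
 and at_mor_slides: "z \<in> Cell S ==> slides w C (at_mor \<phi> (dom2 S z)) (at_mor \<phi> (cod2 S z))
   (whr C (fun2 N z) (at_ob \<phi> (dom1 S (dom2 S z))))
   (whl C (at_ob \<phi> (cod1 S (dom2 S z))) (fun2 M z))"
 and at_mor_Tight: "s \<in> Tight S ==> identity_cell C (at_mor \<phi> s)"
 using w_natural unfolding w_natural_def by (cases w; auto simp: cell_between_def)+

lemma at_mor_wgood: "s \<in> Mor S ==> wgood w C (at_mor \<phi> s)"
 using w_natural w_natural_orient[OF M.A.fcat M.B.fcat] by blast

lemma dom1_dom2_at_mor [simp]: "s \<in> Mor S ==> dom1 C (dom2 C (at_mor \<phi> s)) = fun0 M (dom1 S s)"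
 and cod1_dom2_at_mor [simp]: "s \<in> Mor S ==> cod1 C (dom2 C (at_mor \<phi> s)) = fun0 N (cod1 S s)"
 by (cases "w = Colax"; simp add: dom2_at_mor dom2_at_mor')+

end

lemma w_natI: "[|fcategory S; fcategory C; is_ffunctor S C M; is_ffunctor S C N; w_natural w S C M N \<phi>|]
 ==> w_nat S C M N w \<phi>"
 by (simp add: w_nat_def w_nat_axioms_def ffunctorI)

lemma w_natural_comp:
 assumes "w_nat S C M N w \<phi>" "w_nat S C N P w q"
 shows "w_natural w S C M P (comp_transf w S C q \<phi>)"
proof -
 interpret f: w_nat S C M N w \<phi> by fact
 interpret g: w_nat S C N P w q by fact
 interpret O: fcategory "orient w C" by (intro fcategory_orient) unfold_locales
 have "w_natural Lax (orient w S) (orient w C) M P (comp_transf w S C q \<phi>)"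
  unfolding comp_transf_orient[of w] by (rule lax_nat_comp[OF f.lax_nat g.lax_nat])
 moreover have "wgood w C (at_mor (comp_transf w S C q \<phi>) s)" if s: "s \<in> Mor S" for s
 proof (cases "w = Colax")
  case True then show ?thesis by (simp add: wgood_def)
 next
  case False
  show ?thesis unfolding comp_transf_def vpaste_def using s False
   by (auto simp: f.dom2_at_mor f.cod2_at_mor g.dom2_at_mor g.cod2_at_mor
     intro!: f.M.B.wgood_vcmp f.M.B.wgood_hcmp f.at_mor_wgood g.at_mor_wgood)
 qed
 ultimately show ?thesis by (subst w_natural_orient) (auto intro: f.M.A.fcat f.M.B.fcat)
qed

lemma w_natural_id:
 assumes "ffunctor S C M" shows "w_natural w S C M M (id_transf S C M)"
proof -
 interpret M: ffunctor S C M by fact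
 have [simp]: "id_transf (orient w S) (orient w C) M = id_transf S C M"
  by (simp add: id_transf_def)
 have "w_natural Lax (orient w S) (orient w C) M M (id_transf S C M)"
  using lax_nat_id[of "orient w S" "orient w C" M]
  by (simp add: ffunctorI fcategory_orient is_ffunctor_orient M.is_ffunctor M.A.fcat M.B.fcat)
 then show ?thesis
  by (subst w_natural_orient) (auto intro: M.A.fcat M.B.fcat M.B.wgood_identity simp: id_transf_def)
qed

lemma w_modification_vcmp:
 assumes "w_nat S C M N w \<phi>" "w_nat S C M N w q" "w_nat S C M N w r"
  and m: "modification w S C M N \<phi> q m" and n: "modification w S C M N q r n"
 shows "modification w S C M N \<phi> r (\<lambda>X\<in>Obj S. vcmp C (n X) (m X))"
 \<comment> \<open>The second instance serves the colax case, where the modifications run from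
   \<open>r\<close> through \<open>q\<close> to \<open>\<phi>\<close>.\<close>
 using modification_vcmp[OF assms(1-3)[THEN w_nat.lax_nat]] modification_vcmp[OF assms(3,2,1)[THEN w_nat.lax_nat]] m n
 by (auto simp: modification_orient[of w] orient_def split: if_splits)

lemma w_modification_hcmp:
 assumes "w_nat S C M N w \<phi>" "w_nat S C M N w \<phi>'" "w_nat S C N P w q" "w_nat S C N P w q'"
  and m: "modification w S C M N \<phi> \<phi>' m" and n: "modification w S C N P w' q' n" and "w' = q"
 shows "modification w S C M P (comp_transf w S C q \<phi>) (comp_transf w S C q' \<phi>')
  (\<lambda>X\<in>Obj S. hcmp C (n X) (m X))"
 using modification_hcmp[OF assms(1-4)[THEN w_nat.lax_nat]] modification_hcmp[OF assms(2,1,4,3)[THEN w_nat.lax_nat]] m n \<open>w' = q\<close>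
 by (auto simp: modification_orient[of w] comp_transf_orient[of w] orient_def split: if_splits)

lemma w_modification_id2:
 assumes "w_nat S C M N w \<phi>"
 shows "modification w S C M N \<phi> \<phi> (\<lambda>X\<in>Obj S. id2 C (at_ob \<phi> X))"
proof -
 interpret f: w_nat S C M N w \<phi> by fact
 show ?thesis unfolding modification_def slides_def cell_between_def
  by (cases "w = Colax") (auto simp: f.dom2_at_mor f.cod2_at_mor f.dom2_at_mor' f.cod2_at_mor')
qed

section \<open>Membership and operations of the functor \<open>F\<close>-category\<close>

lemma Obj_Fun [simp]: "M \<in> Obj (Fun w S C) \<longleftrightarrow> is_ffunctor S C M"
 by (simp add: Fun_def)

lemma Mor_Fun: "f \<in> Mor (Fun w S C) \<longleftrightarrow> is_ffunctor S C (adom f) & is_ffunctor S C (acod f) &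
  w_natural w S C (adom f) (acod f) (amap f)"
 by (cases f) (auto simp: Fun_def)

lemma Cell_Fun: "a \<in> Cell (Fun w S C) \<longleftrightarrow> adom a \<in> Mor (Fun w S C) & acod a \<in> Mor (Fun w S C) &
  adom (acod a) = adom (adom a) & acod (acod a) = acod (adom a) &
  modification w S C (adom (adom a)) (acod (adom a)) (amap (adom a)) (amap (acod a)) (amap a)"
 unfolding Mor_Fun by (cases a; cases "adom a"; cases "acod a") (auto simp: Fun_def)

lemma Tight_Fun: "f \<in> Tight (Fun w S C) \<longleftrightarrow> f \<in> Mor (Fun w S C) &
  (\<forall>X\<in>Obj S. at_ob (amap f) X \<in> Tight C) & (\<forall>s\<in>Mor S. identity_cell C (at_mor (amap f) s))"
 unfolding Mor_Fun by (cases f) (auto simp: Fun_def)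

lemma Fun_simps [simp]:
 "dom1 (Fun w S C) = adom" "cod1 (Fun w S C) = acod" "dom2 (Fun w S C) = adom" "cod2 (Fun w S C) = acod"
 "id1 (Fun w S C) M = Arr M M (id_transf S C M)"
 "cmp1 (Fun w S C) g f = Arr (adom f) (acod g) (comp_transf w S C (amap g) (amap f))"
 "id2 (Fun w S C) f = Arr f f (\<lambda>X\<in>Obj S. id2 C (at_ob (amap f) X))"
 "vcmp (Fun w S C) b a = Arr (adom a) (acod b) (\<lambda>X\<in>Obj S. vcmp C (amap b X) (amap a X))"
 "hcmp (Fun w S C) b a =
    Arr (Arr (adom (adom a)) (acod (adom b)) (comp_transf w S C (amap (adom b)) (amap (adom a))))
      (Arr (adom (adom a)) (acod (adom b)) (comp_transf w S C (amap (acod b)) (amap (acod a))))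
      (\<lambda>X\<in>Obj S. hcmp C (amap b X) (amap a X))"
 by (simp_all add: Fun_def)

lemma Mor_FunD:
 "[|fcategory S; fcategory C; f \<in> Mor (Fun w S C)|] ==> w_nat S C (adom f) (acod f) w (amap f)"
 by (auto simp: Mor_Fun intro: w_natI)

text \<open>The component maps are \<open>undefined\<close> off the carriers, so agreement on the
  objects and 1-cells of \<open>S\<close> already gives equality in HOL. Almost all equations in
  functor categories below are reduced to \<open>C\<close> in this way.\<close>

lemma Mor_Fun_eqI:
 assumes "f \<in> Mor (Fun w S C)" "g \<in> Mor (Fun w S C)" "adom f = adom g" "acod f = acod g"
  and "!!X. X \<in> Obj S ==> at_ob (amap f) X = at_ob (amap g) X"
  and "!!s. s \<in> Mor S ==> at_mor (amap f) s = at_mor (amap g) s"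
 shows "f = g"
proof -
 have "at_ob (amap f) = at_ob (amap g)" "at_mor (amap f) = at_mor (amap g)"
  using assms by (auto simp: Mor_Fun w_natural_def intro: extensionalityI)
 then show ?thesis using assms(3,4)
  by (auto intro!: arr.expand transf.equality)
qed

lemma Cell_Fun_eqI:
 assumes "a \<in> Cell (Fun w S C)" "b \<in> Cell (Fun w S C)" "adom a = adom b" "acod a = acod b"
  and "!!X. X \<in> Obj S ==> amap a X = amap b X"
 shows "a = b"
proof -
 have "amap a = amap b"
  using assms by (auto simp: Cell_Fun modification_def intro: extensionalityI)
 then show ?thesis using assms(3,4) by (auto intro!: arr.expand)
qed

lemma Cell_FunD:
 assumes "a \<in> Cell (Fun w S C)"
 shows "adom a \<in> Mor (Fun w S C)" "acod a \<in> Mor (Fun w S C)" "adom (acod a) = adom (adom a)"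
  "acod (acod a) = acod (adom a)"
  "!!X. X \<in> Obj S ==> amap a X \<in> Cell C"
  "!!X. X \<in> Obj S ==> dom2 C (amap a X) = at_ob (amap (adom a)) X"
  "!!X. X \<in> Obj S ==> cod2 C (amap a X) = at_ob (amap (acod a)) X"
  "amap a \<in> extensional (Obj S)"
 using assms by (auto simp: Cell_Fun modification_def cell_between_def)

context
 fixes S :: "('os, 'ms, 'cs) fcat" and C :: "('o, 'm, 'c) fcat" and w :: weakness
 assumes S: "fcategory S" and C: "fcategory C"
begin

interpretation S: fcategory S by (rule S)
interpretation C: fcategory C by (rule C)

lemma Mor_Fun_simps:
 assumes "f \<in> Mor (Fun w S C)"
 shows "is_ffunctor S C (adom f)" "is_ffunctor S C (acod f)"
  "!!X. X \<in> Obj S ==> at_ob (amap f) X \<in> Mor C"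
  "!!X. X \<in> Obj S ==> dom1 C (at_ob (amap f) X) = fun0 (adom f) X"
  "!!X. X \<in> Obj S ==> cod1 C (at_ob (amap f) X) = fun0 (acod f) X"
  "!!s. s \<in> Mor S ==> at_mor (amap f) s \<in> Cell C"
  "!!s. s \<in> Mor S ==> dom1 C (dom2 C (at_mor (amap f) s)) = fun0 (adom f) (dom1 S s)"
  "!!s. s \<in> Mor S ==> cod1 C (dom2 C (at_mor (amap f) s)) = fun0 (acod f) (cod1 S s)"
  "at_ob (amap f) \<in> extensional (Obj S)"
  "at_mor (amap f) \<in> extensional (Mor S)"
proof -
 interpret f: w_nat S C "adom f" "acod f" w "amap f" by (rule Mor_FunD[OF S C assms])
 show "is_ffunctor S C (adom f)" "is_ffunctor S C (acod f)"
  "!!X. X \<in> Obj S ==> at_ob (amap f) X \<in> Mor C"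
  "!!X. X \<in> Obj S ==> dom1 C (at_ob (amap f) X) = fun0 (adom f) X"
  "!!X. X \<in> Obj S ==> cod1 C (at_ob (amap f) X) = fun0 (acod f) X"
  "!!s. s \<in> Mor S ==> at_mor (amap f) s \<in> Cell C"
  "!!s. s \<in> Mor S ==> dom1 C (dom2 C (at_mor (amap f) s)) = fun0 (adom f) (dom1 S s)"
  "!!s. s \<in> Mor S ==> cod1 C (dom2 C (at_mor (amap f) s)) = fun0 (acod f) (cod1 S s)"
  "at_ob (amap f) \<in> extensional (Obj S)"
  "at_mor (amap f) \<in> extensional (Mor S)"
  by (simp_all add: f.at_ob_ext f.at_mor_ext f.M.is_ffunctor f.N.is_ffunctor)
qed

lemma comp_Mor_Fun:
 assumes "f \<in> Mor (Fun w S C)" "g \<in> Mor (Fun w S C)" "acod f = adom g"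
 shows "Arr (adom f) (acod g) (comp_transf w S C (amap g) (amap f)) \<in> Mor (Fun w S C)"
 using assms Mor_Fun_simps[OF assms(1)] Mor_Fun_simps[OF assms(2)]
  w_natural_comp[OF Mor_FunD[OF S C assms(1)], of "acod g" "amap g"] Mor_FunD[OF S C assms(2)]
 by (auto simp: Mor_Fun)

lemma id_Mor_Fun: "is_ffunctor S C M ==> Arr M M (id_transf S C M) \<in> Mor (Fun w S C)"
 by (auto simp: Mor_Fun intro!: w_natural_id ffunctorI S C)

lemma vcmp_Cell_Fun:
 assumes "a \<in> Cell (Fun w S C)" "b \<in> Cell (Fun w S C)" "acod a = adom b"
 shows "Arr (adom a) (acod b) (\<lambda>X\<in>Obj S. vcmp C (amap b X) (amap a X)) \<in> Cell (Fun w S C)"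
proof -
 have "w_nat S C (adom (adom a)) (acod (adom a)) w (amap (adom a))"
  "w_nat S C (adom (adom a)) (acod (adom a)) w (amap (acod a))"
  "w_nat S C (adom (adom a)) (acod (adom a)) w (amap (acod b))"
  using Mor_FunD[OF S C, of "adom a" w] Mor_FunD[OF S C, of "acod a" w]
    Mor_FunD[OF S C, of "acod b" w] Cell_FunD[OF assms(1)] Cell_FunD[OF assms(2)] assms(3)
  by auto
 from w_modification_vcmp[OF this, of "amap a" "amap b"] show ?thesis
  using assms by (auto simp: Cell_Fun)
qed

lemma id_Cell_Fun:
 assumes "f \<in> Mor (Fun w S C)"
 shows "Arr f f (\<lambda>X\<in>Obj S. id2 C (at_ob (amap f) X)) \<in> Cell (Fun w S C)"
 using assms w_modification_id2[OF Mor_FunD[OF S C assms]] by (auto simp: Cell_Fun)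

lemma hcmp_Cell_Fun:
 assumes "a \<in> Cell (Fun w S C)" "b \<in> Cell (Fun w S C)" "acod (adom a) = adom (adom b)"
 shows "hcmp (Fun w S C) b a \<in> Cell (Fun w S C)"
proof -
 have m: "w_nat S C (adom (adom a)) (acod (adom a)) w (amap (adom a))"
  "w_nat S C (adom (adom a)) (acod (adom a)) w (amap (acod a))"
  "w_nat S C (acod (adom a)) (acod (adom b)) w (amap (adom b))"
  "w_nat S C (acod (adom a)) (acod (adom b)) w (amap (acod b))"
  using Mor_FunD[OF S C, of "adom a" w] Mor_FunD[OF S C, of "acod a" w]
    Mor_FunD[OF S C, of "adom b" w] Mor_FunD[OF S C, of "acod b" w] Cell_FunD[OF assms(1)] Cell_FunD[OF assms(2)] assms(3)
  by auto
 have n: "modification w S C (adom (adom a)) (acod (adom a)) (amap (adom a)) (amap (acod a)) (amap a)"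
  "modification w S C (acod (adom a)) (acod (adom b)) (amap (adom b)) (amap (acod b)) (amap b)"
  using assms by (auto simp: Cell_Fun)
 have "Arr (adom (adom a)) (acod (adom b)) (comp_transf w S C (amap (adom b)) (amap (adom a))) \<in> Mor (Fun w S C)"
  "Arr (adom (adom a)) (acod (adom b)) (comp_transf w S C (amap (acod b)) (amap (acod a))) \<in> Mor (Fun w S C)"
  using comp_Mor_Fun[of "adom a" "adom b"] comp_Mor_Fun[of "acod a" "acod b"]
   Cell_FunD[OF assms(1)] Cell_FunD[OF assms(2)] assms(3) by auto
 then show ?thesis
  using w_modification_hcmp[OF m n refl] by (simp add: Cell_Fun)
qed

lemma comp_unit_Fun:
 assumes f: "f \<in> Mor (Fun w S C)"
 shows "cmp1 (Fun w S C) (id1 (Fun w S C) (acod f)) f = f" "cmp1 (Fun w S C) f (id1 (Fun w S C) (adom f)) = f"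
proof -
 let ?F = "Fun w S C"
 interpret f: w_nat S C "adom f" "acod f" w "amap f" by (rule Mor_FunD[OF S C f])
 have "cmp1 ?F (id1 ?F (acod f)) f \<in> Mor ?F" "cmp1 ?F f (id1 ?F (adom f)) \<in> Mor ?F"
  using f comp_Mor_Fun[OF f id_Mor_Fun] comp_Mor_Fun[OF id_Mor_Fun f] Mor_Fun_simps[OF f] by simp_all
 then show "cmp1 ?F (id1 ?F (acod f)) f = f" "cmp1 ?F f (id1 ?F (adom f)) = f" using f
  by (cases "w = Colax"; auto intro!: Mor_Fun_eqI simp: comp_transf_def id_transf_def vpaste_def
   f.dom2_at_mor f.cod2_at_mor f.dom2_at_mor' f.cod2_at_mor')+
qed

lemma comp_assoc_Fun:
 assumes c: "f \<in> Mor (Fun w S C)" "g \<in> Mor (Fun w S C)" "h \<in> Mor (Fun w S C)" "acod f = adom g" "acod g = adom h"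
 shows "cmp1 (Fun w S C) (cmp1 (Fun w S C) h g) f = cmp1 (Fun w S C) h (cmp1 (Fun w S C) g f)"
proof -
 let ?F = "Fun w S C"
 interpret f: w_nat S C "adom f" "acod f" w "amap f" by (rule Mor_FunD[OF S C c(1)])
 interpret g: w_nat S C "acod f" "acod g" w "amap g" using Mor_FunD[OF S C c(2)] c by simp
 interpret h: w_nat S C "acod g" "acod h" w "amap h" using Mor_FunD[OF S C c(3)] c by simp
 have "cmp1 ?F (cmp1 ?F h g) f \<in> Mor ?F" "cmp1 ?F h (cmp1 ?F g f) \<in> Mor ?F"
  using c comp_Mor_Fun[OF c(1,2)] comp_Mor_Fun[OF c(2,3)] comp_Mor_Fun[OF c(1) comp_Mor_Fun[OF c(2,3)]]
   comp_Mor_Fun[OF comp_Mor_Fun[OF c(1,2)] c(3)] comp_Mor_Fun[of f "cmp1 ?F h g"] by simp_all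
 then show ?thesis
  by (cases "w = Colax") (auto intro!: Mor_Fun_eqI simp: comp_transf_def vpaste_def
    f.dom2_at_mor f.cod2_at_mor f.dom2_at_mor' f.cod2_at_mor'
    g.dom2_at_mor g.cod2_at_mor g.dom2_at_mor' g.cod2_at_mor'
    h.dom2_at_mor h.cod2_at_mor h.dom2_at_mor' h.cod2_at_mor')
qed

lemma fcategory_Fun: "fcategory (Fun w S C)"
proof -
 let ?F = "Fun w S C"
 have two: "two_category ?F"
 proof (rule two_categoryI, goal_cases)
  case (1 f) then show ?case using Mor_Fun_simps by simp
 next
  case (2 X) then show ?case by (simp add: id_Mor_Fun)
 next
  case (3 f g) then show ?case by (simp add: comp_Mor_Fun)
 next
  case (4 f)
  then show ?case using comp_unit_Fun[OF 4] by simp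
 next
  case (5 f g h)
  then show ?case using comp_assoc_Fun[of f g h] by simp
 next
  case (6 a) then show ?case using Cell_FunD[OF 6] by simp
 next
  case (7 f) then show ?case by (simp add: id_Cell_Fun)
 next
  case (8 a b) then show ?case by (simp add: vcmp_Cell_Fun)
 next
  case (9 a)
  note c = Cell_FunD[OF 9]
  have "vcmp ?F (id2 ?F (acod a)) a \<in> Cell ?F" "vcmp ?F a (id2 ?F (adom a)) \<in> Cell ?F"
   using 9 c vcmp_Cell_Fun[OF 9 id_Cell_Fun] vcmp_Cell_Fun[OF id_Cell_Fun 9] by simp_all
  then show ?case using 9 c by (auto intro!: Cell_Fun_eqI)
 next
  case (10 a b \<gamma>)
  note c = 10[unfolded Fun_simps] and d = Cell_FunD[OF 10(1)] Cell_FunD[OF 10(2)] Cell_FunD[OF 10(3)]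
  have "vcmp ?F (vcmp ?F \<gamma> b) a \<in> Cell ?F" "vcmp ?F \<gamma> (vcmp ?F b a) \<in> Cell ?F"
   using vcmp_Cell_Fun[OF c(1) vcmp_Cell_Fun[OF c(2,3)]] vcmp_Cell_Fun[OF vcmp_Cell_Fun[OF c(1,2)] c(3)] c by simp_all
  then show ?case using c d by (auto intro!: Cell_Fun_eqI)
 next
  case (11 a b)
  show ?case using 11 hcmp_Cell_Fun[of a b] Cell_FunD[OF 11(1)] Cell_FunD[OF 11(2)] by simp
 next
  case (12 a)
  note d = Cell_FunD[OF 12]
  note m = Mor_Fun_simps[OF d(1)] Mor_Fun_simps[OF d(2)]
  have "whl ?F (id1 ?F (acod (adom a))) a \<in> Cell ?F" "whr ?F a (id1 ?F (adom (adom a))) \<in> Cell ?F"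
   using 12 d m hcmp_Cell_Fun[OF 12 id_Cell_Fun[OF id_Mor_Fun]] hcmp_Cell_Fun[OF id_Cell_Fun[OF id_Mor_Fun] 12] by simp_all
  then show ?case using 12 d m comp_unit_Fun[OF d(1)] comp_unit_Fun[OF d(2)]
   by (auto intro!: Cell_Fun_eqI simp: id_transf_def)
 next
  case (13 a b \<gamma>)
  note c = 13[unfolded Fun_simps o_def] and d = Cell_FunD[OF 13(1)] Cell_FunD[OF 13(2)] Cell_FunD[OF 13(3)]
  have m: "X \<in> Obj S ==> fun0 (acod (adom a)) X = fun0 (adom (adom b)) X"
    "X \<in> Obj S ==> fun0 (acod (adom b)) X = fun0 (adom (adom \<gamma>)) X" for X
   using c by simp_all
  note M = Mor_Fun_simps[OF d(1)] Mor_Fun_simps[OF d(2)] Mor_Fun_simps[OF d(9)] Mor_Fun_simps[OF d(10)]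
    Mor_Fun_simps[OF d(17)] Mor_Fun_simps[OF d(18)]
  have e: "hcmp ?F (hcmp ?F \<gamma> b) a \<in> Cell ?F" "hcmp ?F \<gamma> (hcmp ?F b a) \<in> Cell ?F"
   using hcmp_Cell_Fun[OF c(1) hcmp_Cell_Fun[OF c(2,3)]] hcmp_Cell_Fun[OF hcmp_Cell_Fun[OF c(1,2)] c(3)] c d by auto
  show ?case
  proof (rule Cell_Fun_eqI[OF e])
   show "adom (hcmp ?F (hcmp ?F \<gamma> b) a) = adom (hcmp ?F \<gamma> (hcmp ?F b a))"
    using comp_assoc_Fun[OF d(1) d(9) d(17)] c d by simp
   show "acod (hcmp ?F (hcmp ?F \<gamma> b) a) = acod (hcmp ?F \<gamma> (hcmp ?F b a))"
    using comp_assoc_Fun[OF d(2) d(10) d(18)] c d by simp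
   show "amap (hcmp ?F (hcmp ?F \<gamma> b) a) X = amap (hcmp ?F \<gamma> (hcmp ?F b a)) X" if "X \<in> Obj S" for X
    using that d M m by simp
  qed
 next
  case (14 f g)
  then show ?case using Mor_Fun_simps[OF 14(1)] Mor_Fun_simps[OF 14(2)]
   by (auto simp: comp_transf_def fun_eq_iff)
 next
  case (15 a a' b b')
  note c = 15[unfolded Fun_simps o_def] and d = Cell_FunD[OF 15(1)] Cell_FunD[OF 15(2)] Cell_FunD[OF 15(3)] Cell_FunD[OF 15(4)]
  have m: "X \<in> Obj S ==> fun0 (acod (adom a)) X = fun0 (adom (adom b)) X" for X
   using c by simp
  note M = Mor_Fun_simps[OF d(1)] Mor_Fun_simps[OF d(2)] Mor_Fun_simps[OF d(9)] Mor_Fun_simps[OF d(10)]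
    Mor_Fun_simps[OF d(17)] Mor_Fun_simps[OF d(18)] Mor_Fun_simps[OF d(25)] Mor_Fun_simps[OF d(26)]
  show ?case using d m M c by (auto simp: fun_eq_iff C.interchange)
 qed
 have "id1 ?F X \<in> Tight ?F" if "X \<in> Obj ?F" for X
 proof -
  interpret X: ffunctor S C X using that by (simp add: ffunctorI S C)
  show ?thesis using that by (simp add: Tight_Fun id_Mor_Fun) (simp add: id_transf_def)
 qed
 moreover have "cmp1 ?F g f \<in> Tight ?F" if f: "f \<in> Tight ?F" and g: "g \<in> Tight ?F" and fg: "acod f = adom g" for f g
 proof -
  have m: "f \<in> Mor ?F" "g \<in> Mor ?F" using f g by (auto simp: Tight_Fun)
  note M = Mor_Fun_simps[OF m(1)] Mor_Fun_simps[OF m(2)]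
  interpret f: w_nat S C "adom f" "acod f" w "amap f" by (rule Mor_FunD[OF S C m(1)])
  interpret g: w_nat S C "acod f" "acod g" w "amap g" using Mor_FunD[OF S C m(2)] fg by simp
  have "identity_cell C (at_mor (comp_transf w S C (amap g) (amap f)) s)" if "s \<in> Mor S" for s
  proof -
   have "identity_cell C (at_mor (amap f) s)" "identity_cell C (at_mor (amap g) s)"
    using f g that by (auto simp: Tight_Fun)
   then show ?thesis using that
    by (cases "w = Colax") (auto simp: comp_transf_def vpaste_def f.dom2_at_mor f.cod2_at_mor f.dom2_at_mor' f.cod2_at_mor'
      g.dom2_at_mor g.cod2_at_mor g.dom2_at_mor' g.cod2_at_mor'
      intro!: C.identity_cell_vcmp C.identity_cell_hcmp)
  qed
  then show ?thesis using f g fg comp_Mor_Fun[OF m fg] M by (auto simp: Tight_Fun comp_transf_def)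
 qed
 ultimately show ?thesis using two by (auto simp: fcategory_def fcategory_axioms_def Tight_Fun)
qed

end

lemma full_subfcat_simps [simp]:
 "Obj (full_subfcat C P) = Obj C \<inter> P"
 "Mor (full_subfcat C P) = {f \<in> Mor C. dom1 C f \<in> P & cod1 C f \<in> P}"
 "Cell (full_subfcat C P) = {a \<in> Cell C. dom1 C (dom2 C a) \<in> P & cod1 C (dom2 C a) \<in> P}"
 "Tight (full_subfcat C P) = {f \<in> Tight C. dom1 C f \<in> P & cod1 C f \<in> P}"
 "dom1 (full_subfcat C P) = dom1 C" "cod1 (full_subfcat C P) = cod1 C" "id1 (full_subfcat C P) = id1 C"
 "cmp1 (full_subfcat C P) = cmp1 C" "dom2 (full_subfcat C P) = dom2 C" "cod2 (full_subfcat C P) = cod2 C"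
 "id2 (full_subfcat C P) = id2 C" "vcmp (full_subfcat C P) = vcmp C" "hcmp (full_subfcat C P) = hcmp C"
 by (simp_all add: full_subfcat_def)

lemma fcategory_full_subfcat:
 assumes "fcategory C" shows "fcategory (full_subfcat C P)"
proof -
 interpret fcategory C by fact
 have "two_category (full_subfcat C P)"
  by (rule two_categoryI) (simp_all add: interchange)
 then show ?thesis by (auto simp: fcategory_def fcategory_axioms_def)
qed

section \<open>Evaluation at an object\<close>

definition ev :: "weakness => ('os, 'ms, 'cs) fcat => ('o, 'm, 'c) fcat => 'os =>
  (('os, 'ms, 'cs, 'o, 'm, 'c) two_fun, ('os, 'ms, 'cs, 'o, 'm, 'c) fun1c,
   ('os, 'ms, 'cs, 'o, 'm, 'c) fun2c, 'o, 'm, 'c) two_fun" where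
 "ev w S C X = \<lparr>fun0 = \<lambda>M\<in>Obj (Fun w S C). fun0 M X, fun1 = \<lambda>f\<in>Mor (Fun w S C). at_ob (amap f) X,
   fun2 = \<lambda>\<alpha>\<in>Cell (Fun w S C). amap \<alpha> X\<rparr>"

lemma is_ffunctor_ev:
 assumes S: "fcategory S" and C: "fcategory C" and X: "X \<in> Obj S"
 shows "is_ffunctor (Fun w S C) C (ev w S C X)"
proof -
 let ?F = "Fun w S C"
 interpret S: fcategory S by (rule S)
 interpret C: fcategory C by (rule C)
 interpret F: fcategory ?F by (rule fcategory_Fun[OF S C])
 have "is_two_functor ?F C (ev w S C X)"
 proof (rule is_two_functorI, goal_cases)
  case 3
  have "fun0 M X \<in> Obj C" if "is_ffunctor S C M" for M
  proof -
   interpret M: ffunctor S C M by (rule ffunctorI[OF S C that])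
   show ?thesis using X by simp
  qed
  then show ?case by (simp add: ev_def)
 next
  case 4 then show ?case using X Mor_Fun_simps[OF S C] by (auto simp: ev_def)
 next
  case 5 then show ?case using X Cell_FunD by (fastforce simp: ev_def)
 next
  case (6 f) then show ?case using X Mor_Fun_simps[OF S C 6] by (auto simp: ev_def)
 next
  case (7 a) then show ?case using X Cell_FunD[OF 7] by (auto simp: ev_def)
 next
  case (8 M) then show ?case using X F.id1_Mor[OF 8] by (auto simp: ev_def id_transf_def)
 next
  case (9 f) then show ?case using X F.id2_Cell[OF 9] Mor_Fun_simps[OF S C 9] by (auto simp: ev_def)
 next
  case (10 f g) then show ?case using X F.cmp1_Mor[OF 10] by (auto simp: ev_def comp_transf_def)
 next
  case (11 a b) then show ?case using X F.vcmp_Cell[OF 11] by (auto simp: ev_def)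
 next
  case (12 a b) then show ?case using X F.hcmp_Cell[OF 12] by (auto simp: ev_def)
 qed (simp_all add: F.two_category_axioms C.two_category_axioms)
 then show ?thesis using X by (auto simp: is_ffunctor_def ev_def Tight_Fun)
qed

section \<open>Weights for tight limits\<close>

lemma chordate_simps [simp]:
 "Obj (chordate J) = Obj J" "Mor (chordate J) = Mor J" "Cell (chordate J) = Cell J" "dom1 (chordate J) = dom1 J"
 "cod1 (chordate J) = cod1 J" "id1 (chordate J) = id1 J" "cmp1 (chordate J) = cmp1 J" "dom2 (chordate J) = dom2 J"
 "cod2 (chordate J) = cod2 J" "id2 (chordate J) = id2 J" "vcmp (chordate J) = vcmp J" "hcmp (chordate J) = hcmp J"
 "Tight (chordate J) = Mor J"
 by (simp_all add: chordate_def two_cat.extend_def fcat.fields_def)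

lemma fcategory_chordate: assumes "two_category J" shows "fcategory (chordate J)"
proof -
 interpret two_category J by fact
 have "two_category (chordate J)"
  by (rule two_categoryI) (simp_all add: interchange)
 then show ?thesis by (auto simp: fcategory_def fcategory_axioms_def)
qed

lemma is_functor_cong_ext:
 "is_functor A B F \<longleftrightarrow> on_ob F \<in> extensional (Ob A) & on_ar F \<in> extensional (Ar A) &
  (\<forall>x\<in>Ob A. on_ob F x \<in> Ob B) & (\<forall>f\<in>Ar A. on_ar F f \<in> Ar B &
   src B (on_ar F f) = on_ob F (src A f) & trg B (on_ar F f) = on_ob F (trg A f)) &
  (\<forall>x\<in>Ob A. on_ar F (idn A x) = idn B (on_ob F x)) &
  (\<forall>f\<in>Ar A. \<forall>g\<in>Ar A. trg A f = src A g -->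
   on_ar F (cmp A g f) = cmp B (on_ar F g) (on_ar F f))"
 unfolding is_functor_def PiE_iff by blast

lemma id_functor_is_functor: "category A ==> is_functor A A (id_functor A)"
 by (auto simp: is_functor_def id_functor_def category_def)

lemma full_embedding_id: "category A ==> full_embedding (id_embedding A)"
 unfolding full_embedding_def id_embedding_def
 by (auto simp: id_functor_is_functor) (auto simp: id_functor_def inj_on_def bij_betw_def homset_def)

lemma comp_functor_id:
 assumes "is_functor A B F" shows "comp_functor A F (id_functor A) = F" "comp_functor A (id_functor B) F = F"
 using assms unfolding is_functor_cong_ext comp_functor_def id_functor_def
 by (auto intro!: functr.equality simp: compose_def extensional_def fun_eq_iff)

lemma tight_functor_id: "is_functor A B F ==> tight_functor (id_embedding A) (id_embedding B) F"
 by (auto simp: tight_functor_def id_embedding_def comp_functor_id)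

locale cat_weight = J: two_category J
 for J :: "('oj, 'mj, 'cj) two_cat" +
 fixes W :: "('oj, 'mj, 'cj, ('x, 'y) cat, ('x, 'y) cat1, ('x, 'y) cat2) two_fun"
 assumes W: "is_two_functor J CAT W"
begin

lemma W0 [simp]: "j \<in> Obj J ==> category (fun0 W j)"
 using W unfolding is_two_functor_def is_functor_def mor_cat_def CAT_def cats_over_def by auto

lemma W1 [simp]: assumes "u \<in> Mor J" shows "adom (fun1 W u) = fun0 W (dom1 J u)" "acod (fun1 W u) = fun0 W (cod1 J u)"
  "is_functor (fun0 W (dom1 J u)) (fun0 W (cod1 J u)) (amap (fun1 W u))"
proof -
 have "fun1 W u \<in> Mor CAT" and a: "adom (fun1 W u) = fun0 W (dom1 J u)" "acod (fun1 W u) = fun0 W (cod1 J u)"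
  using W assms unfolding is_two_functor_def is_functor_def mor_cat_def CAT_def cats_over_def by (auto simp: PiE_iff)
 then show "adom (fun1 W u) = fun0 W (dom1 J u)" "acod (fun1 W u) = fun0 W (cod1 J u)"
  "is_functor (fun0 W (dom1 J u)) (fun0 W (cod1 J u)) (amap (fun1 W u))"
  by (auto simp: CAT_def cats_over_def)
qed

lemma W2: assumes "e \<in> Cell J" shows "adom (fun2 W e) = fun1 W (dom2 J e)" "acod (fun2 W e) = fun1 W (cod2 J e)"
  "is_nat_trans (fun0 W (dom1 J (dom2 J e))) (fun0 W (cod1 J (dom2 J e))) (amap (fun1 W (dom2 J e))) (amap (fun1 W (cod2 J e)))
   (amap (fun2 W e))"
proof -
 have "fun2 W e \<in> Cell CAT" and a: "adom (fun2 W e) = fun1 W (dom2 J e)" "acod (fun2 W e) = fun1 W (cod2 J e)"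
  using W assms unfolding is_two_functor_def is_functor_def vert_cat_def CAT_def cats_over_def by (auto simp: PiE_iff)
 then obtain a b F G t where "fun2 W e = Arr (Arr a b F) (Arr a b G) t" "is_nat_trans a b F G t"
  by (auto simp: CAT_def cats_over_def)
 then show "adom (fun2 W e) = fun1 W (dom2 J e)" "acod (fun2 W e) = fun1 W (cod2 J e)"
  "is_nat_trans (fun0 W (dom1 J (dom2 J e))) (fun0 W (cod1 J (dom2 J e))) (amap (fun1 W (dom2 J e))) (amap (fun1 W (cod2 J e)))
   (amap (fun2 W e))"
  using a W1[of "dom2 J e"] assms by (auto simp: a[symmetric])
qed

lemma Wops:
 "X \<in> Obj J ==> fun1 W (id1 J X) = Arr (fun0 W X) (fun0 W X) (id_functor (fun0 W X))"
 "[|u \<in> Mor J; v \<in> Mor J; cod1 J u = dom1 J v|] ==> fun1 W (cmp1 J v u) =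
   Arr (fun0 W (dom1 J u)) (fun0 W (cod1 J v)) (comp_functor (fun0 W (dom1 J u)) (amap (fun1 W v)) (amap (fun1 W u)))"
 "u \<in> Mor J ==> fun2 W (id2 J u) = id2 CAT (fun1 W u)"
 "[|a \<in> Cell J; b \<in> Cell J; cod2 J a = dom2 J b|] ==> fun2 W (vcmp J b a) = vcmp CAT (fun2 W b) (fun2 W a)"
 "[|a \<in> Cell J; b \<in> Cell J; cod1 J (dom2 J a) = dom1 J (dom2 J b)|] ==> fun2 W (hcmp J b a) = hcmp CAT (fun2 W b) (fun2 W a)"
   apply (insert W)
 subgoal unfolding is_two_functor_def is_functor_def mor_cat_def by (simp add: CAT_def cats_over_def)
 subgoal unfolding is_two_functor_def is_functor_def mor_cat_def by (simp add: CAT_def cats_over_def)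
 subgoal unfolding is_two_functor_def is_functor_def vert_cat_def by simp
 subgoal unfolding is_two_functor_def is_functor_def vert_cat_def by simp
 subgoal unfolding is_two_functor_def is_functor_def horiz_cat_def by simp
 done

lemma W_ob [simp]: "[|u \<in> Mor J; x \<in> Ob (fun0 W (dom1 J u))|] ==> on_ob (amap (fun1 W u)) x \<in> Ob (fun0 W (cod1 J u))"
 and W_ar [simp]: "[|u \<in> Mor J; a \<in> Ar (fun0 W (dom1 J u))|] ==> on_ar (amap (fun1 W u)) a \<in> Ar (fun0 W (cod1 J u))"
 and W_src [simp]: "[|u \<in> Mor J; a \<in> Ar (fun0 W (dom1 J u))|] ==> src (fun0 W (cod1 J u)) (on_ar (amap (fun1 W u)) a) = on_ob (amap (fun1 W u)) (src (fun0 W (dom1 J u)) a)"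
 and W_trg [simp]: "[|u \<in> Mor J; a \<in> Ar (fun0 W (dom1 J u))|] ==> trg (fun0 W (cod1 J u)) (on_ar (amap (fun1 W u)) a) = on_ob (amap (fun1 W u)) (trg (fun0 W (dom1 J u)) a)"
 and W_ext: "u \<in> Mor J ==> on_ob (amap (fun1 W u)) \<in> extensional (Ob (fun0 W (dom1 J u)))"
  "u \<in> Mor J ==> on_ar (amap (fun1 W u)) \<in> extensional (Ar (fun0 W (dom1 J u)))"
 using W1(3)[of u] by (auto simp: is_functor_cong_ext)

lemma W_cell [simp]: assumes "a \<in> Cell J" "x \<in> Ob (fun0 W (dom1 J (dom2 J a)))"
 shows "amap (fun2 W a) x \<in> Ar (fun0 W (cod1 J (dom2 J a)))"
  "src (fun0 W (cod1 J (dom2 J a))) (amap (fun2 W a) x) = on_ob (amap (fun1 W (dom2 J a))) x"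
  "trg (fun0 W (cod1 J (dom2 J a))) (amap (fun2 W a) x) = on_ob (amap (fun1 W (cod2 J a))) x"
 using W2(3)[OF assms(1)] assms by (auto simp: is_nat_trans_def homset_def)

lemma W_cat [simp]:
 assumes "j \<in> Obj J"
 shows "a \<in> Ar (fun0 W j) ==> src (fun0 W j) a \<in> Ob (fun0 W j)"
  "a \<in> Ar (fun0 W j) ==> trg (fun0 W j) a \<in> Ob (fun0 W j)"
  "x \<in> Ob (fun0 W j) ==> idn (fun0 W j) x \<in> Ar (fun0 W j)"
  "x \<in> Ob (fun0 W j) ==> src (fun0 W j) (idn (fun0 W j) x) = x"
  "x \<in> Ob (fun0 W j) ==> trg (fun0 W j) (idn (fun0 W j) x) = x"
  "[|a \<in> Ar (fun0 W j); b \<in> Ar (fun0 W j); trg (fun0 W j) a = src (fun0 W j) b|] ==> cmp (fun0 W j) b a \<in> Ar (fun0 W j)"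
  "[|a \<in> Ar (fun0 W j); b \<in> Ar (fun0 W j); trg (fun0 W j) a = src (fun0 W j) b|] ==> src (fun0 W j) (cmp (fun0 W j) b a) = src (fun0 W j) a"
  "[|a \<in> Ar (fun0 W j); b \<in> Ar (fun0 W j); trg (fun0 W j) a = src (fun0 W j) b|] ==> trg (fun0 W j) (cmp (fun0 W j) b a) = trg (fun0 W j) b"
 using category.src_Ob category.trg_Ob category.idn_Ar category.src_idn category.trg_idn category.cmp_Ar
  category.src_cmp category.trg_cmp W0[OF assms] by metis+

text \<open>Between identity embeddings every functor is tight, so all 1-cells of the chordate shape
  go to tight 1-cells and the remaining conditions are those of the 2-functor
  \<open>W\<close>.\<close>

lemma f_weight_plus: "f_weight (plus_weight J W)"
proof -
 let ?w = "wt (plus_weight J W)"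
 have m: "map_arr id_embedding id (fun1 W u) \<in> Mor FF" if "u \<in> Mor J" for u
  using W1[OF that] that by (cases "fun1 W u")
   (auto simp: FF_def two_cat.extend_def fcat.fields_def cats_over_def full_embedding_id, auto simp: id_embedding_def)
 have c: "map_arr (map_arr id_embedding id) id (fun2 W e) \<in> Cell FF" if "e \<in> Cell J" for e
  using W1[of "dom2 J e"] W1[of "cod2 J e"] W2[OF that] that
  by (cases "fun2 W e"; cases "fun1 W (dom2 J e)"; cases "fun1 W (cod2 J e)")
   (auto simp: FF_def two_cat.extend_def fcat.fields_def cats_over_def full_embedding_id, auto simp: id_embedding_def)
 have l: "loose (id_embedding A) = A" for A :: "('x, 'y) cat" by (simp add: id_embedding_def)
 have [simp]: "Obj FF = {A :: ('x, 'y) embedding. full_embedding A}"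
   "!!A :: ('x, 'y) embedding. id1 FF A = Arr A A (id_functor (loose A))"
   "!!g f :: ('x, 'y) emb1. cmp1 FF g f = Arr (adom f) (acod g) (comp_functor (loose (adom f)) (amap g) (amap f))"
   "!!f :: ('x, 'y) emb1. dom1 FF f = adom f" "!!f :: ('x, 'y) emb1. cod1 FF f = acod f"
   "!!f :: ('x, 'y) emb2. dom2 FF f = adom f" "!!f :: ('x, 'y) emb2. cod2 FF f = acod f"
  by (simp_all add: FF_def two_cat.extend_def fcat.fields_def cats_over_def)
 have am: "adom (map_arr f g a) = f (adom a)" "acod (map_arr f g a) = f (acod a)" "amap (map_arr f g a) = g (amap a)"
  for f g and a :: "('z1, 'z2) arr" by (cases a; simp)+
 have d1: "dom1 J u \<in> Obj J" if "u \<in> Mor J" for u using that by simp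
 have 1: "is_functor (mor_cat (chordate J)) (mor_cat FF) \<lparr>on_ob = fun0 ?w, on_ar = fun1 ?w\<rparr>"
  unfolding is_functor_def mor_cat_def plus_weight_def
  using m by (auto simp: full_embedding_id am Wops l)
 have 2: "is_functor (vert_cat (chordate J)) (vert_cat FF) \<lparr>on_ob = fun1 ?w, on_ar = fun2 ?w\<rparr>"
  unfolding is_functor_def vert_cat_def plus_weight_def
  using m c by (auto simp: am Wops l W2 CAT_def FF_def two_cat.extend_def fcat.fields_def cats_over_def)
 have 3: "is_functor (horiz_cat (chordate J)) (horiz_cat FF) \<lparr>on_ob = fun0 ?w, on_ar = fun2 ?w\<rparr>"
  unfolding is_functor_def horiz_cat_def plus_weight_def
  using c by (auto simp: full_embedding_id am Wops l W2 CAT_def FF_def two_cat.extend_def fcat.fields_def cats_over_def)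
 have 4: "fun1 ?w u \<in> Tight FF" if "u \<in> Mor J" for u
  using that W1[OF that] by (cases "fun1 W u") (auto simp: plus_weight_def FF_def two_cat.extend_def fcat.fields_def full_embedding_id tight_functor_id)
 show ?thesis unfolding f_weight_def is_ffunctor_def is_two_functor_def
  using 1 2 3 4 fcategory_chordate[OF J.two_category_axioms] by (simp add: plus_weight_def)
qed

end

section \<open>Limits in elementary terms\<close>

text \<open>\<open>lcone C J W D Y c0 c1\<close>: the 1-cells \<open>c0 j x\<close> and the 2-cells \<open>c1 j a\<close> form a 2-natural
 transformation \<open>W => C(Y, D-)\<close>.  \<open>lmod\<close> describes the modifications between two of these, and
 \<open>limcone\<close> spells out in these terms that a cone with tight legs is a limit cone.\<close>

definition lcone :: "('o, 'm, 'c) fcat => ('oj, 'mj, 'cj) two_cat =>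
  ('oj, 'mj, 'cj, ('x, 'y) cat, ('x, 'y) cat1, ('x, 'y) cat2) two_fun =>
  ('oj, 'mj, 'cj, 'o, 'm, 'c) two_fun => 'o => ('oj => 'x => 'm) => ('oj => 'y => 'c) => bool" where
 "lcone C J W D Y c0 c1 \<longleftrightarrow> Y \<in> Obj C &
  (\<forall>j\<in>Obj J. \<forall>x\<in>Ob (fun0 W j). c0 j x \<in> Mor C & dom1 C (c0 j x) = Y & cod1 C (c0 j x) = fun0 D j) &
  (\<forall>j\<in>Obj J. \<forall>a\<in>Ar (fun0 W j). c1 j a \<in> Cell C & dom2 C (c1 j a) = c0 j (src (fun0 W j) a) &
    cod2 C (c1 j a) = c0 j (trg (fun0 W j) a)) &
  (\<forall>j\<in>Obj J. \<forall>x\<in>Ob (fun0 W j). c1 j (idn (fun0 W j) x) = id2 C (c0 j x)) &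
  (\<forall>j\<in>Obj J. \<forall>a\<in>Ar (fun0 W j). \<forall>b\<in>Ar (fun0 W j). trg (fun0 W j) a = src (fun0 W j) b -->
    c1 j (cmp (fun0 W j) b a) = vcmp C (c1 j b) (c1 j a)) &
  (\<forall>u\<in>Mor J. \<forall>x\<in>Ob (fun0 W (dom1 J u)).
    cmp1 C (fun1 D u) (c0 (dom1 J u) x) = c0 (cod1 J u) (on_ob (amap (fun1 W u)) x)) &
  (\<forall>u\<in>Mor J. \<forall>a\<in>Ar (fun0 W (dom1 J u)).
    whl C (fun1 D u) (c1 (dom1 J u) a) = c1 (cod1 J u) (on_ar (amap (fun1 W u)) a)) &
  (\<forall>\<alpha>\<in>Cell J. \<forall>x\<in>Ob (fun0 W (dom1 J (dom2 J \<alpha>))).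
    whr C (fun2 D \<alpha>) (c0 (dom1 J (dom2 J \<alpha>)) x) = c1 (cod1 J (dom2 J \<alpha>)) (amap (fun2 W \<alpha>) x))"

definition lmod :: "('o, 'm, 'c) fcat => ('oj, 'mj, 'cj) two_cat =>
  ('oj, 'mj, 'cj, ('x, 'y) cat, ('x, 'y) cat1, ('x, 'y) cat2) two_fun =>
  ('oj, 'mj, 'cj, 'o, 'm, 'c) two_fun => ('oj => 'x => 'm) => ('oj => 'y => 'c) =>
  ('oj => 'x => 'm) => ('oj => 'y => 'c) => ('oj => 'x => 'c) => bool" where
 "lmod C J W D c0 c1 d0 d1 m \<longleftrightarrow>
  (\<forall>j\<in>Obj J. \<forall>x\<in>Ob (fun0 W j). m j x \<in> Cell C & dom2 C (m j x) = c0 j x & cod2 C (m j x) = d0 j x) &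
  (\<forall>j\<in>Obj J. \<forall>a\<in>Ar (fun0 W j).
    vcmp C (d1 j a) (m j (src (fun0 W j) a)) = vcmp C (m j (trg (fun0 W j) a)) (c1 j a)) &
  (\<forall>u\<in>Mor J. \<forall>x\<in>Ob (fun0 W (dom1 J u)).
    whl C (fun1 D u) (m (dom1 J u) x) = m (cod1 J u) (on_ob (amap (fun1 W u)) x))"

definition limcone :: "('o, 'm, 'c) fcat => ('oj, 'mj, 'cj) two_cat =>
  ('oj, 'mj, 'cj, ('x, 'y) cat, ('x, 'y) cat1, ('x, 'y) cat2) two_fun =>
  ('oj, 'mj, 'cj, 'o, 'm, 'c) two_fun => 'o => ('oj => 'x => 'm) => ('oj => 'y => 'c) => bool" where
 "limcone C J W D P p0 p1 \<longleftrightarrow> lcone C J W D P p0 p1 &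
  (\<forall>j\<in>Obj J. \<forall>x\<in>Ob (fun0 W j). p0 j x \<in> Tight C) &
  (\<forall>Y c0 c1. lcone C J W D Y c0 c1 --> (\<exists>f\<in>Mor C. dom1 C f = Y & cod1 C f = P &
    (\<forall>j\<in>Obj J. \<forall>x\<in>Ob (fun0 W j). cmp1 C (p0 j x) f = c0 j x) &
    (\<forall>j\<in>Obj J. \<forall>a\<in>Ar (fun0 W j). whr C (p1 j a) f = c1 j a))) &
  (\<forall>f\<in>Mor C. \<forall>g\<in>Mor C. dom1 C f = dom1 C g --> cod1 C f = P --> cod1 C g = P -->
    (\<forall>j\<in>Obj J. \<forall>x\<in>Ob (fun0 W j). cmp1 C (p0 j x) f = cmp1 C (p0 j x) g) -->
    (\<forall>j\<in>Obj J. \<forall>a\<in>Ar (fun0 W j). whr C (p1 j a) f = whr C (p1 j a) g) --> f = g) &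
  (\<forall>f\<in>Mor C. \<forall>g\<in>Mor C. \<forall>m. dom1 C f = dom1 C g --> cod1 C f = P --> cod1 C g = P -->
    lmod C J W D (%j x. cmp1 C (p0 j x) f) (%j a. whr C (p1 j a) f)
     (%j x. cmp1 C (p0 j x) g) (%j a. whr C (p1 j a) g) m -->
    (\<exists>\<alpha>\<in>Cell C. dom2 C \<alpha> = f & cod2 C \<alpha> = g &
     (\<forall>j\<in>Obj J. \<forall>x\<in>Ob (fun0 W j). whl C (p0 j x) \<alpha> = m j x))) &
  (\<forall>\<alpha>\<in>Cell C. \<forall>\<beta>\<in>Cell C. dom2 C \<alpha> = dom2 C \<beta> --> cod2 C \<alpha> = cod2 C \<beta> --> cod1 C (dom2 C \<alpha>) = P -->
    (\<forall>j\<in>Obj J. \<forall>x\<in>Ob (fun0 W j). whl C (p0 j x) \<alpha> = whl C (p0 j x) \<beta>) --> \<alpha> = \<beta>) &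
  (\<forall>f\<in>Mor C. cod1 C f = P --> (\<forall>j\<in>Obj J. \<forall>x\<in>Ob (fun0 W j). cmp1 C (p0 j x) f \<in> Tight C) --> f \<in> Tight C)"

lemma limcone_lcone: "limcone C J W D P p0 p1 ==> lcone C J W D P p0 p1"
 unfolding limcone_def by (rule conjunct1)

lemma limcone_Tight: "[|limcone C J W D P p0 p1; j \<in> Obj J; x \<in> Ob (fun0 W j)|] ==> p0 j x \<in> Tight C"
 by (rule limcone_def[THEN iffD1, THEN conjunct2, THEN conjunct1, rule_format])

lemma limcone_ex1:
 assumes "limcone C J W D P p0 p1" "lcone C J W D Y c0 c1"
 obtains f where "f \<in> Mor C" "dom1 C f = Y" "cod1 C f = P"
  "!!j x. [|j \<in> Obj J; x \<in> Ob (fun0 W j)|] ==> cmp1 C (p0 j x) f = c0 j x"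
  "!!j a. [|j \<in> Obj J; a \<in> Ar (fun0 W j)|] ==> whr C (p1 j a) f = c1 j a"
 using assms(1)[unfolded limcone_def, THEN conjunct2, THEN conjunct2, THEN conjunct1, rule_format, OF assms(2)]
 by blast

lemma limcone_eq1:
 assumes "limcone C J W D P p0 p1" "f \<in> Mor C" "g \<in> Mor C" "dom1 C f = dom1 C g" "cod1 C f = P" "cod1 C g = P"
  "!!j x. [|j \<in> Obj J; x \<in> Ob (fun0 W j)|] ==> cmp1 C (p0 j x) f = cmp1 C (p0 j x) g"
  "!!j a. [|j \<in> Obj J; a \<in> Ar (fun0 W j)|] ==> whr C (p1 j a) f = whr C (p1 j a) g"
 shows "f = g"
 by (rule assms(1)[unfolded limcone_def, THEN conjunct2, THEN conjunct2, THEN conjunct2, THEN conjunct1, rule_format, OF assms(2-8)])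

lemma limcone_ex2:
 assumes "limcone C J W D P p0 p1" "f \<in> Mor C" "g \<in> Mor C" "dom1 C f = dom1 C g" "cod1 C f = P" "cod1 C g = P"
   "lmod C J W D (%j x. cmp1 C (p0 j x) f) (%j a. whr C (p1 j a) f)
     (%j x. cmp1 C (p0 j x) g) (%j a. whr C (p1 j a) g) m"
 obtains e where "e \<in> Cell C" "dom2 C e = f" "cod2 C e = g"
  "!!j x. [|j \<in> Obj J; x \<in> Ob (fun0 W j)|] ==> whl C (p0 j x) e = m j x"
 using assms(1)[unfolded limcone_def, THEN conjunct2, THEN conjunct2, THEN conjunct2, THEN conjunct2, THEN conjunct1, rule_format, OF assms(2-7)]
 by blast

lemma limcone_eq2:
 assumes "limcone C J W D P p0 p1" "a \<in> Cell C" "b \<in> Cell C" "dom2 C a = dom2 C b" "cod2 C a = cod2 C b" "cod1 C (dom2 C a) = P"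
  "!!j x. [|j \<in> Obj J; x \<in> Ob (fun0 W j)|] ==> whl C (p0 j x) a = whl C (p0 j x) b"
 shows "a = b"
 by (rule assms(1)[unfolded limcone_def, THEN conjunct2, THEN conjunct2, THEN conjunct2, THEN conjunct2, THEN conjunct2, THEN conjunct1, rule_format, OF assms(2-7)])

lemma limconeI:
 assumes "lcone C J W D P p0 p1" "!!j x. [|j \<in> Obj J; x \<in> Ob (fun0 W j)|] ==> p0 j x \<in> Tight C"
  and "!!Y c0 c1. lcone C J W D Y c0 c1 ==> \<exists>f\<in>Mor C. dom1 C f = Y & cod1 C f = P &
    (\<forall>j\<in>Obj J. \<forall>x\<in>Ob (fun0 W j). cmp1 C (p0 j x) f = c0 j x) &
    (\<forall>j\<in>Obj J. \<forall>a\<in>Ar (fun0 W j). whr C (p1 j a) f = c1 j a)"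
  and "!!f g. [|f \<in> Mor C; g \<in> Mor C; dom1 C f = dom1 C g; cod1 C f = P; cod1 C g = P;
    !!j x. [|j \<in> Obj J; x \<in> Ob (fun0 W j)|] ==> cmp1 C (p0 j x) f = cmp1 C (p0 j x) g;
    !!j a. [|j \<in> Obj J; a \<in> Ar (fun0 W j)|] ==> whr C (p1 j a) f = whr C (p1 j a) g|] ==> f = g"
  and "!!f g m. [|f \<in> Mor C; g \<in> Mor C; dom1 C f = dom1 C g; cod1 C f = P; cod1 C g = P;
    lmod C J W D (%j x. cmp1 C (p0 j x) f) (%j a. whr C (p1 j a) f)
     (%j x. cmp1 C (p0 j x) g) (%j a. whr C (p1 j a) g) m|] ==>
    \<exists>e\<in>Cell C. dom2 C e = f & cod2 C e = g &
     (\<forall>j\<in>Obj J. \<forall>x\<in>Ob (fun0 W j). whl C (p0 j x) e = m j x)"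
  and "!!e b. [|e \<in> Cell C; b \<in> Cell C; dom2 C e = dom2 C b; cod2 C e = cod2 C b; cod1 C (dom2 C e) = P;
    !!j x. [|j \<in> Obj J; x \<in> Ob (fun0 W j)|] ==> whl C (p0 j x) e = whl C (p0 j x) b|] ==> e = b"
  and "!!f. [|f \<in> Mor C; cod1 C f = P; !!j x. [|j \<in> Obj J; x \<in> Ob (fun0 W j)|] ==> cmp1 C (p0 j x) f \<in> Tight C|] ==> f \<in> Tight C"
 shows "limcone C J W D P p0 p1"
 unfolding limcone_def
proof (intro conjI allI impI ballI)
 fix f g m assume a: "f \<in> Mor C" "g \<in> Mor C" "dom1 C f = dom1 C g" "cod1 C f = P" "cod1 C g = P"
  "lmod C J W D (%j x. cmp1 C (p0 j x) f) (%j a. whr C (p1 j a) f) (%j x. cmp1 C (p0 j x) g) (%j a. whr C (p1 j a) g) m"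
 show "\<exists>e\<in>Cell C. dom2 C e = f & cod2 C e = g & (\<forall>j\<in>Obj J. \<forall>x\<in>Ob (fun0 W j). whl C (p0 j x) e = m j x)"
  by (rule assms(5)[OF a])
next
 fix f g assume a: "f \<in> Mor C" "g \<in> Mor C" "dom1 C f = dom1 C g" "cod1 C f = P" "cod1 C g = P"
  "\<forall>j\<in>Obj J. \<forall>x\<in>Ob (fun0 W j). cmp1 C (p0 j x) f = cmp1 C (p0 j x) g"
  "\<forall>j\<in>Obj J. \<forall>a\<in>Ar (fun0 W j). whr C (p1 j a) f = whr C (p1 j a) g"
 show "f = g" by (rule assms(4)[OF a(1-5) a(6,7)[rule_format]])
next
 fix e b assume a: "e \<in> Cell C" "b \<in> Cell C" "dom2 C e = dom2 C b" "cod2 C e = cod2 C b" "cod1 C (dom2 C e) = P"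
  "\<forall>j\<in>Obj J. \<forall>x\<in>Ob (fun0 W j). whl C (p0 j x) e = whl C (p0 j x) b"
 show "e = b" by (rule assms(6)[OF a(1-5) a(6)[rule_format]])
next
 fix f assume a: "f \<in> Mor C" "cod1 C f = P" "\<forall>j\<in>Obj J. \<forall>x\<in>Ob (fun0 W j). cmp1 C (p0 j x) f \<in> Tight C"
 show "f \<in> Tight C" by (rule assms(7)[OF a(1,2) a(3)[rule_format]])
qed (fact assms(1-3))+

text \<open>This clause comes from invertibility on tight parts: the inverse of the induced functor
  must send natural transformations with tight components back to tight 1-cells.\<close>

lemma limcone_detect:
 assumes "limcone C J W D P p0 p1" "f \<in> Mor C" "cod1 C f = P"
  "!!j x. [|j \<in> Obj J; x \<in> Ob (fun0 W j)|] ==> cmp1 C (p0 j x) f \<in> Tight C"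
 shows "f \<in> Tight C"
 by (rule assms(1)[unfolded limcone_def, THEN conjunct2, THEN conjunct2, THEN conjunct2, THEN conjunct2, THEN conjunct2, THEN conjunct2, rule_format, OF assms(2-4)])

text \<open>The conditions evaluate the families at values of \<open>W\<close>. That
  \<open>W\<close> is a 2-functor keeps these indices inside the carriers, where the families
  agree.\<close>

lemma lcone_cong:
 assumes "two_category J" "is_two_functor J CAT W"
  and "!!j x. [|j \<in> Obj J; x \<in> Ob (fun0 W j)|] ==> c0 j x = d0 j x"
  and "!!j a. [|j \<in> Obj J; a \<in> Ar (fun0 W j)|] ==> c1 j a = d1 j a"
 shows "lcone C J W D Y c0 c1 \<longleftrightarrow> lcone C J W D Y d0 d1"
proof -
 interpret cat_weight J W using assms by (simp add: cat_weight_def cat_weight_axioms_def)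
 show ?thesis unfolding lcone_def by (simp add: assms(3,4) cong: ball_cong)
qed

lemma lmod_cong:
 assumes "two_category J" "is_two_functor J CAT W"
  and "!!j x. [|j \<in> Obj J; x \<in> Ob (fun0 W j)|] ==> c0 j x = c0' j x"
  and "!!j a. [|j \<in> Obj J; a \<in> Ar (fun0 W j)|] ==> c1 j a = c1' j a"
  and "!!j x. [|j \<in> Obj J; x \<in> Ob (fun0 W j)|] ==> d0 j x = d0' j x"
  and "!!j a. [|j \<in> Obj J; a \<in> Ar (fun0 W j)|] ==> d1 j a = d1' j a"
  and "!!j x. [|j \<in> Obj J; x \<in> Ob (fun0 W j)|] ==> m j x = m' j x"
 shows "lmod C J W D c0 c1 d0 d1 m \<longleftrightarrow> lmod C J W D c0' c1' d0' d1' m'"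
proof -
 interpret cat_weight J W using assms by (simp add: cat_weight_def cat_weight_axioms_def)
 show ?thesis unfolding lmod_def by (simp add: assms(3-) cong: ball_cong)
qed

text \<open>In elementary terms this is the value at \<open>f\<close> of the functor induced by the
  cone.\<close>

lemma lcone_pre:
 assumes C: "fcategory C" and "two_category J" "is_two_functor J CAT W" and D: "is_ffunctor (chordate J) C D"
  and p: "lcone C J W D P p0 p1" and f: "f \<in> Mor C" "cod1 C f = P"
 shows "lcone C J W D (dom1 C f) (%j x. cmp1 C (p0 j x) f) (%j a. whr C (p1 j a) f)"
proof -
 interpret cat_weight J W using assms by (simp add: cat_weight_def cat_weight_axioms_def)
 interpret C: fcategory C by fact
 interpret D: ffunctor "chordate J" C D by (intro ffunctorI fcategory_chordate) fact+
 note D.fun1_Mor[simplified, simp] D.fun2_Cell[simplified, simp] D.dom1_fun1[simplified, simp] D.dom2_fun2[simplified, simp]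
 note [simp] = f
 have [simp]: "p0 j x \<in> Mor C" "dom1 C (p0 j x) = P" "cod1 C (p0 j x) = fun0 D j" if "j \<in> Obj J" "x \<in> Ob (fun0 W j)" for j x
  using p that by (auto simp: lcone_def)
 have [simp]: "p1 j a \<in> Cell C" "dom2 C (p1 j a) = p0 j (src (fun0 W j) a)" "cod2 C (p1 j a) = p0 j (trg (fun0 W j) a)"
  if "j \<in> Obj J" "a \<in> Ar (fun0 W j)" for j a
  using p that by (auto simp: lcone_def)
 have 1: "cmp1 C (fun1 D u) (cmp1 C (p0 (dom1 J u) x) f) = cmp1 C (p0 (cod1 J u) (on_ob (amap (fun1 W u)) x)) f"
  if "u \<in> Mor J" "x \<in> Ob (fun0 W (dom1 J u))" for u x
  using p that by (subst C.cmp1_assoc [symmetric]) (auto simp: lcone_def)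
 have 2: "whl C (fun1 D u) (whr C (p1 (dom1 J u) a) f) = whr C (p1 (cod1 J u) (on_ar (amap (fun1 W u)) a)) f"
  if "u \<in> Mor J" "a \<in> Ar (fun0 W (dom1 J u))" for u a
  using p that by (subst C.hcmp_assoc [symmetric]) (auto simp: lcone_def)
 have 3: "whr C (fun2 D e) (cmp1 C (p0 (dom1 J (dom2 J e)) x) f) = whr C (p1 (cod1 J (dom2 J e)) (amap (fun2 W e) x)) f"
  if "e \<in> Cell J" "x \<in> Ob (fun0 W (dom1 J (dom2 J e)))" for e x
  using p that by (subst C.hcmp_id2 [symmetric], simp, simp, simp, subst C.hcmp_assoc [symmetric]) (auto simp: lcone_def)
 show ?thesis using p 1 2 3
  unfolding lcone_def by simp
qed

section \<open>Hom-categories, full subcategories and invertibility in \<open>F\<close>\<close>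

lemma hom_cat_simps [simp]:
 "Ob (hom_cat C X Y) = {f \<in> Mor C. dom1 C f = X & cod1 C f = Y}"
 "Ar (hom_cat C X Y) = {a \<in> Cell C. dom1 C (dom2 C a) = X & cod1 C (dom2 C a) = Y}"
 "src (hom_cat C X Y) = dom2 C" "trg (hom_cat C X Y) = cod2 C" "idn (hom_cat C X Y) = id2 C" "cmp (hom_cat C X Y) = vcmp C"
 by (simp_all add: hom_cat_def)

lemma category_hom_cat: "fcategory C ==> category (hom_cat C X Y)"
proof -
 assume "fcategory C" then interpret fcategory C .
 show ?thesis by unfold_locales simp_all
qed

lemma sub_embedding_simps [simp]:
 "loose (sub_embedding A P) = A" "tight (sub_embedding A P) = full_subcat A P"
 "emb (sub_embedding A P) = id_functor (full_subcat A P)"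
 by (simp_all add: sub_embedding_def)

lemma full_subcat_simps [simp]:
 "Ob (full_subcat A P) = Ob A \<inter> P" "Ar (full_subcat A P) = {f \<in> Ar A. src A f \<in> P & trg A f \<in> P}"
 "src (full_subcat A P) = src A" "trg (full_subcat A P) = trg A" "idn (full_subcat A P) = idn A" "cmp (full_subcat A P) = cmp A"
 by (simp_all add: full_subcat_def)

lemma tight_functor_subD:
 assumes "tight_functor (sub_embedding A P) (sub_embedding B Q) F"
 shows "is_functor A B F" "x \<in> Ob A ==> x \<in> P ==> on_ob F x \<in> Q"
proof -
 obtain F' where F: "is_functor A B F" and F': "is_functor (full_subcat A P) (full_subcat B Q) F'"
  and e: "comp_functor (full_subcat A P) (id_functor (full_subcat B Q)) F' = comp_functor (full_subcat A P) F (id_functor (full_subcat A P))"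
  using assms by (auto simp: tight_functor_def)
 show "on_ob F x \<in> Q" if x: "x \<in> Ob A" "x \<in> P"
 proof -
  have "on_ob F' x \<in> Ob B \<inter> Q" using F' x by (auto simp: is_functor_cong_ext)
  moreover have "on_ob (comp_functor (full_subcat A P) (id_functor (full_subcat B Q)) F') x = on_ob (comp_functor (full_subcat A P) F (id_functor (full_subcat A P))) x"
   using e by simp
  ultimately show ?thesis using x by (simp add: comp_functor_def id_functor_def compose_def)
 qed
 show "is_functor A B F" by fact
qed

text \<open>Since the embeddings are inclusions of full subcategories, the functor on tight parts is
  the restriction of \<open>F\<close>. Together with \<open>tight_functor_subD\<close> this turns
  tightness of a functor into preservation of a set of objects.\<close>

lemma tight_functor_subI:
 assumes A: "category A" and a: "is_functor A B F" "!!x. x \<in> Ob A ==> x \<in> P ==> on_ob F x \<in> Q"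
 shows "tight_functor (sub_embedding A P) (sub_embedding B Q) F"
proof -
 interpret category A by fact
 let ?F = "\<lparr>on_ob = restrict (on_ob F) (Ob A \<inter> P), on_ar = restrict (on_ar F) (Ar (full_subcat A P))\<rparr>"
 have "is_functor (full_subcat A P) (full_subcat B Q) ?F"
  using a src_Ob trg_Ob idn_Ar src_idn trg_idn cmp_Ar src_cmp trg_cmp by (auto simp: is_functor_cong_ext)
 moreover have "comp_functor (full_subcat A P) (id_functor (full_subcat B Q)) ?F = comp_functor (full_subcat A P) F (id_functor (full_subcat A P))"
  using a src_Ob trg_Ob by (auto simp: comp_functor_def id_functor_def compose_def fun_eq_iff is_functor_cong_ext)
 ultimately show ?thesis
  using a by (auto simp: tight_functor_def)
qed

text \<open>An identity embedding is the inclusion of the full subcategory on everything, so the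
  criterion for subcategories applies with \<open>P = UNIV\<close>.\<close>

lemma tight_functor_id_sub_iff:
 assumes A: "category A"
 shows "tight_functor (id_embedding A) (sub_embedding B Q) F \<longleftrightarrow>
  is_functor A B F & (\<forall>x\<in>Ob A. on_ob F x \<in> Q)"
proof -
 have "full_subcat A UNIV = A" by (simp add: full_subcat_def)
 then have "id_embedding A = sub_embedding A UNIV" unfolding id_embedding_def sub_embedding_def by (simp only:)
 then show ?thesis using tight_functor_subI[OF A, of B F UNIV Q] tight_functor_subD[of A UNIV B Q F] by auto
qed

text \<open>The structure is transported along the two bijections. In
  \<open>invertible_sub_iff\<close> this supplies the category axioms for the target, which in the
  application is a category of natural transformations.\<close>

lemma category_bij_functor:
 assumes A: "category A" and F: "is_functor A B F" and b0: "bij_betw (on_ob F) (Ob A) (Ob B)"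
  and b1: "bij_betw (on_ar F) (Ar A) (Ar B)"
 shows "category B"
proof -
 interpret A: category A by fact
 have F': "!!x. x \<in> Ob A ==> on_ob F x \<in> Ob B" "!!f. f \<in> Ar A ==> on_ar F f \<in> Ar B"
  "!!f. f \<in> Ar A ==> src B (on_ar F f) = on_ob F (src A f)" "!!f. f \<in> Ar A ==> trg B (on_ar F f) = on_ob F (trg A f)"
  "!!x. x \<in> Ob A ==> idn B (on_ob F x) = on_ar F (idn A x)"
  "!!f g. [|f \<in> Ar A; g \<in> Ar A; trg A f = src A g|] ==> cmp B (on_ar F g) (on_ar F f) = on_ar F (cmp A g f)"
  using F by (auto simp: is_functor_cong_ext)
 have ob: "\<exists>a\<in>Ob A. x = on_ob F a" if "x \<in> Ob B" for x using b0 that by (auto simp: bij_betw_def)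
 have ar: "\<exists>a\<in>Ar A. x = on_ar F a" if "x \<in> Ar B" for x using b1 that by (auto simp: bij_betw_def)
 have inj: "x = y" if "on_ob F x = on_ob F y" "x \<in> Ob A" "y \<in> Ob A" for x y using b0 that by (auto simp: bij_betw_def inj_on_def)
 note [simp] = F' A.src_Ob A.trg_Ob A.idn_Ar A.src_idn A.trg_idn A.cmp_Ar A.src_cmp A.trg_cmp A.cmp_idn_left A.cmp_idn_right A.cmp_assoc
 show ?thesis
  by unfold_locales (auto dest!: ob ar inj)
qed

text \<open>A functor bijective on objects and on arrows has an inverse functor, and both are tight
  exactly when the selected objects correspond. The universal property can thus be stated without
  mentioning an inverse.\<close>

lemma invertible_sub_iff:
 assumes A: "category A"
 shows "invertible_in_F (sub_embedding A P) (sub_embedding B Q) F \<longleftrightarrow>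
  is_functor A B F & bij_betw (on_ob F) (Ob A) (Ob B) & bij_betw (on_ar F) (Ar A) (Ar B) &
  (\<forall>x\<in>Ob A. x \<in> P \<longleftrightarrow> on_ob F x \<in> Q)" (is "?L \<longleftrightarrow> ?R")
proof
 assume ?L
 then obtain G where F: "tight_functor (sub_embedding A P) (sub_embedding B Q) F"
  and G: "tight_functor (sub_embedding B Q) (sub_embedding A P) G"
  and e: "comp_functor A G F = id_functor A" "comp_functor B F G = id_functor B"
  by (auto simp: invertible_in_F_def)
 note F' = tight_functor_subD[OF F] and G' = tight_functor_subD[OF G]
 have m: "!!x. x \<in> Ob A ==> on_ob F x \<in> Ob B" "!!x. x \<in> Ar A ==> on_ar F x \<in> Ar B"
   "!!x. x \<in> Ob B ==> on_ob G x \<in> Ob A" "!!x. x \<in> Ar B ==> on_ar G x \<in> Ar A"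
  using F'(1) G'(1) by (auto simp: is_functor_cong_ext)
 have i: "on_ob G (on_ob F x) = x" if "x \<in> Ob A" for x
  using arg_cong[OF e(1), of "%F. on_ob F x"] that by (simp add: comp_functor_def id_functor_def compose_def)
 have i': "on_ob F (on_ob G x) = x" if "x \<in> Ob B" for x
  using arg_cong[OF e(2), of "%F. on_ob F x"] that by (simp add: comp_functor_def id_functor_def compose_def)
 have j: "on_ar G (on_ar F x) = x" if "x \<in> Ar A" for x
  using arg_cong[OF e(1), of "%F. on_ar F x"] that by (simp add: comp_functor_def id_functor_def compose_def)
 have j': "on_ar F (on_ar G x) = x" if "x \<in> Ar B" for x
  using arg_cong[OF e(2), of "%F. on_ar F x"] that by (simp add: comp_functor_def id_functor_def compose_def)
 have "bij_betw (on_ob F) (Ob A) (Ob B)" "bij_betw (on_ar F) (Ar A) (Ar B)"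
  by (rule bij_betw_byWitness[of _ "on_ob G"] bij_betw_byWitness[of _ "on_ar G"]; use m i i' j j' in auto)+
 moreover have "x \<in> P \<longleftrightarrow> on_ob F x \<in> Q" if "x \<in> Ob A" for x
  using F'(2)[OF that] G'(2)[OF m(1)[OF that]] i[OF that] by auto
 ultimately show ?R using F'(1) by blast
next
 assume R: ?R
 then have F: "is_functor A B F" and b0: "bij_betw (on_ob F) (Ob A) (Ob B)" and b1: "bij_betw (on_ar F) (Ar A) (Ar B)"
  and PQ: "!!x. x \<in> Ob A ==> x \<in> P \<longleftrightarrow> on_ob F x \<in> Q" by auto
 interpret A: category A by fact
 interpret B: category B using category_bij_functor[OF A F b0 b1] .
 have F': "!!x. x \<in> Ob A ==> on_ob F x \<in> Ob B" "!!f. f \<in> Ar A ==> on_ar F f \<in> Ar B"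
  "!!f. f \<in> Ar A ==> src B (on_ar F f) = on_ob F (src A f)" "!!f. f \<in> Ar A ==> trg B (on_ar F f) = on_ob F (trg A f)"
  "!!x. x \<in> Ob A ==> idn B (on_ob F x) = on_ar F (idn A x)"
  "!!f g. [|f \<in> Ar A; g \<in> Ar A; trg A f = src A g|] ==> cmp B (on_ar F g) (on_ar F f) = on_ar F (cmp A g f)"
  "on_ob F \<in> extensional (Ob A)" "on_ar F \<in> extensional (Ar A)"
  using F by (auto simp: is_functor_cong_ext)
 \<comment> \<open>The inverse maps are cut down to the carriers of \<open>B\<close>, because a
   functor must be extensional.\<close>
 let ?G = "\<lparr>on_ob = restrict (inv_into (Ob A) (on_ob F)) (Ob B), on_ar = restrict (inv_into (Ar A) (on_ar F)) (Ar B)\<rparr>"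
 have inv: "!!x. x \<in> Ob A ==> inv_into (Ob A) (on_ob F) (on_ob F x) = x" "!!x. x \<in> Ar A ==> inv_into (Ar A) (on_ar F) (on_ar F x) = x"
  using b0 b1 by (simp_all add: bij_betw_inv_into_left)
 have ob: "\<exists>a\<in>Ob A. x = on_ob F a" if "x \<in> Ob B" for x using b0 that by (auto simp: bij_betw_def)
 have ar: "\<exists>a\<in>Ar A. x = on_ar F a" if "x \<in> Ar B" for x using b1 that by (auto simp: bij_betw_def)
 have inj: "x = y" if "on_ob F x = on_ob F y" "x \<in> Ob A" "y \<in> Ob A" for x y using b0 that by (auto simp: bij_betw_def inj_on_def)
 note [simp] = A.src_Ob A.trg_Ob A.idn_Ar A.src_idn A.trg_idn A.cmp_Ar A.src_cmp A.trg_cmp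
 have G: "is_functor B A ?G"
  unfolding is_functor_cong_ext by (auto dest!: ob ar inj simp: F' inv intro!: inj_onD[OF bij_betw_imp_inj_on[OF b1]])
 have "tight_functor (sub_embedding B Q) (sub_embedding A P) ?G"
  by (rule tight_functor_subI[OF B.category_axioms G]) (auto dest!: ob simp: F' inv PQ)
 moreover have "tight_functor (sub_embedding A P) (sub_embedding B Q) F"
  by (rule tight_functor_subI[OF A F]) (simp add: PQ)
 moreover have "comp_functor A ?G F = id_functor A"
  by (auto simp: comp_functor_def id_functor_def compose_def fun_eq_iff F' inv)
 moreover have "comp_functor B F ?G = id_functor B"
  by (auto simp: comp_functor_def id_functor_def compose_def fun_eq_iff restrict_def dest!: ob ar simp: F' inv)
 ultimately show ?L by (auto simp: invertible_in_F_def)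
qed

text \<open>\<open>lcone\<close> constrains a family only on the carriers, while a natural
  transformation is an extensional map with extensional functors as values. This is the
  normalisation that separates the two.\<close>

definition legs_ext :: "('oj, 'mj, 'cj) two_cat =>
  ('oj, 'mj, 'cj, ('x, 'y) cat, ('x, 'y) cat1, ('x, 'y) cat2) two_fun => ('oj => ('x, 'y, 'm, 'c) functr) => bool" where
 "legs_ext J W \<delta> \<longleftrightarrow> \<delta> \<in> extensional (Obj J) & (\<forall>j\<in>Obj J. on_ob (\<delta> j) \<in> extensional (Ob (fun0 W j)) &
   on_ar (\<delta> j) \<in> extensional (Ar (fun0 W j)))"

lemma amap_map_arr [simp]: "amap (map_arr f g a) = g (amap a)"
 by (cases a) simp

lemma functr_eqI: "[|on_ob F = on_ob G; on_ar F = on_ar G|] ==> F = (G :: ('o1, 'm1, 'o2, 'm2) functr)"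
 by (rule functr.equality) simp_all

lemma legs_eqI:
 assumes "legs_ext J W c" "legs_ext J W \<delta>"
  and "!!j x. [|j \<in> Obj J; x \<in> Ob (fun0 W j)|] ==> on_ob (c j) x = on_ob (\<delta> j) x"
  and "!!j a. [|j \<in> Obj J; a \<in> Ar (fun0 W j)|] ==> on_ar (c j) a = on_ar (\<delta> j) a"
 shows "c = \<delta>"
 using assms unfolding legs_ext_def
 by (auto intro!: extensionalityI[of c "Obj J" \<delta>] functr_eqI intro: extensionalityI)

section \<open>Agreement of the elementary and the enriched notion of limit cone\<close>

locale cone_data = cat_weight J W + C: fcategory C + D: ffunctor "chordate J" C D
 for J :: "('oj, 'mj, 'cj) two_cat"
 and W :: "('oj, 'mj, 'cj, ('x, 'y) cat, ('x, 'y) cat1, ('x, 'y) cat2) two_fun"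
 and C :: "('o, 'm, 'c) fcat" and D :: "('oj, 'mj, 'cj, 'o, 'm, 'c) two_fun"
begin

abbreviation "Hom Y \<equiv> comp_ffunctor (chordate J) (representable C Y) D"
abbreviation "\<omega> \<equiv> wt (plus_weight J W)"

lemma D_simps [simp]:
 "j \<in> Obj J ==> fun0 D j \<in> Obj C"
 "u \<in> Mor J ==> fun1 D u \<in> Mor C" "u \<in> Mor J ==> dom1 C (fun1 D u) = fun0 D (dom1 J u)"
 "u \<in> Mor J ==> cod1 C (fun1 D u) = fun0 D (cod1 J u)"
 "u \<in> Mor J ==> fun1 D u \<in> Tight C"
 "a \<in> Cell J ==> fun2 D a \<in> Cell C"
 "a \<in> Cell J ==> dom2 C (fun2 D a) = fun1 D (dom2 J a)"
 "a \<in> Cell J ==> cod2 C (fun2 D a) = fun1 D (cod2 J a)"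
 using D.fun0_Obj D.fun1_Mor D.fun1_Tight D.dom1_fun1 D.cod1_fun1 D.fun2_Cell D.dom2_fun2 D.cod2_fun2 by simp_all

lemma \<omega>_simps [simp]:
 "j \<in> Obj J ==> fun0 \<omega> j = id_embedding (fun0 W j)"
 "u \<in> Mor J ==> amap (fun1 \<omega> u) = amap (fun1 W u)"
 "a \<in> Cell J ==> amap (fun2 \<omega> a) = amap (fun2 W a)"
 by (simp_all add: plus_weight_def)

lemma loose_id_embedding [simp]: "loose (id_embedding A) = A"
 by (simp add: id_embedding_def)

lemma loose_hom_obj [simp]: "loose (hom_obj C X Y) = hom_cat C X Y"
 by (simp add: hom_obj_def)

lemma Hom_simps:
 "j \<in> Obj J ==> fun0 (Hom Y) j = hom_obj C Y (fun0 D j)"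
 "u \<in> Mor J ==> amap (fun1 (Hom Y) u) = \<lparr>on_ob = (\<lambda>f\<in>Ob (hom_cat C Y (fun0 D (dom1 J u))). cmp1 C (fun1 D u) f),
   on_ar = (\<lambda>a\<in>Ar (hom_cat C Y (fun0 D (dom1 J u))). whl C (fun1 D u) a)\<rparr>"
 "a \<in> Cell J ==> amap (fun2 (Hom Y) a) = (\<lambda>f\<in>Ob (hom_cat C Y (fun0 D (dom1 J (dom2 J a)))). whr C (fun2 D a) f)"
 by (simp_all add: comp_ffunctor_def compose_def representable_def postcomp_def)

text \<open>The naturality conditions on 1-cells are equations between composite functors. Once the
  components are known to land in the hom-categories, extensionality turns them into equations at
  each object and arrow of the weight.\<close>

lemma two_natural_iff:
 assumes Y: "Y \<in> Obj C"
 shows "two_natural (chordate J) \<omega> (Hom Y) \<delta> \<longleftrightarrow>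
  legs_ext J W \<delta> & lcone C J W D Y (%j. on_ob (\<delta> j)) (%j. on_ar (\<delta> j))"
proof -
 let ?fun = "\<forall>j\<in>Obj J. is_functor (fun0 W j) (hom_cat C Y (fun0 D j)) (\<delta> j)"
 have eq: "comp_functor (fun0 W (dom1 J u)) (amap (fun1 (Hom Y) u)) (\<delta> (dom1 J u)) =
   comp_functor (fun0 W (dom1 J u)) (\<delta> (cod1 J u)) (amap (fun1 W u)) \<longleftrightarrow>
   (\<forall>x\<in>Ob (fun0 W (dom1 J u)). cmp1 C (fun1 D u) (on_ob (\<delta> (dom1 J u)) x) = on_ob (\<delta> (cod1 J u)) (on_ob (amap (fun1 W u)) x)) &
   (\<forall>a\<in>Ar (fun0 W (dom1 J u)). whl C (fun1 D u) (on_ar (\<delta> (dom1 J u)) a) = on_ar (\<delta> (cod1 J u)) (on_ar (amap (fun1 W u)) a))"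
  if f: ?fun and u: "u \<in> Mor J" for u
 proof -
  have "is_functor (fun0 W (dom1 J u)) (hom_cat C Y (fun0 D (dom1 J u))) (\<delta> (dom1 J u))"
   using f u by simp
  then have *: "!!x. x \<in> Ob (fun0 W (dom1 J u)) ==> on_ob (\<delta> (dom1 J u)) x \<in> Ob (hom_cat C Y (fun0 D (dom1 J u)))"
   "!!a. a \<in> Ar (fun0 W (dom1 J u)) ==> on_ar (\<delta> (dom1 J u)) a \<in> Ar (hom_cat C Y (fun0 D (dom1 J u)))"
   by (auto simp: is_functor_cong_ext simp del: hom_cat_simps)
  show ?thesis unfolding comp_functor_def functr.simps compose_def Hom_simps(2)[OF u]
   by (simp add: fun_eq_iff restrict_def * del: hom_cat_simps) (use * in blast)
 qed
 have eq2: "amap (fun2 (Hom Y) e) (on_ob (\<delta> (dom1 J (dom2 J e))) x) = whr C (fun2 D e) (on_ob (\<delta> (dom1 J (dom2 J e))) x)"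
  if f: ?fun and a: "e \<in> Cell J" "x \<in> Ob (fun0 W (dom1 J (dom2 J e)))" for e x
 proof -
  have "is_functor (fun0 W (dom1 J (dom2 J e))) (hom_cat C Y (fun0 D (dom1 J (dom2 J e)))) (\<delta> (dom1 J (dom2 J e)))"
   using f a by simp
  then have "on_ob (\<delta> (dom1 J (dom2 J e))) x \<in> Ob (hom_cat C Y (fun0 D (dom1 J (dom2 J e))))"
   using a by (auto simp: is_functor_cong_ext simp del: hom_cat_simps)
  then show ?thesis by (simp add: Hom_simps(3)[OF a(1)] del: hom_cat_simps)
 qed
 have 1: "two_natural (chordate J) \<omega> (Hom Y) \<delta> \<longleftrightarrow> \<delta> \<in> extensional (Obj J) & ?fun &
   (\<forall>u\<in>Mor J. comp_functor (fun0 W (dom1 J u)) (amap (fun1 (Hom Y) u)) (\<delta> (dom1 J u)) =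
     comp_functor (fun0 W (dom1 J u)) (\<delta> (cod1 J u)) (amap (fun1 W u))) &
   (\<forall>e\<in>Cell J. \<forall>x\<in>Ob (fun0 W (dom1 J (dom2 J e))). amap (fun2 (Hom Y) e) (on_ob (\<delta> (dom1 J (dom2 J e))) x) =
     on_ar (\<delta> (cod1 J (dom2 J e))) (amap (fun2 W e) x))"
  unfolding two_natural_def by (simp add: Hom_simps(1) cong: ball_cong conj_cong)
 show ?thesis unfolding 1
  using Y by (simp add: eq eq2 legs_ext_def lcone_def is_functor_cong_ext cong: conj_cong) (rule iffI; auto)
qed

text \<open>Every object of an identity embedding is tight, so a component is a tight functor
  exactly when all its values are tight 1-cells. This is where a weight for a tight limit forces
  tight legs.\<close>

lemma f_natural_iff:
 assumes Y: "Y \<in> Obj C"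
 shows "f_natural (chordate J) \<omega> (Hom Y) \<delta> \<longleftrightarrow> two_natural (chordate J) \<omega> (Hom Y) \<delta> &
  (\<forall>j\<in>Obj J. \<forall>x\<in>Ob (fun0 W j). on_ob (\<delta> j) x \<in> Tight C)"
proof -
 have "tight_functor (fun0 \<omega> j) (fun0 (Hom Y) j) (\<delta> j) \<longleftrightarrow> (\<forall>x\<in>Ob (fun0 W j). on_ob (\<delta> j) x \<in> Tight C)"
  if "two_natural (chordate J) \<omega> (Hom Y) \<delta>" "j \<in> Obj J" for j
 proof -
  have "is_functor (fun0 W j) (hom_cat C Y (fun0 D j)) (\<delta> j)"
   using that by (auto simp: two_natural_def Hom_simps)
  then show ?thesis using that by (simp add: Hom_simps hom_obj_def tight_functor_id_sub_iff)
 qed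
 then show ?thesis unfolding f_natural_def by auto
qed

lemma nat_modification_iff:
 assumes Y: "Y \<in> Obj C" and d: "two_natural (chordate J) \<omega> (Hom Y) \<gamma>" "two_natural (chordate J) \<omega> (Hom Y) \<delta>"
 shows "nat_modification (chordate J) \<omega> (Hom Y) \<gamma> \<delta> m \<longleftrightarrow>
  m \<in> extensional (Obj J) & (\<forall>j\<in>Obj J. m j \<in> extensional (Ob (fun0 W j))) &
  lmod C J W D (%j. on_ob (\<gamma> j)) (%j. on_ar (\<gamma> j)) (%j. on_ob (\<delta> j)) (%j. on_ar (\<delta> j)) m"
proof -
 let ?t = "\<forall>j\<in>Obj J. is_nat_trans (fun0 W j) (hom_cat C Y (fun0 D j)) (\<gamma> j) (\<delta> j) (m j)"
 note c = d[unfolded two_natural_iff[OF Y], THEN conjunct2, unfolded lcone_def]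
 have g: "!!j x. [|j \<in> Obj J; x \<in> Ob (fun0 W j)|] ==> dom1 C (on_ob (\<gamma> j) x) = Y & cod1 C (on_ob (\<gamma> j) x) = fun0 D j"
  using d(1)[unfolded two_natural_iff[OF Y] lcone_def] by simp
 have t: "?t \<longleftrightarrow> (\<forall>j\<in>Obj J. m j \<in> extensional (Ob (fun0 W j))) &
   (\<forall>j\<in>Obj J. \<forall>x\<in>Ob (fun0 W j). m j x \<in> Cell C & dom2 C (m j x) = on_ob (\<gamma> j) x & cod2 C (m j x) = on_ob (\<delta> j) x) &
  (\<forall>j\<in>Obj J. \<forall>a\<in>Ar (fun0 W j).
    vcmp C (on_ar (\<delta> j) a) (m j (src (fun0 W j) a)) = vcmp C (m j (trg (fun0 W j) a)) (on_ar (\<gamma> j) a))"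
  unfolding is_nat_trans_def homset_def using c by auto
 have e: "on_ar (amap (fun1 (Hom Y) u)) (m (dom1 J u) x) = whl C (fun1 D u) (m (dom1 J u) x)"
  if ?t "u \<in> Mor J" "x \<in> Ob (fun0 W (dom1 J u))" for u x
 proof -
  have "m (dom1 J u) x \<in> Ar (hom_cat C Y (fun0 D (dom1 J u)))"
   using that g by (auto simp: is_nat_trans_def homset_def)
  then show ?thesis using that by (simp add: Hom_simps)
 qed
 have "nat_modification (chordate J) \<omega> (Hom Y) \<gamma> \<delta> m \<longleftrightarrow>
  m \<in> extensional (Obj J) & ?t &
  (\<forall>u\<in>Mor J. \<forall>x\<in>Ob (fun0 W (dom1 J u)). on_ar (amap (fun1 (Hom Y) u)) (m (dom1 J u) x) = m (cod1 J u) (on_ob (amap (fun1 W u)) x))"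
  unfolding nat_modification_def by (simp add: Hom_simps(1) cong: ball_cong conj_cong)
 also have "\<dots> \<longleftrightarrow> m \<in> extensional (Obj J) & ?t &
  (\<forall>u\<in>Mor J. \<forall>x\<in>Ob (fun0 W (dom1 J u)). whl C (fun1 D u) (m (dom1 J u) x) = m (cod1 J u) (on_ob (amap (fun1 W u)) x))"
  using e by auto
 also have "\<dots> \<longleftrightarrow> m \<in> extensional (Obj J) & (\<forall>j\<in>Obj J. m j \<in> extensional (Ob (fun0 W j))) &
  lmod C J W D (%j. on_ob (\<gamma> j)) (%j. on_ar (\<gamma> j)) (%j. on_ob (\<delta> j)) (%j. on_ar (\<delta> j)) m"
  unfolding t lmod_def by blast
 finally show ?thesis .
qed

lemma nat_cat_simps:
 "Ob (nat_cat (chordate J) \<omega> (Hom Y)) = {c. two_natural (chordate J) \<omega> (Hom Y) c}"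
 "a \<in> Ar (nat_cat (chordate J) \<omega> (Hom Y)) \<longleftrightarrow> two_natural (chordate J) \<omega> (Hom Y) (adom a) &
   two_natural (chordate J) \<omega> (Hom Y) (acod a) & nat_modification (chordate J) \<omega> (Hom Y) (adom a) (acod a) (amap a)"
 "src (nat_cat (chordate J) \<omega> (Hom Y)) = adom" "trg (nat_cat (chordate J) \<omega> (Hom Y)) = acod"
 by (cases a; auto simp: nat_cat_def)+

lemma weighted_cone_iff:
 assumes w: "wgt c = plus_weight J W" and d: "dgm c = D"
 shows "weighted_cone C c \<longleftrightarrow> legs_ext J W (legs c) &
  lcone C J W D (apex c) (%j. on_ob (legs c j)) (%j. on_ar (legs c j)) &
  (\<forall>j\<in>Obj J. \<forall>x\<in>Ob (fun0 W j). on_ob (legs c j) x \<in> Tight C)"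
proof -
 have sh: "shape (plus_weight J W) = chordate J" by (simp add: plus_weight_def)
 have "weighted_cone C c \<longleftrightarrow> apex c \<in> Obj C & f_natural (chordate J) \<omega> (Hom (apex c)) (legs c)"
  unfolding weighted_cone_def w d sh using f_weight_plus D.is_ffunctor by simp
 also have "\<dots> \<longleftrightarrow> legs_ext J W (legs c) &
  lcone C J W D (apex c) (%j. on_ob (legs c j)) (%j. on_ar (legs c j)) &
  (\<forall>j\<in>Obj J. \<forall>x\<in>Ob (fun0 W j). on_ob (legs c j) x \<in> Tight C)"
  using f_natural_iff[of "apex c"] two_natural_iff[of "apex c"] by (auto simp: lcone_def)
 finally show ?thesis .
qed

text \<open>By \<open>invertible_sub_iff\<close> the induced functor has to be bijective on objects,
  bijective on arrows and to match tight objects. The first condition amounts to existence and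
  uniqueness for 1-cells, the second to the same for 2-cells, the third to detection of tightness;
  that a tight 1-cell has tight composites with the legs follows from the legs being tight.\<close>

lemma limit_cone_iff:
 assumes w: "wgt y = plus_weight J W" and d: "dgm y = D"
 shows "limit_cone C y \<longleftrightarrow> legs_ext J W (legs y) &
  limcone C J W D (apex y) (%j. on_ob (legs y j)) (%j. on_ar (legs y j))"
proof -
 define P where "P = apex y"
 define p0 where "p0 = (%j. on_ob (legs y j))"
 define p1 where "p1 = (%j. on_ar (legs y j))"
 have sh: "shape (plus_weight J W) = chordate J" by (simp add: plus_weight_def)
 have wc: "weighted_cone C y \<longleftrightarrow> legs_ext J W (legs y) & lcone C J W D P p0 p1 &
   (\<forall>j\<in>Obj J. \<forall>x\<in>Ob (fun0 W j). p0 j x \<in> Tight C)"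
  unfolding P_def p0_def p1_def by (rule weighted_cone_iff[OF w d])
 have main: "(\<forall>Y\<in>Obj C. invertible_in_F (hom_obj C Y P) (nat_obj (chordate J) \<omega> (Hom Y)) (induced_functor C y Y)) \<longleftrightarrow>
   limcone C J W D P p0 p1"
  if l: "lcone C J W D P p0 p1" and t: "\<forall>j\<in>Obj J. \<forall>x\<in>Ob (fun0 W j). p0 j x \<in> Tight C"
 proof -
  let ?N = "%Y. nat_cat (chordate J) \<omega> (Hom Y)" and ?H = "%Y. hom_cat C Y P"
  let ?F = "%Y. induced_functor C y Y"
  \<comment> \<open>\<open>pre\<close> and \<open>pm\<close> are the actions of the induced functor
    on 1-cells and on 2-cells.\<close>
  define pre where "pre = cone_precomp C y"
  define pm where "pm = (%n. \<lambda>j\<in>Obj J. \<lambda>x\<in>Ob (fun0 W j). whl C (p0 j x) n)"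
  have P: "P \<in> Obj C" using l by (simp add: lcone_def)
  have p0: "p0 j x \<in> Mor C" "dom1 C (p0 j x) = P" "cod1 C (p0 j x) = fun0 D j" if "j \<in> Obj J" "x \<in> Ob (fun0 W j)" for j x
   using l that by (auto simp: lcone_def)
  have p1: "p1 j a \<in> Cell C" "dom2 C (p1 j a) = p0 j (src (fun0 W j) a)" "cod2 C (p1 j a) = p0 j (trg (fun0 W j) a)"
   if "j \<in> Obj J" "a \<in> Ar (fun0 W j)" for j a
   using l that by (auto simp: lcone_def)
  have pre0: "on_ob (pre f j) x = cmp1 C (p0 j x) f" if "j \<in> Obj J" "x \<in> Ob (fun0 W j)" for f j x
   using that by (simp add: pre_def cone_precomp_def w sh p0_def)
  have pre1: "on_ar (pre f j) a = whr C (p1 j a) f" if "j \<in> Obj J" "a \<in> Ar (fun0 W j)" for f j a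
   using that by (simp add: pre_def cone_precomp_def w sh p1_def)
  have pre_ext: "legs_ext J W (pre f)" for f
   by (simp add: pre_def cone_precomp_def w sh legs_ext_def)
  have lpre: "lcone C J W D Y (%j. on_ob (pre f j)) (%j. on_ar (pre f j)) \<longleftrightarrow>
    lcone C J W D Y (%j x. cmp1 C (p0 j x) f) (%j a. whr C (p1 j a) f)" for Y f
   by (rule lcone_cong[OF J.two_category_axioms W]) (simp_all add: pre0 pre1)
  have pre_nat: "two_natural (chordate J) \<omega> (Hom (dom1 C f)) (pre f)" if "f \<in> Mor C" "cod1 C f = P" for f
   using that lcone_pre[OF C.fcat J.two_category_axioms W D.is_ffunctor l that]
   by (simp add: two_natural_iff lpre pre_ext)
  have mod_iff: "nat_modification (chordate J) \<omega> (Hom Y) (pre f) (pre g) m \<longleftrightarrow>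
    m \<in> extensional (Obj J) & (\<forall>j\<in>Obj J. m j \<in> extensional (Ob (fun0 W j))) &
    lmod C J W D (%j x. cmp1 C (p0 j x) f) (%j a. whr C (p1 j a) f)
     (%j x. cmp1 C (p0 j x) g) (%j a. whr C (p1 j a) g) m"
   if "f \<in> Mor C" "cod1 C f = P" "g \<in> Mor C" "cod1 C g = P" "dom1 C f = Y" "dom1 C g = Y" for f g m Y
  proof -
   have "lmod C J W D (%j. on_ob (pre f j)) (%j. on_ar (pre f j)) (%j. on_ob (pre g j)) (%j. on_ar (pre g j)) m \<longleftrightarrow>
    lmod C J W D (%j x. cmp1 C (p0 j x) f) (%j a. whr C (p1 j a) f)
     (%j x. cmp1 C (p0 j x) g) (%j a. whr C (p1 j a) g) m"
    by (rule lmod_cong[OF J.two_category_axioms W]) (simp_all add: pre0 pre1)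
   then show ?thesis
    using that pre_nat[of f] pre_nat[of g] by (subst nat_modification_iff) auto
  qed
  have Fob: "on_ob (?F Y) f = pre f" if "f \<in> Mor C" "cod1 C f = P" "dom1 C f = Y" for f Y
   using that by (simp add: induced_functor_def pre_def P_def[symmetric])
  have Far: "on_ar (?F Y) n = Arr (pre (dom2 C n)) (pre (cod2 C n)) (pm n)"
    if "n \<in> Cell C" "cod1 C (dom2 C n) = P" "dom1 C (dom2 C n) = Y" for n Y
   using that by (simp add: induced_functor_def pre_def P_def[symmetric] pm_def p0_def w sh cong: restrict_cong)
  have pm: "nat_modification (chordate J) \<omega> (Hom (dom1 C (dom2 C n))) (pre (dom2 C n)) (pre (cod2 C n)) (pm n)"
   if a: "n \<in> Cell C" "cod1 C (dom2 C n) = P" for n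
  proof -
   have "whl C (fun1 D u) (whl C (p0 (dom1 J u) x) n) = whl C (p0 (cod1 J u) (on_ob (amap (fun1 W u)) x)) n"
    if "u \<in> Mor J" "x \<in> Ob (fun0 W (dom1 J u))" for u x
    using l that a p0[of "dom1 J u" x] by (simp add: lcone_def)
   then show ?thesis using a
    by (subst mod_iff) (auto simp: lmod_def pm_def p0 p1 C.exchange)
  qed
  have pre_nat': "two_natural (chordate J) \<omega> (Hom Y) (pre f)" if "f \<in> Mor C" "cod1 C f = P" "dom1 C f = Y" for f Y
   using pre_nat[of f] that by simp
  have pm': "nat_modification (chordate J) \<omega> (Hom Y) (pre (dom2 C n)) (pre (cod2 C n)) (pm n)"
   if a: "n \<in> Cell C" "cod1 C (dom2 C n) = P" "dom1 C (dom2 C n) = Y" for n Y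
   using pm[of n] that by simp
  have fctr: "is_functor (?H Y) (?N Y) (?F Y)" if "Y \<in> Obj C" for Y
  proof -
   have 1: "on_ar (?F Y) (id2 C f) = idn (?N Y) (on_ob (?F Y) f)" if "f \<in> Mor C" "cod1 C f = P" "dom1 C f = Y" for f
    using that p0 by (simp add: Far Fob nat_cat_def pm_def pre0 Hom_simps fun_eq_iff restrict_def)
   have 2: "on_ar (?F Y) (vcmp C \<beta> n) = cmp (?N Y) (on_ar (?F Y) \<beta>) (on_ar (?F Y) n)"
    if "n \<in> Cell C" "\<beta> \<in> Cell C" "cod1 C (dom2 C n) = P" "dom1 C (dom2 C n) = Y" "cod2 C n = dom2 C \<beta>" for n \<beta>
   proof -
    have "cod1 C (dom2 C \<beta>) = P" "dom1 C (dom2 C \<beta>) = Y"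
     using that C.dom1_cod2_simp[of n] C.cod1_cod2_simp[of n] by auto
    then show ?thesis
     using that p0 by (simp add: Far Fob nat_cat_def pm_def pre0 Hom_simps fun_eq_iff restrict_def)
   qed
   have e: "on_ob (?F Y) \<in> extensional (Ob (?H Y))" "on_ar (?F Y) \<in> extensional (Ar (?H Y))"
    by (simp_all only: induced_functor_def functr.simps restrict_extensional P_def)
   show ?thesis unfolding is_functor_cong_ext
    using e 1 2 by (auto simp: nat_cat_simps Fob Far pre_nat' pm')
  qed
  have inv: "invertible_in_F (hom_obj C Y P) (nat_obj (chordate J) \<omega> (Hom Y)) (?F Y) \<longleftrightarrow>
    bij_betw (on_ob (?F Y)) (Ob (?H Y)) (Ob (?N Y)) & bij_betw (on_ar (?F Y)) (Ar (?H Y)) (Ar (?N Y)) &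
    (\<forall>f\<in>Ob (?H Y). f \<in> Tight C \<longleftrightarrow> (\<forall>j\<in>Obj J. \<forall>x\<in>Ob (fun0 W j). cmp1 C (p0 j x) f \<in> Tight C))" if Y: "Y \<in> Obj C" for Y
  proof -
   have "on_ob (?F Y) f \<in> {\<gamma>. f_natural (chordate J) \<omega> (Hom Y) \<gamma>} \<longleftrightarrow> (\<forall>j\<in>Obj J. \<forall>x\<in>Ob (fun0 W j). cmp1 C (p0 j x) f \<in> Tight C)"
    if "f \<in> Ob (?H Y)" for f
    using that Y by (simp add: Fob f_natural_iff pre_nat' pre0)
   then show ?thesis
    unfolding hom_obj_def nat_obj_def invertible_sub_iff[OF category_hom_cat[OF C.fcat]]
    using fctr[OF Y] by auto
  qed
  have pre_eq: "pre f = pre g" if "\<forall>j\<in>Obj J. \<forall>x\<in>Ob (fun0 W j). cmp1 C (p0 j x) f = cmp1 C (p0 j x) g"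
    "\<forall>j\<in>Obj J. \<forall>a\<in>Ar (fun0 W j). whr C (p1 j a) f = whr C (p1 j a) g" for f g
   by (rule legs_eqI[OF pre_ext pre_ext]) (use that in \<open>simp_all add: pre0 pre1\<close>)
  have pre_eqD: "cmp1 C (p0 j x) f = cmp1 C (p0 j x) g" if "pre f = pre g" "j \<in> Obj J" "x \<in> Ob (fun0 W j)" for f g j x
   using that pre0 by metis
  have pre_eqD': "whr C (p1 j a) f = whr C (p1 j a) g" if "pre f = pre g" "j \<in> Obj J" "a \<in> Ar (fun0 W j)" for f g j a
   using that pre1 by metis
  show ?thesis
  proof
   assume *: "\<forall>Y\<in>Obj C. invertible_in_F (hom_obj C Y P) (nat_obj (chordate J) \<omega> (Hom Y)) (induced_functor C y Y)"
   have b0: "bij_betw (on_ob (?F Y)) (Ob (?H Y)) (Ob (?N Y))" and b1: "bij_betw (on_ar (?F Y)) (Ar (?H Y)) (Ar (?N Y))"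
    and bt: "\<forall>f\<in>Ob (?H Y). f \<in> Tight C \<longleftrightarrow> (\<forall>j\<in>Obj J. \<forall>x\<in>Ob (fun0 W j). cmp1 C (p0 j x) f \<in> Tight C)"
    if "Y \<in> Obj C" for Y
    using * that inv[OF that] by auto
   have inj: "f = g" if "f \<in> Mor C" "g \<in> Mor C" "dom1 C f = dom1 C g" "cod1 C f = P" "cod1 C g = P" "pre f = pre g" for f g
   proof (rule inj_onD[OF bij_betw_imp_inj_on[OF b0[of "dom1 C f"]]])
    show "on_ob (?F (dom1 C f)) f = on_ob (?F (dom1 C f)) g" using that by (simp add: Fob)
   qed (use that in auto)
   have inj2: "f = g" if "f \<in> Cell C" "g \<in> Cell C" "dom2 C f = dom2 C g" "cod2 C f = cod2 C g" "cod1 C (dom2 C f) = P" "pm f = pm g" for f g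
   proof (rule inj_onD[OF bij_betw_imp_inj_on[OF b1[of "dom1 C (dom2 C f)"]]])
    show "on_ar (?F (dom1 C (dom2 C f))) f = on_ar (?F (dom1 C (dom2 C f))) g" using that by (simp add: Far)
   qed (use that in auto)
   show "limcone C J W D P p0 p1"
    unfolding limcone_def
   proof (intro conjI allI impI ballI)
    fix Y c0 c1 assume c: "lcone C J W D Y c0 c1"
    then have Y: "Y \<in> Obj C" by (simp add: lcone_def)
    \<comment> \<open>The family is cut down to the carriers, so that it becomes an object of the
      category of natural transformations and surjectivity applies to it.\<close>
    define \<delta> where "\<delta> = (\<lambda>j\<in>Obj J. \<lparr>on_ob = restrict (c0 j) (Ob (fun0 W j)), on_ar = restrict (c1 j) (Ar (fun0 W j))\<rparr>)"
    have "lcone C J W D Y (%j. on_ob (\<delta> j)) (%j. on_ar (\<delta> j))"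
     using c by (subst lcone_cong[OF J.two_category_axioms W, of _ c0 _ c1]) (simp_all add: \<delta>_def)
    then have "two_natural (chordate J) \<omega> (Hom Y) \<delta>"
     by (simp add: two_natural_iff[OF Y] legs_ext_def) (simp add: \<delta>_def)
    then have "\<delta> \<in> on_ob (?F Y) ` Ob (?H Y)"
     by (simp only: bij_betw_imp_surj_on[OF b0[OF Y]] nat_cat_simps mem_Collect_eq)
    then obtain f where "f \<in> Ob (?H Y)" and e: "on_ob (?F Y) f = \<delta>"
     by (metis imageE)
    then have f: "f \<in> Mor C" "cod1 C f = P" "dom1 C f = Y" by auto
    then have "pre f = \<delta>" using e by (simp add: Fob)
    then have "cmp1 C (p0 j x) f = c0 j x" if "j \<in> Obj J" "x \<in> Ob (fun0 W j)" for j x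
     using that pre0[OF that, of f] by (simp add: \<delta>_def)
    moreover have "whr C (p1 j a) f = c1 j a" if "j \<in> Obj J" "a \<in> Ar (fun0 W j)" for j a
     using that pre1[OF that, of f] \<open>pre f = \<delta>\<close> by (simp add: \<delta>_def)
    ultimately show "\<exists>f\<in>Mor C. dom1 C f = Y & cod1 C f = P &
       (\<forall>j\<in>Obj J. \<forall>x\<in>Ob (fun0 W j). cmp1 C (p0 j x) f = c0 j x) &
       (\<forall>j\<in>Obj J. \<forall>a\<in>Ar (fun0 W j). whr C (p1 j a) f = c1 j a)"
     using f by auto
   next
    fix f g assume fg: "f \<in> Mor C" "g \<in> Mor C" "dom1 C f = dom1 C g" "cod1 C f = P" "cod1 C g = P"
     "\<forall>j\<in>Obj J. \<forall>x\<in>Ob (fun0 W j). cmp1 C (p0 j x) f = cmp1 C (p0 j x) g"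
     "\<forall>j\<in>Obj J. \<forall>a\<in>Ar (fun0 W j). whr C (p1 j a) f = whr C (p1 j a) g"
    show "f = g" using inj[OF fg(1-5) pre_eq[OF fg(6,7)]] .
   next
    fix f g m assume fg: "f \<in> Mor C" "g \<in> Mor C" "dom1 C f = dom1 C g" "cod1 C f = P" "cod1 C g = P"
     and m: "lmod C J W D (%j x. cmp1 C (p0 j x) f) (%j a. whr C (p1 j a) f)
       (%j x. cmp1 C (p0 j x) g) (%j a. whr C (p1 j a) g) m"
    define m' where "m' = (\<lambda>j\<in>Obj J. restrict (m j) (Ob (fun0 W j)))"
    have Y: "dom1 C f \<in> Obj C" using fg by simp
    have "lmod C J W D (%j x. cmp1 C (p0 j x) f) (%j a. whr C (p1 j a) f)
       (%j x. cmp1 C (p0 j x) g) (%j a. whr C (p1 j a) g) m'"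
     using m by (subst lmod_cong[OF J.two_category_axioms W refl refl refl refl, of m' m]) (simp_all add: m'_def)
    then have "nat_modification (chordate J) \<omega> (Hom (dom1 C f)) (pre f) (pre g) m'"
     using fg by (subst mod_iff) (auto simp: m'_def)
    then have "Arr (pre f) (pre g) m' \<in> Ar (?N (dom1 C f))"
     using pre_nat'[OF fg(1,4) refl] pre_nat'[OF fg(2,5) fg(3)[symmetric]] by (simp only: nat_cat_simps arr.sel simp_thms)
    then have "Arr (pre f) (pre g) m' \<in> on_ar (?F (dom1 C f)) ` Ar (?H (dom1 C f))"
     by (simp only: bij_betw_imp_surj_on[OF b1[OF Y]])
    then obtain n where ae: "Arr (pre f) (pre g) m' = on_ar (?F (dom1 C f)) n" and a0: "n \<in> Ar (?H (dom1 C f))"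
     by (rule imageE)
    have "n \<in> Cell C" "cod1 C (dom2 C n) = P" "dom1 C (dom2 C n) = dom1 C f"
     using a0 by auto
    with ae have a: "n \<in> Cell C" "cod1 C (dom2 C n) = P" "dom1 C (dom2 C n) = dom1 C f"
     "pre (dom2 C n) = pre f" "pre (cod2 C n) = pre g" "pm n = m'"
     by (simp_all add: Far)
    have "dom2 C n = f" "cod2 C n = g" using a fg by (auto intro!: inj)
    moreover have "whl C (p0 j x) n = m j x" if "j \<in> Obj J" "x \<in> Ob (fun0 W j)" for j x
     using that fun_cong[OF fun_cong[OF a(6)], of j x] by (simp add: pm_def m'_def)
    ultimately show "\<exists>n\<in>Cell C. dom2 C n = f & cod2 C n = g &
      (\<forall>j\<in>Obj J. \<forall>x\<in>Ob (fun0 W j). whl C (p0 j x) n = m j x)"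
     using a(1) by blast
   next
    fix n \<beta> assume ab: "n \<in> Cell C" "\<beta> \<in> Cell C" "dom2 C n = dom2 C \<beta>" "cod2 C n = cod2 C \<beta>" "cod1 C (dom2 C n) = P"
     and e: "\<forall>j\<in>Obj J. \<forall>x\<in>Ob (fun0 W j). whl C (p0 j x) n = whl C (p0 j x) \<beta>"
    show "n = \<beta>" using e by (intro inj2[OF ab]) (simp add: pm_def fun_eq_iff restrict_def)
   next
    fix f assume f: "f \<in> Mor C" "cod1 C f = P" "\<forall>j\<in>Obj J. \<forall>x\<in>Ob (fun0 W j). cmp1 C (p0 j x) f \<in> Tight C"
    then have "dom1 C f \<in> Obj C" "f \<in> Ob (?H (dom1 C f))" by auto
    then show "f \<in> Tight C" using bt f(3) by blast
   qed (use l t in auto)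
  next
   assume L: "limcone C J W D P p0 p1"
   show "\<forall>Y\<in>Obj C. invertible_in_F (hom_obj C Y P) (nat_obj (chordate J) \<omega> (Hom Y)) (induced_functor C y Y)"
   proof
    fix Y assume Y: "Y \<in> Obj C"
    have inj: "f = g" if fg: "f \<in> Mor C" "g \<in> Mor C" "dom1 C f = dom1 C g" "cod1 C f = P" "cod1 C g = P" "pre f = pre g" for f g
     by (rule limcone_eq1[OF L fg(1-5)]) (simp_all only: pre_eqD[OF fg(6)] pre_eqD'[OF fg(6)])
    have "inj_on (on_ob (?F Y)) (Ob (?H Y))"
     by (rule inj_onI) (auto simp: Fob intro!: inj)
    moreover have ex: "\<exists>f\<in>Ob (?H Y). pre f = \<delta>" if "\<delta> \<in> Ob (?N Y)" for \<delta>
    proof -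
     have d: "legs_ext J W \<delta>" "lcone C J W D Y (%j. on_ob (\<delta> j)) (%j. on_ar (\<delta> j))"
      using that by (auto simp: nat_cat_simps two_natural_iff[OF Y])
     obtain f where "f \<in> Mor C" "dom1 C f = Y" "cod1 C f = P"
       "!!j x. [|j \<in> Obj J; x \<in> Ob (fun0 W j)|] ==> cmp1 C (p0 j x) f = on_ob (\<delta> j) x"
       "!!j a. [|j \<in> Obj J; a \<in> Ar (fun0 W j)|] ==> whr C (p1 j a) f = on_ar (\<delta> j) a"
      using limcone_ex1[OF L d(2)] by blast
     then have "f \<in> Ob (?H Y)" "pre f = \<delta>"
      by (auto intro!: legs_eqI[OF pre_ext d(1)] simp: pre0 pre1)
     then show ?thesis by blast
    qed
    have "\<exists>f\<in>Ob (?H Y). on_ob (?F Y) f = \<delta>" if "\<delta> \<in> Ob (?N Y)" for \<delta>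
     using ex[OF that] by (auto simp: Fob)
    moreover have "on_ob (?F Y) ` Ob (?H Y) \<subseteq> Ob (?N Y)"
     using fctr[OF Y] by (auto simp: is_functor_cong_ext)
    ultimately have 1: "bij_betw (on_ob (?F Y)) (Ob (?H Y)) (Ob (?N Y))"
     unfolding bij_betw_def by blast
    have "inj_on (on_ar (?F Y)) (Ar (?H Y))"
    proof (rule inj_onI)
     fix n \<beta> assume ab: "n \<in> Ar (?H Y)" "\<beta> \<in> Ar (?H Y)" and e: "on_ar (?F Y) n = on_ar (?F Y) \<beta>"
     then have e: "pre (dom2 C n) = pre (dom2 C \<beta>)" "pre (cod2 C n) = pre (cod2 C \<beta>)" "pm n = pm \<beta>"
      by (auto simp: Far)
     have d: "dom2 C n = dom2 C \<beta>" "cod2 C n = cod2 C \<beta>"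
      using ab by (auto intro!: inj e)
     have "whl C (p0 j x) n = whl C (p0 j x) \<beta>" if "j \<in> Obj J" "x \<in> Ob (fun0 W j)" for j x
      using that fun_cong[OF fun_cong[OF e(3)], of j x] by (simp add: pm_def)
     note w = this
     have c: "n \<in> Cell C" "\<beta> \<in> Cell C" "cod1 C (dom2 C n) = P" using ab by auto
     show "n = \<beta>" by (rule limcone_eq2[OF L c(1,2) d c(3) w])
    qed
    moreover have "\<exists>n\<in>Ar (?H Y). on_ar (?F Y) n = t" if t: "t \<in> Ar (?N Y)" for t
    proof -
     obtain \<gamma> \<delta> m where te: "t = Arr \<gamma> \<delta> m" by (cases t)
     have gd: "\<gamma> \<in> Ob (?N Y)" "\<delta> \<in> Ob (?N Y)" using t by (auto simp: te nat_cat_simps)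
     obtain f where f: "f \<in> Mor C" "dom1 C f = Y" "cod1 C f = P" "pre f = \<gamma>" using ex[OF gd(1)] by auto
     obtain g where g: "g \<in> Mor C" "dom1 C g = Y" "cod1 C g = P" "pre g = \<delta>" using ex[OF gd(2)] by auto
     have m: "m \<in> extensional (Obj J)" "\<forall>j\<in>Obj J. m j \<in> extensional (Ob (fun0 W j))"
       "lmod C J W D (%j x. cmp1 C (p0 j x) f) (%j a. whr C (p1 j a) f)
       (%j x. cmp1 C (p0 j x) g) (%j a. whr C (p1 j a) g) m"
      using t mod_iff[of f g Y m] f g by (auto simp: te nat_cat_simps)
     obtain n where a: "n \<in> Cell C" "dom2 C n = f" "cod2 C n = g"
      "!!j x. [|j \<in> Obj J; x \<in> Ob (fun0 W j)|] ==> whl C (p0 j x) n = m j x"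
     proof -
      have "dom1 C f = dom1 C g" using f g by simp
      from limcone_ex2[OF L f(1) g(1) this f(3) g(3) m(3)] show ?thesis using that by blast
     qed
     have "pm n = m" using m a(4)
      by (auto intro!: extensionalityI[of _ "Obj J"] extensionalityI[of _ "Ob (fun0 W _)"] simp: pm_def)
     then have "on_ar (?F Y) n = t" using a f g by (simp add: Far te)
     then show ?thesis using a f by auto
    qed
    moreover have "on_ar (?F Y) ` Ar (?H Y) \<subseteq> Ar (?N Y)"
     using fctr[OF Y] by (auto simp: is_functor_cong_ext)
    ultimately have 2: "bij_betw (on_ar (?F Y)) (Ar (?H Y)) (Ar (?N Y))"
     unfolding bij_betw_def by blast
    have 3: "\<forall>f\<in>Ob (?H Y). f \<in> Tight C \<longleftrightarrow> (\<forall>j\<in>Obj J. \<forall>x\<in>Ob (fun0 W j). cmp1 C (p0 j x) f \<in> Tight C)"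
    proof
     fix f assume "f \<in> Ob (?H Y)"
     then have f: "f \<in> Mor C" "cod1 C f = P" by auto
     have "cmp1 C (p0 j x) f \<in> Tight C" if "f \<in> Tight C" "j \<in> Obj J" "x \<in> Ob (fun0 W j)" for j x
      using that f t p0[OF that(2,3)] by (intro C.Tight_cmp1) auto
     then show "f \<in> Tight C \<longleftrightarrow> (\<forall>j\<in>Obj J. \<forall>x\<in>Ob (fun0 W j). cmp1 C (p0 j x) f \<in> Tight C)"
      using limcone_detect[OF L f] by blast
    qed
    show "invertible_in_F (hom_obj C Y P) (nat_obj (chordate J) \<omega> (Hom Y)) (induced_functor C y Y)"
     by (rule inv[OF Y, THEN iffD2, OF conjI[OF 1 conjI[OF 2 3]]])
   qed
  qed
 qed
 have "limit_cone C y \<longleftrightarrow> legs_ext J W (legs y) & limcone C J W D P p0 p1"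
 proof (cases "legs_ext J W (legs y) & lcone C J W D P p0 p1 & (\<forall>j\<in>Obj J. \<forall>x\<in>Ob (fun0 W j). p0 j x \<in> Tight C)")
  case True
  then have c: "legs_ext J W (legs y)" "lcone C J W D P p0 p1" "\<forall>j\<in>Obj J. \<forall>x\<in>Ob (fun0 W j). p0 j x \<in> Tight C"
   by blast+
  have k: "weighted_cone C y" by (rule wc[THEN iffD2, OF True])
  show ?thesis
   unfolding limit_cone_def w d sh P_def[symmetric] main[OF c(2,3)] by (simp only: k c(1) simp_thms)
 next
  \<comment> \<open>Both notions of limit cone contain these three conditions, so both sides are
    false.\<close>
  case False
  then have "\<not> weighted_cone C y" by (simp only: wc not_False_eq_True)
  moreover have "\<not> (legs_ext J W (legs y) & limcone C J W D P p0 p1)"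
   using False limcone_lcone[of C J W D P p0 p1] limcone_Tight[of C J W D P p0 p1] by blast
  ultimately show ?thesis by (simp only: limit_cone_def simp_thms)
 qed
 then show ?thesis by (simp only: P_def p0_def p1_def)
qed

end

lemma cone_dataI:
 assumes "cat_weight J W" "fcategory C" "is_ffunctor (chordate J) C D"
 shows "cone_data J W C D"
proof -
 interpret cat_weight J W by fact
 have "ffunctor (chordate J) C D" using assms fcategory_chordate[OF J.two_category_axioms] by (intro ffunctorI)
 then show ?thesis using assms by (simp add: cone_data_def)
qed

section \<open>Images of cones under \<open>F\<close>-functors\<close>

lemma comp_ffunctor_simps [simp]:
 "X \<in> Obj A ==> fun0 (comp_ffunctor A G F) X = fun0 G (fun0 F X)"
 "f \<in> Mor A ==> fun1 (comp_ffunctor A G F) f = fun1 G (fun1 F f)"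
 "a \<in> Cell A ==> fun2 (comp_ffunctor A G F) a = fun2 G (fun2 F a)"
 by (simp_all add: comp_ffunctor_def compose_def)

lemma is_ffunctor_comp:
 assumes "fcategory A" "fcategory B" "fcategory C" "is_ffunctor A B F" "is_ffunctor B C G"
 shows "is_ffunctor A C (comp_ffunctor A G F)"
proof -
 interpret F: ffunctor A B F using assms by (intro ffunctorI)
 interpret G: ffunctor B C G using assms by (intro ffunctorI)
 have "is_two_functor A C (comp_ffunctor A G F)"
  by (rule is_two_functorI) (auto simp: F.A.two_category_axioms G.B.two_category_axioms comp_ffunctor_def compose_def)
 then show ?thesis by (simp add: is_ffunctor_def)
qed

lemma lcone_image:
 assumes "fcategory C" "fcategory C'" "is_ffunctor C C' G" "cat_weight J W" "is_ffunctor (chordate J) C D"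
  and l: "lcone C J W D Y c0 c1"
 shows "lcone C' J W (comp_ffunctor (chordate J) G D) (fun0 G Y) (%j x. fun1 G (c0 j x)) (%j a. fun2 G (c1 j a))"
proof -
 interpret G: ffunctor C C' G using assms by (intro ffunctorI)
 interpret cat_weight J W by fact
 interpret cone_data J W C D using assms by (intro cone_dataI)
 have c0: "c0 j x \<in> Mor C" "dom1 C (c0 j x) = Y" "cod1 C (c0 j x) = fun0 D j" if "j \<in> Obj J" "x \<in> Ob (fun0 W j)" for j x
  using l that by (simp_all add: lcone_def)
 have c1: "c1 j a \<in> Cell C" "dom2 C (c1 j a) = c0 j (src (fun0 W j) a)" "cod2 C (c1 j a) = c0 j (trg (fun0 W j) a)"
  if "j \<in> Obj J" "a \<in> Ar (fun0 W j)" for j a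
  using l that by (simp_all add: lcone_def)
 have e: "c1 j (idn (fun0 W j) x) = id2 C (c0 j x)" if "j \<in> Obj J" "x \<in> Ob (fun0 W j)" for j x
  using l that by (simp add: lcone_def)
 have e1: "c1 j (cmp (fun0 W j) b a) = vcmp C (c1 j b) (c1 j a)" if "j \<in> Obj J" "a \<in> Ar (fun0 W j)" "b \<in> Ar (fun0 W j)"
   "trg (fun0 W j) a = src (fun0 W j) b" for j a b
  using l that by (simp add: lcone_def)
 have e2: "c0 (cod1 J u) (on_ob (amap (fun1 W u)) x) = cmp1 C (fun1 D u) (c0 (dom1 J u) x)" if "u \<in> Mor J" "x \<in> Ob (fun0 W (dom1 J u))" for u x
  using l that by (simp add: lcone_def)
 have e3: "c1 (cod1 J u) (on_ar (amap (fun1 W u)) a) = whl C (fun1 D u) (c1 (dom1 J u) a)" if "u \<in> Mor J" "a \<in> Ar (fun0 W (dom1 J u))" for u a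
  using l that by (simp add: lcone_def)
 have e4: "c1 (cod1 J (dom2 J m)) (amap (fun2 W m) x) = whr C (fun2 D m) (c0 (dom1 J (dom2 J m)) x)"
  if "m \<in> Cell J" "x \<in> Ob (fun0 W (dom1 J (dom2 J m)))" for m x
  using l that by (simp add: lcone_def)
 have "Y \<in> Obj C" using l by (simp add: lcone_def)
 then show ?thesis
  by (simp add: lcone_def c0 c1 e e1 e2 e3 e4)
qed

lemma lmod_image:
 assumes "fcategory C" "fcategory C'" "is_ffunctor C C' G" "cat_weight J W" "is_ffunctor (chordate J) C D"
  and l: "lcone C J W D Y c0 c1" and l': "lcone C J W D Y d0 d1" and m: "lmod C J W D c0 c1 d0 d1 m"
 shows "lmod C' J W (comp_ffunctor (chordate J) G D) (%j x. fun1 G (c0 j x)) (%j a. fun2 G (c1 j a))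
  (%j x. fun1 G (d0 j x)) (%j a. fun2 G (d1 j a)) (%j x. fun2 G (m j x))"
proof -
 interpret G: ffunctor C C' G using assms by (intro ffunctorI)
 interpret cat_weight J W by fact
 interpret cone_data J W C D using assms by (intro cone_dataI)
 have c0: "c0 j x \<in> Mor C" "dom1 C (c0 j x) = Y" "cod1 C (c0 j x) = fun0 D j" if "j \<in> Obj J" "x \<in> Ob (fun0 W j)" for j x
  using l that by (simp_all add: lcone_def)
 have c1: "c1 j a \<in> Cell C" "dom2 C (c1 j a) = c0 j (src (fun0 W j) a)" "cod2 C (c1 j a) = c0 j (trg (fun0 W j) a)"
  if "j \<in> Obj J" "a \<in> Ar (fun0 W j)" for j a
  using l that by (simp_all add: lcone_def)
 have d1: "d1 j a \<in> Cell C" "dom2 C (d1 j a) = d0 j (src (fun0 W j) a)" "cod2 C (d1 j a) = d0 j (trg (fun0 W j) a)"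
  if "j \<in> Obj J" "a \<in> Ar (fun0 W j)" for j a
  using l' that by (simp_all add: lcone_def)
 have mm: "m j x \<in> Cell C" "dom2 C (m j x) = c0 j x" "cod2 C (m j x) = d0 j x" if "j \<in> Obj J" "x \<in> Ob (fun0 W j)" for j x
  using m that by (simp_all add: lmod_def)
 have e0: "vcmp C (d1 j a) (m j (src (fun0 W j) a)) = vcmp C (m j (trg (fun0 W j) a)) (c1 j a)"
  if "j \<in> Obj J" "a \<in> Ar (fun0 W j)" for j a
  using m that by (simp add: lmod_def)
 have e: "vcmp C' (fun2 G (d1 j a)) (fun2 G (m j (src (fun0 W j) a))) = vcmp C' (fun2 G (m j (trg (fun0 W j) a))) (fun2 G (c1 j a))"
  if "j \<in> Obj J" "a \<in> Ar (fun0 W j)" for j a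
  using that arg_cong[OF e0[OF that], of "fun2 G"] by (simp add: c1 d1 mm)
 have e2: "m (cod1 J u) (on_ob (amap (fun1 W u)) x) = whl C (fun1 D u) (m (dom1 J u) x)"
  if "u \<in> Mor J" "x \<in> Ob (fun0 W (dom1 J u))" for u x
  using m that by (simp add: lmod_def)
 show ?thesis by (simp add: lmod_def mm e e2 c0)
qed

section \<open>Legs of a limit cone reflect identity and invertible 2-cells\<close>

context two_category
begin

lemma inverse_unique:
 assumes "a \<in> Cell C" "b \<in> Cell C" "c \<in> Cell C" "dom2 C a = f" "cod2 C a = g"
  "dom2 C b = g" "cod2 C c = f" "cod2 C b = f" "dom2 C c = g"
  "vcmp C b a = id2 C f" "vcmp C a c = id2 C g"
 shows "b = c"
proof -
 have "b = vcmp C b (vcmp C a c)" using assms(1-9) by (simp add: assms(11))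
 also have "\<dots> = vcmp C (vcmp C b a) c" using assms(1-9) by simp
 also have "\<dots> = c" using assms(1-9) by (simp add: assms(10) del: vcmp_assoc)
 finally show ?thesis .
qed

text \<open>Compose the square with \<open>n'\<close> on one side and with \<open>e'\<close> on the
  other; \<open>e'\<close> enters as a right inverse of \<open>e\<close> and \<open>n'\<close> as a
  left inverse of \<open>n\<close>. It is applied wherever a commuting square must be read with two
  opposite sides inverted.\<close>

lemma square_inverse:
 assumes "e \<in> Cell C" "dom2 C e = x" "cod2 C e = y" and "e' \<in> Cell C" "dom2 C e' = y" "cod2 C e' = x"
  and "n \<in> Cell C" "dom2 C n = x'" "cod2 C n = y'" and "n' \<in> Cell C" "dom2 C n' = y'" "cod2 C n' = x'"
  and "\<mu> \<in> Cell C" "dom2 C \<mu> = x" "cod2 C \<mu> = x'" and "\<nu> \<in> Cell C" "dom2 C \<nu> = y" "cod2 C \<nu> = y'"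
  and a: "vcmp C e e' = id2 C y" and b: "vcmp C n' n = id2 C x'" and sq: "vcmp C \<nu> e = vcmp C n \<mu>"
 shows "vcmp C \<mu> e' = vcmp C n' \<nu>"
proof -
 note ty = assms(1-18)
 have "vcmp C \<mu> e' = vcmp C (vcmp C n' n) (vcmp C \<mu> e')" using ty by (simp add: b del: vcmp_assoc)
 also have "\<dots> = vcmp C n' (vcmp C (vcmp C n \<mu>) e')" using ty by simp
 also have "\<dots> = vcmp C n' (vcmp C \<nu> (vcmp C e e'))" using ty by (simp add: sq[symmetric])
 also have "\<dots> = vcmp C n' \<nu>" using ty by (simp add: a)
 finally show ?thesis .
qed

end

context cone_data
begin

lemma limcone_p:
 assumes "lcone C J W D P p0 p1"
 shows "!!j x. [|j \<in> Obj J; x \<in> Ob (fun0 W j)|] ==> p0 j x \<in> Mor C"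
  "!!j x. [|j \<in> Obj J; x \<in> Ob (fun0 W j)|] ==> dom1 C (p0 j x) = P"
  "!!j x. [|j \<in> Obj J; x \<in> Ob (fun0 W j)|] ==> cod1 C (p0 j x) = fun0 D j"
  "!!j a. [|j \<in> Obj J; a \<in> Ar (fun0 W j)|] ==> p1 j a \<in> Cell C"
  "!!j a. [|j \<in> Obj J; a \<in> Ar (fun0 W j)|] ==> dom2 C (p1 j a) = p0 j (src (fun0 W j) a)"
  "!!j a. [|j \<in> Obj J; a \<in> Ar (fun0 W j)|] ==> cod2 C (p1 j a) = p0 j (trg (fun0 W j) a)"
 using assms by (simp_all add: lcone_def)

lemma lcone_eqs:
 assumes "lcone C J W D P p0 p1"
 shows "!!j x. [|j \<in> Obj J; x \<in> Ob (fun0 W j)|] ==> p1 j (idn (fun0 W j) x) = id2 C (p0 j x)"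
  "!!j a b. [|j \<in> Obj J; a \<in> Ar (fun0 W j); b \<in> Ar (fun0 W j); trg (fun0 W j) a = src (fun0 W j) b|] ==>
    p1 j (cmp (fun0 W j) b a) = vcmp C (p1 j b) (p1 j a)"
  "!!u x. [|u \<in> Mor J; x \<in> Ob (fun0 W (dom1 J u))|] ==>
    p0 (cod1 J u) (on_ob (amap (fun1 W u)) x) = cmp1 C (fun1 D u) (p0 (dom1 J u) x)"
  "!!u a. [|u \<in> Mor J; a \<in> Ar (fun0 W (dom1 J u))|] ==>
    p1 (cod1 J u) (on_ar (amap (fun1 W u)) a) = whl C (fun1 D u) (p1 (dom1 J u) a)"
  "!!e x. [|e \<in> Cell J; x \<in> Ob (fun0 W (dom1 J (dom2 J e)))|] ==>
    p1 (cod1 J (dom2 J e)) (amap (fun2 W e) x) = whr C (fun2 D e) (p0 (dom1 J (dom2 J e)) x)"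
 using assms by (simp_all add: lcone_def)

text \<open>Uniqueness for 1-cells identifies the two ends of \<open>e\<close>: the 1-cell legs
  agree because the whiskered cells are identities, the 2-cell legs by the exchange law. Uniqueness
  for 2-cells then identifies \<open>e\<close> with the identity. This handles the strict case and
  the tight 1-cells of \<open>S\<close>.\<close>

lemma limcone_reflect_identity:
 assumes L: "limcone C J W D P p0 p1" and a: "e \<in> Cell C" "cod1 C (dom2 C e) = P"
  and i: "!!j x. [|j \<in> Obj J; x \<in> Ob (fun0 W j)|] ==> identity_cell C (whl C (p0 j x) e)"
 shows "identity_cell C e"
proof -
 note p = limcone_p[OF limcone_lcone[OF L]]
 have w: "whl C (p0 j x) e = id2 C (cmp1 C (p0 j x) (dom2 C e)) & cmp1 C (p0 j x) (cod2 C e) = cmp1 C (p0 j x) (dom2 C e)"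
  if "j \<in> Obj J" "x \<in> Ob (fun0 W j)" for j x
  using C.identity_cell_eq[OF i[OF that]] p(1-3)[OF that] a by simp
 have "cod2 C e = dom2 C e"
 proof (rule limcone_eq1[OF L])
  fix j b assume jb: "j \<in> Obj J" "b \<in> Ar (fun0 W j)"
  have "vcmp C (whr C (p1 j b) (cod2 C e)) (whl C (p0 j (src (fun0 W j) b)) e) =
    vcmp C (whl C (p0 j (trg (fun0 W j) b)) e) (whr C (p1 j b) (dom2 C e))"
   using jb a p by (intro C.exchange) auto
  then show "whr C (p1 j b) (cod2 C e) = whr C (p1 j b) (dom2 C e)"
   using jb a p w by simp
 qed (use a w in auto)
 then have "e = id2 C (dom2 C e)"
  using a w p by - (rule limcone_eq2[OF L], auto)
 then show ?thesis using a unfolding identity_cell_def by (intro bexI[of _ "dom2 C e"]) auto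
qed

text \<open>Inverses of the whiskered cells form a modification and so descend to one 2-cell. Its
  two composites with \<open>n\<close> are identities because they are so after whiskering with each
  leg. This handles the pseudo case.\<close>

lemma limcone_reflect_invertible:
 assumes L: "limcone C J W D P p0 p1" and a: "n \<in> Cell C" "cod1 C (dom2 C n) = P"
  and i: "!!j x. [|j \<in> Obj J; x \<in> Ob (fun0 W j)|] ==> invertible_cell C (whl C (p0 j x) n)"
 shows "invertible_cell C n"
proof -
 note p = limcone_p[OF limcone_lcone[OF L]]
 let ?f = "dom2 C n" and ?g = "cod2 C n"
 \<comment> \<open>An arbitrary inverse at each index. Since inverses are unique, the choices are
   compatible with the 1-cells of \<open>J\<close>.\<close>
 define m where "m j x = (SOME \<beta>. \<beta> \<in> Cell C & dom2 C \<beta> = cmp1 C (p0 j x) ?g & cod2 C \<beta> = cmp1 C (p0 j x) ?f &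
   vcmp C \<beta> (whl C (p0 j x) n) = id2 C (cmp1 C (p0 j x) ?f) & vcmp C (whl C (p0 j x) n) \<beta> = id2 C (cmp1 C (p0 j x) ?g))" for j x
 have "m j x \<in> Cell C & dom2 C (m j x) = cmp1 C (p0 j x) ?g & cod2 C (m j x) = cmp1 C (p0 j x) ?f &
   vcmp C (m j x) (whl C (p0 j x) n) = id2 C (cmp1 C (p0 j x) ?f) & vcmp C (whl C (p0 j x) n) (m j x) = id2 C (cmp1 C (p0 j x) ?g)"
  if "j \<in> Obj J" "x \<in> Ob (fun0 W j)" for j x
  unfolding m_def
  by (rule someI_ex) (use i[OF that] p(1-3)[OF that] a in \<open>auto simp: invertible_cell_def\<close>)
 then have m: "m j x \<in> Cell C" "dom2 C (m j x) = cmp1 C (p0 j x) ?g" "cod2 C (m j x) = cmp1 C (p0 j x) ?f"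
   "vcmp C (m j x) (whl C (p0 j x) n) = id2 C (cmp1 C (p0 j x) ?f)" "vcmp C (whl C (p0 j x) n) (m j x) = id2 C (cmp1 C (p0 j x) ?g)"
  if "j \<in> Obj J" "x \<in> Ob (fun0 W j)" for j x using that by auto
 have "lmod C J W D (%j x. cmp1 C (p0 j x) ?g) (%j a. whr C (p1 j a) ?g)
     (%j x. cmp1 C (p0 j x) ?f) (%j a. whr C (p1 j a) ?f) m"
  unfolding lmod_def
 proof (intro conjI ballI)
  fix j b assume jb: "j \<in> Obj J" "b \<in> Ar (fun0 W j)"
  let ?s = "src (fun0 W j) b" and ?t = "trg (fun0 W j) b"
  have st: "?s \<in> Ob (fun0 W j)" "?t \<in> Ob (fun0 W j)" using jb by auto
  have ex: "vcmp C (whr C (p1 j b) ?g) (whl C (p0 j ?s) n) =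
    vcmp C (whl C (p0 j ?t) n) (whr C (p1 j b) ?f)"
   using jb a p by (intro C.exchange) auto
  note c = p(1-3)[OF jb(1) st(1)] p(1-3)[OF jb(1) st(2)] p(4-6)[OF jb] a
  show "vcmp C (whr C (p1 j b) ?f) (m j ?s) = vcmp C (m j ?t) (whr C (p1 j b) ?g)"
   by (rule C.square_inverse[OF _ _ _ m(1-3)[OF jb(1) st(1)] _ _ _ m(1-3)[OF jb(1) st(2)] _ _ _ _ _ _
      m(5)[OF jb(1) st(1)] m(4)[OF jb(1) st(2)] ex]) (use c in simp_all)
 next
  fix u x assume u: "u \<in> Mor J" "x \<in> Ob (fun0 W (dom1 J u))"
  let ?x = "on_ob (amap (fun1 W u)) x" and ?j = "cod1 J u"
  have x: "dom1 J u \<in> Obj J" "?j \<in> Obj J" "?x \<in> Ob (fun0 W ?j)" using u by auto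
  note ty = m(1-3)[OF x(1) u(2)] p(1-3)[OF x(1) u(2)] a u
  have e: "p0 ?j ?x = cmp1 C (fun1 D u) (p0 (dom1 J u) x)" using lcone_eqs(3)[OF limcone_lcone[OF L]] u by simp
  have 1: "vcmp C (whl C (fun1 D u) (m (dom1 J u) x)) (whl C (p0 ?j ?x) n) = id2 C (cmp1 C (p0 ?j ?x) ?f)"
   using arg_cong[OF m(4)[OF x(1) u(2)], of "whl C (fun1 D u)"] ty by (simp add: e)
  show "whl C (fun1 D u) (m (dom1 J u) x) = m ?j ?x"
   by (rule C.inverse_unique[OF _ _ _ _ _ _ _ _ _ 1 m(5)[OF x(2,3)]])
    (use m(1-3)[OF x(1) u(2)] m(1-3)[OF x(2,3)] p(1-3)[OF x(1) u(2)] a u in \<open>simp_all add: e\<close>)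
 qed (use m in simp_all)
 then obtain \<beta> where b: "\<beta> \<in> Cell C" "dom2 C \<beta> = ?g" "cod2 C \<beta> = ?f"
   "!!j x. [|j \<in> Obj J; x \<in> Ob (fun0 W j)|] ==> whl C (p0 j x) \<beta> = m j x"
  using limcone_ex2[OF L, of ?g ?f m] a by auto
 have "vcmp C \<beta> n = id2 C ?f" using a b p m by - (rule limcone_eq2[OF L], auto)
 moreover have "vcmp C n \<beta> = id2 C ?g" using a b p m by - (rule limcone_eq2[OF L], auto)
 ultimately show ?thesis using b unfolding invertible_cell_def by blast
qed

end

section \<open>Pointwise limits\<close>

text \<open>The structure cell of a tight 1-cell is an identity, so its two ends coincide whichever
  way the cell is directed.\<close>

lemma Tight_Fun_strict:
 assumes S: "fcategory S" and C: "fcategory C" and f: "f \<in> Tight (Fun w S C)" and s: "s \<in> Mor S"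
 shows "at_mor (amap f) s = id2 C (cmp1 C (fun1 (acod f) s) (at_ob (amap f) (dom1 S s)))"
  "cmp1 C (at_ob (amap f) (cod1 S s)) (fun1 (adom f) s) = cmp1 C (fun1 (acod f) s) (at_ob (amap f) (dom1 S s))"
proof -
 interpret C: fcategory C by (rule C)
 have "f \<in> Mor (Fun w S C)" and i: "identity_cell C (at_mor (amap f) s)" using f s by (auto simp: Tight_Fun)
 then interpret f: w_nat S C "adom f" "acod f" w "amap f" by (intro Mor_FunD[OF S C])
 note e = C.identity_cell_eq[OF i]
 show "at_mor (amap f) s = id2 C (cmp1 C (fun1 (acod f) s) (at_ob (amap f) (dom1 S s)))"
  "cmp1 C (at_ob (amap f) (cod1 S s)) (fun1 (adom f) s) = cmp1 C (fun1 (acod f) s) (at_ob (amap f) (dom1 S s))"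
  using e f.dom2_at_mor[OF s] f.cod2_at_mor[OF s] f.dom2_at_mor'[OF s] f.cod2_at_mor'[OF s]
  by metis+
qed

text \<open>Both structure cells are identities, so the modification square collapses to an equation
  between its two other sides.\<close>

lemma Cell_Fun_strict:
 assumes S: "fcategory S" and C: "fcategory C" and a: "a \<in> Cell (Fun w S C)"
  and t: "adom a \<in> Tight (Fun w S C)" "acod a \<in> Tight (Fun w S C)" and s: "s \<in> Mor S"
 shows "whr C (amap a (cod1 S s)) (fun1 (adom (adom a)) s) = whl C (fun1 (acod (adom a)) s) (amap a (dom1 S s))"
proof -
 interpret S: fcategory S by (rule S)
 interpret C: fcategory C by (rule C)
 note c = Cell_FunD[OF a]
 interpret M: ffunctor S C "adom (adom a)" using Mor_Fun_simps(1)[OF S C c(1)] by (intro ffunctorI S C)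
 interpret N: ffunctor S C "acod (adom a)" using Mor_Fun_simps(2)[OF S C c(1)] by (intro ffunctorI S C)
 have X: "dom1 S s \<in> Obj S" "cod1 S s \<in> Obj S" using s by simp_all
 note f = Mor_Fun_simps(3-5)[OF S C c(1) X(1)] Mor_Fun_simps(3-5)[OF S C c(1) X(2)]
  Mor_Fun_simps(3-5)[OF S C c(2) X(1)] Mor_Fun_simps(3-5)[OF S C c(2) X(2)] c(3,4)
 note k = c(5-7)[OF X(1)] c(5-7)[OF X(2)]
 note e1 = Tight_Fun_strict[OF S C t(1) s] and e2 = Tight_Fun_strict[OF S C t(2) s]
 have "modification w S C (adom (adom a)) (acod (adom a)) (amap (adom a)) (amap (acod a)) (amap a)"
  using a by (simp add: Cell_Fun)
 then have sl: "slides w C (at_mor (amap (adom a)) s) (at_mor (amap (acod a)) s)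
   (whl C (fun1 (acod (adom a)) s) (amap a (dom1 S s))) (whr C (amap a (cod1 S s)) (fun1 (adom (adom a)) s))"
  using s by (simp add: modification_def)
 show ?thesis
  using sl unfolding slides_def e1(1) e2(1) by (simp add: f k s X e1(2) e2(2)[unfolded f] split: if_splits)
qed

lemma Tight_Fun_nat:
 assumes S: "fcategory S" and C: "fcategory C" and f: "f \<in> Tight (Fun w S C)" and s: "z \<in> Cell S"
 shows "whl C (at_ob (amap f) (cod1 S (dom2 S z))) (fun2 (adom f) z) = whr C (fun2 (acod f) z) (at_ob (amap f) (dom1 S (dom2 S z)))"
proof -
 interpret S: fcategory S by (rule S)
 interpret C: fcategory C by (rule C)
 have f': "f \<in> Mor (Fun w S C)" using f by (simp add: Tight_Fun)
 interpret f: w_nat S C "adom f" "acod f" w "amap f" by (rule Mor_FunD[OF S C f'])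
 let ?q = "at_ob (amap f)" and ?P = "adom f" and ?D = "acod f"
 have d: "dom2 S z \<in> Mor S" "cod2 S z \<in> Mor S" using s by auto
 have e: "dom1 S (cod2 S z) = dom1 S (dom2 S z)" "cod1 S (cod2 S z) = cod1 S (dom2 S z)" using s by simp_all
 note t = Tight_Fun_strict(2,1)[OF S C f d(1)] Tight_Fun_strict(2,1)[OF S C f d(2), unfolded e]
 have X: "dom1 S (dom2 S z) \<in> Obj S" "cod1 S (dom2 S z) \<in> Obj S" using s by simp_all
 have 1: "vcmp C (whl C (?q (cod1 S (dom2 S z))) (fun2 ?P z)) (id2 C (cmp1 C (fun1 ?D (dom2 S z)) (?q (dom1 S (dom2 S z)))))
   = whl C (?q (cod1 S (dom2 S z))) (fun2 ?P z)"
  "vcmp C (id2 C (cmp1 C (fun1 ?D (cod2 S z)) (?q (dom1 S (dom2 S z))))) (whl C (?q (cod1 S (dom2 S z))) (fun2 ?P z))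
   = whl C (?q (cod1 S (dom2 S z))) (fun2 ?P z)"
  by (rule C.vcmp_id_right C.vcmp_id_left; simp add: t s X)+
 have 2: "vcmp C (whr C (fun2 ?D z) (?q (dom1 S (dom2 S z)))) (id2 C (cmp1 C (fun1 ?D (dom2 S z)) (?q (dom1 S (dom2 S z)))))
   = whr C (fun2 ?D z) (?q (dom1 S (dom2 S z)))"
  "vcmp C (id2 C (cmp1 C (fun1 ?D (cod2 S z)) (?q (dom1 S (dom2 S z))))) (whr C (fun2 ?D z) (?q (dom1 S (dom2 S z))))
   = whr C (fun2 ?D z) (?q (dom1 S (dom2 S z)))"
  by (rule C.vcmp_id_right C.vcmp_id_left; simp add: t s X)+
 show ?thesis
  using f.at_mor_slides[OF s] unfolding slides_def t(2,4) 1 2 by (cases "w = Colax") (simp_all only: if_True if_False simp_thms)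
qed

text \<open>The factor contributed by \<open>p\<close> is an identity and disappears. Tight legs
  thus act on structure cells just as 1-cells of \<open>C\<close> act on 2-cells, which opens the
  way to the 2-dimensional universal property in \<open>C\<close>.\<close>

lemma at_mor_comp_Tight:
 assumes S: "fcategory S" and C: "fcategory C" and p: "p \<in> Tight (Fun w S C)" and f: "f \<in> Mor (Fun w S C)"
  and e: "acod f = adom p" and s: "s \<in> Mor S"
 shows "at_mor (comp_transf w S C (amap p) (amap f)) s = whl C (at_ob (amap p) (cod1 S s)) (at_mor (amap f) s)"
proof -
 interpret S: fcategory S by (rule S)
 interpret C: fcategory C by (rule C)
 have p': "p \<in> Mor (Fun w S C)" using p by (simp add: Tight_Fun)
 interpret f: w_nat S C "adom f" "acod f" w "amap f" by (rule Mor_FunD[OF S C f])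
 interpret p: w_nat S C "acod f" "acod p" w "amap p" using Mor_FunD[OF S C p'] e by simp
 note i = Tight_Fun_strict[OF S C p s, folded e]
 have 1: "cmp1 C (at_ob (amap p) (cod1 S s)) (cmp1 C (fun1 (acod f) s) (at_ob (amap f) (dom1 S s))) =
   cmp1 C (fun1 (acod p) s) (cmp1 C (at_ob (amap p) (dom1 S s)) (at_ob (amap f) (dom1 S s)))"
  using arg_cong[OF i(2), of "%x. cmp1 C x (at_ob (amap f) (dom1 S s))"] s by simp
 show ?thesis
  using s by (cases "w = Colax") (simp_all add: comp_transf_def vpaste_def i(1) 1 f.dom2_at_mor f.cod2_at_mor f.dom2_at_mor' f.cod2_at_mor')
qed

section \<open>Cones in a functor category and their evaluations\<close>

locale Fun_cone = S: fcategory S + C: fcategory C + cat_weight J W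
 for S :: "('os, 'ms, 'cs) fcat" and C :: "('o, 'm, 'c) fcat"
 and J :: "('oj, 'mj, 'cj) two_cat"
 and W :: "('oj, 'mj, 'cj, ('x, 'y) cat, ('x, 'y) cat1, ('x, 'y) cat2) two_fun" +
 fixes w :: weakness and D
 assumes D: "is_ffunctor (chordate J) (Fun w S C) D"
begin

lemmas SC = S.fcat C.fcat

abbreviation "\<F> \<equiv> Fun w S C"

sublocale F: fcategory \<F> by (rule fcategory_Fun[OF SC])

sublocale FD: cone_data J W \<F> D
 by (rule cone_dataI[OF cat_weight_axioms F.fcat D])

definition "DX X = comp_ffunctor (chordate J) (ev w S C X) D"

lemma is_ffunctor_DX: "X \<in> Obj S ==> is_ffunctor (chordate J) C (DX X)"
 unfolding DX_def by (rule is_ffunctor_comp[OF _ F.fcat C.fcat D is_ffunctor_ev[OF SC]])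
  (rule fcategory_chordate[OF J.two_category_axioms])

lemma cone_data_DX: "X \<in> Obj S ==> cone_data J W C (DX X)"
 by (rule cone_dataI[OF cat_weight_axioms C.fcat is_ffunctor_DX])

lemma DX_simps:
 "j \<in> Obj J ==> fun0 (DX X) j = fun0 (fun0 D j) X"
 "u \<in> Mor J ==> fun1 (DX X) u = at_ob (amap (fun1 D u)) X"
 "a \<in> Cell J ==> fun2 (DX X) a = amap (fun2 D a) X"
 using FD.D_simps by (simp_all add: DX_def ev_def)

lemma D_facts:
 "u \<in> Mor J ==> adom (fun1 D u) = fun0 D (dom1 J u)" "u \<in> Mor J ==> acod (fun1 D u) = fun0 D (cod1 J u)"
 using FD.D_simps(3,4) by (simp_all only: Fun_simps)

lemma Dj: assumes "j \<in> Obj J" shows "ffunctor S C (fun0 D j)"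
 using FD.D_simps(1)[OF assms] by (intro ffunctorI SC) simp

lemma Du_facts:
 assumes "u \<in> Mor J" "X \<in> Obj S"
 shows "at_ob (amap (fun1 D u)) X \<in> Mor C" "dom1 C (at_ob (amap (fun1 D u)) X) = fun0 (fun0 D (dom1 J u)) X"
  "cod1 C (at_ob (amap (fun1 D u)) X) = fun0 (fun0 D (cod1 J u)) X"
 using Mor_Fun_simps(3-5)[OF SC FD.D_simps(2)[OF assms(1)] assms(2)] D_facts[OF assms(1)] by simp_all

lemma D\<alpha>_facts:
 assumes "\<alpha> \<in> Cell J"
 shows "adom (fun2 D \<alpha>) = fun1 D (dom2 J \<alpha>)" "acod (fun2 D \<alpha>) = fun1 D (cod2 J \<alpha>)"
  "X \<in> Obj S ==> amap (fun2 D \<alpha>) X \<in> Cell C"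
  "X \<in> Obj S ==> dom2 C (amap (fun2 D \<alpha>) X) = at_ob (amap (fun1 D (dom2 J \<alpha>))) X"
  "X \<in> Obj S ==> cod2 C (amap (fun2 D \<alpha>) X) = at_ob (amap (fun1 D (cod2 J \<alpha>))) X"
 using FD.D_simps(7,8)[OF assms] Cell_FunD(5-7)[OF FD.D_simps(6)[OF assms]] by simp_all

lemma Du_strict:
 assumes "u \<in> Mor J" "s \<in> Mor S"
 shows "cmp1 C (at_ob (amap (fun1 D u)) (cod1 S s)) (fun1 (fun0 D (dom1 J u)) s) = cmp1 C (fun1 (fun0 D (cod1 J u)) s) (at_ob (amap (fun1 D u)) (dom1 S s))"
 using Tight_Fun_strict(2)[OF SC FD.D_simps(5)[OF assms(1)] assms(2)] D_facts[OF assms(1)] by simp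

lemma Du_nat:
 assumes "u \<in> Mor J" "z \<in> Cell S"
 shows "whl C (at_ob (amap (fun1 D u)) (cod1 S (dom2 S z))) (fun2 (fun0 D (dom1 J u)) z) =
  whr C (fun2 (fun0 D (cod1 J u)) z) (at_ob (amap (fun1 D u)) (dom1 S (dom2 S z)))"
 using Tight_Fun_nat[OF SC FD.D_simps(5)[OF assms(1)] assms(2)] D_facts[OF assms(1)] by simp

lemma D\<alpha>_strict:
 assumes "\<alpha> \<in> Cell J" "s \<in> Mor S"
 shows "whr C (amap (fun2 D \<alpha>) (cod1 S s)) (fun1 (fun0 D (dom1 J (dom2 J \<alpha>))) s) =
   whl C (fun1 (fun0 D (cod1 J (dom2 J \<alpha>))) s) (amap (fun2 D \<alpha>) (dom1 S s))"
proof -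
 have d: "dom2 J \<alpha> \<in> Mor J" "cod2 J \<alpha> \<in> Mor J" using assms by simp_all
 show ?thesis
  using Cell_Fun_strict[OF SC FD.D_simps(6)[OF assms(1)] _ _ assms(2)] FD.D_simps(5)[OF d(1)] FD.D_simps(5)[OF d(2)]
   D\<alpha>_facts(1,2)[OF assms(1)] D_facts[OF d(1)] by simp
qed

lemma lcone_ev:
 assumes "lcone \<F> J W D Y c0 c1" "X \<in> Obj S"
 shows "lcone C J W (DX X) (fun0 Y X) (%j x. at_ob (amap (c0 j x)) X) (%j a. amap (c1 j a) X)"
proof -
 note p = FD.limcone_p[OF assms(1)]
 have "Y \<in> Obj \<F>" using assms by (simp add: lcone_def)
 have "lcone C J W (DX X) (fun0 (ev w S C X) Y) (%j x. fun1 (ev w S C X) (c0 j x)) (%j a. fun2 (ev w S C X) (c1 j a))"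
  unfolding DX_def
  by (rule lcone_image[OF F.fcat C.fcat is_ffunctor_ev[OF SC assms(2)] cat_weight_axioms D assms(1)])
 moreover have "fun0 (ev w S C X) Y = fun0 Y X" using \<open>Y \<in> Obj \<F>\<close> by (simp add: ev_def)
 ultimately have "lcone C J W (DX X) (fun0 Y X) (%j x. fun1 (ev w S C X) (c0 j x)) (%j a. fun2 (ev w S C X) (c1 j a))"
  by (simp only:)
 then show ?thesis
  by (rule lcone_cong[OF J.two_category_axioms W, THEN iffD1, rotated -1]) (simp_all add: ev_def p)
qed

lemma lmod_ev:
 assumes "lcone \<F> J W D Y c0 c1" "lcone \<F> J W D Y d0 d1" "lmod \<F> J W D c0 c1 d0 d1 m" "X \<in> Obj S"
 shows "lmod C J W (DX X) (%j x. at_ob (amap (c0 j x)) X) (%j a. amap (c1 j a) X)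
  (%j x. at_ob (amap (d0 j x)) X) (%j a. amap (d1 j a) X) (%j x. amap (m j x) X)"
proof -
 note p = FD.limcone_p[OF assms(1)] and q = FD.limcone_p[OF assms(2)]
 have m: "m j x \<in> Cell \<F>" if "j \<in> Obj J" "x \<in> Ob (fun0 W j)" for j x
  using assms(3) that unfolding lmod_def by blast
 let ?e = "ev w S C X"
 have "lmod C J W (DX X) (%j x. fun1 ?e (c0 j x)) (%j a. fun2 ?e (c1 j a)) (%j x. fun1 ?e (d0 j x)) (%j a. fun2 ?e (d1 j a)) (%j x. fun2 ?e (m j x))"
  unfolding DX_def
  by (rule lmod_image[OF F.fcat C.fcat is_ffunctor_ev[OF SC assms(4)] cat_weight_axioms D assms(1-3)])
 then show ?thesis
  by (rule lmod_cong[OF J.two_category_axioms W, THEN iffD1, rotated -1]) (simp_all add: ev_def p q m)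
qed

end

text \<open>The hypotheses of the pointwise criterion, whose conclusion is
  \<open>limcone_Fun\<close>. They are met by the limits built from \<open>Fun_limits\<close> and by
  any cone in a category of models that is pointwise a limit.\<close>

locale Fun_pointwise = Fun_cone +
 fixes P p0 p1
 assumes lP: "lcone \<F> J W D P p0 p1"
  and tP: "!!j x. [|j \<in> Obj J; x \<in> Ob (fun0 W j)|] ==> p0 j x \<in> Tight \<F>"
  and L: "!!X. X \<in> Obj S ==> limcone C J W (DX X) (fun0 P X) (%j x. at_ob (amap (p0 j x)) X) (%j a. amap (p1 j a) X)"
begin

abbreviation "q0 X j x \<equiv> at_ob (amap (p0 j x)) X"
abbreviation "q1 X j a \<equiv> amap (p1 j a) X"

lemma ffP: "is_ffunctor S C P" using lP by (simp add: lcone_def)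
sublocale P: ffunctor S C P by (rule ffunctorI[OF SC ffP])

lemma p_facts:
 assumes "j \<in> Obj J" "x \<in> Ob (fun0 W j)"
 shows "p0 j x \<in> Mor \<F>" "adom (p0 j x) = P" "acod (p0 j x) = fun0 D j"
 using FD.limcone_p(1-3)[OF lP assms] by simp_all

lemma q0_facts [simp]:
 assumes "j \<in> Obj J" "x \<in> Ob (fun0 W j)" "X \<in> Obj S"
 shows "q0 X j x \<in> Mor C" "dom1 C (q0 X j x) = fun0 P X" "cod1 C (q0 X j x) = fun0 (fun0 D j) X"
 using Mor_Fun_simps[OF SC p_facts(1)[OF assms(1,2)]] p_facts[OF assms(1,2)] assms(3) by simp_all

lemma q1_facts [simp]:
 assumes "j \<in> Obj J" "a \<in> Ar (fun0 W j)" "X \<in> Obj S"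
 shows "q1 X j a \<in> Cell C" "dom2 C (q1 X j a) = q0 X j (src (fun0 W j) a)" "cod2 C (q1 X j a) = q0 X j (trg (fun0 W j) a)"
 using FD.limcone_p(4-6)[OF lP assms(1,2)] Cell_FunD[of "p1 j a" w S C] assms(3) by simp_all

lemma strict:
 assumes "j \<in> Obj J" "x \<in> Ob (fun0 W j)" "s \<in> Mor S"
 shows "cmp1 C (q0 (cod1 S s) j x) (fun1 P s) = cmp1 C (fun1 (fun0 D j) s) (q0 (dom1 S s) j x)"
  "at_mor (amap (p0 j x)) s = id2 C (cmp1 C (fun1 (fun0 D j) s) (q0 (dom1 S s) j x))"
 using Tight_Fun_strict[OF SC tP[OF assms(1,2)] assms(3)] p_facts[OF assms(1,2)] by simp_all

lemma at_mor_proj: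
 assumes "j \<in> Obj J" "x \<in> Ob (fun0 W j)" "s \<in> Mor S" "f \<in> Mor \<F>" "acod f = P"
 shows "at_mor (amap (cmp1 \<F> (p0 j x) f)) s = whl C (q0 (cod1 S s) j x) (at_mor (amap f) s)"
 using at_mor_comp_Tight[OF SC tP[OF assms(1,2)] assms(4) _ assms(3)] p_facts[OF assms(1,2)] assms(5) by simp

lemma q1_strict:
 assumes j: "j \<in> Obj J" and a: "a \<in> Ar (fun0 W j)" and s: "s \<in> Mor S"
 shows "whr C (q1 (cod1 S s) j a) (fun1 P s) = whl C (fun1 (fun0 D j) s) (q1 (dom1 S s) j a)"
proof -
 have st: "src (fun0 W j) a \<in> Ob (fun0 W j)" "trg (fun0 W j) a \<in> Ob (fun0 W j)" using j a by auto
 have c: "p1 j a \<in> Cell \<F>" "adom (p1 j a) = p0 j (src (fun0 W j) a)" "acod (p1 j a) = p0 j (trg (fun0 W j) a)"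
  using FD.limcone_p(4-6)[OF lP j a] by simp_all
 show ?thesis using Cell_Fun_strict[OF SC c(1) _ _ s] tP[OF j st(1)] tP[OF j st(2)] p_facts[OF j st(1)] c by simp
qed

lemma q0_nat:
 assumes j: "j \<in> Obj J" and x: "x \<in> Ob (fun0 W j)" and s: "z \<in> Cell S"
 shows "whl C (q0 (cod1 S (dom2 S z)) j x) (fun2 P z) = whr C (fun2 (fun0 D j) z) (q0 (dom1 S (dom2 S z)) j x)"
 using Tight_Fun_nat[OF SC tP[OF j x] s] p_facts[OF j x] by simp

end

lemma slides_Colax: "w = Colax ==> slides w C \<phi> q \<nu> \<mu> \<longleftrightarrow> vcmp C \<nu> \<phi> = vcmp C q \<mu>"
 and slides_not_Colax: "w \<noteq> Colax ==> slides w C \<phi> q \<nu> \<mu> \<longleftrightarrow> vcmp C \<mu> \<phi> = vcmp C q \<nu>"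
 and vpaste_Colax: "w = Colax ==> vpaste w C b a = vcmp C a b"
 and vpaste_not_Colax: "w \<noteq> Colax ==> vpaste w C b a = vcmp C b a"
 by (simp_all add: slides_def vpaste_def)

lemma w_naturalI:
 assumes "at_ob \<phi> \<in> extensional (Obj S)" "at_mor \<phi> \<in> extensional (Mor S)"
  and "!!X. X \<in> Obj S ==> at_ob \<phi> X \<in> Mor C & dom1 C (at_ob \<phi> X) = fun0 M X & cod1 C (at_ob \<phi> X) = fun0 N X"
  and "!!s. s \<in> Mor S ==> at_mor \<phi> s \<in> Cell C"
  and "!!s. s \<in> Mor S ==> dom2 C (at_mor \<phi> s) = (if w = Colax then cmp1 C (at_ob \<phi> (cod1 S s)) (fun1 M s) else cmp1 C (fun1 N s) (at_ob \<phi> (dom1 S s)))"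
  and "!!s. s \<in> Mor S ==> cod2 C (at_mor \<phi> s) = (if w = Colax then cmp1 C (fun1 N s) (at_ob \<phi> (dom1 S s)) else cmp1 C (at_ob \<phi> (cod1 S s)) (fun1 M s))"
  and "!!s. s \<in> Mor S ==> wgood w C (at_mor \<phi> s)"
  and "!!z. z \<in> Cell S ==> slides w C (at_mor \<phi> (dom2 S z)) (at_mor \<phi> (cod2 S z))
   (whr C (fun2 N z) (at_ob \<phi> (dom1 S (dom2 S z))))
   (whl C (at_ob \<phi> (cod1 S (dom2 S z))) (fun2 M z))"
  and "!!X. X \<in> Obj S ==> at_mor \<phi> (id1 S X) = id2 C (at_ob \<phi> X)"
  and "!!s t. [|s \<in> Mor S; t \<in> Mor S; cod1 S s = dom1 S t|] ==>
   at_mor \<phi> (cmp1 S t s) = vpaste w C (whr C (at_mor \<phi> t) (fun1 M s)) (whl C (fun1 N t) (at_mor \<phi> s))"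
  and "!!s. s \<in> Tight S ==> identity_cell C (at_mor \<phi> s)"
 shows "w_natural w S C M N \<phi>"
proof -
 have wc: "w_cell w C (at_ob \<phi> (dom1 S s)) (fun1 M s) (fun1 N s) (at_ob \<phi> (cod1 S s)) (at_mor \<phi> s)" if "s \<in> Mor S" for s
  using assms(4-7)[OF that] by (cases w) (simp_all add: cell_between_def wgood_def)
 then show ?thesis
  unfolding w_natural_def by (intro conjI ballI impI) (simp_all only: assms wc)
qed

lemma modificationD:
 assumes "modification w S C M N \<phi> q m" "s \<in> Mor S"
 shows "slides w C (at_mor \<phi> s) (at_mor q s) (whl C (fun1 N s) (m (dom1 S s))) (whr C (m (cod1 S s)) (fun1 M s))"
 using assms by (simp add: modification_def)

section \<open>Existence of mediating 1-cells\<close>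

context Fun_pointwise
begin

lemma cone_facts:
 assumes lc: "lcone \<F> J W D Y c0 c1"
 shows "is_ffunctor S C Y"
  "!!j x. [|j \<in> Obj J; x \<in> Ob (fun0 W j)|] ==> w_nat S C Y (fun0 D j) w (amap (c0 j x))"
  "!!j a. [|j \<in> Obj J; a \<in> Ar (fun0 W j)|] ==>
    modification w S C Y (fun0 D j) (amap (c0 j (src (fun0 W j) a))) (amap (c0 j (trg (fun0 W j) a))) (amap (c1 j a))"
  "!!j a X. [|j \<in> Obj J; a \<in> Ar (fun0 W j); X \<in> Obj S|] ==> amap (c1 j a) X \<in> Cell C"
  "!!j a X. [|j \<in> Obj J; a \<in> Ar (fun0 W j); X \<in> Obj S|] ==> dom2 C (amap (c1 j a) X) = at_ob (amap (c0 j (src (fun0 W j) a))) X"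
  "!!j a X. [|j \<in> Obj J; a \<in> Ar (fun0 W j); X \<in> Obj S|] ==> cod2 C (amap (c1 j a) X) = at_ob (amap (c0 j (trg (fun0 W j) a))) X"
proof -
 note p = FD.limcone_p[OF lc, unfolded Fun_simps]
 show "is_ffunctor S C Y" using lc by (simp add: lcone_def)
 show n: "w_nat S C Y (fun0 D j) w (amap (c0 j x))" if "j \<in> Obj J" "x \<in> Ob (fun0 W j)" for j x
  using Mor_FunD[OF SC p(1)[OF that]] p(2,3)[OF that] by simp
 fix j a assume ja: "j \<in> Obj J" "a \<in> Ar (fun0 W j)"
 have s: "src (fun0 W j) a \<in> Ob (fun0 W j)" using ja by simp
 note c = p(4-6)[OF ja]
 show "modification w S C Y (fun0 D j) (amap (c0 j (src (fun0 W j) a))) (amap (c0 j (trg (fun0 W j) a))) (amap (c1 j a))"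
  using c(1) p(2,3)[OF ja(1) s] unfolding Cell_Fun c(2,3) by simp
 fix X assume X: "X \<in> Obj S"
 show "amap (c1 j a) X \<in> Cell C" "dom2 C (amap (c1 j a) X) = at_ob (amap (c0 j (src (fun0 W j) a))) X"
  "cod2 C (amap (c1 j a) X) = at_ob (amap (c0 j (trg (fun0 W j) a))) X"
  using Cell_FunD(5-7)[OF c(1) X] by (simp_all only: c(2,3))
qed

lemma proj_1cell:
 assumes "f \<in> Mor \<F>" "acod f = P" "j \<in> Obj J" "x \<in> Ob (fun0 W j)"
 shows "!!X. X \<in> Obj S ==> at_ob (amap (cmp1 \<F> (p0 j x) f)) X = cmp1 C (q0 X j x) (at_ob (amap f) X)"
 by (simp add: comp_transf_def)

lemma ex1:
 assumes lc: "lcone \<F> J W D Y c0 c1"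
 shows "\<exists>f\<in>Mor \<F>. dom1 \<F> f = Y & cod1 \<F> f = P &
    (\<forall>j\<in>Obj J. \<forall>x\<in>Ob (fun0 W j). cmp1 \<F> (p0 j x) f = c0 j x) &
    (\<forall>j\<in>Obj J. \<forall>a\<in>Ar (fun0 W j). whr \<F> (p1 j a) f = c1 j a)"
proof -
 note cf = cone_facts[OF lc] and cp = FD.limcone_p[OF lc, unfolded Fun_simps]
 interpret Y: ffunctor S C Y by (rule ffunctorI[OF SC cf(1)])
 let ?b0 = "%j x. at_ob (amap (c0 j x))" and ?b1 = "%j x. at_mor (amap (c0 j x))"
 have c0: "?b0 j x X \<in> Mor C" "dom1 C (?b0 j x X) = fun0 Y X" "cod1 C (?b0 j x X) = fun0 (fun0 D j) X"
  if "j \<in> Obj J" "x \<in> Ob (fun0 W j)" "X \<in> Obj S" for j x X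
 proof -
  interpret c: w_nat S C Y "fun0 D j" w "amap (c0 j x)" using that by (intro cf(2))
  show "?b0 j x X \<in> Mor C" "dom1 C (?b0 j x X) = fun0 Y X" "cod1 C (?b0 j x X) = fun0 (fun0 D j) X"
   using that by simp_all
 qed
 define R where "R X f \<longleftrightarrow> f \<in> Mor C & dom1 C f = fun0 Y X & cod1 C f = fun0 P X &
  (\<forall>j\<in>Obj J. \<forall>x\<in>Ob (fun0 W j). cmp1 C (q0 X j x) f = ?b0 j x X) &
  (\<forall>j\<in>Obj J. \<forall>a\<in>Ar (fun0 W j). whr C (q1 X j a) f = amap (c1 j a) X)" for X f
 have "\<exists>f. R X f" if X: "X \<in> Obj S" for X
  using limcone_ex1[OF L[OF X] lcone_ev[OF lc X]] unfolding R_def by metis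
 then have "\<exists>f. \<forall>X\<in>Obj S. R X (f X)" by (intro bchoice ballI)
 then obtain f where R: "!!X. X \<in> Obj S ==> R X (f X)" by blast
 have f: "f X \<in> Mor C" "dom1 C (f X) = fun0 Y X" "cod1 C (f X) = fun0 P X" if "X \<in> Obj S" for X
  using R[OF that] by (simp_all add: R_def)
 have qf: "cmp1 C (q0 X j x) (f X) = ?b0 j x X" if "j \<in> Obj J" "x \<in> Ob (fun0 W j)" "X \<in> Obj S" for j x X
  using R[OF that(3)] that by (simp add: R_def)
 have qf1: "whr C (q1 X j a) (f X) = amap (c1 j a) X" if "j \<in> Obj J" "a \<in> Ar (fun0 W j)" "X \<in> Obj S" for j a X
  using R[OF that(3)] that by (simp add: R_def)
 \<comment> \<open>\<open>A s\<close> and \<open>B s\<close> are the two 1-cells between which the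
   structure cell of the mediator at \<open>s\<close> must run. Their projections, computed in
   \<open>A0\<close> to \<open>B1\<close>, are the ends of the structure cells of the given
   cone.\<close>
 define A where "A s = cmp1 C (fun1 P s) (f (dom1 S s))" for s
 define B where "B s = cmp1 C (f (cod1 S s)) (fun1 Y s)" for s
 have AB: "A s \<in> Mor C" "dom1 C (A s) = fun0 Y (dom1 S s)" "cod1 C (A s) = fun0 P (cod1 S s)"
   "B s \<in> Mor C" "dom1 C (B s) = fun0 Y (dom1 S s)" "cod1 C (B s) = fun0 P (cod1 S s)" if "s \<in> Mor S" for s
  using that f by (simp_all add: A_def B_def)
 have A0: "cmp1 C (q0 (cod1 S s) j x) (A s) = cmp1 C (fun1 (fun0 D j) s) (?b0 j x (dom1 S s))"
  if "j \<in> Obj J" "x \<in> Ob (fun0 W j)" "s \<in> Mor S" for j x s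
 proof -
  interpret Dj: ffunctor S C "fun0 D j" by (rule Dj[OF that(1)])
  have "cmp1 C (q0 (cod1 S s) j x) (A s) = cmp1 C (cmp1 C (q0 (cod1 S s) j x) (fun1 P s)) (f (dom1 S s))"
   using that f by (simp add: A_def)
  also have "\<dots> = cmp1 C (fun1 (fun0 D j) s) (cmp1 C (q0 (dom1 S s) j x) (f (dom1 S s)))"
   unfolding strict(1)[OF that] using that f by simp
  finally show ?thesis using that by (simp add: qf)
 qed
 have A1: "whr C (q1 (cod1 S s) j a) (A s) = whl C (fun1 (fun0 D j) s) (amap (c1 j a) (dom1 S s))"
  if "j \<in> Obj J" "a \<in> Ar (fun0 W j)" "s \<in> Mor S" for j a s
 proof -
  interpret Dj: ffunctor S C "fun0 D j" by (rule Dj[OF that(1)])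
  have "whr C (q1 (cod1 S s) j a) (A s) = whr C (whr C (q1 (cod1 S s) j a) (fun1 P s)) (f (dom1 S s))"
   using that f by (simp add: A_def)
  also have "\<dots> = whl C (fun1 (fun0 D j) s) (whr C (q1 (dom1 S s) j a) (f (dom1 S s)))"
   unfolding q1_strict[OF that] using that f by simp
  finally show ?thesis using that by (simp add: qf1)
 qed
 have B0: "cmp1 C (q0 (cod1 S s) j x) (B s) = cmp1 C (?b0 j x (cod1 S s)) (fun1 Y s)"
  if "j \<in> Obj J" "x \<in> Ob (fun0 W j)" "s \<in> Mor S" for j x s
 proof -
  have "cmp1 C (q0 (cod1 S s) j x) (B s) = cmp1 C (cmp1 C (q0 (cod1 S s) j x) (f (cod1 S s))) (fun1 Y s)"
   using that f by (simp add: B_def)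
  then show ?thesis using that by (simp add: qf)
 qed
 have B1: "whr C (q1 (cod1 S s) j a) (B s) = whr C (amap (c1 j a) (cod1 S s)) (fun1 Y s)"
  if "j \<in> Obj J" "a \<in> Ar (fun0 W j)" "s \<in> Mor S" for j a s
 proof -
  have "whr C (q1 (cod1 S s) j a) (B s) = whr C (whr C (q1 (cod1 S s) j a) (f (cod1 S s))) (fun1 Y s)"
   using that f by (simp add: B_def)
  then show ?thesis using that by (simp add: qf1)
 qed
 \<comment> \<open>For colax transformations the cell runs the other way; from here on it goes from
   \<open>A'\<close> to \<open>B'\<close> for every weakness.\<close>
 define A' where "A' s = (if w = Colax then B s else A s)" for s
 define B' where "B' s = (if w = Colax then A s else B s)" for s
 have AB': "A' s \<in> Mor C" "dom1 C (A' s) = fun0 Y (dom1 S s)" "cod1 C (A' s) = fun0 P (cod1 S s)"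
   "B' s \<in> Mor C" "dom1 C (B' s) = fun0 Y (dom1 S s)" "cod1 C (B' s) = fun0 P (cod1 S s)" if "s \<in> Mor S" for s
  using AB[OF that] by (simp_all add: A'_def B'_def)
 have m: "?b1 j x s \<in> Cell C" "dom2 C (?b1 j x s) = cmp1 C (q0 (cod1 S s) j x) (A' s)" "cod2 C (?b1 j x s) = cmp1 C (q0 (cod1 S s) j x) (B' s)"
   if "j \<in> Obj J" "x \<in> Ob (fun0 W j)" "s \<in> Mor S" for j x s
 proof -
  interpret c: w_nat S C Y "fun0 D j" w "amap (c0 j x)" using that by (intro cf(2))
  show "?b1 j x s \<in> Cell C" using that by simp
  show "dom2 C (?b1 j x s) = cmp1 C (q0 (cod1 S s) j x) (A' s)" "cod2 C (?b1 j x s) = cmp1 C (q0 (cod1 S s) j x) (B' s)"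
   using c.dom2_at_mor[OF that(3)] c.cod2_at_mor[OF that(3)] c.dom2_at_mor'[OF that(3)] c.cod2_at_mor'[OF that(3)]
   by (simp_all add: A'_def B'_def A0[OF that] B0[OF that])
 qed
 \<comment> \<open>The structure cells of the given cone at \<open>s\<close> form a modification:
   compatibility with the arrows of the weight is the modification axiom of \<open>c1 j a\<close>,
   and compatibility with \<open>u\<close> holds because \<open>D u\<close> is tight and only
   whiskers.\<close>
 have lm: "lmod C J W (DX (cod1 S s)) (%j x. cmp1 C (q0 (cod1 S s) j x) (A' s)) (%j a. whr C (q1 (cod1 S s) j a) (A' s))
   (%j x. cmp1 C (q0 (cod1 S s) j x) (B' s)) (%j a. whr C (q1 (cod1 S s) j a) (B' s)) (%j x. ?b1 j x s)"
  if s: "s \<in> Mor S" for s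
  unfolding lmod_def
 proof (intro conjI ballI)
  fix j a assume ja: "j \<in> Obj J" "a \<in> Ar (fun0 W j)"
  show "vcmp C (whr C (q1 (cod1 S s) j a) (B' s)) (?b1 j (src (fun0 W j) a) s) =
   vcmp C (?b1 j (trg (fun0 W j) a) s) (whr C (q1 (cod1 S s) j a) (A' s))"
   using modificationD[OF cf(3)[OF ja] s]
   by (cases "w = Colax") (simp_all add: slides_def A'_def B'_def A1[OF ja s] B1[OF ja s])
 next
  fix u x assume u: "u \<in> Mor J" "x \<in> Ob (fun0 W (dom1 J u))"
  have j: "dom1 J u \<in> Obj J" using u by simp
  have "fun1 D u \<in> Tight \<F>" "c0 (dom1 J u) x \<in> Mor \<F>" "acod (c0 (dom1 J u) x) = adom (fun1 D u)"
   using FD.D_simps(5)[OF u(1)] cp(1-3)[OF j u(2)] D_facts[OF u(1)] by simp_all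
  note e = at_mor_comp_Tight[OF SC this s]
  have "c0 (cod1 J u) (on_ob (amap (fun1 W u)) x) = cmp1 \<F> (fun1 D u) (c0 (dom1 J u) x)"
   by (rule FD.lcone_eqs(3)[OF lc u])
  then show "whl C (fun1 (DX (cod1 S s)) u) (?b1 (dom1 J u) x s) = ?b1 (cod1 J u) (on_ob (amap (fun1 W u)) x) s"
   by (simp add: DX_simps(2)[OF u(1)] e)
 qed (use m s in simp_all)
 define Q where "Q s n \<longleftrightarrow> n \<in> Cell C & dom2 C n = A' s & cod2 C n = B' s &
   (\<forall>j\<in>Obj J. \<forall>x\<in>Ob (fun0 W j). whl C (q0 (cod1 S s) j x) n = ?b1 j x s)" for s n
 have "\<exists>n. Q s n" if s: "s \<in> Mor S" for s
 proof -
  have X: "cod1 S s \<in> Obj S" using s by simp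
  have d: "dom1 C (A' s) = dom1 C (B' s)" using AB'[OF s] by simp
  show ?thesis
   using limcone_ex2[OF L[OF X] AB'(1)[OF s] AB'(4)[OF s] d AB'(3)[OF s] AB'(6)[OF s] lm[OF s]] unfolding Q_def by metis
 qed
 then have "\<exists>fs. \<forall>s\<in>Mor S. Q s (fs s)" by (intro bchoice ballI)
 then obtain fs where Q: "!!s. s \<in> Mor S ==> Q s (fs s)" by blast
 have fs: "fs s \<in> Cell C" "dom2 C (fs s) = A' s" "cod2 C (fs s) = B' s" if "s \<in> Mor S" for s
  using Q[OF that] by (simp_all add: Q_def)
 have fs': "dom1 C (dom2 C (fs s)) = fun0 Y (dom1 S s)" "cod1 C (dom2 C (fs s)) = fun0 P (cod1 S s)" if "s \<in> Mor S" for s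
  using fs[OF that] AB'[OF that] by simp_all
 have qfs: "whl C (q0 (cod1 S s) j x) (fs s) = ?b1 j x s" if "j \<in> Obj J" "x \<in> Ob (fun0 W j)" "s \<in> Mor S" for j x s
  using Q[OF that(3)] that by (simp add: Q_def)
 define \<phi> where "\<phi> = \<lparr>at_ob = restrict f (Obj S), at_mor = restrict fs (Mor S)\<rparr>"
 have nat: "w_natural w S C Y P \<phi>"
 proof (rule w_naturalI)
  show "at_ob \<phi> \<in> extensional (Obj S)" "at_mor \<phi> \<in> extensional (Mor S)" by (simp_all add: \<phi>_def)
  show "at_ob \<phi> X \<in> Mor C & dom1 C (at_ob \<phi> X) = fun0 Y X & cod1 C (at_ob \<phi> X) = fun0 P X" if "X \<in> Obj S" for X
   using f[OF that] that by (simp add: \<phi>_def)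
 next
  fix s assume s: "s \<in> Mor S"
  then have X: "dom1 S s \<in> Obj S" "cod1 S s \<in> Obj S" by simp_all
  have p: "at_mor \<phi> s = fs s" "at_ob \<phi> (dom1 S s) = f (dom1 S s)" "at_ob \<phi> (cod1 S s) = f (cod1 S s)"
   using s X by (simp_all add: \<phi>_def)
  show "at_mor \<phi> s \<in> Cell C" unfolding p by (rule fs(1)[OF s])
  show "dom2 C (at_mor \<phi> s) = (if w = Colax then cmp1 C (at_ob \<phi> (cod1 S s)) (fun1 Y s) else cmp1 C (fun1 P s) (at_ob \<phi> (dom1 S s)))"
   "cod2 C (at_mor \<phi> s) = (if w = Colax then cmp1 C (fun1 P s) (at_ob \<phi> (dom1 S s)) else cmp1 C (at_ob \<phi> (cod1 S s)) (fun1 Y s))"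
   unfolding p fs(2,3)[OF s] A'_def B'_def A_def B_def by (rule refl)+
  interpret K: cone_data J W C "DX (cod1 S s)" by (rule cone_data_DX[OF X(2)])
  have g: "wgood w C (?b1 j x s)" if "j \<in> Obj J" "x \<in> Ob (fun0 W j)" for j x
   by (rule w_nat.at_mor_wgood[OF cf(2)[OF that] s])
  \<comment> \<open>The whiskered cells are structure cells of \<open>c0 j x\<close>, hence
    invertible or identities as \<open>w\<close> demands, and the legs reflect this.\<close>
  show "wgood w C (at_mor \<phi> s)" unfolding p wgood_def
  proof (intro conjI impI)
   assume "w = Pseudo"
   then show "invertible_cell C (fs s)"
    using g by (intro K.limcone_reflect_invertible[OF L[OF X(2)] fs(1)[OF s] fs'(2)[OF s]]) (simp add: qfs s wgood_def)
  next
   assume "w = Strict"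
   then show "identity_cell C (fs s)"
    using g by (intro K.limcone_reflect_identity[OF L[OF X(2)] fs(1)[OF s] fs'(2)[OF s]]) (simp add: qfs s wgood_def)
  qed
 next
  fix s assume s: "s \<in> Tight S"
  then have s': "s \<in> Mor S" by simp
  then have X: "dom1 S s \<in> Obj S" "cod1 S s \<in> Obj S" by simp_all
  interpret K: cone_data J W C "DX (cod1 S s)" by (rule cone_data_DX[OF X(2)])
  have "identity_cell C (?b1 j x s)" if "j \<in> Obj J" "x \<in> Ob (fun0 W j)" for j x
   by (rule w_nat.at_mor_Tight[OF cf(2)[OF that] s])
  then have "identity_cell C (fs s)"
   by (intro K.limcone_reflect_identity[OF L[OF X(2)] fs(1)[OF s'] fs'(2)[OF s']]) (simp add: qfs s')
  then show "identity_cell C (at_mor \<phi> s)" using s' by (simp add: \<phi>_def)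
 next
  fix X assume X: "X \<in> Obj S"
  have e: "A' (id1 S X) = f X" "B' (id1 S X) = f X"
   using X f[OF X] by (simp_all add: A'_def B'_def A_def B_def)
  have i: "id1 S X \<in> Mor S" using X by simp
  \<comment> \<open>This axiom, like the two that follow, equates 2-cells into a limit; whiskered
    with a leg it becomes the same axiom for \<open>c0 j x\<close>.\<close>
  have "fs (id1 S X) = id2 C (f X)"
  proof (rule limcone_eq2[OF L[OF X]])
   fix j x assume jx: "j \<in> Obj J" "x \<in> Ob (fun0 W j)"
   have "?b1 j x (id1 S X) = id2 C (?b0 j x X)" by (rule w_nat.at_mor_id1[OF cf(2)[OF jx] X])
   then show "whl C (q0 X j x) (fs (id1 S X)) = whl C (q0 X j x) (id2 C (f X))"
    using qfs[OF jx i] X f[OF X] jx qf[OF jx X] by simp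
  qed (use fs[OF i] f[OF X] e in simp_all)
  then show "at_mor \<phi> (id1 S X) = id2 C (at_ob \<phi> X)" using X by (simp add: \<phi>_def)
 next
  fix z assume z: "z \<in> Cell S"
  let ?s = "dom2 S z" and ?t = "cod2 S z"
  let ?X = "dom1 S ?s" and ?X' = "cod1 S ?s"
  have st: "?s \<in> Mor S" "?t \<in> Mor S" "dom1 S ?t = ?X" "cod1 S ?t = ?X'" and X: "?X \<in> Obj S" "?X' \<in> Obj S" using z by simp_all
  \<comment> \<open>A tight leg is strictly natural in \<open>z\<close>, so it moves past
    \<open>fun2 P z\<close> and meets \<open>f ?X\<close>, where its composite is known.\<close>
  have h1: "whl C (q0 ?X' j x) (whr C (fun2 P z) (f ?X)) = whr C (fun2 (fun0 D j) z) (?b0 j x ?X)"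
   if jx: "j \<in> Obj J" "x \<in> Ob (fun0 W j)" for j x
  proof -
   interpret Dj: ffunctor S C "fun0 D j" by (rule Dj[OF that(1)])
   have "whl C (q0 ?X' j x) (whr C (fun2 P z) (f ?X)) = whr C (whl C (q0 ?X' j x) (fun2 P z)) (f ?X)"
    using jx z f[OF X(1)] X by simp
   also have "\<dots> = whr C (fun2 (fun0 D j) z) (cmp1 C (q0 ?X j x) (f ?X))"
    unfolding q0_nat[OF jx z] using jx z f[OF X(1)] X by simp
   finally show ?thesis unfolding qf[OF jx X(1)] .
  qed
  have h2: "whl C (q0 ?X' j x) (whl C (f ?X') (fun2 Y z)) = whl C (?b0 j x ?X') (fun2 Y z)"
   if jx: "j \<in> Obj J" "x \<in> Ob (fun0 W j)" for j x
   using jx z f[OF X(2)] X qf[OF jx X(2)] by simp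
  have q: "whl C (q0 ?X' j x) (fs ?s) = ?b1 j x ?s" "whl C (q0 ?X' j x) (fs ?t) = ?b1 j x ?t"
   if jx: "j \<in> Obj J" "x \<in> Ob (fun0 W j)" for j x
   using qfs[OF jx st(1)] qfs[OF jx st(2)] by (simp_all only: st)
  have sl: "slides w C (?b1 j x ?s) (?b1 j x ?t) (whr C (fun2 (fun0 D j) z) (?b0 j x ?X)) (whl C (?b0 j x ?X') (fun2 Y z))"
   if jx: "j \<in> Obj J" "x \<in> Ob (fun0 W j)" for j x
   by (rule w_nat.at_mor_slides[OF cf(2)[OF jx] z])
  note ty = fs[OF st(1)] fs[OF st(2)] A'_def B'_def A_def B_def st X f[OF X(1)] f[OF X(2)] z
  have "slides w C (fs ?s) (fs ?t) (whr C (fun2 P z) (f ?X)) (whl C (f ?X') (fun2 Y z))"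
  proof (cases "w = Colax")
   case True
   have "vcmp C (whr C (fun2 P z) (f ?X)) (fs ?s) = vcmp C (fs ?t) (whl C (f ?X') (fun2 Y z))"
   proof (rule limcone_eq2[OF L[OF X(2)]])
    fix j x assume jx: "j \<in> Obj J" "x \<in> Ob (fun0 W j)"
    have "whl C (q0 ?X' j x) (vcmp C (whr C (fun2 P z) (f ?X)) (fs ?s)) =
      vcmp C (whl C (q0 ?X' j x) (whr C (fun2 P z) (f ?X))) (whl C (q0 ?X' j x) (fs ?s))"
     using jx by (intro C.hcmp_vcmp_left) (simp_all add: ty True)
    moreover have "whl C (q0 ?X' j x) (vcmp C (fs ?t) (whl C (f ?X') (fun2 Y z))) =
      vcmp C (whl C (q0 ?X' j x) (fs ?t)) (whl C (q0 ?X' j x) (whl C (f ?X') (fun2 Y z)))"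
     using jx by (intro C.hcmp_vcmp_left) (simp_all add: ty True)
    ultimately show "whl C (q0 ?X' j x) (vcmp C (whr C (fun2 P z) (f ?X)) (fs ?s)) =
      whl C (q0 ?X' j x) (vcmp C (fs ?t) (whl C (f ?X') (fun2 Y z)))"
     unfolding h1[OF jx] h2[OF jx] q[OF jx] using sl[OF jx] by (simp only: slides_Colax[OF True])
   qed (simp_all add: ty True)
   then show ?thesis by (simp only: slides_Colax[OF True])
  next
   case False
   have "vcmp C (whl C (f ?X') (fun2 Y z)) (fs ?s) = vcmp C (fs ?t) (whr C (fun2 P z) (f ?X))"
   proof (rule limcone_eq2[OF L[OF X(2)]])
    fix j x assume jx: "j \<in> Obj J" "x \<in> Ob (fun0 W j)"
    have "whl C (q0 ?X' j x) (vcmp C (whl C (f ?X') (fun2 Y z)) (fs ?s)) =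
      vcmp C (whl C (q0 ?X' j x) (whl C (f ?X') (fun2 Y z))) (whl C (q0 ?X' j x) (fs ?s))"
     using jx by (intro C.hcmp_vcmp_left) (simp_all add: ty False)
    moreover have "whl C (q0 ?X' j x) (vcmp C (fs ?t) (whr C (fun2 P z) (f ?X))) =
      vcmp C (whl C (q0 ?X' j x) (fs ?t)) (whl C (q0 ?X' j x) (whr C (fun2 P z) (f ?X)))"
     using jx by (intro C.hcmp_vcmp_left) (simp_all add: ty False)
    ultimately show "whl C (q0 ?X' j x) (vcmp C (whl C (f ?X') (fun2 Y z)) (fs ?s)) =
      whl C (q0 ?X' j x) (vcmp C (fs ?t) (whr C (fun2 P z) (f ?X)))"
     unfolding h1[OF jx] h2[OF jx] q[OF jx] using sl[OF jx] by (simp only: slides_not_Colax[OF False])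
   qed (simp_all add: ty False)
   then show ?thesis by (simp only: slides_not_Colax[OF False])
  qed
  then show "slides w C (at_mor \<phi> ?s) (at_mor \<phi> ?t) (whr C (fun2 P z) (at_ob \<phi> ?X)) (whl C (at_ob \<phi> ?X') (fun2 Y z))"
   using st X by (simp add: \<phi>_def)
 next
  fix s t assume st: "s \<in> Mor S" "t \<in> Mor S" "cod1 S s = dom1 S t"
  let ?X = "dom1 S s" and ?Y = "dom1 S t" and ?Z = "cod1 S t"
  have X: "?X \<in> Obj S" "?Y \<in> Obj S" "?Z \<in> Obj S" using st by simp_all
  have ts: "cmp1 S t s \<in> Mor S" "cod1 S (cmp1 S t s) = ?Z" "dom1 S (cmp1 S t s) = ?X" using st by simp_all
  have h1: "whl C (q0 ?Z j x) (whr C (fs t) (fun1 Y s)) = whr C (?b1 j x t) (fun1 Y s)"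
   if jx: "j \<in> Obj J" "x \<in> Ob (fun0 W j)" for j x
  proof -
   have "whl C (q0 ?Z j x) (whr C (fs t) (fun1 Y s)) = whr C (whl C (q0 ?Z j x) (fs t)) (fun1 Y s)"
    using jx st X fs(1)[OF st(2)] fs'[OF st(2)] by simp
   then show ?thesis unfolding qfs[OF jx st(2)] .
  qed
  have h2: "whl C (q0 ?Z j x) (whl C (fun1 P t) (fs s)) = whl C (fun1 (fun0 D j) t) (?b1 j x s)"
   if jx: "j \<in> Obj J" "x \<in> Ob (fun0 W j)" for j x
  proof -
   interpret Dj: ffunctor S C "fun0 D j" by (rule Dj[OF that(1)])
   have "whl C (q0 ?Z j x) (whl C (fun1 P t) (fs s)) = whl C (cmp1 C (fun1 (fun0 D j) t) (q0 ?Y j x)) (fs s)"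
    using jx st X fs(1)[OF st(1)] fs'[OF st(1)] strict(1)[OF jx st(2)] by simp
   also have "\<dots> = whl C (fun1 (fun0 D j) t) (whl C (q0 (cod1 S s) j x) (fs s))"
    using jx st X fs(1)[OF st(1)] fs'[OF st(1)] by simp
   finally show ?thesis unfolding qfs[OF jx st(1)] .
  qed
  have cc: "?b1 j x (cmp1 S t s) = vpaste w C (whr C (?b1 j x t) (fun1 Y s)) (whl C (fun1 (fun0 D j) t) (?b1 j x s))"
   if jx: "j \<in> Obj J" "x \<in> Ob (fun0 W j)" for j x
   by (rule w_nat.at_mor_cmp1[OF cf(2)[OF jx] st])
  have q: "whl C (q0 ?Z j x) (fs (cmp1 S t s)) = ?b1 j x (cmp1 S t s)"
   if jx: "j \<in> Obj J" "x \<in> Ob (fun0 W j)" for j x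
   using qfs[OF jx ts(1)] by (simp only: ts)
  note ty = fs[OF st(1)] fs[OF st(2)] fs[OF ts(1)] A'_def B'_def A_def B_def st X f[OF X(1)] f[OF X(2)] f[OF X(3)]
  have "fs (cmp1 S t s) = vpaste w C (whr C (fs t) (fun1 Y s)) (whl C (fun1 P t) (fs s))"
  proof (cases "w = Colax")
   case True
   have "fs (cmp1 S t s) = vcmp C (whl C (fun1 P t) (fs s)) (whr C (fs t) (fun1 Y s))"
   proof (rule limcone_eq2[OF L[OF X(3)]])
    fix j x assume jx: "j \<in> Obj J" "x \<in> Ob (fun0 W j)"
    have "whl C (q0 ?Z j x) (vcmp C (whl C (fun1 P t) (fs s)) (whr C (fs t) (fun1 Y s))) =
     vcmp C (whl C (q0 ?Z j x) (whl C (fun1 P t) (fs s))) (whl C (q0 ?Z j x) (whr C (fs t) (fun1 Y s)))"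
     using jx by (intro C.hcmp_vcmp_left) (simp_all add: ty True)
    then show "whl C (q0 ?Z j x) (fs (cmp1 S t s)) = whl C (q0 ?Z j x) (vcmp C (whl C (fun1 P t) (fs s)) (whr C (fs t) (fun1 Y s)))"
     unfolding h1[OF jx] h2[OF jx] q[OF jx] cc[OF jx] by (simp only: vpaste_Colax[OF True])
   qed (simp_all add: ty True)
   then show ?thesis by (simp only: vpaste_Colax[OF True])
  next
   case False
   have "fs (cmp1 S t s) = vcmp C (whr C (fs t) (fun1 Y s)) (whl C (fun1 P t) (fs s))"
   proof (rule limcone_eq2[OF L[OF X(3)]])
    fix j x assume jx: "j \<in> Obj J" "x \<in> Ob (fun0 W j)"
    have "whl C (q0 ?Z j x) (vcmp C (whr C (fs t) (fun1 Y s)) (whl C (fun1 P t) (fs s))) =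
     vcmp C (whl C (q0 ?Z j x) (whr C (fs t) (fun1 Y s))) (whl C (q0 ?Z j x) (whl C (fun1 P t) (fs s)))"
     using jx by (intro C.hcmp_vcmp_left) (simp_all add: ty False)
    then show "whl C (q0 ?Z j x) (fs (cmp1 S t s)) = whl C (q0 ?Z j x) (vcmp C (whr C (fs t) (fun1 Y s)) (whl C (fun1 P t) (fs s)))"
     unfolding h1[OF jx] h2[OF jx] q[OF jx] cc[OF jx] by (simp only: vpaste_not_Colax[OF False])
   qed (simp_all add: ty False)
   then show ?thesis by (simp only: vpaste_not_Colax[OF False])
  qed
  then show "at_mor \<phi> (cmp1 S t s) = vpaste w C (whr C (at_mor \<phi> t) (fun1 Y s)) (whl C (fun1 P t) (at_mor \<phi> s))"
   using st ts by (simp add: \<phi>_def)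
 qed
 define F where "F = Arr Y P \<phi>"
 have F: "F \<in> Mor \<F>" "adom F = Y" "acod F = P" using nat cf(1) ffP by (simp_all add: F_def Mor_Fun)
 have "cmp1 \<F> (p0 j x) F = c0 j x" if "j \<in> Obj J" "x \<in> Ob (fun0 W j)" for j x
 proof (rule Mor_Fun_eqI)
  show "cmp1 \<F> (p0 j x) F \<in> Mor \<F>" using p_facts[OF that] F by (intro F.cmp1_Mor) simp_all
  show "c0 j x \<in> Mor \<F>" by (rule cp(1)[OF that])
  show "adom (cmp1 \<F> (p0 j x) F) = adom (c0 j x)" "acod (cmp1 \<F> (p0 j x) F) = acod (c0 j x)"
   using cp(2,3)[OF that] p_facts[OF that] F by simp_all
  show "at_ob (amap (cmp1 \<F> (p0 j x) F)) X = ?b0 j x X" if X: "X \<in> Obj S" for X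
   unfolding proj_1cell[OF F(1,3) \<open>j \<in> Obj J\<close> \<open>x \<in> Ob (fun0 W j)\<close> X]
   using that qf[OF \<open>j \<in> Obj J\<close> \<open>x \<in> Ob (fun0 W j)\<close> X] by (simp add: F_def \<phi>_def)
  show "at_mor (amap (cmp1 \<F> (p0 j x) F)) s = ?b1 j x s" if s: "s \<in> Mor S" for s
   unfolding at_mor_proj[OF \<open>j \<in> Obj J\<close> \<open>x \<in> Ob (fun0 W j)\<close> s F(1,3)]
   using qfs[OF \<open>j \<in> Obj J\<close> \<open>x \<in> Ob (fun0 W j)\<close> s] s by (simp add: F_def \<phi>_def)
 qed
 note e0 = this
 have "whr \<F> (p1 j a) F = c1 j a" if ja: "j \<in> Obj J" "a \<in> Ar (fun0 W j)" for j a
 proof (rule Cell_Fun_eqI)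
  have st: "src (fun0 W j) a \<in> Ob (fun0 W j)" "trg (fun0 W j) a \<in> Ob (fun0 W j)" using ja by simp_all
  note pp = FD.limcone_p(4-6)[OF lP ja]
  have t: "p1 j a \<in> Cell \<F>" "id2 \<F> F \<in> Cell \<F>" "cod1 \<F> (dom2 \<F> (id2 \<F> F)) = dom1 \<F> (dom2 \<F> (p1 j a))"
   using pp F F.id2_Cell[OF F(1)] p_facts[OF ja(1) st(1)] by simp_all
  show h: "whr \<F> (p1 j a) F \<in> Cell \<F>" by (rule F.hcmp_Cell[OF t(2,1,3)])
  show "c1 j a \<in> Cell \<F>" by (rule cp(4)[OF ja])
  have "dom2 \<F> (whr \<F> (p1 j a) F) = cmp1 \<F> (p0 j (src (fun0 W j) a)) F"
   unfolding F.dom2_hcmp[OF t(2,1,3)] F.dom2_id2[OF F(1)] pp(2) ..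
  then show "adom (whr \<F> (p1 j a) F) = adom (c1 j a)"
   unfolding e0[OF ja(1) st(1)] cp(5)[OF ja] by (simp only: Fun_simps)
  have "cod2 \<F> (whr \<F> (p1 j a) F) = cmp1 \<F> (p0 j (trg (fun0 W j) a)) F"
   unfolding F.cod2_hcmp[OF t(2,1,3)] F.cod2_id2[OF F(1)] pp(3) ..
  then show "acod (whr \<F> (p1 j a) F) = acod (c1 j a)"
   unfolding e0[OF ja(1) st(2)] cp(6)[OF ja] by (simp only: Fun_simps)
  show "amap (whr \<F> (p1 j a) F) X = amap (c1 j a) X" if "X \<in> Obj S" for X
   using qf1[OF ja that] that by (simp add: F_def \<phi>_def)
 qed
 then show ?thesis using F e0 by (intro bexI[of _ F]) (simp_all only: Fun_simps simp_thms, blast)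
qed

end

section \<open>Uniqueness, mediating 2-cells and detection of tightness\<close>

context Fun_pointwise
begin

lemma at_mor_ends:
 assumes "F \<in> Mor \<F>" "s \<in> Mor S"
 shows "dom2 C (at_mor (amap F) s) = (if w = Colax then cmp1 C (at_ob (amap F) (cod1 S s)) (fun1 (adom F) s) else cmp1 C (fun1 (acod F) s) (at_ob (amap F) (dom1 S s)))"
  "cod2 C (at_mor (amap F) s) = (if w = Colax then cmp1 C (fun1 (acod F) s) (at_ob (amap F) (dom1 S s)) else cmp1 C (at_ob (amap F) (cod1 S s)) (fun1 (adom F) s))"
 using w_nat.dom2_at_mor[OF Mor_FunD[OF SC assms(1)] assms(2)] w_nat.dom2_at_mor'[OF Mor_FunD[OF SC assms(1)] assms(2)]
  w_nat.cod2_at_mor[OF Mor_FunD[OF SC assms(1)] assms(2)] w_nat.cod2_at_mor'[OF Mor_FunD[OF SC assms(1)] assms(2)]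
 by simp_all

lemma proj_2cell:
 assumes "j \<in> Obj J" "a \<in> Ar (fun0 W j)" "X \<in> Obj S"
 shows "amap (whr \<F> (p1 j a) F) X = whr C (q1 X j a) (at_ob (amap F) X)"
  "amap (whl \<F> (p0 j x) e) X = whl C (q0 X j x) (amap e X)"
 using assms by simp_all

text \<open>Components are cancelled by uniqueness for 1-cells at each object. With the ends thereby
  equal, structure cells are cancelled by uniqueness for 2-cells.\<close>

lemma eq1:
 assumes F: "F \<in> Mor \<F>" "G \<in> Mor \<F>" "adom F = adom G" "acod F = P" "acod G = P"
  and e0: "!!j x. [|j \<in> Obj J; x \<in> Ob (fun0 W j)|] ==> cmp1 \<F> (p0 j x) F = cmp1 \<F> (p0 j x) G"
  and e1: "!!j a. [|j \<in> Obj J; a \<in> Ar (fun0 W j)|] ==> whr \<F> (p1 j a) F = whr \<F> (p1 j a) G"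
 shows "F = G"
proof -
 note fF = Mor_Fun_simps[OF SC F(1)] and fG = Mor_Fun_simps[OF SC F(2)]
 have ob: "at_ob (amap F) X = at_ob (amap G) X" if X: "X \<in> Obj S" for X
 proof (rule limcone_eq1[OF L[OF X] fF(3)[OF X] fG(3)[OF X]])
  show "cmp1 C (q0 X j x) (at_ob (amap F) X) = cmp1 C (q0 X j x) (at_ob (amap G) X)" if "j \<in> Obj J" "x \<in> Ob (fun0 W j)" for j x
   using e0[OF that] proj_1cell[OF F(1,4) that X] proj_1cell[OF F(2,5) that X] by (simp only:)
  show "whr C (q1 X j a) (at_ob (amap F) X) = whr C (q1 X j a) (at_ob (amap G) X)" if "j \<in> Obj J" "a \<in> Ar (fun0 W j)" for j a
   using e1[OF that] proj_2cell(1)[OF that X, of F] proj_2cell(1)[OF that X, of G] by (simp only:)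
 qed (simp_all only: fF(4,5)[OF X] fG(4,5)[OF X] F(3-5))
 have mor: "at_mor (amap F) s = at_mor (amap G) s" if s: "s \<in> Mor S" for s
 proof -
  have X: "dom1 S s \<in> Obj S" "cod1 S s \<in> Obj S" using s by simp_all
  show ?thesis
  proof (rule limcone_eq2[OF L[OF X(2)] fF(6)[OF s] fG(6)[OF s]])
   show "whl C (q0 (cod1 S s) j x) (at_mor (amap F) s) = whl C (q0 (cod1 S s) j x) (at_mor (amap G) s)"
    if "j \<in> Obj J" "x \<in> Ob (fun0 W j)" for j x
    using e0[OF that] at_mor_proj[OF that s F(1,4)] at_mor_proj[OF that s F(2,5)] by (simp only:)
   show "cod1 C (dom2 C (at_mor (amap F) s)) = fun0 P (cod1 S s)" by (simp only: fF(8)[OF s] F)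
  qed (simp_all only: at_mor_ends[OF F(1) s] at_mor_ends[OF F(2) s] ob[OF X(1)] ob[OF X(2)] F)
 qed
 show ?thesis using F ob mor by (intro Mor_Fun_eqI[of F w S C G]) simp_all
qed

lemma eq2:
 assumes a: "m \<in> Cell \<F>" "b \<in> Cell \<F>" "adom m = adom b" "acod m = acod b" "acod (adom m) = P"
  and e: "!!j x. [|j \<in> Obj J; x \<in> Ob (fun0 W j)|] ==> whl \<F> (p0 j x) m = whl \<F> (p0 j x) b"
 shows "m = b"
proof (rule Cell_Fun_eqI[OF a(1-4)])
 fix X assume X: "X \<in> Obj S"
 note fa = Cell_FunD[OF a(1)] and fb = Cell_FunD[OF a(2)]
 have d: "cod1 C (at_ob (amap (adom m)) X) = fun0 P X"
  using Mor_Fun_simps(5)[OF SC fa(1) X] by (simp only: a(5))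
 show "amap m X = amap b X"
 proof (rule limcone_eq2[OF L[OF X] fa(5)[OF X] fb(5)[OF X]])
  show "whl C (q0 X j x) (amap m X) = whl C (q0 X j x) (amap b X)" if "j \<in> Obj J" "x \<in> Ob (fun0 W j)" for j x
   using arg_cong[OF e[OF that], of "%z. amap z X"] X by simp
  show "cod1 C (dom2 C (amap m X)) = fun0 P X" unfolding fa(6)[OF X] by (rule d)
 qed (simp_all only: fa(6,7)[OF X] fb(6,7)[OF X] a(3,4))
qed

text \<open>Tightness of the components is detected in \<open>C\<close>; that the structure cells
  are identities is reflected by the legs, which act on them by whiskering.\<close>

lemma detect:
 assumes F: "F \<in> Mor \<F>" "acod F = P"
  and t: "!!j x. [|j \<in> Obj J; x \<in> Ob (fun0 W j)|] ==> cmp1 \<F> (p0 j x) F \<in> Tight \<F>"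
 shows "F \<in> Tight \<F>"
proof -
 note fF = Mor_Fun_simps[OF SC F(1)]
 have "at_ob (amap F) X \<in> Tight C" if X: "X \<in> Obj S" for X
 proof (rule limcone_detect[OF L[OF X] fF(3)[OF X]])
  show "cmp1 C (q0 X j x) (at_ob (amap F) X) \<in> Tight C" if "j \<in> Obj J" "x \<in> Ob (fun0 W j)" for j x
   using t[OF that] X unfolding Tight_Fun proj_1cell[OF F that X, symmetric] by blast
 qed (simp only: fF(5)[OF X] F)
 moreover have "identity_cell C (at_mor (amap F) s)" if s: "s \<in> Mor S" for s
 proof -
  have X: "cod1 S s \<in> Obj S" using s by simp
  interpret K: cone_data J W C "DX (cod1 S s)" by (rule cone_data_DX[OF X])
  show ?thesis
  proof (rule K.limcone_reflect_identity[OF L[OF X] fF(6)[OF s]])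
   show "identity_cell C (whl C (q0 (cod1 S s) j x) (at_mor (amap F) s))" if "j \<in> Obj J" "x \<in> Ob (fun0 W j)" for j x
    using t[OF that] s unfolding Tight_Fun at_mor_proj[OF that s F, symmetric] by blast
  qed (simp only: fF(8)[OF s] F)
 qed
 ultimately show ?thesis using F by (simp add: Tight_Fun)
qed

text \<open>The component at \<open>X\<close> is the 2-cell mediating for the evaluation of
  \<open>m\<close> at \<open>X\<close>. The modification axiom at \<open>s\<close> equates two
  2-cells into a limit, so it may be checked after each leg, where it is the axiom of
  \<open>m j x\<close>.\<close>

lemma ex2:
 assumes F: "F \<in> Mor \<F>" "G \<in> Mor \<F>" "adom F = adom G" "acod F = P" "acod G = P"
  and m: "lmod \<F> J W D (%j x. cmp1 \<F> (p0 j x) F) (%j a. whr \<F> (p1 j a) F)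
     (%j x. cmp1 \<F> (p0 j x) G) (%j a. whr \<F> (p1 j a) G) m"
 shows "\<exists>e\<in>Cell \<F>. dom2 \<F> e = F & cod2 \<F> e = G &
     (\<forall>j\<in>Obj J. \<forall>x\<in>Ob (fun0 W j). whl \<F> (p0 j x) e = m j x)"
proof -
 note fF = Mor_Fun_simps[OF SC F(1)] and fG = Mor_Fun_simps[OF SC F(2)]
 let ?Y = "adom F"
 interpret Y: ffunctor S C ?Y by (rule ffunctorI[OF SC fF(1)])
 have cF: "lcone \<F> J W D ?Y (%j x. cmp1 \<F> (p0 j x) F) (%j a. whr \<F> (p1 j a) F)"
  using lcone_pre[OF F.fcat J.two_category_axioms W D lP F(1)] F(4) by (simp only: Fun_simps)
 have cG: "lcone \<F> J W D ?Y (%j x. cmp1 \<F> (p0 j x) G) (%j a. whr \<F> (p1 j a) G)"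
  using lcone_pre[OF F.fcat J.two_category_axioms W D lP F(2)] F(3,5) by (simp only: Fun_simps)
 have mc: "m j x \<in> Cell \<F>" "adom (m j x) = cmp1 \<F> (p0 j x) F" "acod (m j x) = cmp1 \<F> (p0 j x) G" if "j \<in> Obj J" "x \<in> Ob (fun0 W j)" for j x
  using m that unfolding lmod_def Fun_simps(3,4) by blast+
 define Q where "Q X e \<longleftrightarrow> e \<in> Cell C & dom2 C e = at_ob (amap F) X & cod2 C e = at_ob (amap G) X &
   (\<forall>j\<in>Obj J. \<forall>x\<in>Ob (fun0 W j). whl C (q0 X j x) e = amap (m j x) X)" for X e
 have "\<exists>e. Q X e" if X: "X \<in> Obj S" for X
 proof -
  have lm: "lmod C J W (DX X) (%j x. cmp1 C (q0 X j x) (at_ob (amap F) X)) (%j a. whr C (q1 X j a) (at_ob (amap F) X))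
    (%j x. cmp1 C (q0 X j x) (at_ob (amap G) X)) (%j a. whr C (q1 X j a) (at_ob (amap G) X)) (%j x. amap (m j x) X)"
   by (rule lmod_cong[OF J.two_category_axioms W, THEN iffD1, OF _ _ _ _ _ lmod_ev[OF cF cG m X]])
    (simp_all only: proj_1cell[OF F(1,4) _ _ X] proj_1cell[OF F(2,5) _ _ X] proj_2cell(1)[OF _ _ X])
  have d: "dom1 C (at_ob (amap F) X) = dom1 C (at_ob (amap G) X)" "cod1 C (at_ob (amap F) X) = fun0 P X" "cod1 C (at_ob (amap G) X) = fun0 P X"
   by (simp_all only: fF(4,5)[OF X] fG(4,5)[OF X] F)
  show ?thesis
  proof (rule limcone_ex2[OF L[OF X] fF(3)[OF X] fG(3)[OF X] d lm])
   fix b assume "b \<in> Cell C" "dom2 C b = at_ob (amap F) X" "cod2 C b = at_ob (amap G) X"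
    "!!j x. [|j \<in> Obj J; x \<in> Ob (fun0 W j)|] ==> whl C (q0 X j x) b = amap (m j x) X"
   then have "Q X b" by (simp add: Q_def)
   then show ?thesis by (rule exI)
  qed
 qed
 then have "\<exists>e. \<forall>X\<in>Obj S. Q X (e X)" by (intro bchoice ballI)
 then obtain e where Q: "!!X. X \<in> Obj S ==> Q X (e X)" by blast
 have a: "e X \<in> Cell C" "dom2 C (e X) = at_ob (amap F) X" "cod2 C (e X) = at_ob (amap G) X" if "X \<in> Obj S" for X
  using Q[OF that] by (simp_all add: Q_def)
 have qa: "whl C (q0 X j x) (e X) = amap (m j x) X" if "j \<in> Obj J" "x \<in> Ob (fun0 W j)" "X \<in> Obj S" for j x X
  using Q[OF that(3)] that by (simp add: Q_def)
 have FG: "adom G = ?Y" "acod F = P" "acod G = P" using F by simp_all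
 have sl: "slides w C (at_mor (amap F) s) (at_mor (amap G) s) (whl C (fun1 P s) (e (dom1 S s))) (whr C (e (cod1 S s)) (fun1 ?Y s))"
  if s: "s \<in> Mor S" for s
 proof -
  let ?X = "dom1 S s" and ?X' = "cod1 S s"
  have X: "?X \<in> Obj S" "?X' \<in> Obj S" using s by simp_all
  have h1: "whl C (q0 ?X' j x) (whl C (fun1 P s) (e ?X)) = whl C (fun1 (fun0 D j) s) (amap (m j x) ?X)"
   if jx: "j \<in> Obj J" "x \<in> Ob (fun0 W j)" for j x
  proof -
   interpret Dj: ffunctor S C "fun0 D j" by (rule Dj[OF that(1)])
   have "whl C (q0 ?X' j x) (whl C (fun1 P s) (e ?X)) = whl C (cmp1 C (fun1 (fun0 D j) s) (q0 ?X j x)) (e ?X)"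
    using jx s X a[OF X(1)] fF(5)[OF X(1)] F(4) strict(1)[OF jx s] by simp
   also have "\<dots> = whl C (fun1 (fun0 D j) s) (whl C (q0 ?X j x) (e ?X))"
    using jx s X a[OF X(1)] fF(5)[OF X(1)] F(4) by simp
   finally show ?thesis unfolding qa[OF jx X(1)] .
  qed
  have h2: "whl C (q0 ?X' j x) (whr C (e ?X') (fun1 ?Y s)) = whr C (amap (m j x) ?X') (fun1 ?Y s)"
   if jx: "j \<in> Obj J" "x \<in> Ob (fun0 W j)" for j x
  proof -
   have "whl C (q0 ?X' j x) (whr C (e ?X') (fun1 ?Y s)) = whr C (whl C (q0 ?X' j x) (e ?X')) (fun1 ?Y s)"
    using jx s X a[OF X(2)] fF(4,5)[OF X(2)] F(4) by simp
   then show ?thesis unfolding qa[OF jx X(2)] .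
  qed
  \<comment> \<open>The modification \<open>m j x\<close> runs between composites with a tight leg,
    so by \<open>at_mor_proj\<close> its axiom already concerns whiskered structure cells.\<close>
  have sm: "slides w C (whl C (q0 ?X' j x) (at_mor (amap F) s)) (whl C (q0 ?X' j x) (at_mor (amap G) s))
    (whl C (fun1 (fun0 D j) s) (amap (m j x) ?X)) (whr C (amap (m j x) ?X') (fun1 ?Y s))"
   if jx: "j \<in> Obj J" "x \<in> Ob (fun0 W j)" for j x
  proof -
   have "modification w S C ?Y (fun0 D j) (amap (cmp1 \<F> (p0 j x) F)) (amap (cmp1 \<F> (p0 j x) G)) (amap (m j x))"
    using mc[OF jx] p_facts[OF jx] F by (simp add: Cell_Fun)
   from modificationD[OF this s] show ?thesis
    unfolding at_mor_proj[OF jx s F(1,4)] at_mor_proj[OF jx s F(2,5)] .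
  qed
  note ty = fF(6)[OF s] fG(6)[OF s] at_mor_ends[OF F(1) s] at_mor_ends[OF F(2) s] FG a[OF X(1)] a[OF X(2)] X s
    fF(3-5)[OF X(1)] fF(3-5)[OF X(2)] fG(3-5)[OF X(1)] fG(3-5)[OF X(2)]
  show ?thesis
  proof (cases "w = Colax")
   case True
   have "vcmp C (whl C (fun1 P s) (e ?X)) (at_mor (amap F) s) = vcmp C (at_mor (amap G) s) (whr C (e ?X') (fun1 ?Y s))"
   proof (rule limcone_eq2[OF L[OF X(2)]])
    fix j x assume jx: "j \<in> Obj J" "x \<in> Ob (fun0 W j)"
    have "whl C (q0 ?X' j x) (vcmp C (whl C (fun1 P s) (e ?X)) (at_mor (amap F) s)) =
     vcmp C (whl C (q0 ?X' j x) (whl C (fun1 P s) (e ?X))) (whl C (q0 ?X' j x) (at_mor (amap F) s))"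
     using jx by (intro C.hcmp_vcmp_left) (simp_all add: ty True)
    moreover have "whl C (q0 ?X' j x) (vcmp C (at_mor (amap G) s) (whr C (e ?X') (fun1 ?Y s))) =
     vcmp C (whl C (q0 ?X' j x) (at_mor (amap G) s)) (whl C (q0 ?X' j x) (whr C (e ?X') (fun1 ?Y s)))"
     using jx by (intro C.hcmp_vcmp_left) (simp_all add: ty True)
    ultimately show "whl C (q0 ?X' j x) (vcmp C (whl C (fun1 P s) (e ?X)) (at_mor (amap F) s)) =
      whl C (q0 ?X' j x) (vcmp C (at_mor (amap G) s) (whr C (e ?X') (fun1 ?Y s)))"
     unfolding h1[OF jx] h2[OF jx] using sm[OF jx] by (simp only: slides_Colax[OF True])
   qed (simp_all add: ty True)
   then show ?thesis by (simp only: slides_Colax[OF True])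
  next
   case False
   have "vcmp C (whr C (e ?X') (fun1 ?Y s)) (at_mor (amap F) s) = vcmp C (at_mor (amap G) s) (whl C (fun1 P s) (e ?X))"
   proof (rule limcone_eq2[OF L[OF X(2)]])
    fix j x assume jx: "j \<in> Obj J" "x \<in> Ob (fun0 W j)"
    have "whl C (q0 ?X' j x) (vcmp C (whr C (e ?X') (fun1 ?Y s)) (at_mor (amap F) s)) =
     vcmp C (whl C (q0 ?X' j x) (whr C (e ?X') (fun1 ?Y s))) (whl C (q0 ?X' j x) (at_mor (amap F) s))"
     using jx by (intro C.hcmp_vcmp_left) (simp_all add: ty False)
    moreover have "whl C (q0 ?X' j x) (vcmp C (at_mor (amap G) s) (whl C (fun1 P s) (e ?X))) =
     vcmp C (whl C (q0 ?X' j x) (at_mor (amap G) s)) (whl C (q0 ?X' j x) (whl C (fun1 P s) (e ?X)))"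
     using jx by (intro C.hcmp_vcmp_left) (simp_all add: ty False)
    ultimately show "whl C (q0 ?X' j x) (vcmp C (whr C (e ?X') (fun1 ?Y s)) (at_mor (amap F) s)) =
      whl C (q0 ?X' j x) (vcmp C (at_mor (amap G) s) (whl C (fun1 P s) (e ?X)))"
     unfolding h1[OF jx] h2[OF jx] using sm[OF jx] by (simp only: slides_not_Colax[OF False])
   qed (simp_all add: ty False)
   then show ?thesis by (simp only: slides_not_Colax[OF False])
  qed
 qed
 define A where "A = Arr F G (restrict e (Obj S))"
 have A: "A \<in> Cell \<F>" "adom A = F" "acod A = G"
  using F sl a by (simp_all add: A_def Cell_Fun modification_def cell_between_def)
 have "whl \<F> (p0 j x) A = m j x" if jx: "j \<in> Obj J" "x \<in> Ob (fun0 W j)" for j x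
 proof (rule Cell_Fun_eqI)
  have t: "A \<in> Cell \<F>" "id2 \<F> (p0 j x) \<in> Cell \<F>" "cod1 \<F> (dom2 \<F> A) = dom1 \<F> (dom2 \<F> (id2 \<F> (p0 j x)))"
   using A F p_facts[OF jx] F.id2_Cell[OF p_facts(1)[OF jx]] by simp_all
  show "whl \<F> (p0 j x) A \<in> Cell \<F>" by (rule F.hcmp_Cell[OF t])
  show "m j x \<in> Cell \<F>" by (rule mc(1)[OF jx])
  have "dom2 \<F> (whl \<F> (p0 j x) A) = cmp1 \<F> (p0 j x) F"
   unfolding F.dom2_hcmp[OF t] F.dom2_id2[OF p_facts(1)[OF jx]] using A by (simp only: Fun_simps)
  then show "adom (whl \<F> (p0 j x) A) = adom (m j x)" unfolding mc(2)[OF jx] Fun_simps(3) .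
  have "cod2 \<F> (whl \<F> (p0 j x) A) = cmp1 \<F> (p0 j x) G"
   unfolding F.cod2_hcmp[OF t] F.cod2_id2[OF p_facts(1)[OF jx]] using A by (simp only: Fun_simps)
  then show "acod (whl \<F> (p0 j x) A) = acod (m j x)" unfolding mc(3)[OF jx] Fun_simps(4) .
  show "amap (whl \<F> (p0 j x) A) X = amap (m j x) X" if "X \<in> Obj S" for X
   using qa[OF jx that] that by (simp add: A_def)
 qed
 then show ?thesis using A by (intro bexI[of _ A]) (simp_all only: Fun_simps simp_thms, blast)
qed

theorem limcone_Fun: "limcone \<F> J W D P p0 p1"
 by (rule limconeI[OF lP tP ex1 eq1 ex2 eq2 detect]) (simp_all only: Fun_simps)

end

section \<open>Existence of pointwise limits\<close>

text \<open>A strict 2-natural transformation of diagrams whose components may be loose: they will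
  be the 1-cells \<open>fun1 (fun0 D j) s\<close> for arbitrary \<open>s\<close>, and later legs of
  evaluated cones.\<close>

locale diagram_map = A: cone_data J W C D + B: cone_data J W C D'
 for J :: "('oj, 'mj, 'cj) two_cat"
 and W :: "('oj, 'mj, 'cj, ('x, 'y) cat, ('x, 'y) cat1, ('x, 'y) cat2) two_fun"
 and C :: "('o, 'm, 'c) fcat" and D D' :: "('oj, 'mj, 'cj, 'o, 'm, 'c) two_fun" +
 fixes t :: "'oj => 'm"
 assumes t [simp]: "j \<in> Obj J ==> t j \<in> Mor C" "j \<in> Obj J ==> dom1 C (t j) = fun0 D j" "j \<in> Obj J ==> cod1 C (t j) = fun0 D' j"
  and t1: "u \<in> Mor J ==> cmp1 C (t (cod1 J u)) (fun1 D u) = cmp1 C (fun1 D' u) (t (dom1 J u))"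
  and t2: "\<alpha> \<in> Cell J ==> whl C (t (cod1 J (dom2 J \<alpha>))) (fun2 D \<alpha>) = whr C (fun2 D' \<alpha>) (t (dom1 J (dom2 J \<alpha>)))"
begin

lemma lcone_post:
 assumes l: "lcone C J W D Y c0 c1"
 shows "lcone C J W D' Y (%j x. cmp1 C (t j) (c0 j x)) (%j a. whl C (t j) (c1 j a))"
proof -
 note c [simp] = A.limcone_p[OF l]
 have 1: "cmp1 C (fun1 D' u) (cmp1 C (t (dom1 J u)) (c0 (dom1 J u) x)) = cmp1 C (t (cod1 J u)) (c0 (cod1 J u) (on_ob (amap (fun1 W u)) x))"
  if u: "u \<in> Mor J" "x \<in> Ob (fun0 W (dom1 J u))" for u x
 proof -
  have "cmp1 C (fun1 D' u) (cmp1 C (t (dom1 J u)) (c0 (dom1 J u) x)) = cmp1 C (cmp1 C (fun1 D' u) (t (dom1 J u))) (c0 (dom1 J u) x)"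
   using u by simp
  also have "\<dots> = cmp1 C (t (cod1 J u)) (cmp1 C (fun1 D u) (c0 (dom1 J u) x))"
   unfolding t1[OF u(1), symmetric] using u by simp
  finally show ?thesis unfolding A.lcone_eqs(3)[OF l u] .
 qed
 have 2: "whl C (fun1 D' u) (whl C (t (dom1 J u)) (c1 (dom1 J u) a)) = whl C (t (cod1 J u)) (c1 (cod1 J u) (on_ar (amap (fun1 W u)) a))"
  if u: "u \<in> Mor J" "a \<in> Ar (fun0 W (dom1 J u))" for u a
 proof -
  have "whl C (fun1 D' u) (whl C (t (dom1 J u)) (c1 (dom1 J u) a)) = whl C (cmp1 C (fun1 D' u) (t (dom1 J u))) (c1 (dom1 J u) a)"
   using u by simp
  also have "\<dots> = whl C (t (cod1 J u)) (whl C (fun1 D u) (c1 (dom1 J u) a))"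
   unfolding t1[OF u(1), symmetric] using u by simp
  finally show ?thesis unfolding A.lcone_eqs(4)[OF l u] .
 qed
 have 3: "whr C (fun2 D' e) (cmp1 C (t (dom1 J (dom2 J e))) (c0 (dom1 J (dom2 J e)) x)) = whl C (t (cod1 J (dom2 J e))) (c1 (cod1 J (dom2 J e)) (amap (fun2 W e) x))"
  if a: "e \<in> Cell J" "x \<in> Ob (fun0 W (dom1 J (dom2 J e)))" for e x
 proof -
  have j: "dom1 J (dom2 J e) \<in> Obj J" "cod1 J (dom2 J e) \<in> Obj J" using a by simp_all
  have "whr C (fun2 D' e) (cmp1 C (t (dom1 J (dom2 J e))) (c0 (dom1 J (dom2 J e)) x)) =
    whr C (whr C (fun2 D' e) (t (dom1 J (dom2 J e)))) (c0 (dom1 J (dom2 J e)) x)"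
   using a j by simp
  also have "\<dots> = whl C (t (cod1 J (dom2 J e))) (whr C (fun2 D e) (c0 (dom1 J (dom2 J e)) x))"
   unfolding t2[OF a(1), symmetric] using a j by simp
  finally show ?thesis unfolding A.lcone_eqs(5)[OF l a] .
 qed
 have "Y \<in> Obj C" using l by (simp add: lcone_def)
 then show ?thesis unfolding lcone_def by (intro conjI ballI impI) (simp_all only: 1 2 3, simp_all add: A.lcone_eqs(1,2)[OF l])
qed

lemma lmod_post:
 assumes l: "lcone C J W D Y c0 c1" and l': "lcone C J W D Y d0 d1" and m: "lmod C J W D c0 c1 d0 d1 m"
 shows "lmod C J W D' (%j x. cmp1 C (t j) (c0 j x)) (%j a. whl C (t j) (c1 j a))
  (%j x. cmp1 C (t j) (d0 j x)) (%j a. whl C (t j) (d1 j a)) (%j x. whl C (t j) (m j x))"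
proof -
 note c [simp] = A.limcone_p[OF l] A.limcone_p[OF l']
 have mm [simp]: "m j x \<in> Cell C" "dom2 C (m j x) = c0 j x" "cod2 C (m j x) = d0 j x" if "j \<in> Obj J" "x \<in> Ob (fun0 W j)" for j x
  using m that by (simp_all add: lmod_def)
 have e: "vcmp C (d1 j a) (m j (src (fun0 W j) a)) = vcmp C (m j (trg (fun0 W j) a)) (c1 j a)" if "j \<in> Obj J" "a \<in> Ar (fun0 W j)" for j a
  using m that by (simp add: lmod_def)
 have e1: "vcmp C (whl C (t j) (d1 j a)) (whl C (t j) (m j (src (fun0 W j) a))) = vcmp C (whl C (t j) (m j (trg (fun0 W j) a))) (whl C (t j) (c1 j a))"
  if "j \<in> Obj J" "a \<in> Ar (fun0 W j)" for j a
  using arg_cong[OF e[OF that], of "whl C (t j)"] that by simp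
 have e2: "whl C (fun1 D' u) (whl C (t (dom1 J u)) (m (dom1 J u) x)) = whl C (t (cod1 J u)) (m (cod1 J u) (on_ob (amap (fun1 W u)) x))"
  if u: "u \<in> Mor J" "x \<in> Ob (fun0 W (dom1 J u))" for u x
 proof -
  have "whl C (fun1 D' u) (whl C (t (dom1 J u)) (m (dom1 J u) x)) = whl C (cmp1 C (fun1 D' u) (t (dom1 J u))) (m (dom1 J u) x)"
   using u by simp
  also have "\<dots> = whl C (t (cod1 J u)) (whl C (fun1 D u) (m (dom1 J u) x))"
   unfolding t1[OF u(1), symmetric] using u by simp
  also have "whl C (fun1 D u) (m (dom1 J u) x) = m (cod1 J u) (on_ob (amap (fun1 W u)) x)"
   using m u by (simp add: lmod_def)
  finally show ?thesis .
 qed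
 show ?thesis unfolding lmod_def by (intro conjI ballI) (simp_all only: e1 e2, simp_all)
qed

end

text \<open>A modification between two such transformations. Whiskered with a cone it yields the
  data for a mediating 2-cell.\<close>

locale diagram_cell = P: diagram_map J W C D D' t + Q: diagram_map J W C D D' t'
 for J :: "('oj, 'mj, 'cj) two_cat"
 and W :: "('oj, 'mj, 'cj, ('x, 'y) cat, ('x, 'y) cat1, ('x, 'y) cat2) two_fun"
 and C :: "('o, 'm, 'c) fcat" and D D' :: "('oj, 'mj, 'cj, 'o, 'm, 'c) two_fun" and t t' +
 fixes \<tau> :: "'oj => 'c"
 assumes \<tau> [simp]: "j \<in> Obj J ==> \<tau> j \<in> Cell C" "j \<in> Obj J ==> dom2 C (\<tau> j) = t j" "j \<in> Obj J ==> cod2 C (\<tau> j) = t' j"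
  and \<tau>1: "u \<in> Mor J ==> whr C (\<tau> (cod1 J u)) (fun1 D u) = whl C (fun1 D' u) (\<tau> (dom1 J u))"
begin

lemma lmod_cell:
 assumes l: "lcone C J W D Y c0 c1"
 shows "lmod C J W D' (%j x. cmp1 C (t j) (c0 j x)) (%j a. whl C (t j) (c1 j a))
  (%j x. cmp1 C (t' j) (c0 j x)) (%j a. whl C (t' j) (c1 j a)) (%j x. whr C (\<tau> j) (c0 j x))"
proof -
 note c [simp] = P.A.limcone_p[OF l]
 have e1: "vcmp C (whl C (t' j) (c1 j a)) (whr C (\<tau> j) (c0 j (src (fun0 W j) a))) =
   vcmp C (whr C (\<tau> j) (c0 j (trg (fun0 W j) a))) (whl C (t j) (c1 j a))"
  if "j \<in> Obj J" "a \<in> Ar (fun0 W j)" for j a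
  using that by (intro P.A.C.exchange[symmetric]) simp_all
 have e2: "whl C (fun1 D' u) (whr C (\<tau> (dom1 J u)) (c0 (dom1 J u) x)) = whr C (\<tau> (cod1 J u)) (c0 (cod1 J u) (on_ob (amap (fun1 W u)) x))"
  if u: "u \<in> Mor J" "x \<in> Ob (fun0 W (dom1 J u))" for u x
 proof -
  have "whl C (fun1 D' u) (whr C (\<tau> (dom1 J u)) (c0 (dom1 J u) x)) = whr C (whl C (fun1 D' u) (\<tau> (dom1 J u))) (c0 (dom1 J u) x)"
   using u by simp
  also have "\<dots> = whr C (\<tau> (cod1 J u)) (cmp1 C (fun1 D u) (c0 (dom1 J u) x))"
   unfolding \<tau>1[OF u(1), symmetric] using u by simp
  finally show ?thesis unfolding P.A.lcone_eqs(3)[OF l u] .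
 qed
 show ?thesis unfolding lmod_def by (intro conjI ballI) (simp_all only: e1 e2, simp_all)
qed

end

section \<open>The functor formed by chosen pointwise limits\<close>

locale Fun_limits = Fun_cone +
 fixes P0 r0 r1
 assumes L0: "!!X. X \<in> Obj S ==> limcone C J W (DX X) (P0 X) (r0 X) (r1 X)"
begin

lemma r_facts [simp]:
 assumes "X \<in> Obj S"
 shows "!!j x. [|j \<in> Obj J; x \<in> Ob (fun0 W j)|] ==> r0 X j x \<in> Mor C"
  "!!j x. [|j \<in> Obj J; x \<in> Ob (fun0 W j)|] ==> dom1 C (r0 X j x) = P0 X"
  "!!j x. [|j \<in> Obj J; x \<in> Ob (fun0 W j)|] ==> cod1 C (r0 X j x) = fun0 (fun0 D j) X"
  "!!j a. [|j \<in> Obj J; a \<in> Ar (fun0 W j)|] ==> r1 X j a \<in> Cell C"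
  "!!j a. [|j \<in> Obj J; a \<in> Ar (fun0 W j)|] ==> dom2 C (r1 X j a) = r0 X j (src (fun0 W j) a)"
  "!!j a. [|j \<in> Obj J; a \<in> Ar (fun0 W j)|] ==> cod2 C (r1 X j a) = r0 X j (trg (fun0 W j) a)"
  "P0 X \<in> Obj C"
 using cone_data.limcone_p[OF cone_data_DX[OF assms] limcone_lcone[OF L0[OF assms]]] L0[OF assms]
 by (simp_all add: DX_simps limcone_def lcone_def)

text \<open>The chordate shape enters here: every \<open>D u\<close> is a tight 1-cell of
  \<open>\<F>\<close>, so it commutes strictly with the values at \<open>s\<close>, and the diagrams
  at the two ends of \<open>s\<close> are related by a strict transformation.\<close>

lemma diagram_map_s:
 assumes s: "s \<in> Mor S"
 shows "diagram_map J W C (DX (dom1 S s)) (DX (cod1 S s)) (%j. fun1 (fun0 D j) s)"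
proof -
 have X: "dom1 S s \<in> Obj S" "cod1 S s \<in> Obj S" using s by simp_all
 interpret A: cone_data J W C "DX (dom1 S s)" by (rule cone_data_DX[OF X(1)])
 interpret B: cone_data J W C "DX (cod1 S s)" by (rule cone_data_DX[OF X(2)])
 show ?thesis
 proof (unfold_locales, goal_cases)
  case (1 j) then interpret Dj: ffunctor S C "fun0 D j" by (rule Dj)
  show ?case using s by simp
 next
  case (2 j) then interpret Dj: ffunctor S C "fun0 D j" by (rule Dj)
  show ?case using 2 s by (simp add: DX_simps)
 next
  case (3 j) then interpret Dj: ffunctor S C "fun0 D j" by (rule Dj)
  show ?case using 3 s by (simp add: DX_simps)
 next
  case (4 u) then show ?case using Du_strict[OF _ s] by (simp add: DX_simps)
 next
  case (5 \<alpha>) then show ?case using D\<alpha>_strict[OF _ s] by (simp add: DX_simps)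
 qed
qed

lemma diagram_cell_s:
 assumes s: "z \<in> Cell S"
 shows "diagram_cell J W C (DX (dom1 S (dom2 S z))) (DX (cod1 S (dom2 S z))) (%j. fun1 (fun0 D j) (dom2 S z)) (%j. fun1 (fun0 D j) (cod2 S z)) (%j. fun2 (fun0 D j) z)"
proof -
 have d: "dom2 S z \<in> Mor S" "cod2 S z \<in> Mor S" "dom1 S (cod2 S z) = dom1 S (dom2 S z)" "cod1 S (cod2 S z) = cod1 S (dom2 S z)" using s by simp_all
 interpret P: diagram_map J W C "DX (dom1 S (dom2 S z))" "DX (cod1 S (dom2 S z))" "%j. fun1 (fun0 D j) (dom2 S z)"
  by (rule diagram_map_s[OF d(1)])
 interpret Q: diagram_map J W C "DX (dom1 S (dom2 S z))" "DX (cod1 S (dom2 S z))" "%j. fun1 (fun0 D j) (cod2 S z)"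
  using diagram_map_s[OF d(2)] by (simp only: d)
 show ?thesis
 proof (unfold_locales, goal_cases)
  case (1 j) then interpret Dj: ffunctor S C "fun0 D j" by (rule Dj)
  show ?case using s by simp
 next
  case (2 j) then interpret Dj: ffunctor S C "fun0 D j" by (rule Dj)
  show ?case using s by simp
 next
  case (3 j) then interpret Dj: ffunctor S C "fun0 D j" by (rule Dj)
  show ?case using s by simp
 next
  case (4 u) then show ?case using Du_nat[OF _ s] by (simp add: DX_simps)
 qed
qed

text \<open>The 1-cell that \<open>s\<close> induces between the chosen limits. Any choice is the
  same one, since a 1-cell into a limit is determined by its projections.\<close>

definition "P1 s = (SOME f. f \<in> Mor C & dom1 C f = P0 (dom1 S s) & cod1 C f = P0 (cod1 S s) &
 (\<forall>j\<in>Obj J. \<forall>x\<in>Ob (fun0 W j). cmp1 C (r0 (cod1 S s) j x) f = cmp1 C (fun1 (fun0 D j) s) (r0 (dom1 S s) j x)) &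
 (\<forall>j\<in>Obj J. \<forall>a\<in>Ar (fun0 W j). whr C (r1 (cod1 S s) j a) f = whl C (fun1 (fun0 D j) s) (r1 (dom1 S s) j a)))"

lemma P1:
 assumes s: "s \<in> Mor S"
 shows "P1 s \<in> Mor C" "dom1 C (P1 s) = P0 (dom1 S s)" "cod1 C (P1 s) = P0 (cod1 S s)"
  "!!j x. [|j \<in> Obj J; x \<in> Ob (fun0 W j)|] ==> cmp1 C (r0 (cod1 S s) j x) (P1 s) = cmp1 C (fun1 (fun0 D j) s) (r0 (dom1 S s) j x)"
  "!!j a. [|j \<in> Obj J; a \<in> Ar (fun0 W j)|] ==> whr C (r1 (cod1 S s) j a) (P1 s) = whl C (fun1 (fun0 D j) s) (r1 (dom1 S s) j a)"
proof -
 have X: "dom1 S s \<in> Obj S" "cod1 S s \<in> Obj S" using s by simp_all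
 interpret dm: diagram_map J W C "DX (dom1 S s)" "DX (cod1 S s)" "%j. fun1 (fun0 D j) s" by (rule diagram_map_s[OF s])
 have "\<exists>f. f \<in> Mor C & dom1 C f = P0 (dom1 S s) & cod1 C f = P0 (cod1 S s) &
 (\<forall>j\<in>Obj J. \<forall>x\<in>Ob (fun0 W j). cmp1 C (r0 (cod1 S s) j x) f = cmp1 C (fun1 (fun0 D j) s) (r0 (dom1 S s) j x)) &
 (\<forall>j\<in>Obj J. \<forall>a\<in>Ar (fun0 W j). whr C (r1 (cod1 S s) j a) f = whl C (fun1 (fun0 D j) s) (r1 (dom1 S s) j a))"
  by (rule limcone_ex1[OF L0[OF X(2)] dm.lcone_post[OF limcone_lcone[OF L0[OF X(1)]]]]) blast
 from someI_ex[OF this, folded P1_def] show "P1 s \<in> Mor C" "dom1 C (P1 s) = P0 (dom1 S s)" "cod1 C (P1 s) = P0 (cod1 S s)"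
  "!!j x. [|j \<in> Obj J; x \<in> Ob (fun0 W j)|] ==> cmp1 C (r0 (cod1 S s) j x) (P1 s) = cmp1 C (fun1 (fun0 D j) s) (r0 (dom1 S s) j x)"
  "!!j a. [|j \<in> Obj J; a \<in> Ar (fun0 W j)|] ==> whr C (r1 (cod1 S s) j a) (P1 s) = whl C (fun1 (fun0 D j) s) (r1 (dom1 S s) j a)"
  by blast+
qed

text \<open>Both sides have the same projections. The statement stands alone because the ends of
  \<open>P2\<close> on a horizontal composite depend on it.\<close>

lemma P1_cmp1:
 assumes st: "s \<in> Mor S" "t \<in> Mor S" "cod1 S s = dom1 S t"
 shows "P1 (cmp1 S t s) = cmp1 C (P1 t) (P1 s)"
proof -
  let ?X = "dom1 S s" and ?Y = "dom1 S t" and ?Z = "cod1 S t"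
  have c: "cmp1 S t s \<in> Mor S" "dom1 S (cmp1 S t s) = ?X" "cod1 S (cmp1 S t s) = ?Z" using st by simp_all
  have X: "?X \<in> Obj S" "?Y \<in> Obj S" "?Z \<in> Obj S" using st by simp_all
  note p = P1[OF c(1), unfolded c(2,3)] and q = P1[OF st(1), unfolded st(3)] and r = P1[OF st(2)]
  show "P1 (cmp1 S t s) = cmp1 C (P1 t) (P1 s)"
  proof (rule limcone_eq1[OF L0[OF X(3)] p(1)])
   fix j x assume jx: "j \<in> Obj J" "x \<in> Ob (fun0 W j)"
   interpret Dj: ffunctor S C "fun0 D j" by (rule Dj[OF jx(1)])
   have "cmp1 C (r0 ?Z j x) (cmp1 C (P1 t) (P1 s)) = cmp1 C (cmp1 C (r0 ?Z j x) (P1 t)) (P1 s)"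
    using jx X q(1-3) r(1-3) by simp
   also have "\<dots> = cmp1 C (fun1 (fun0 D j) t) (cmp1 C (r0 ?Y j x) (P1 s))"
    unfolding r(4)[OF jx] using jx X q(1-3) r(1-3) st by simp
   also have "\<dots> = cmp1 C (fun1 (fun0 D j) (cmp1 S t s)) (r0 ?X j x)"
    unfolding q(4)[OF jx] using jx X st by simp
   finally show "cmp1 C (r0 ?Z j x) (P1 (cmp1 S t s)) = cmp1 C (r0 ?Z j x) (cmp1 C (P1 t) (P1 s))"
    unfolding p(4)[OF jx] ..
  next
   fix j a assume ja: "j \<in> Obj J" "a \<in> Ar (fun0 W j)"
   interpret Dj: ffunctor S C "fun0 D j" by (rule Dj[OF ja(1)])
   have "whr C (r1 ?Z j a) (cmp1 C (P1 t) (P1 s)) = whr C (whr C (r1 ?Z j a) (P1 t)) (P1 s)"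
    using ja X q(1-3) r(1-3) by simp
   also have "\<dots> = whl C (fun1 (fun0 D j) t) (whr C (r1 ?Y j a) (P1 s))"
    unfolding r(5)[OF ja] using ja X q(1-3) r(1-3) st by simp
   also have "\<dots> = whl C (fun1 (fun0 D j) (cmp1 S t s)) (r1 ?X j a)"
    unfolding q(5)[OF ja] using ja X st by simp
   finally show "whr C (r1 ?Z j a) (P1 (cmp1 S t s)) = whr C (r1 ?Z j a) (cmp1 C (P1 t) (P1 s))"
    unfolding p(5)[OF ja] ..
  qed (use p(2,3) q(1-3) r(1-3) in simp_all)
qed

definition "P2 \<sigma> = (SOME f. f \<in> Cell C & dom2 C f = P1 (dom2 S \<sigma>) & cod2 C f = P1 (cod2 S \<sigma>) &
 (\<forall>j\<in>Obj J. \<forall>x\<in>Ob (fun0 W j). whl C (r0 (cod1 S (dom2 S \<sigma>)) j x) f = whr C (fun2 (fun0 D j) \<sigma>) (r0 (dom1 S (dom2 S \<sigma>)) j x)))"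

lemma P2:
 assumes s: "z \<in> Cell S"
 shows "P2 z \<in> Cell C" "dom2 C (P2 z) = P1 (dom2 S z)" "cod2 C (P2 z) = P1 (cod2 S z)"
  "!!j x. [|j \<in> Obj J; x \<in> Ob (fun0 W j)|] ==> whl C (r0 (cod1 S (dom2 S z)) j x) (P2 z) = whr C (fun2 (fun0 D j) z) (r0 (dom1 S (dom2 S z)) j x)"
proof -
 let ?X = "dom1 S (dom2 S z)" and ?X' = "cod1 S (dom2 S z)"
 have d: "dom2 S z \<in> Mor S" "cod2 S z \<in> Mor S" "dom1 S (cod2 S z) = dom1 S (dom2 S z)" "cod1 S (cod2 S z) = cod1 S (dom2 S z)" using s by simp_all
 have X: "?X \<in> Obj S" "?X' \<in> Obj S" using s by simp_all
 interpret dm: diagram_cell J W C "DX ?X" "DX ?X'" "%j. fun1 (fun0 D j) (dom2 S z)" "%j. fun1 (fun0 D j) (cod2 S z)" "%j. fun2 (fun0 D j) z"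
   by (rule diagram_cell_s[OF s])
 note p = P1[OF d(1)] and q = P1[OF d(2), unfolded d(3,4)]
 have "lmod C J W (DX ?X') (%j x. cmp1 C (r0 ?X' j x) (P1 (dom2 S z))) (%j a. whr C (r1 ?X' j a) (P1 (dom2 S z)))
  (%j x. cmp1 C (r0 ?X' j x) (P1 (cod2 S z))) (%j a. whr C (r1 ?X' j a) (P1 (cod2 S z))) (%j x. whr C (fun2 (fun0 D j) z) (r0 ?X j x))"
  by (rule lmod_cong[OF J.two_category_axioms W, THEN iffD1, OF _ _ _ _ _ dm.lmod_cell[OF limcone_lcone[OF L0[OF X(1)]]]])
   (simp_all only: p(4,5) q(4,5))
 note lm = this
 have dd: "dom1 C (P1 (dom2 S z)) = dom1 C (P1 (cod2 S z))" by (simp only: p q)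
 have "\<exists>f. f \<in> Cell C & dom2 C f = P1 (dom2 S z) & cod2 C f = P1 (cod2 S z) &
  (\<forall>j\<in>Obj J. \<forall>x\<in>Ob (fun0 W j). whl C (r0 (cod1 S (dom2 S z)) j x) f = whr C (fun2 (fun0 D j) z) (r0 (dom1 S (dom2 S z)) j x))"
  by (rule limcone_ex2[OF L0[OF X(2)] p(1) q(1) dd p(3) q(3) lm]) blast
 from someI_ex[OF this, folded P2_def] show "P2 z \<in> Cell C" "dom2 C (P2 z) = P1 (dom2 S z)" "cod2 C (P2 z) = P1 (cod2 S z)"
  "!!j x. [|j \<in> Obj J; x \<in> Ob (fun0 W j)|] ==> whl C (r0 (cod1 S (dom2 S z)) j x) (P2 z) = whr C (fun2 (fun0 D j) z) (r0 (dom1 S (dom2 S z)) j x)"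
  by blast+
qed

definition "P = \<lparr>fun0 = restrict P0 (Obj S), fun1 = restrict P1 (Mor S), fun2 = restrict P2 (Cell S)\<rparr>"

text \<open>Each axiom compares two cells into a chosen limit with equal projections. For tight
  \<open>s\<close> the projections of \<open>P1 s\<close> are composites of tight 1-cells, so
  \<open>P1 s\<close> is tight by detection.\<close>

lemma P_ffunctor: "is_ffunctor S C P"
proof -
 have "is_two_functor S C P"
 proof (rule is_two_functorI, goal_cases)
  case 3 then show ?case by (simp add: P_def)
 next
  case 4 then show ?case by (simp add: P_def P1)
 next
  case 5 then show ?case by (simp add: P_def P2)
 next
  case (6 s) then show ?case by (simp add: P_def P1)
 next
  case (7 z) then show ?case by (simp add: P_def P2)
 next
  case (8 X)
  then have i: "id1 S X \<in> Mor S" "dom1 S (id1 S X) = X" "cod1 S (id1 S X) = X" by simp_all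
  note p = P1[OF i(1), unfolded i(2,3)]
  have "P1 (id1 S X) = id1 C (P0 X)"
  proof (rule limcone_eq1[OF L0[OF 8] p(1)])
   fix j x assume jx: "j \<in> Obj J" "x \<in> Ob (fun0 W j)"
   interpret Dj: ffunctor S C "fun0 D j" by (rule Dj[OF jx(1)])
   show "cmp1 C (r0 X j x) (P1 (id1 S X)) = cmp1 C (r0 X j x) (id1 C (P0 X))"
    unfolding p(4)[OF jx] using jx 8 by simp
  next
   fix j a assume ja: "j \<in> Obj J" "a \<in> Ar (fun0 W j)"
   interpret Dj: ffunctor S C "fun0 D j" by (rule Dj[OF ja(1)])
   show "whr C (r1 X j a) (P1 (id1 S X)) = whr C (r1 X j a) (id1 C (P0 X))"
    unfolding p(5)[OF ja] using ja 8 by simp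
  qed (use 8 p in simp_all)
  then show ?case using 8 by (simp add: P_def)
 next
  case (9 s)
  then have i: "id2 S s \<in> Cell S" "dom2 S (id2 S s) = s" "cod2 S (id2 S s) = s" by simp_all
  note p = P2[OF i(1), unfolded i(2,3)] and q = P1[OF 9]
  have X: "cod1 S s \<in> Obj S" "dom1 S s \<in> Obj S" using 9 by simp_all
  have "P2 (id2 S s) = id2 C (P1 s)"
  proof (rule limcone_eq2[OF L0[OF X(1)] p(1)])
   fix j x assume jx: "j \<in> Obj J" "x \<in> Ob (fun0 W j)"
   interpret Dj: ffunctor S C "fun0 D j" by (rule Dj[OF jx(1)])
   show "whl C (r0 (cod1 S s) j x) (P2 (id2 S s)) = whl C (r0 (cod1 S s) j x) (id2 C (P1 s))"
    unfolding p(4)[OF jx] using jx 9 X q(1-3) q(4)[OF jx] by simp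
  qed (use p q in simp_all)
  then show ?case using 9 by (simp add: P_def)
 next
  case (10 s t)
  have "P1 (cmp1 S t s) = cmp1 C (P1 t) (P1 s)" by (rule P1_cmp1[OF 10])
  then show ?case using 10 by (simp add: P_def)
 next
  case (11 z \<tau>)
  let ?X = "dom1 S (dom2 S z)" and ?Z = "cod1 S (dom2 S z)"
  have c: "vcmp S \<tau> z \<in> Cell S" "dom2 S (vcmp S \<tau> z) = dom2 S z" "cod2 S (vcmp S \<tau> z) = cod2 S \<tau>" using 11 by simp_all
  have e: "dom1 S (dom2 S \<tau>) = ?X" "cod1 S (dom2 S \<tau>) = ?Z"
   using S.dom1_cod2_simp[OF 11(1)] S.cod1_cod2_simp[OF 11(1)] by (simp_all only: 11(3))
  have d: "dom2 S z \<in> Mor S" "dom2 S \<tau> \<in> Mor S" using 11 by simp_all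
  have X: "?X \<in> Obj S" "?Z \<in> Obj S" using d by simp_all
  note p = P2[OF c(1), unfolded c(2,3)] and q = P2[OF 11(1), unfolded 11(3)] and r = P2[OF 11(2), unfolded e]
  note ty = P1(1-3)[OF d(1)] P1(1-3)[OF d(2), unfolded e]
  have "P2 (vcmp S \<tau> z) = vcmp C (P2 \<tau>) (P2 z)"
  proof (rule limcone_eq2[OF L0[OF X(2)] p(1)])
   fix j x assume jx: "j \<in> Obj J" "x \<in> Ob (fun0 W j)"
   interpret Dj: ffunctor S C "fun0 D j" by (rule Dj[OF jx(1)])
   have "whl C (r0 ?Z j x) (vcmp C (P2 \<tau>) (P2 z)) = vcmp C (whl C (r0 ?Z j x) (P2 \<tau>)) (whl C (r0 ?Z j x) (P2 z))"
    using jx X q(1-3) r(1-3) ty by (intro C.hcmp_vcmp_left) simp_all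
   also have "\<dots> = whr C (fun2 (fun0 D j) (vcmp S \<tau> z)) (r0 ?X j x)"
    unfolding q(4)[OF jx] r(4)[OF jx] using jx X 11 e by simp
   finally show "whl C (r0 ?Z j x) (P2 (vcmp S \<tau> z)) = whl C (r0 ?Z j x) (vcmp C (P2 \<tau>) (P2 z))"
    unfolding p(4)[OF jx] ..
  qed (use p(2,3) q(1-3) r(1-3) ty in simp_all)
  then show ?case using 11 c by (simp add: P_def)
 next
  case (12 z \<tau>)
  let ?X = "dom1 S (dom2 S z)" and ?Y = "dom1 S (dom2 S \<tau>)" and ?Z = "cod1 S (dom2 S \<tau>)"
  have c: "hcmp S \<tau> z \<in> Cell S" "dom2 S (hcmp S \<tau> z) = cmp1 S (dom2 S \<tau>) (dom2 S z)" "cod2 S (hcmp S \<tau> z) = cmp1 S (cod2 S \<tau>) (cod2 S z)"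
    using 12 by simp_all
  have d: "dom2 S z \<in> Mor S" "dom2 S \<tau> \<in> Mor S" "cod2 S z \<in> Mor S" "cod2 S \<tau> \<in> Mor S"
   "cod1 S (cod2 S z) = dom1 S (cod2 S \<tau>)" "dom1 S (cod2 S z) = ?X" "dom1 S (cod2 S \<tau>) = ?Y" "cod1 S (cod2 S \<tau>) = ?Z" using 12 by simp_all
  have ee: "dom1 S (cmp1 S (dom2 S \<tau>) (dom2 S z)) = ?X" "cod1 S (cmp1 S (dom2 S \<tau>) (dom2 S z)) = ?Z" using 12 by simp_all
  have X: "?X \<in> Obj S" "?Y \<in> Obj S" "?Z \<in> Obj S" using d by simp_all
  note p = P2[OF c(1), unfolded c(2,3) ee] and q = P2[OF 12(1), unfolded 12(3)] and r = P2[OF 12(2)]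
  note ty = P1(1-3)[OF d(1), unfolded 12(3)] P1(1-3)[OF d(2)] P1(1-3)[OF d(3), unfolded d(5-8)] P1(1-3)[OF d(4), unfolded d(7,8)]
  have "P2 (hcmp S \<tau> z) = hcmp C (P2 \<tau>) (P2 z)"
  proof (rule limcone_eq2[OF L0[OF X(3)] p(1)])
   fix j x assume jx: "j \<in> Obj J" "x \<in> Ob (fun0 W j)"
   interpret Dj: ffunctor S C "fun0 D j" by (rule Dj[OF jx(1)])
   have "whl C (r0 ?Z j x) (hcmp C (P2 \<tau>) (P2 z)) = hcmp C (whl C (r0 ?Z j x) (P2 \<tau>)) (P2 z)"
    using jx X q(1-3) r(1-3) ty by simp
   also have "\<dots> = hcmp C (fun2 (fun0 D j) \<tau>) (whl C (r0 ?Y j x) (P2 z))"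
    unfolding r(4)[OF jx] using jx X q(1-3) r(1-3) ty 12 by simp
   also have "\<dots> = whr C (fun2 (fun0 D j) (hcmp S \<tau> z)) (r0 ?X j x)"
    unfolding q(4)[OF jx] using jx X 12 by simp
   finally show "whl C (r0 ?Z j x) (P2 (hcmp S \<tau> z)) = whl C (r0 ?Z j x) (hcmp C (P2 \<tau>) (P2 z))"
    unfolding p(4)[OF jx] ..
  qed (use p(2,3) q(1-3) r(1-3) ty P1_cmp1[OF d(1,2) 12(3)] P1_cmp1[OF d(3,4,5)] in simp_all)
  then show ?case using 12 c by (simp add: P_def)
 qed (rule S.two_category_axioms C.two_category_axioms)+
 moreover have "fun1 P s \<in> Tight C" if s: "s \<in> Tight S" for s
 proof -
  have s': "s \<in> Mor S" using s by simp
  then have X: "dom1 S s \<in> Obj S" "cod1 S s \<in> Obj S" by simp_all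
  note p = P1[OF s']
  have "P1 s \<in> Tight C"
  proof (rule limcone_detect[OF L0[OF X(2)] p(1,3)])
   fix j x assume jx: "j \<in> Obj J" "x \<in> Ob (fun0 W j)"
   interpret Dj: ffunctor S C "fun0 D j" by (rule Dj[OF jx(1)])
   show "cmp1 C (r0 (cod1 S s) j x) (P1 s) \<in> Tight C"
    unfolding p(4)[OF jx] using s jx X limcone_Tight[OF L0[OF X(1)] jx] by simp
  qed
  then show ?thesis using s' by (simp add: P_def)
 qed
 ultimately show ?thesis by (simp add: is_ffunctor_def)
qed

end

section \<open>The projections from the pointwise limit\<close>

context Fun_limits
begin

lemma P_simps:
 "X \<in> Obj S ==> fun0 P X = P0 X" "s \<in> Mor S ==> fun1 P s = P1 s" "z \<in> Cell S ==> fun2 P z = P2 z"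
 by (simp_all add: P_def)

definition "pl0 j x = Arr P (fun0 D j) \<lparr>at_ob = (\<lambda>X\<in>Obj S. r0 X j x),
  at_mor = (\<lambda>s\<in>Mor S. id2 C (cmp1 C (fun1 (fun0 D j) s) (r0 (dom1 S s) j x)))\<rparr>"

definition "pl1 j a = Arr (pl0 j (src (fun0 W j) a)) (pl0 j (trg (fun0 W j) a)) (\<lambda>X\<in>Obj S. r1 X j a)"

lemma pl0_simps: "adom (pl0 j x) = P" "acod (pl0 j x) = fun0 D j"
  "X \<in> Obj S ==> at_ob (amap (pl0 j x)) X = r0 X j x"
  "s \<in> Mor S ==> at_mor (amap (pl0 j x)) s = id2 C (cmp1 C (fun1 (fun0 D j) s) (r0 (dom1 S s) j x))"
 by (simp_all add: pl0_def)

text \<open>\<open>P1\<close> and \<open>P2\<close> were chosen so that the projections commute with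
  them on the nose. Identities therefore serve as structure cells for every weakness, and the axioms
  reduce to equations of 1-cells or to the projections of \<open>P2\<close>.\<close>

lemma pl0_Tight:
 assumes jx: "j \<in> Obj J" "x \<in> Ob (fun0 W j)"
 shows "pl0 j x \<in> Tight \<F>"
proof -
 interpret P: ffunctor S C P by (rule ffunctorI[OF SC P_ffunctor])
 interpret Dj: ffunctor S C "fun0 D j" by (rule Dj[OF jx(1)])
 let ?\<phi> = "amap (pl0 j x)"
 have "w_natural w S C P (fun0 D j) ?\<phi>"
 proof (rule w_naturalI)
  show "at_ob ?\<phi> \<in> extensional (Obj S)" "at_mor ?\<phi> \<in> extensional (Mor S)" by (simp_all add: pl0_def)
  show "at_ob ?\<phi> X \<in> Mor C & dom1 C (at_ob ?\<phi> X) = fun0 P X & cod1 C (at_ob ?\<phi> X) = fun0 (fun0 D j) X" if "X \<in> Obj S" for X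
   using that jx by (simp add: pl0_simps P_simps)
 next
  fix s assume s: "s \<in> Mor S"
  then have X: "dom1 S s \<in> Obj S" "cod1 S s \<in> Obj S" by simp_all
  have m: "cmp1 C (fun1 (fun0 D j) s) (r0 (dom1 S s) j x) \<in> Mor C" using s X jx by simp
  have e: "cmp1 C (at_ob ?\<phi> (cod1 S s)) (fun1 P s) = cmp1 C (fun1 (fun0 D j) s) (r0 (dom1 S s) j x)"
   using P1(4)[OF s jx] X s by (simp add: pl0_simps P_simps)
  show "at_mor ?\<phi> s \<in> Cell C" "wgood w C (at_mor ?\<phi> s)" using m s by (simp_all add: pl0_simps)
  show "dom2 C (at_mor ?\<phi> s) = (if w = Colax then cmp1 C (at_ob ?\<phi> (cod1 S s)) (fun1 P s) else cmp1 C (fun1 (fun0 D j) s) (at_ob ?\<phi> (dom1 S s)))"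
   "cod2 C (at_mor ?\<phi> s) = (if w = Colax then cmp1 C (fun1 (fun0 D j) s) (at_ob ?\<phi> (dom1 S s)) else cmp1 C (at_ob ?\<phi> (cod1 S s)) (fun1 P s))"
   using m X unfolding e pl0_simps(4)[OF s] pl0_simps(3)[OF X(1)] by simp_all
 next
  fix s assume "s \<in> Tight S"
  then have "s \<in> Mor S" by simp
  then show "identity_cell C (at_mor ?\<phi> s)" using jx by (simp add: pl0_simps)
 next
  fix X assume "X \<in> Obj S" then show "at_mor ?\<phi> (id1 S X) = id2 C (at_ob ?\<phi> X)" using jx by (simp add: pl0_simps)
 next
  fix z assume z: "z \<in> Cell S"
  let ?X = "dom1 S (dom2 S z)" and ?X' = "cod1 S (dom2 S z)"
  have st: "dom2 S z \<in> Mor S" "cod2 S z \<in> Mor S" "dom1 S (cod2 S z) = ?X" "cod1 S (cod2 S z) = ?X'" and X: "?X \<in> Obj S" "?X' \<in> Obj S" using z by simp_all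
  have e: "whl C (at_ob ?\<phi> ?X') (fun2 P z) = whr C (fun2 (fun0 D j) z) (r0 ?X j x)"
   using P2(4)[OF z jx] by (simp add: pl0_simps(3)[OF X(2)] P_simps(3)[OF z])
  show "slides w C (at_mor ?\<phi> (dom2 S z)) (at_mor ?\<phi> (cod2 S z)) (whr C (fun2 (fun0 D j) z) (at_ob ?\<phi> ?X)) (whl C (at_ob ?\<phi> ?X') (fun2 P z))"
   unfolding e pl0_simps(3)[OF X(1)] pl0_simps(4)[OF st(1)] pl0_simps(4)[OF st(2)] slides_def
   using jx z X st(1,2) by (simp add: st(3,4))
 next
  fix s t assume st: "s \<in> Mor S" "t \<in> Mor S" "cod1 S s = dom1 S t"
  have X: "dom1 S s \<in> Obj S" "dom1 S t \<in> Obj S" "cod1 S t \<in> Obj S" using st by simp_all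
  have ts: "cmp1 S t s \<in> Mor S" "dom1 S (cmp1 S t s) = dom1 S s" using st by simp_all
  note p = P1[OF st(1), unfolded st(3)]
  have "whl C (cmp1 C (fun1 (fun0 D j) t) (r0 (dom1 S t) j x)) (id2 C (fun1 P s)) = id2 C (cmp1 C (fun1 (fun0 D j) t) (cmp1 C (r0 (dom1 S t) j x) (P1 s)))"
   using st X jx p(1-3) by (simp add: P_simps)
  then have "whl C (cmp1 C (fun1 (fun0 D j) t) (r0 (dom1 S t) j x)) (id2 C (fun1 P s)) = id2 C (cmp1 C (fun1 (fun0 D j) (cmp1 S t s)) (r0 (dom1 S s) j x))"
   unfolding p(4)[OF jx] using st X jx by simp
  then show "at_mor ?\<phi> (cmp1 S t s) = vpaste w C (whr C (at_mor ?\<phi> t) (fun1 P s)) (whl C (fun1 (fun0 D j) t) (at_mor ?\<phi> s))"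
   unfolding pl0_simps(4)[OF st(1)] pl0_simps(4)[OF st(2)] pl0_simps(4)[OF ts(1)] ts(2) vpaste_def
   using st X jx by simp
 qed
 then show ?thesis
  using jx FD.D_simps(1)[OF jx(1)] P_ffunctor limcone_Tight[OF L0 jx] by (simp add: Tight_Fun Mor_Fun pl0_simps)
qed

lemma pl1_Cell:
 assumes ja: "j \<in> Obj J" "a \<in> Ar (fun0 W j)"
 shows "pl1 j a \<in> Cell \<F>"
proof -
 interpret P: ffunctor S C P by (rule ffunctorI[OF SC P_ffunctor])
 interpret Dj: ffunctor S C "fun0 D j" by (rule Dj[OF ja(1)])
 have st: "src (fun0 W j) a \<in> Ob (fun0 W j)" "trg (fun0 W j) a \<in> Ob (fun0 W j)" using ja by simp_all
 have m: "pl0 j (src (fun0 W j) a) \<in> Mor \<F>" "pl0 j (trg (fun0 W j) a) \<in> Mor \<F>"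
  using pl0_Tight[OF ja(1) st(1)] pl0_Tight[OF ja(1) st(2)] by simp_all
 have "slides w C (at_mor (amap (pl0 j (src (fun0 W j) a))) s) (at_mor (amap (pl0 j (trg (fun0 W j) a))) s)
   (whl C (fun1 (fun0 D j) s) (amap (pl1 j a) (dom1 S s))) (whr C (amap (pl1 j a) (cod1 S s)) (fun1 P s))"
  if s: "s \<in> Mor S" for s
 proof -
  have X: "dom1 S s \<in> Obj S" "cod1 S s \<in> Obj S" using s by simp_all
  have e: "whr C (amap (pl1 j a) (cod1 S s)) (fun1 P s) = whl C (fun1 (fun0 D j) s) (r1 (dom1 S s) j a)"
   using P1(5)[OF s ja] X by (simp add: pl1_def P_simps(2)[OF s])
  have e': "amap (pl1 j a) (dom1 S s) = r1 (dom1 S s) j a" using X by (simp add: pl1_def)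
  show ?thesis unfolding e e' pl0_simps(4)[OF s] slides_def using s X ja st by simp
 qed
 then have "modification w S C P (fun0 D j) (amap (pl0 j (src (fun0 W j) a))) (amap (pl0 j (trg (fun0 W j) a))) (amap (pl1 j a))"
  using ja by (simp add: modification_def cell_between_def pl0_simps) (simp add: pl1_def)
 then show ?thesis using m by (simp add: Cell_Fun pl1_def pl0_simps)
qed

lemma pl_lcone: "lcone \<F> J W D P pl0 pl1"
proof -
 interpret P: ffunctor S C P by (rule ffunctorI[OF SC P_ffunctor])
 have r: "lcone C J W (DX X) (P0 X) (r0 X) (r1 X)" if "X \<in> Obj S" for X
  by (rule limcone_lcone[OF L0[OF that]])
 note re = cone_data.lcone_eqs[OF cone_data_DX r]
 have pm: "pl0 j x \<in> Mor \<F>" if "j \<in> Obj J" "x \<in> Ob (fun0 W j)" for j x using pl0_Tight[OF that] by simp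
 \<comment> \<open>This equation of 1-cells identifies the ends of the 2-cells compared in
   \<open>f4\<close> and \<open>f5\<close>.\<close>
 have f3: "cmp1 \<F> (fun1 D u) (pl0 (dom1 J u) x) = pl0 (cod1 J u) (on_ob (amap (fun1 W u)) x)"
  if u: "u \<in> Mor J" "x \<in> Ob (fun0 W (dom1 J u))" for u x
 proof -
  have j: "dom1 J u \<in> Obj J" "cod1 J u \<in> Obj J" "on_ob (amap (fun1 W u)) x \<in> Ob (fun0 W (cod1 J u))" using u by simp_all
  interpret Dj: ffunctor S C "fun0 D (dom1 J u)" by (rule Dj[OF j(1)])
  interpret Dj': ffunctor S C "fun0 D (cod1 J u)" by (rule Dj[OF j(2)])
  have ob: "at_ob (amap (cmp1 \<F> (fun1 D u) (pl0 (dom1 J u) x))) X = r0 X (cod1 J u) (on_ob (amap (fun1 W u)) x)" if "X \<in> Obj S" for X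
   using re(3)[OF that that u] that by (simp add: comp_transf_def DX_simps u pl0_simps)
  show ?thesis
  proof (rule Mor_Fun_eqI)
   have c: "cod1 \<F> (pl0 (dom1 J u) x) = dom1 \<F> (fun1 D u)" using D_facts(1)[OF u(1)] by (simp add: pl0_simps)
   show "cmp1 \<F> (fun1 D u) (pl0 (dom1 J u) x) \<in> Mor \<F>" by (rule F.cmp1_Mor[OF pm[OF j(1) u(2)] FD.D_simps(2)[OF u(1)] c])
   show "pl0 (cod1 J u) (on_ob (amap (fun1 W u)) x) \<in> Mor \<F>" by (rule pm[OF j(2,3)])
   show "adom (cmp1 \<F> (fun1 D u) (pl0 (dom1 J u) x)) = adom (pl0 (cod1 J u) (on_ob (amap (fun1 W u)) x))"
    "acod (cmp1 \<F> (fun1 D u) (pl0 (dom1 J u) x)) = acod (pl0 (cod1 J u) (on_ob (amap (fun1 W u)) x))"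
    using D_facts(2)[OF u(1)] by (simp_all add: pl0_simps)
   show "at_ob (amap (cmp1 \<F> (fun1 D u) (pl0 (dom1 J u) x))) X = at_ob (amap (pl0 (cod1 J u) (on_ob (amap (fun1 W u)) x))) X" if "X \<in> Obj S" for X
    unfolding ob[OF that] pl0_simps(3)[OF that] ..
   fix s assume s: "s \<in> Mor S"
   then have X: "dom1 S s \<in> Obj S" "cod1 S s \<in> Obj S" by simp_all
   have "at_mor (amap (cmp1 \<F> (fun1 D u) (pl0 (dom1 J u) x))) s = whl C (at_ob (amap (fun1 D u)) (cod1 S s)) (at_mor (amap (pl0 (dom1 J u) x)) s)"
    using at_mor_comp_Tight[OF SC FD.D_simps(5)[OF u(1)] pm[OF j(1) u(2)] _ s] D_facts[OF u(1)] by (simp add: pl0_simps)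
   also have "\<dots> = id2 C (cmp1 C (cmp1 C (at_ob (amap (fun1 D u)) (cod1 S s)) (fun1 (fun0 D (dom1 J u)) s)) (r0 (dom1 S s) (dom1 J u) x))"
    unfolding pl0_simps(4)[OF s] using s X j u Du_facts[OF u(1) X(2)] by simp
   also have "\<dots> = id2 C (cmp1 C (fun1 (fun0 D (cod1 J u)) s) (cmp1 C (at_ob (amap (fun1 D u)) (dom1 S s)) (r0 (dom1 S s) (dom1 J u) x)))"
    unfolding Du_strict[OF u(1) s] using s X j u Du_facts[OF u(1) X(1)] by simp
   also have "cmp1 C (at_ob (amap (fun1 D u)) (dom1 S s)) (r0 (dom1 S s) (dom1 J u) x) = r0 (dom1 S s) (cod1 J u) (on_ob (amap (fun1 W u)) x)"
    using re(3)[OF X(1) X(1) u] by (simp add: DX_simps u)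
   finally show "at_mor (amap (cmp1 \<F> (fun1 D u) (pl0 (dom1 J u) x))) s = at_mor (amap (pl0 (cod1 J u) (on_ob (amap (fun1 W u)) x))) s"
    unfolding pl0_simps(4)[OF s] .
  qed
 qed
 have pl1s: "adom (pl1 j a) = pl0 j (src (fun0 W j) a)" "acod (pl1 j a) = pl0 j (trg (fun0 W j) a)" "X \<in> Obj S ==> amap (pl1 j a) X = r1 X j a" for j a X
  by (simp_all add: pl1_def)
 have f1: "pl1 j (idn (fun0 W j) x) = id2 \<F> (pl0 j x)" if jx: "j \<in> Obj J" "x \<in> Ob (fun0 W j)" for j x
 proof (rule Cell_Fun_eqI)
  show "pl1 j (idn (fun0 W j) x) \<in> Cell \<F>" using jx by (simp add: pl1_Cell)
  show "id2 \<F> (pl0 j x) \<in> Cell \<F>" by (rule F.id2_Cell[OF pm[OF jx]])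
  show "amap (pl1 j (idn (fun0 W j) x)) X = amap (id2 \<F> (pl0 j x)) X" if "X \<in> Obj S" for X
   using re(1)[OF that that jx] that by (simp add: pl1s pl0_simps)
 qed (use jx in \<open>simp_all add: pl1s\<close>)
 have f2: "pl1 j (cmp (fun0 W j) b a) = vcmp \<F> (pl1 j b) (pl1 j a)"
  if ab: "j \<in> Obj J" "a \<in> Ar (fun0 W j)" "b \<in> Ar (fun0 W j)" "trg (fun0 W j) a = src (fun0 W j) b" for j a b
 proof (rule Cell_Fun_eqI)
  show "pl1 j (cmp (fun0 W j) b a) \<in> Cell \<F>" using ab by (simp add: pl1_Cell)
  show "vcmp \<F> (pl1 j b) (pl1 j a) \<in> Cell \<F>" using ab by (intro F.vcmp_Cell pl1_Cell) (simp_all add: pl1s)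
  show "amap (pl1 j (cmp (fun0 W j) b a)) X = amap (vcmp \<F> (pl1 j b) (pl1 j a)) X" if "X \<in> Obj S" for X
   using re(2)[OF that that ab] that by (simp add: pl1s)
 qed (use ab in \<open>simp_all add: pl1s\<close>)
 have f4: "whl \<F> (fun1 D u) (pl1 (dom1 J u) a) = pl1 (cod1 J u) (on_ar (amap (fun1 W u)) a)"
  if u: "u \<in> Mor J" "a \<in> Ar (fun0 W (dom1 J u))" for u a
 proof (rule Cell_Fun_eqI)
  have j: "dom1 J u \<in> Obj J" "cod1 J u \<in> Obj J" "on_ar (amap (fun1 W u)) a \<in> Ar (fun0 W (cod1 J u))"
   "src (fun0 W (dom1 J u)) a \<in> Ob (fun0 W (dom1 J u))" "trg (fun0 W (dom1 J u)) a \<in> Ob (fun0 W (dom1 J u))" using u by simp_all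
  have t: "pl1 (dom1 J u) a \<in> Cell \<F>" "id2 \<F> (fun1 D u) \<in> Cell \<F>" "cod1 \<F> (dom2 \<F> (pl1 (dom1 J u) a)) = dom1 \<F> (dom2 \<F> (id2 \<F> (fun1 D u)))"
   using pl1_Cell[OF j(1) u(2)] F.id2_Cell[OF FD.D_simps(2)[OF u(1)]] D_facts[OF u(1)] by (simp_all add: pl1s pl0_simps)
  show "whl \<F> (fun1 D u) (pl1 (dom1 J u) a) \<in> Cell \<F>" by (rule F.hcmp_Cell[OF t])
  show "pl1 (cod1 J u) (on_ar (amap (fun1 W u)) a) \<in> Cell \<F>" by (rule pl1_Cell[OF j(2,3)])
  have "dom2 \<F> (whl \<F> (fun1 D u) (pl1 (dom1 J u) a)) = cmp1 \<F> (fun1 D u) (pl0 (dom1 J u) (src (fun0 W (dom1 J u)) a))"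
   unfolding F.dom2_hcmp[OF t] F.dom2_id2[OF FD.D_simps(2)[OF u(1)]] by (simp only: Fun_simps pl1s)
  then show "adom (whl \<F> (fun1 D u) (pl1 (dom1 J u) a)) = adom (pl1 (cod1 J u) (on_ar (amap (fun1 W u)) a))"
   unfolding f3[OF u(1) j(4)] Fun_simps(3) pl1s using u by simp
  have "cod2 \<F> (whl \<F> (fun1 D u) (pl1 (dom1 J u) a)) = cmp1 \<F> (fun1 D u) (pl0 (dom1 J u) (trg (fun0 W (dom1 J u)) a))"
   unfolding F.cod2_hcmp[OF t] F.cod2_id2[OF FD.D_simps(2)[OF u(1)]] by (simp only: Fun_simps pl1s)
  then show "acod (whl \<F> (fun1 D u) (pl1 (dom1 J u) a)) = acod (pl1 (cod1 J u) (on_ar (amap (fun1 W u)) a))"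
   unfolding f3[OF u(1) j(5)] Fun_simps(4) pl1s using u by simp
  show "amap (whl \<F> (fun1 D u) (pl1 (dom1 J u) a)) X = amap (pl1 (cod1 J u) (on_ar (amap (fun1 W u)) a)) X" if "X \<in> Obj S" for X
   using re(4)[OF that that u] that by (simp add: pl1s DX_simps u)
 qed
 have f5: "whr \<F> (fun2 D \<alpha>) (pl0 (dom1 J (dom2 J \<alpha>)) x) = pl1 (cod1 J (dom2 J \<alpha>)) (amap (fun2 W \<alpha>) x)"
  if a: "\<alpha> \<in> Cell J" "x \<in> Ob (fun0 W (dom1 J (dom2 J \<alpha>)))" for \<alpha> x
 proof (rule Cell_Fun_eqI)
  let ?j = "dom1 J (dom2 J \<alpha>)" and ?j' = "cod1 J (dom2 J \<alpha>)"
  have j: "?j \<in> Obj J" "?j' \<in> Obj J" "amap (fun2 W \<alpha>) x \<in> Ar (fun0 W ?j')" "dom2 J \<alpha> \<in> Mor J" "cod2 J \<alpha> \<in> Mor J"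
    "dom1 J (cod2 J \<alpha>) = ?j" "cod1 J (cod2 J \<alpha>) = ?j'" using a by simp_all
  have t: "id2 \<F> (pl0 ?j x) \<in> Cell \<F>" "fun2 D \<alpha> \<in> Cell \<F>" "cod1 \<F> (dom2 \<F> (id2 \<F> (pl0 ?j x))) = dom1 \<F> (dom2 \<F> (fun2 D \<alpha>))"
   using F.id2_Cell[OF pm[OF j(1) a(2)]] FD.D_simps(6)[OF a(1)] D\<alpha>_facts(1)[OF a(1)] D_facts[OF j(4)] by (simp_all add: pl0_simps)
  show "whr \<F> (fun2 D \<alpha>) (pl0 ?j x) \<in> Cell \<F>" by (rule F.hcmp_Cell[OF t])
  show "pl1 ?j' (amap (fun2 W \<alpha>) x) \<in> Cell \<F>" by (rule pl1_Cell[OF j(2,3)])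
  have "dom2 \<F> (whr \<F> (fun2 D \<alpha>) (pl0 ?j x)) = cmp1 \<F> (fun1 D (dom2 J \<alpha>)) (pl0 ?j x)"
   unfolding F.dom2_hcmp[OF t] F.dom2_id2[OF pm[OF j(1) a(2)]] by (simp only: Fun_simps D\<alpha>_facts(1)[OF a(1)])
  then show "adom (whr \<F> (fun2 D \<alpha>) (pl0 ?j x)) = adom (pl1 ?j' (amap (fun2 W \<alpha>) x))"
   unfolding f3[OF j(4) a(2)] Fun_simps(3) pl1s using a by simp
  have "cod2 \<F> (whr \<F> (fun2 D \<alpha>) (pl0 ?j x)) = cmp1 \<F> (fun1 D (cod2 J \<alpha>)) (pl0 ?j x)"
   unfolding F.cod2_hcmp[OF t] F.cod2_id2[OF pm[OF j(1) a(2)]] by (simp only: Fun_simps D\<alpha>_facts(2)[OF a(1)])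
  then show "acod (whr \<F> (fun2 D \<alpha>) (pl0 ?j x)) = acod (pl1 ?j' (amap (fun2 W \<alpha>) x))"
   unfolding f3[OF j(5), unfolded j(6,7), OF a(2)] Fun_simps(4) pl1s using a by simp
  show "amap (whr \<F> (fun2 D \<alpha>) (pl0 ?j x)) X = amap (pl1 ?j' (amap (fun2 W \<alpha>) x)) X" if "X \<in> Obj S" for X
   using re(5)[OF that that a] that by (simp add: pl1s pl0_simps DX_simps a)
 qed
 show ?thesis unfolding lcone_def
  by (intro conjI ballI impI) (simp_all only: f1 f2 f3 f4 f5, simp_all add: P_ffunctor pm pl1_Cell pl0_simps pl1s)
qed

lemma Fun_pointwise_pl: "Fun_pointwise S C J W w D P pl0 pl1"
proof (unfold_locales, goal_cases)
 case 1 show ?case by (rule pl_lcone)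
next
 case (2 j x) then show ?case by (rule pl0_Tight)
next
 case (3 X)
 show ?case using L0[OF 3] by (simp add: pl0_simps(3)[OF 3] P_simps(1)[OF 3] pl1_def 3)
qed

end

section \<open>Limits commute with limits\<close>

text \<open>Limits commute with limits: if every \<open>D j\<close> preserves the limit cone \<open>k0\<close>, \<open>k1\<close>, then so does the
 pointwise limit \<open>P\<close>.\<close>

locale commuting_limits = Fun_pointwise S C J W w D P p0 p1 + K: cat_weight K V
 for S :: "('os, 'ms, 'cs) fcat" and C :: "('o, 'm, 'c) fcat"
 and J :: "('oj, 'mj, 'cj) two_cat"
 and W :: "('oj, 'mj, 'cj, ('x, 'y) cat, ('x, 'y) cat1, ('x, 'y) cat2) two_fun"
 and w :: weakness and D P p0 p1
 and K :: "('ok, 'mk, 'ck) two_cat"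
 and V :: "('ok, 'mk, 'ck, ('v, 'b) cat, ('v, 'b) cat1, ('v, 'b) cat2) two_fun" +
 fixes E A k0 k1
 assumes E: "is_ffunctor (chordate K) S E"
  and lk: "lcone S K V E A k0 k1"
  and H: "!!j. j \<in> Obj J ==> limcone C K V (comp_ffunctor (chordate K) (fun0 D j) E) (fun0 (fun0 D j) A)
    (%k v. fun1 (fun0 D j) (k0 k v)) (%k b. fun2 (fun0 D j) (k1 k b))"
  and tk: "!!k v. [|k \<in> Obj K; v \<in> Ob (fun0 V k)|] ==> k0 k v \<in> Tight S"
begin

abbreviation "PE \<equiv> comp_ffunctor (chordate K) P E"
abbreviation "DE j \<equiv> comp_ffunctor (chordate K) (fun0 D j) E"
abbreviation "\<pi> k v \<equiv> fun1 P (k0 k v)"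
abbreviation "\<pi>1 k b \<equiv> fun2 P (k1 k b)"
abbreviation "\<delta> j k v \<equiv> fun1 (fun0 D j) (k0 k v)"
abbreviation "\<delta>1 j k b \<equiv> fun2 (fun0 D j) (k1 k b)"

lemma fK: "fcategory (chordate K)" by (rule fcategory_chordate[OF K.J.two_category_axioms])

sublocale E: cone_data K V S E
 by (rule cone_dataI[OF K.cat_weight_axioms S.fcat E])

lemma Aobj [simp]: "A \<in> Obj S" using lk by (simp add: lcone_def)

lemmas k_facts [simp] = E.limcone_p[OF lk]

lemma cone_data_PE: "cone_data K V C PE"
 by (rule cone_dataI[OF K.cat_weight_axioms C.fcat is_ffunctor_comp[OF fK S.fcat C.fcat E ffP]])

lemma cone_data_DE: assumes "j \<in> Obj J" shows "cone_data K V C (DE j)"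
 using FD.D_simps(1)[OF assms]
 by (intro cone_dataI[OF K.cat_weight_axioms C.fcat is_ffunctor_comp[OF fK S.fcat C.fcat E]]) simp

lemma q_map:
 assumes "j \<in> Obj J" "x \<in> Ob (fun0 W j)"
 shows "diagram_map K V C PE (DE j) (%k. q0 (fun0 E k) j x)"
proof -
 interpret A: cone_data K V C PE by (rule cone_data_PE)
 interpret B: cone_data K V C "DE j" by (rule cone_data_DE[OF assms(1)])
 show ?thesis
 proof (unfold_locales, goal_cases)
  case (4 u) then show ?case using strict(1)[OF assms E.D_simps(2)[OF 4]] by simp
 next
  case (5 a) then show ?case using q0_nat[OF assms E.D_simps(6)[OF 5]] by simp
 qed (use assms in simp_all)
qed

lemma q_cell:
 assumes ja: "j \<in> Obj J" "a \<in> Ar (fun0 W j)"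
 shows "diagram_cell K V C PE (DE j) (%k. q0 (fun0 E k) j (src (fun0 W j) a)) (%k. q0 (fun0 E k) j (trg (fun0 W j) a)) (%k. q1 (fun0 E k) j a)"
proof -
 have st: "src (fun0 W j) a \<in> Ob (fun0 W j)" "trg (fun0 W j) a \<in> Ob (fun0 W j)" using ja by simp_all
 interpret A: diagram_map K V C PE "DE j" "%k. q0 (fun0 E k) j (src (fun0 W j) a)" by (rule q_map[OF ja(1) st(1)])
 interpret B: diagram_map K V C PE "DE j" "%k. q0 (fun0 E k) j (trg (fun0 W j) a)" by (rule q_map[OF ja(1) st(2)])
 show ?thesis
 proof (unfold_locales, goal_cases)
  case (4 u) then show ?case using q1_strict[OF ja E.D_simps(2)[OF 4]] by simp
 qed (use ja in simp_all)
qed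

lemma lcone_PE: "lcone C K V PE (fun0 P A) \<pi> \<pi>1"
 by (rule lcone_image[OF S.fcat C.fcat ffP K.cat_weight_axioms E lk])

lemmas pi_facts [simp] = cone_data.limcone_p[OF cone_data_PE lcone_PE]

lemma dl_facts [simp]:
 assumes "j \<in> Obj J"
 shows "!!k v. [|k \<in> Obj K; v \<in> Ob (fun0 V k)|] ==> \<delta> j k v \<in> Mor C"
  "!!k v. [|k \<in> Obj K; v \<in> Ob (fun0 V k)|] ==> dom1 C (\<delta> j k v) = fun0 (fun0 D j) A"
  "!!k v. [|k \<in> Obj K; v \<in> Ob (fun0 V k)|] ==> cod1 C (\<delta> j k v) = fun0 (fun0 D j) (fun0 E k)"
  "!!k b. [|k \<in> Obj K; b \<in> Ar (fun0 V k)|] ==> \<delta>1 j k b \<in> Cell C"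
  "!!k b. [|k \<in> Obj K; b \<in> Ar (fun0 V k)|] ==> dom2 C (\<delta>1 j k b) = \<delta> j k (src (fun0 V k) b)"
  "!!k b. [|k \<in> Obj K; b \<in> Ar (fun0 V k)|] ==> cod2 C (\<delta>1 j k b) = \<delta> j k (trg (fun0 V k) b)"
 using cone_data.limcone_p[OF cone_data_DE[OF assms] limcone_lcone[OF H[OF assms]]] by simp_all

text \<open>The leg \<open>p0 j x\<close> is strict at the 1-cell \<open>k0 k v\<close>, which
  exchanges the projections of the two limits. \<open>G2\<close> to \<open>G4\<close> are the
  variants for 2-cells of the outer cone, of the inner cone, and into the limit.\<close>

lemma G1:
 assumes jx: "j \<in> Obj J" "x \<in> Ob (fun0 W j)" and kv: "k \<in> Obj K" "v \<in> Ob (fun0 V k)" and F: "F \<in> Mor C" "cod1 C F = fun0 P A"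
 shows "cmp1 C (q0 (fun0 E k) j x) (cmp1 C (\<pi> k v) F) = cmp1 C (\<delta> j k v) (cmp1 C (q0 A j x) F)"
proof -
 have "cmp1 C (q0 (fun0 E k) j x) (cmp1 C (\<pi> k v) F) = cmp1 C (cmp1 C (q0 (fun0 E k) j x) (\<pi> k v)) F" using assms by simp
 also have "cmp1 C (q0 (fun0 E k) j x) (\<pi> k v) = cmp1 C (\<delta> j k v) (q0 A j x)" using strict(1)[OF jx, of "k0 k v"] kv by simp
 finally show ?thesis using assms by simp
qed

lemma G2:
 assumes ja: "j \<in> Obj J" "a \<in> Ar (fun0 W j)" and kv: "k \<in> Obj K" "v \<in> Ob (fun0 V k)" and F: "F \<in> Mor C" "cod1 C F = fun0 P A"
 shows "whr C (q1 (fun0 E k) j a) (cmp1 C (\<pi> k v) F) = whl C (\<delta> j k v) (whr C (q1 A j a) F)"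
proof -
 have "whr C (q1 (fun0 E k) j a) (cmp1 C (\<pi> k v) F) = whr C (whr C (q1 (fun0 E k) j a) (\<pi> k v)) F" using assms by simp
 also have "whr C (q1 (fun0 E k) j a) (\<pi> k v) = whl C (\<delta> j k v) (q1 A j a)" using q1_strict[OF ja, of "k0 k v"] kv by simp
 finally show ?thesis using assms by simp
qed

lemma G3:
 assumes jx: "j \<in> Obj J" "x \<in> Ob (fun0 W j)" and kb: "k \<in> Obj K" "b \<in> Ar (fun0 V k)" and F: "F \<in> Mor C" "cod1 C F = fun0 P A"
 shows "whl C (q0 (fun0 E k) j x) (whr C (\<pi>1 k b) F) = whr C (\<delta>1 j k b) (cmp1 C (q0 A j x) F)"
proof -
 have "whl C (q0 (fun0 E k) j x) (whr C (\<pi>1 k b) F) = whr C (whl C (q0 (fun0 E k) j x) (\<pi>1 k b)) F" using assms by simp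
 also have "whl C (q0 (fun0 E k) j x) (\<pi>1 k b) = whr C (\<delta>1 j k b) (q0 A j x)" using q0_nat[OF jx, of "k1 k b"] kb by simp
 finally show ?thesis using assms by simp
qed

lemma G4:
 assumes jx: "j \<in> Obj J" "x \<in> Ob (fun0 W j)" and kv: "k \<in> Obj K" "v \<in> Ob (fun0 V k)" and F: "a \<in> Cell C" "cod1 C (dom2 C a) = fun0 P A"
 shows "whl C (q0 (fun0 E k) j x) (whl C (\<pi> k v) a) = whl C (\<delta> j k v) (whl C (q0 A j x) a)"
proof -
 have "whl C (q0 (fun0 E k) j x) (whl C (\<pi> k v) a) = whl C (cmp1 C (q0 (fun0 E k) j x) (\<pi> k v)) a" using assms by simp
 also have "cmp1 C (q0 (fun0 E k) j x) (\<pi> k v) = cmp1 C (\<delta> j k v) (q0 A j x)" using strict(1)[OF jx, of "k0 k v"] kv by simp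
 finally show ?thesis using assms by simp
qed

abbreviation "du u X \<equiv> at_ob (amap (fun1 D u)) X"
abbreviation "da \<alpha> X \<equiv> amap (fun2 D \<alpha>) X"

lemmas [simp] = Du_facts D\<alpha>_facts(3-5)

text \<open>The tight 1-cell \<open>D u\<close> is strict at \<open>k0 k v\<close> as well.
  \<open>U1\<close> to \<open>U3\<close> transport the compatibility conditions of the outer diagram
  from \<open>fun0 E k\<close> to \<open>A\<close>.\<close>

lemma U1:
 assumes u: "u \<in> Mor J" and kv: "k \<in> Obj K" "v \<in> Ob (fun0 V k)" and F: "F \<in> Mor C" "cod1 C F = fun0 (fun0 D (dom1 J u)) A"
 shows "cmp1 C (\<delta> (cod1 J u) k v) (cmp1 C (du u A) F) = cmp1 C (du u (fun0 E k)) (cmp1 C (\<delta> (dom1 J u) k v) F)"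
proof -
 have "cmp1 C (\<delta> (cod1 J u) k v) (cmp1 C (du u A) F) = cmp1 C (cmp1 C (\<delta> (cod1 J u) k v) (du u A)) F" using assms by simp
 also have "cmp1 C (\<delta> (cod1 J u) k v) (du u A) = cmp1 C (du u (fun0 E k)) (\<delta> (dom1 J u) k v)" using Du_strict[OF u, of "k0 k v"] kv by simp
 finally show ?thesis using assms by simp
qed

lemma U1':
 assumes u: "u \<in> Mor J" and kv: "k \<in> Obj K" "v \<in> Ob (fun0 V k)" and F: "a \<in> Cell C" "cod1 C (dom2 C a) = fun0 (fun0 D (dom1 J u)) A"
 shows "whl C (\<delta> (cod1 J u) k v) (whl C (du u A) a) = whl C (du u (fun0 E k)) (whl C (\<delta> (dom1 J u) k v) a)"
proof -
 have "whl C (\<delta> (cod1 J u) k v) (whl C (du u A) a) = whl C (cmp1 C (\<delta> (cod1 J u) k v) (du u A)) a" using assms by simp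
 also have "cmp1 C (\<delta> (cod1 J u) k v) (du u A) = cmp1 C (du u (fun0 E k)) (\<delta> (dom1 J u) k v)" using Du_strict[OF u, of "k0 k v"] kv by simp
 finally show ?thesis using assms by simp
qed

lemma U2:
 assumes u: "u \<in> Mor J" and kb: "k \<in> Obj K" "b \<in> Ar (fun0 V k)" and F: "F \<in> Mor C" "cod1 C F = fun0 (fun0 D (dom1 J u)) A"
 shows "whr C (\<delta>1 (cod1 J u) k b) (cmp1 C (du u A) F) = whl C (du u (fun0 E k)) (whr C (\<delta>1 (dom1 J u) k b) F)"
proof -
 have "whr C (\<delta>1 (cod1 J u) k b) (cmp1 C (du u A) F) = whr C (whr C (\<delta>1 (cod1 J u) k b) (du u A)) F" using assms by simp
 also have "whr C (\<delta>1 (cod1 J u) k b) (du u A) = whl C (du u (fun0 E k)) (\<delta>1 (dom1 J u) k b)" using Du_nat[OF u, of "k1 k b"] kb by simp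
 finally show ?thesis using assms by simp
qed

lemma U3:
 assumes a: "\<alpha> \<in> Cell J" and kv: "k \<in> Obj K" "v \<in> Ob (fun0 V k)" and F: "F \<in> Mor C" "cod1 C F = fun0 (fun0 D (dom1 J (dom2 J \<alpha>))) A"
 shows "whl C (\<delta> (cod1 J (dom2 J \<alpha>)) k v) (whr C (da \<alpha> A) F) = whr C (da \<alpha> (fun0 E k)) (cmp1 C (\<delta> (dom1 J (dom2 J \<alpha>)) k v) F)"
proof -
 have d: "dom2 J \<alpha> \<in> Mor J" using a by simp
 have "whl C (\<delta> (cod1 J (dom2 J \<alpha>)) k v) (whr C (da \<alpha> A) F) = whr C (whl C (\<delta> (cod1 J (dom2 J \<alpha>)) k v) (da \<alpha> A)) F" using assms d by simp
 also have "whl C (\<delta> (cod1 J (dom2 J \<alpha>)) k v) (da \<alpha> A) = whr C (da \<alpha> (fun0 E k)) (\<delta> (dom1 J (dom2 J \<alpha>)) k v)" using D\<alpha>_strict[OF a, of "k0 k v"] kv by simp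
 finally show ?thesis using assms d by simp
qed

end

section \<open>The universal property of the image cone\<close>

context commuting_limits
begin

lemma qe:
 assumes X: "X \<in> Obj S"
 shows "!!j x. [|j \<in> Obj J; x \<in> Ob (fun0 W j)|] ==> q1 X j (idn (fun0 W j) x) = id2 C (q0 X j x)"
  "!!j a b. [|j \<in> Obj J; a \<in> Ar (fun0 W j); b \<in> Ar (fun0 W j); trg (fun0 W j) a = src (fun0 W j) b|] ==>
    q1 X j (cmp (fun0 W j) b a) = vcmp C (q1 X j b) (q1 X j a)"
  "!!u x. [|u \<in> Mor J; x \<in> Ob (fun0 W (dom1 J u))|] ==>
    q0 X (cod1 J u) (on_ob (amap (fun1 W u)) x) = cmp1 C (du u X) (q0 X (dom1 J u) x)"
  "!!u a. [|u \<in> Mor J; a \<in> Ar (fun0 W (dom1 J u))|] ==>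
    q1 X (cod1 J u) (on_ar (amap (fun1 W u)) a) = whl C (du u X) (q1 X (dom1 J u) a)"
  "!!e x. [|e \<in> Cell J; x \<in> Ob (fun0 W (dom1 J (dom2 J e)))|] ==>
    q1 X (cod1 J (dom2 J e)) (amap (fun2 W e) x) = whr C (da e X) (q0 X (dom1 J (dom2 J e)) x)"
 using cone_data.lcone_eqs[OF cone_data_DX[OF X] lcone_ev[OF lP X]] by (simp_all add: DX_simps)

text \<open>The outer legs turn a cone over \<open>PE\<close> into cones over the
  \<open>DE j\<close>. These factor through the limits \<open>H\<close>, and the factorisations
  \<open>f\<close>, \<open>g\<close> form a cone over the outer diagram at \<open>A\<close>, to
  which the limit \<open>P A\<close> is applied.\<close>

lemma B_ex1:
 assumes le: "lcone C K V PE Y \<epsilon>0 \<epsilon>1"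
 shows "\<exists>F\<in>Mor C. dom1 C F = Y & cod1 C F = fun0 P A &
    (\<forall>k\<in>Obj K. \<forall>v\<in>Ob (fun0 V k). cmp1 C (\<pi> k v) F = \<epsilon>0 k v) &
    (\<forall>k\<in>Obj K. \<forall>b\<in>Ar (fun0 V k). whr C (\<pi>1 k b) F = \<epsilon>1 k b)"
proof -
 have Y: "Y \<in> Obj C" using le by (simp add: lcone_def)
 note e = cone_data.limcone_p[OF cone_data_PE le]
 have e3: "!!k v. [|k \<in> Obj K; v \<in> Ob (fun0 V k)|] ==> cod1 C (\<epsilon>0 k v) = fun0 P (fun0 E k)" using e(3) by simp
 note e [simp] = e(1,2) e3 e(4-6)
 have Ek: "!!k. k \<in> Obj K ==> fun0 E k \<in> Obj S" by simp
 \<comment> \<open>The factorisation through the preserved limit of the cone obtained by composing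
   with the leg \<open>p0 j x\<close>.\<close>
 define f where "f j x = (SOME f. f \<in> Mor C & dom1 C f = Y & cod1 C f = fun0 (fun0 D j) A &
   (\<forall>k\<in>Obj K. \<forall>v\<in>Ob (fun0 V k). cmp1 C (\<delta> j k v) f = cmp1 C (q0 (fun0 E k) j x) (\<epsilon>0 k v)) &
   (\<forall>k\<in>Obj K. \<forall>b\<in>Ar (fun0 V k). whr C (\<delta>1 j k b) f = whl C (q0 (fun0 E k) j x) (\<epsilon>1 k b)))" for j x
 have f: "f j x \<in> Mor C" "dom1 C (f j x) = Y" "cod1 C (f j x) = fun0 (fun0 D j) A"
   "!!k v. [|k \<in> Obj K; v \<in> Ob (fun0 V k)|] ==> cmp1 C (\<delta> j k v) (f j x) = cmp1 C (q0 (fun0 E k) j x) (\<epsilon>0 k v)"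
   "!!k b. [|k \<in> Obj K; b \<in> Ar (fun0 V k)|] ==> whr C (\<delta>1 j k b) (f j x) = whl C (q0 (fun0 E k) j x) (\<epsilon>1 k b)"
  if jx: "j \<in> Obj J" "x \<in> Ob (fun0 W j)" for j x
 proof -
  have "\<exists>f. f \<in> Mor C & dom1 C f = Y & cod1 C f = fun0 (fun0 D j) A &
   (\<forall>k\<in>Obj K. \<forall>v\<in>Ob (fun0 V k). cmp1 C (\<delta> j k v) f = cmp1 C (q0 (fun0 E k) j x) (\<epsilon>0 k v)) &
   (\<forall>k\<in>Obj K. \<forall>b\<in>Ar (fun0 V k). whr C (\<delta>1 j k b) f = whl C (q0 (fun0 E k) j x) (\<epsilon>1 k b))"
   by (rule limcone_ex1[OF H[OF jx(1)] diagram_map.lcone_post[OF q_map[OF jx] le]]) blast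
  from someI_ex[OF this, folded f_def] show "f j x \<in> Mor C" "dom1 C (f j x) = Y" "cod1 C (f j x) = fun0 (fun0 D j) A"
   "!!k v. [|k \<in> Obj K; v \<in> Ob (fun0 V k)|] ==> cmp1 C (\<delta> j k v) (f j x) = cmp1 C (q0 (fun0 E k) j x) (\<epsilon>0 k v)"
   "!!k b. [|k \<in> Obj K; b \<in> Ar (fun0 V k)|] ==> whr C (\<delta>1 j k b) (f j x) = whl C (q0 (fun0 E k) j x) (\<epsilon>1 k b)"
   by blast+
 qed
 \<comment> \<open>For an arrow \<open>a\<close> of the outer weight the two composed cones differ
   by a modification, which factors as a 2-cell between the corresponding values of
   \<open>f\<close>.\<close>
 define g where "g j a = (SOME g. g \<in> Cell C & dom2 C g = f j (src (fun0 W j) a) & cod2 C g = f j (trg (fun0 W j) a) &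
   (\<forall>k\<in>Obj K. \<forall>v\<in>Ob (fun0 V k). whl C (\<delta> j k v) g = whr C (q1 (fun0 E k) j a) (\<epsilon>0 k v)))" for j a
 have g: "g j a \<in> Cell C" "dom2 C (g j a) = f j (src (fun0 W j) a)" "cod2 C (g j a) = f j (trg (fun0 W j) a)"
   "!!k v. [|k \<in> Obj K; v \<in> Ob (fun0 V k)|] ==> whl C (\<delta> j k v) (g j a) = whr C (q1 (fun0 E k) j a) (\<epsilon>0 k v)"
  if ja: "j \<in> Obj J" "a \<in> Ar (fun0 W j)" for j a
 proof -
  let ?s = "src (fun0 W j) a" and ?t = "trg (fun0 W j) a"
  have st: "?s \<in> Ob (fun0 W j)" "?t \<in> Ob (fun0 W j)" using ja by simp_all
  note s = f[OF ja(1) st(1)] and t = f[OF ja(1) st(2)]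
  have lm: "lmod C K V (DE j) (%k v. cmp1 C (\<delta> j k v) (f j ?s)) (%k b. whr C (\<delta>1 j k b) (f j ?s))
    (%k v. cmp1 C (\<delta> j k v) (f j ?t)) (%k b. whr C (\<delta>1 j k b) (f j ?t)) (%k v. whr C (q1 (fun0 E k) j a) (\<epsilon>0 k v))"
   by (rule lmod_cong[OF K.J.two_category_axioms K.W, THEN iffD1, OF _ _ _ _ _ diagram_cell.lmod_cell[OF q_cell[OF ja] le]])
    (simp_all only: s(4,5) t(4,5))
  have d: "dom1 C (f j ?s) = dom1 C (f j ?t)" by (simp only: s t)
  have "\<exists>g. g \<in> Cell C & dom2 C g = f j ?s & cod2 C g = f j ?t &
    (\<forall>k\<in>Obj K. \<forall>v\<in>Ob (fun0 V k). whl C (\<delta> j k v) g = whr C (q1 (fun0 E k) j a) (\<epsilon>0 k v))"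
   by (rule limcone_ex2[OF H[OF ja(1)] s(1) t(1) d s(3) t(3) lm]) blast
  from someI_ex[OF this, folded g_def] show "g j a \<in> Cell C" "dom2 C (g j a) = f j (src (fun0 W j) a)" "cod2 C (g j a) = f j (trg (fun0 W j) a)"
   "!!k v. [|k \<in> Obj K; v \<in> Ob (fun0 V k)|] ==> whl C (\<delta> j k v) (g j a) = whr C (q1 (fun0 E k) j a) (\<epsilon>0 k v)"
   by blast+
 qed
 note ft [simp] = f(1-3) g(1-3)
 have c1: "g j (idn (fun0 W j) x) = id2 C (f j x)" if jx: "j \<in> Obj J" "x \<in> Ob (fun0 W j)" for j x
 proof (rule limcone_eq2[OF H[OF jx(1)]])
  fix k v assume kv: "k \<in> Obj K" "v \<in> Ob (fun0 V k)"
  have i: "idn (fun0 W j) x \<in> Ar (fun0 W j)" using jx by simp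
  show "whl C (\<delta> j k v) (g j (idn (fun0 W j) x)) = whl C (\<delta> j k v) (id2 C (f j x))"
   unfolding g(4)[OF jx(1) i kv] qe(1)[OF Ek[OF kv(1)] jx] using jx kv f(4)[OF jx kv] by simp
 qed (use jx in simp_all)
 have c2: "g j (cmp (fun0 W j) b a) = vcmp C (g j b) (g j a)"
  if ab: "j \<in> Obj J" "a \<in> Ar (fun0 W j)" "b \<in> Ar (fun0 W j)" "trg (fun0 W j) a = src (fun0 W j) b" for j a b
 proof (rule limcone_eq2[OF H[OF ab(1)]])
  fix k v assume kv: "k \<in> Obj K" "v \<in> Ob (fun0 V k)"
  have i: "cmp (fun0 W j) b a \<in> Ar (fun0 W j)" using ab by simp
  have "whl C (\<delta> j k v) (vcmp C (g j b) (g j a)) = vcmp C (whl C (\<delta> j k v) (g j b)) (whl C (\<delta> j k v) (g j a))"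
   using ab kv by (intro C.hcmp_vcmp_left) simp_all
  then show "whl C (\<delta> j k v) (g j (cmp (fun0 W j) b a)) = whl C (\<delta> j k v) (vcmp C (g j b) (g j a))"
   unfolding g(4)[OF ab(1) i kv] g(4)[OF ab(1,3) kv] g(4)[OF ab(1,2) kv] qe(2)[OF Ek[OF kv(1)] ab] using ab kv by simp
 qed (use ab in simp_all)
 have c3: "cmp1 C (du u A) (f (dom1 J u) x) = f (cod1 J u) (on_ob (amap (fun1 W u)) x)"
  if u: "u \<in> Mor J" "x \<in> Ob (fun0 W (dom1 J u))" for u x
 proof -
  have j: "dom1 J u \<in> Obj J" "cod1 J u \<in> Obj J" "on_ob (amap (fun1 W u)) x \<in> Ob (fun0 W (cod1 J u))" using u by simp_all
  show ?thesis
  proof (rule limcone_eq1[OF H[OF j(2)]])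
   fix k v assume kv: "k \<in> Obj K" "v \<in> Ob (fun0 V k)"
   show "cmp1 C (\<delta> (cod1 J u) k v) (cmp1 C (du u A) (f (dom1 J u) x)) = cmp1 C (\<delta> (cod1 J u) k v) (f (cod1 J u) (on_ob (amap (fun1 W u)) x))"
    unfolding U1[OF u(1) kv f(1)[OF j(1) u(2)] f(3)[OF j(1) u(2)]] f(4)[OF j(1) u(2) kv] f(4)[OF j(2,3) kv] qe(3)[OF Ek[OF kv(1)] u]
    using u kv j by simp
  next
   fix k b assume kb: "k \<in> Obj K" "b \<in> Ar (fun0 V k)"
   show "whr C (\<delta>1 (cod1 J u) k b) (cmp1 C (du u A) (f (dom1 J u) x)) = whr C (\<delta>1 (cod1 J u) k b) (f (cod1 J u) (on_ob (amap (fun1 W u)) x))"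
    unfolding U2[OF u(1) kb f(1)[OF j(1) u(2)] f(3)[OF j(1) u(2)]] f(5)[OF j(1) u(2) kb] f(5)[OF j(2,3) kb] qe(3)[OF Ek[OF kb(1)] u]
    using u kb j by simp
  qed (use u j in simp_all)
 qed
 have c4: "whl C (du u A) (g (dom1 J u) a) = g (cod1 J u) (on_ar (amap (fun1 W u)) a)"
  if u: "u \<in> Mor J" "a \<in> Ar (fun0 W (dom1 J u))" for u a
 proof -
  have j: "dom1 J u \<in> Obj J" "cod1 J u \<in> Obj J" "on_ar (amap (fun1 W u)) a \<in> Ar (fun0 W (cod1 J u))"
   "src (fun0 W (dom1 J u)) a \<in> Ob (fun0 W (dom1 J u))" "trg (fun0 W (dom1 J u)) a \<in> Ob (fun0 W (dom1 J u))" using u by simp_all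
  have cg: "cod1 C (dom2 C (g (dom1 J u) a)) = fun0 (fun0 D (dom1 J u)) A" using u j by simp
  show ?thesis
  proof (rule limcone_eq2[OF H[OF j(2)]])
   fix k v assume kv: "k \<in> Obj K" "v \<in> Ob (fun0 V k)"
   show "whl C (\<delta> (cod1 J u) k v) (whl C (du u A) (g (dom1 J u) a)) = whl C (\<delta> (cod1 J u) k v) (g (cod1 J u) (on_ar (amap (fun1 W u)) a))"
    unfolding U1'[OF u(1) kv g(1)[OF j(1) u(2)] cg] g(4)[OF j(1) u(2) kv] g(4)[OF j(2,3) kv] qe(4)[OF Ek[OF kv(1)] u]
    using u kv j by simp
  qed (use u j c3[OF u(1) j(4)] c3[OF u(1) j(5)] in simp_all)
 qed
 have c5: "whr C (da m A) (f (dom1 J (dom2 J m)) x) = g (cod1 J (dom2 J m)) (amap (fun2 W m) x)"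
  if a: "m \<in> Cell J" "x \<in> Ob (fun0 W (dom1 J (dom2 J m)))" for m x
 proof -
  let ?j = "dom1 J (dom2 J m)" and ?j' = "cod1 J (dom2 J m)"
  have j: "?j \<in> Obj J" "?j' \<in> Obj J" "amap (fun2 W m) x \<in> Ar (fun0 W ?j')" "dom2 J m \<in> Mor J" "cod2 J m \<in> Mor J"
    "dom1 J (cod2 J m) = ?j" "cod1 J (cod2 J m) = ?j'" using a by simp_all
  show ?thesis
  proof (rule limcone_eq2[OF H[OF j(2)]])
   fix k v assume kv: "k \<in> Obj K" "v \<in> Ob (fun0 V k)"
   show "whl C (\<delta> ?j' k v) (whr C (da m A) (f ?j x)) = whl C (\<delta> ?j' k v) (g ?j' (amap (fun2 W m) x))"
    unfolding U3[OF a(1) kv f(1)[OF j(1) a(2)] f(3)[OF j(1) a(2)]] f(4)[OF j(1) a(2) kv] g(4)[OF j(2,3) kv] qe(5)[OF Ek[OF kv(1)] a]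
    using a kv j(1-5) by simp
  qed (use a j(1-5) c3[OF j(4) a(2)] c3[OF j(5), unfolded j(6,7), OF a(2)] in simp_all)
 qed
 have "lcone C J W (DX A) Y f g"
  unfolding lcone_def
  by (intro conjI ballI impI) (simp_all only: c1 c2 DX_simps J.dom2_Mor Aobj, simp_all add: Y c3 c4 c5)
 then obtain F where F: "F \<in> Mor C" "dom1 C F = Y" "cod1 C F = fun0 P A"
   "!!j x. [|j \<in> Obj J; x \<in> Ob (fun0 W j)|] ==> cmp1 C (q0 A j x) F = f j x"
   "!!j a. [|j \<in> Obj J; a \<in> Ar (fun0 W j)|] ==> whr C (q1 A j a) F = g j a"
  using limcone_ex1[OF L[OF Aobj]] by metis
 \<comment> \<open>The outer limit at \<open>fun0 E k\<close> is used here: whether \<open>F\<close>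
   has the prescribed inner projections is tested against the outer legs.\<close>
 have r1: "cmp1 C (\<pi> k v) F = \<epsilon>0 k v" if kv: "k \<in> Obj K" "v \<in> Ob (fun0 V k)" for k v
 proof (rule limcone_eq1[OF L[OF Ek[OF kv(1)]]])
  fix j x assume jx: "j \<in> Obj J" "x \<in> Ob (fun0 W j)"
  show "cmp1 C (q0 (fun0 E k) j x) (cmp1 C (\<pi> k v) F) = cmp1 C (q0 (fun0 E k) j x) (\<epsilon>0 k v)"
   unfolding G1[OF jx kv F(1,3)] F(4)[OF jx] f(4)[OF jx kv] ..
 next
  fix j a assume ja: "j \<in> Obj J" "a \<in> Ar (fun0 W j)"
  show "whr C (q1 (fun0 E k) j a) (cmp1 C (\<pi> k v) F) = whr C (q1 (fun0 E k) j a) (\<epsilon>0 k v)"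
   unfolding G2[OF ja kv F(1,3)] F(5)[OF ja] g(4)[OF ja kv] ..
 qed (use kv F(1-3) in simp_all)
 have r2: "whr C (\<pi>1 k b) F = \<epsilon>1 k b" if kb: "k \<in> Obj K" "b \<in> Ar (fun0 V k)" for k b
 proof (rule limcone_eq2[OF L[OF Ek[OF kb(1)]]])
  fix j x assume jx: "j \<in> Obj J" "x \<in> Ob (fun0 W j)"
  show "whl C (q0 (fun0 E k) j x) (whr C (\<pi>1 k b) F) = whl C (q0 (fun0 E k) j x) (\<epsilon>1 k b)"
   unfolding G3[OF jx kb F(1,3)] F(4)[OF jx] f(5)[OF jx kb] ..
 qed (use kb F(1-3) r1 in simp_all)
 show ?thesis using F(1-3) r1 r2 by blast
qed

text \<open>Agreement is tested on the outer legs at \<open>A\<close>, and there on the preserved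
  inner legs. The exchange rules turn each double projection into one that begins with
  \<open>\<pi>\<close> or \<open>\<pi>1\<close>, where the hypotheses apply.\<close>

lemma B_eq1:
 assumes F: "F \<in> Mor C" "G \<in> Mor C" "dom1 C F = dom1 C G" "cod1 C F = fun0 P A" "cod1 C G = fun0 P A"
  and e0: "!!k v. [|k \<in> Obj K; v \<in> Ob (fun0 V k)|] ==> cmp1 C (\<pi> k v) F = cmp1 C (\<pi> k v) G"
  and e1: "!!k b. [|k \<in> Obj K; b \<in> Ar (fun0 V k)|] ==> whr C (\<pi>1 k b) F = whr C (\<pi>1 k b) G"
 shows "F = G"
proof -
 have q: "cmp1 C (q0 A j x) F = cmp1 C (q0 A j x) G" if jx: "j \<in> Obj J" "x \<in> Ob (fun0 W j)" for j x
 proof (rule limcone_eq1[OF H[OF jx(1)]])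
  show "cmp1 C (\<delta> j k v) (cmp1 C (q0 A j x) F) = cmp1 C (\<delta> j k v) (cmp1 C (q0 A j x) G)" if kv: "k \<in> Obj K" "v \<in> Ob (fun0 V k)" for k v
   unfolding G1[OF jx kv F(1,4), symmetric] G1[OF jx kv F(2,5), symmetric] e0[OF kv] ..
  show "whr C (\<delta>1 j k b) (cmp1 C (q0 A j x) F) = whr C (\<delta>1 j k b) (cmp1 C (q0 A j x) G)" if kb: "k \<in> Obj K" "b \<in> Ar (fun0 V k)" for k b
   unfolding G3[OF jx kb F(1,4), symmetric] G3[OF jx kb F(2,5), symmetric] e1[OF kb] ..
 qed (use jx F in simp_all)
 show ?thesis
 proof (rule limcone_eq1[OF L[OF Aobj] F])
  fix j a assume ja: "j \<in> Obj J" "a \<in> Ar (fun0 W j)"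
  show "whr C (q1 A j a) F = whr C (q1 A j a) G"
  proof (rule limcone_eq2[OF H[OF ja(1)]])
   show "whl C (\<delta> j k v) (whr C (q1 A j a) F) = whl C (\<delta> j k v) (whr C (q1 A j a) G)" if kv: "k \<in> Obj K" "v \<in> Ob (fun0 V k)" for k v
    unfolding G2[OF ja kv F(1,4), symmetric] G2[OF ja kv F(2,5), symmetric] e0[OF kv] ..
  qed (use ja F q in simp_all)
 qed (rule q)
qed

lemma B_eq2:
 assumes a: "m \<in> Cell C" "n \<in> Cell C" "dom2 C m = dom2 C n" "cod2 C m = cod2 C n" "cod1 C (dom2 C m) = fun0 P A"
  and e: "!!k v. [|k \<in> Obj K; v \<in> Ob (fun0 V k)|] ==> whl C (\<pi> k v) m = whl C (\<pi> k v) n"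
 shows "m = n"
proof (rule limcone_eq2[OF L[OF Aobj] a])
 have b: "cod1 C (dom2 C n) = fun0 P A" using a by simp
 fix j x assume jx: "j \<in> Obj J" "x \<in> Ob (fun0 W j)"
 show "whl C (q0 A j x) m = whl C (q0 A j x) n"
 proof (rule limcone_eq2[OF H[OF jx(1)]])
  show "whl C (\<delta> j k v) (whl C (q0 A j x) m) = whl C (\<delta> j k v) (whl C (q0 A j x) n)" if kv: "k \<in> Obj K" "v \<in> Ob (fun0 V k)" for k v
   unfolding G4[OF jx kv a(1,5), symmetric] G4[OF jx kv a(2) b, symmetric] e[OF kv] ..
 qed (use jx a in simp_all)
qed

lemma B_detect:
 assumes F: "F \<in> Mor C" "cod1 C F = fun0 P A" and t: "!!k v. [|k \<in> Obj K; v \<in> Ob (fun0 V k)|] ==> cmp1 C (\<pi> k v) F \<in> Tight C"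
 shows "F \<in> Tight C"
proof (rule limcone_detect[OF L[OF Aobj] F])
 fix j x assume jx: "j \<in> Obj J" "x \<in> Ob (fun0 W j)"
 show "cmp1 C (q0 A j x) F \<in> Tight C"
 proof (rule limcone_detect[OF H[OF jx(1)]])
  fix k v assume kv: "k \<in> Obj K" "v \<in> Ob (fun0 V k)"
  have X: "fun0 E k \<in> Obj S" using kv by simp
  show "cmp1 C (\<delta> j k v) (cmp1 C (q0 A j x) F) \<in> Tight C"
   unfolding G1[OF jx kv F, symmetric]
   by (rule C.Tight_cmp1[OF t[OF kv] limcone_Tight[OF L[OF X] jx]]) (use jx kv F in simp)
 qed (use jx F in simp_all)
qed

text \<open>The argument of \<open>B_ex1\<close> one dimension higher: whiskering \<open>n\<close>
  with the outer legs gives modifications that factor through \<open>H\<close> as 2-cells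
  \<open>g j x\<close>, and these form a modification for the outer limit at
  \<open>A\<close>.\<close>

lemma B_ex2:
 assumes F: "F \<in> Mor C" "G \<in> Mor C" "dom1 C F = dom1 C G" "cod1 C F = fun0 P A" "cod1 C G = fun0 P A"
  and n: "lmod C K V PE (%k v. cmp1 C (\<pi> k v) F) (%k b. whr C (\<pi>1 k b) F) (%k v. cmp1 C (\<pi> k v) G) (%k b. whr C (\<pi>1 k b) G) n"
 shows "\<exists>e\<in>Cell C. dom2 C e = F & cod2 C e = G & (\<forall>k\<in>Obj K. \<forall>v\<in>Ob (fun0 V k). whl C (\<pi> k v) e = n k v)"
proof -
 have Ek: "!!k. k \<in> Obj K ==> fun0 E k \<in> Obj S" by simp
 have fPE: "is_ffunctor (chordate K) C PE" by (rule is_ffunctor_comp[OF fK S.fcat C.fcat E ffP])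
 note lF = lcone_pre[OF C.fcat K.J.two_category_axioms K.W fPE lcone_PE F(1,4)]
 note lG = lcone_pre[OF C.fcat K.J.two_category_axioms K.W fPE lcone_PE F(2,5), folded F(3)]
 have nn [simp]: "n k v \<in> Cell C" "dom2 C (n k v) = cmp1 C (\<pi> k v) F" "cod2 C (n k v) = cmp1 C (\<pi> k v) G" if "k \<in> Obj K" "v \<in> Ob (fun0 V k)" for k v
  using n that by (simp_all add: lmod_def)
 define g where "g j x = (SOME g. g \<in> Cell C & dom2 C g = cmp1 C (q0 A j x) F & cod2 C g = cmp1 C (q0 A j x) G &
   (\<forall>k\<in>Obj K. \<forall>v\<in>Ob (fun0 V k). whl C (\<delta> j k v) g = whl C (q0 (fun0 E k) j x) (n k v)))" for j x
 have g: "g j x \<in> Cell C" "dom2 C (g j x) = cmp1 C (q0 A j x) F" "cod2 C (g j x) = cmp1 C (q0 A j x) G"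
   "!!k v. [|k \<in> Obj K; v \<in> Ob (fun0 V k)|] ==> whl C (\<delta> j k v) (g j x) = whl C (q0 (fun0 E k) j x) (n k v)"
  if jx: "j \<in> Obj J" "x \<in> Ob (fun0 W j)" for j x
 proof -
  have lm: "lmod C K V (DE j) (%k v. cmp1 C (\<delta> j k v) (cmp1 C (q0 A j x) F)) (%k b. whr C (\<delta>1 j k b) (cmp1 C (q0 A j x) F))
    (%k v. cmp1 C (\<delta> j k v) (cmp1 C (q0 A j x) G)) (%k b. whr C (\<delta>1 j k b) (cmp1 C (q0 A j x) G)) (%k v. whl C (q0 (fun0 E k) j x) (n k v))"
   by (rule lmod_cong[OF K.J.two_category_axioms K.W, THEN iffD1, OF _ _ _ _ _ diagram_map.lmod_post[OF q_map[OF jx] lF lG n]])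
    (simp_all only: G1[OF jx _ _ F(1,4)] G1[OF jx _ _ F(2,5)] G3[OF jx _ _ F(1,4)] G3[OF jx _ _ F(2,5)])
  have m: "cmp1 C (q0 A j x) F \<in> Mor C" "cmp1 C (q0 A j x) G \<in> Mor C" "dom1 C (cmp1 C (q0 A j x) F) = dom1 C (cmp1 C (q0 A j x) G)"
   "cod1 C (cmp1 C (q0 A j x) F) = fun0 (fun0 D j) A" "cod1 C (cmp1 C (q0 A j x) G) = fun0 (fun0 D j) A"
   using jx F by simp_all
  have "\<exists>g. g \<in> Cell C & dom2 C g = cmp1 C (q0 A j x) F & cod2 C g = cmp1 C (q0 A j x) G &
   (\<forall>k\<in>Obj K. \<forall>v\<in>Ob (fun0 V k). whl C (\<delta> j k v) g = whl C (q0 (fun0 E k) j x) (n k v))"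
   by (rule limcone_ex2[OF H[OF jx(1)] m lm]) blast
  from someI_ex[OF this, folded g_def] show "g j x \<in> Cell C" "dom2 C (g j x) = cmp1 C (q0 A j x) F" "cod2 C (g j x) = cmp1 C (q0 A j x) G"
   "!!k v. [|k \<in> Obj K; v \<in> Ob (fun0 V k)|] ==> whl C (\<delta> j k v) (g j x) = whl C (q0 (fun0 E k) j x) (n k v)"
   by blast+
 qed
 note gt [simp] = g(1-3)
 have c1: "vcmp C (whr C (q1 A j a) G) (g j (src (fun0 W j) a)) = vcmp C (g j (trg (fun0 W j) a)) (whr C (q1 A j a) F)"
  if ja: "j \<in> Obj J" "a \<in> Ar (fun0 W j)" for j a
 proof (rule limcone_eq2[OF H[OF ja(1)]])
  fix k v assume kv: "k \<in> Obj K" "v \<in> Ob (fun0 V k)"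
  let ?s = "src (fun0 W j) a" and ?t = "trg (fun0 W j) a"
  have st: "?s \<in> Ob (fun0 W j)" "?t \<in> Ob (fun0 W j)" using ja by simp_all
  have "whl C (\<delta> j k v) (vcmp C (whr C (q1 A j a) G) (g j ?s)) = vcmp C (whl C (\<delta> j k v) (whr C (q1 A j a) G)) (whl C (\<delta> j k v) (g j ?s))"
   using ja kv st F by (intro C.hcmp_vcmp_left) simp_all
  moreover have "whl C (\<delta> j k v) (vcmp C (g j ?t) (whr C (q1 A j a) F)) = vcmp C (whl C (\<delta> j k v) (g j ?t)) (whl C (\<delta> j k v) (whr C (q1 A j a) F))"
   using ja kv st F by (intro C.hcmp_vcmp_left) simp_all
  moreover have "vcmp C (whr C (q1 (fun0 E k) j a) (cmp1 C (\<pi> k v) G)) (whl C (q0 (fun0 E k) j ?s) (n k v)) =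
    vcmp C (whl C (q0 (fun0 E k) j ?t) (n k v)) (whr C (q1 (fun0 E k) j a) (cmp1 C (\<pi> k v) F))"
   using ja kv st F by (intro C.exchange) simp_all
  ultimately show "whl C (\<delta> j k v) (vcmp C (whr C (q1 A j a) G) (g j ?s)) = whl C (\<delta> j k v) (vcmp C (g j ?t) (whr C (q1 A j a) F))"
   unfolding G2[OF ja kv F(1,4), symmetric] G2[OF ja kv F(2,5), symmetric] g(4)[OF ja(1) st(1) kv] g(4)[OF ja(1) st(2) kv] by (simp only:)
 qed (use ja F in simp_all)
 have c2: "whl C (du u A) (g (dom1 J u) x) = g (cod1 J u) (on_ob (amap (fun1 W u)) x)"
  if u: "u \<in> Mor J" "x \<in> Ob (fun0 W (dom1 J u))" for u x
 proof -
  have j: "dom1 J u \<in> Obj J" "cod1 J u \<in> Obj J" "on_ob (amap (fun1 W u)) x \<in> Ob (fun0 W (cod1 J u))" using u by simp_all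
  have cg: "cod1 C (dom2 C (g (dom1 J u) x)) = fun0 (fun0 D (dom1 J u)) A" using u j F by simp
  show ?thesis
  proof (rule limcone_eq2[OF H[OF j(2)]])
   fix k v assume kv: "k \<in> Obj K" "v \<in> Ob (fun0 V k)"
   show "whl C (\<delta> (cod1 J u) k v) (whl C (du u A) (g (dom1 J u) x)) = whl C (\<delta> (cod1 J u) k v) (g (cod1 J u) (on_ob (amap (fun1 W u)) x))"
    unfolding U1'[OF u(1) kv g(1)[OF j(1) u(2)] cg] g(4)[OF j(1) u(2) kv] g(4)[OF j(2,3) kv] qe(3)[OF Ek[OF kv(1)] u]
    using u kv j F by simp
  qed (use u j F qe(3)[OF Aobj u] in simp_all)
 qed
 have "lmod C J W (DX A) (%j x. cmp1 C (q0 A j x) F) (%j a. whr C (q1 A j a) F) (%j x. cmp1 C (q0 A j x) G) (%j a. whr C (q1 A j a) G) g"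
  unfolding lmod_def by (intro conjI ballI) (simp_all only: c1 c2 DX_simps, simp_all)
 then obtain e where a: "e \<in> Cell C" "dom2 C e = F" "cod2 C e = G" "!!j x. [|j \<in> Obj J; x \<in> Ob (fun0 W j)|] ==> whl C (q0 A j x) e = g j x"
  using limcone_ex2[OF L[OF Aobj] F] by blast
 have ca: "cod1 C (dom2 C e) = fun0 P A" using a F by simp
 have "whl C (\<pi> k v) e = n k v" if kv: "k \<in> Obj K" "v \<in> Ob (fun0 V k)" for k v
 proof (rule limcone_eq2[OF L[OF Ek[OF kv(1)]]])
  fix j x assume jx: "j \<in> Obj J" "x \<in> Ob (fun0 W j)"
  show "whl C (q0 (fun0 E k) j x) (whl C (\<pi> k v) e) = whl C (q0 (fun0 E k) j x) (n k v)"
   unfolding G4[OF jx kv a(1) ca] a(4)[OF jx] g(4)[OF jx kv] ..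
 qed (use kv a(1-3) F in simp_all)
 then show ?thesis using a(1-3) by blast
qed

theorem limcone_commute: "limcone C K V PE (fun0 P A) \<pi> \<pi>1"
 by (rule limconeI[OF lcone_PE _ B_ex1 B_eq1 B_ex2 B_eq2 B_detect]) (use tk in simp_all)

end

section \<open>Limits in full sub-F-categories and categories of models\<close>

lemma limcone_cong:
 assumes J: "two_category J" and W: "is_two_functor J CAT W"
  and e0: "!!j x. [|j \<in> Obj J; x \<in> Ob (fun0 W j)|] ==> p0 j x = q0 j x"
  and e1: "!!j a. [|j \<in> Obj J; a \<in> Ar (fun0 W j)|] ==> p1 j a = q1 j a"
  and L: "limcone C J W D P p0 p1"
 shows "limcone C J W D P q0 q1"
proof (rule limconeI)
 show "lcone C J W D P q0 q1"
  by (rule lcone_cong[OF J W e0 e1, THEN iffD1, OF _ _ _ _ limcone_lcone[OF L]])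
 show "q0 j x \<in> Tight C" if "j \<in> Obj J" "x \<in> Ob (fun0 W j)" for j x
  using limcone_Tight[OF L that] e0[OF that] by simp
 show "\<exists>f\<in>Mor C. dom1 C f = Y & cod1 C f = P &
    (\<forall>j\<in>Obj J. \<forall>x\<in>Ob (fun0 W j). cmp1 C (q0 j x) f = c0 j x) &
    (\<forall>j\<in>Obj J. \<forall>a\<in>Ar (fun0 W j). whr C (q1 j a) f = c1 j a)" if "lcone C J W D Y c0 c1" for Y c0 c1
  by (rule limcone_ex1[OF L that]) (simp only: e0 e1, blast)
 show "f = g" if "f \<in> Mor C" "g \<in> Mor C" "dom1 C f = dom1 C g" "cod1 C f = P" "cod1 C g = P"
    "!!j x. [|j \<in> Obj J; x \<in> Ob (fun0 W j)|] ==> cmp1 C (q0 j x) f = cmp1 C (q0 j x) g"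
    "!!j a. [|j \<in> Obj J; a \<in> Ar (fun0 W j)|] ==> whr C (q1 j a) f = whr C (q1 j a) g" for f g
  by (rule limcone_eq1[OF L that(1-5)]) (simp_all only: e0 e1 that(6,7))
 show "\<exists>n\<in>Cell C. dom2 C n = f & cod2 C n = g & (\<forall>j\<in>Obj J. \<forall>x\<in>Ob (fun0 W j). whl C (q0 j x) n = m j x)"
  if a: "f \<in> Mor C" "g \<in> Mor C" "dom1 C f = dom1 C g" "cod1 C f = P" "cod1 C g = P" and
    m: "lmod C J W D (%j x. cmp1 C (q0 j x) f) (%j a. whr C (q1 j a) f) (%j x. cmp1 C (q0 j x) g) (%j a. whr C (q1 j a) g) m"
  for f g m
 proof -
  have m': "lmod C J W D (%j x. cmp1 C (p0 j x) f) (%j a. whr C (p1 j a) f) (%j x. cmp1 C (p0 j x) g) (%j a. whr C (p1 j a) g) m"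
   by (rule lmod_cong[OF J W, THEN iffD1, OF _ _ _ _ _ m]) (simp_all only: e0 e1)
  show ?thesis by (rule limcone_ex2[OF L a m']) (simp only: e0, blast)
 qed
 show "n = b" if "n \<in> Cell C" "b \<in> Cell C" "dom2 C n = dom2 C b" "cod2 C n = cod2 C b" "cod1 C (dom2 C n) = P"
    "!!j x. [|j \<in> Obj J; x \<in> Ob (fun0 W j)|] ==> whl C (q0 j x) n = whl C (q0 j x) b" for n b
  by (rule limcone_eq2[OF L that(1-5)]) (simp_all only: e0 that(6))
 show "f \<in> Tight C" if "f \<in> Mor C" "cod1 C f = P" "!!j x. [|j \<in> Obj J; x \<in> Ob (fun0 W j)|] ==> cmp1 C (q0 j x) f \<in> Tight C" for f
  by (rule limcone_detect[OF L that(1,2)]) (simp only: e0 that(3))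
qed

lemma lcone_full_subfcat:
 assumes W: "cat_weight J W" and D: "!!j. j \<in> Obj J ==> fun0 D j \<in> Q"
 shows "lcone (full_subfcat C Q) J W D Y c0 c1 \<longleftrightarrow> Y \<in> Q & lcone C J W D Y c0 c1"
proof -
 interpret cat_weight J W by (rule W)
 show ?thesis
 proof
  assume "lcone (full_subfcat C Q) J W D Y c0 c1"
  then show "Y \<in> Q & lcone C J W D Y c0 c1" by (simp add: lcone_def)
 next
  assume "Y \<in> Q & lcone C J W D Y c0 c1"
  then show "lcone (full_subfcat C Q) J W D Y c0 c1" using D by (simp add: lcone_def)
 qed
qed

text \<open>By fullness a mediating cell belongs to the subcategory as soon as its ends do, and its
  tightness is inherited from \<open>C\<close>.\<close>

lemma limcone_full_subfcat:
 assumes C: "fcategory C" and W: "cat_weight J W" and D: "!!j. j \<in> Obj J ==> fun0 D j \<in> Q" and P: "P \<in> Q"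
  and L: "limcone C J W D P p0 p1"
 shows "limcone (full_subfcat C Q) J W D P p0 p1"
proof (rule limconeI)
 interpret C: fcategory C by (rule C)
 note lf = lcone_full_subfcat[OF W D]
 note l = limcone_lcone[OF L, unfolded lcone_def]
 have p: "dom1 C (p0 j x) = P" "cod1 C (p0 j x) = fun0 D j" if "j \<in> Obj J" "x \<in> Ob (fun0 W j)" for j x
  using limcone_lcone[OF L] that by (simp_all add: lcone_def)
 show "lcone (full_subfcat C Q) J W D P p0 p1" using limcone_lcone[OF L] P by (simp add: lf)
 show "p0 j x \<in> Tight (full_subfcat C Q)" if "j \<in> Obj J" "x \<in> Ob (fun0 W j)" for j x
  using limcone_Tight[OF L that] p[OF that] P D[OF that(1)] by simp
 show "\<exists>f\<in>Mor (full_subfcat C Q). dom1 (full_subfcat C Q) f = Y & cod1 (full_subfcat C Q) f = P &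
    (\<forall>j\<in>Obj J. \<forall>x\<in>Ob (fun0 W j). cmp1 (full_subfcat C Q) (p0 j x) f = c0 j x) &
    (\<forall>j\<in>Obj J. \<forall>a\<in>Ar (fun0 W j). hcmp (full_subfcat C Q) (p1 j a) (id2 (full_subfcat C Q) f) = c1 j a)"
  if "lcone (full_subfcat C Q) J W D Y c0 c1" for Y c0 c1
 proof -
  have Y: "Y \<in> Q" "lcone C J W D Y c0 c1" using that by (simp_all add: lf)
  show ?thesis
   by (rule limcone_ex1[OF L Y(2)]) (use Y(1) P in \<open>auto intro!: bexI\<close>)
 qed
 show "f = g" if "f \<in> Mor (full_subfcat C Q)" "g \<in> Mor (full_subfcat C Q)" "dom1 (full_subfcat C Q) f = dom1 (full_subfcat C Q) g"
   "cod1 (full_subfcat C Q) f = P" "cod1 (full_subfcat C Q) g = P"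
   "!!j x. [|j \<in> Obj J; x \<in> Ob (fun0 W j)|] ==> cmp1 (full_subfcat C Q) (p0 j x) f = cmp1 (full_subfcat C Q) (p0 j x) g"
   "!!j a. [|j \<in> Obj J; a \<in> Ar (fun0 W j)|] ==> hcmp (full_subfcat C Q) (p1 j a) (id2 (full_subfcat C Q) f) = hcmp (full_subfcat C Q) (p1 j a) (id2 (full_subfcat C Q) g)"
  for f g
  by (rule limcone_eq1[OF L]) (use that in simp_all)
 show "\<exists>e\<in>Cell (full_subfcat C Q). dom2 (full_subfcat C Q) e = f & cod2 (full_subfcat C Q) e = g &
   (\<forall>j\<in>Obj J. \<forall>x\<in>Ob (fun0 W j). hcmp (full_subfcat C Q) (id2 (full_subfcat C Q) (p0 j x)) e = m j x)"
  if a: "f \<in> Mor (full_subfcat C Q)" "g \<in> Mor (full_subfcat C Q)" "dom1 (full_subfcat C Q) f = dom1 (full_subfcat C Q) g"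
   "cod1 (full_subfcat C Q) f = P" "cod1 (full_subfcat C Q) g = P"
   "lmod (full_subfcat C Q) J W D (%j x. cmp1 (full_subfcat C Q) (p0 j x) f) (%j a. hcmp (full_subfcat C Q) (p1 j a) (id2 (full_subfcat C Q) f))
    (%j x. cmp1 (full_subfcat C Q) (p0 j x) g) (%j a. hcmp (full_subfcat C Q) (p1 j a) (id2 (full_subfcat C Q) g)) m"
  for f g m
 proof -
  have m: "lmod C J W D (%j x. cmp1 C (p0 j x) f) (%j a. whr C (p1 j a) f) (%j x. cmp1 C (p0 j x) g) (%j a. whr C (p1 j a) g) m"
   using a(6) by (simp add: lmod_def)
  have b: "f \<in> Mor C" "g \<in> Mor C" "dom1 C f = dom1 C g" "cod1 C f = P" "cod1 C g = P" "dom1 C f \<in> Q" using a by simp_all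
  obtain e where "e \<in> Cell C" "dom2 C e = f" "cod2 C e = g" "!!j x. [|j \<in> Obj J; x \<in> Ob (fun0 W j)|] ==> whl C (p0 j x) e = m j x"
   using limcone_ex2[OF L b(1-5) m] by blast
  then show ?thesis using b P by (intro bexI[of _ e]) simp_all
 qed
 show "e = n" if "e \<in> Cell (full_subfcat C Q)" "n \<in> Cell (full_subfcat C Q)" "dom2 (full_subfcat C Q) e = dom2 (full_subfcat C Q) n"
   "cod2 (full_subfcat C Q) e = cod2 (full_subfcat C Q) n" "cod1 (full_subfcat C Q) (dom2 (full_subfcat C Q) e) = P"
   "!!j x. [|j \<in> Obj J; x \<in> Ob (fun0 W j)|] ==> hcmp (full_subfcat C Q) (id2 (full_subfcat C Q) (p0 j x)) e = hcmp (full_subfcat C Q) (id2 (full_subfcat C Q) (p0 j x)) n"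
  for e n
  by (rule limcone_eq2[OF L]) (use that in simp_all)
 show "f \<in> Tight (full_subfcat C Q)" if "f \<in> Mor (full_subfcat C Q)" "cod1 (full_subfcat C Q) f = P"
  "!!j x. [|j \<in> Obj J; x \<in> Ob (fun0 W j)|] ==> cmp1 (full_subfcat C Q) (p0 j x) f \<in> Tight (full_subfcat C Q)" for f
 proof -
  have "f \<in> Tight C" by (rule limcone_detect[OF L]) (use that in simp_all)
  then show ?thesis using that by simp
 qed
qed

section \<open>Uniqueness and transport of limits\<close>

context cone_data
begin

text \<open>The two comparison 1-cells are mutually inverse by uniqueness. They are tight by
  detection, because their composites with the legs are the legs of the other cone.\<close>

lemma limcone_unique:
 assumes L: "limcone C J W D P p0 p1" and L': "limcone C J W D P' p0' p1'"
 obtains f g where "f \<in> Tight C" "dom1 C f = P" "cod1 C f = P'" "g \<in> Tight C" "dom1 C g = P'" "cod1 C g = P"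
  "cmp1 C g f = id1 C P" "cmp1 C f g = id1 C P'"
  "!!j x. [|j \<in> Obj J; x \<in> Ob (fun0 W j)|] ==> cmp1 C (p0' j x) f = p0 j x"
  "!!j a. [|j \<in> Obj J; a \<in> Ar (fun0 W j)|] ==> whr C (p1' j a) f = p1 j a"
proof -
 note p [simp] = limcone_p[OF limcone_lcone[OF L]] limcone_p[OF limcone_lcone[OF L']]
 have P [simp]: "P \<in> Obj C" "P' \<in> Obj C" using limcone_lcone[OF L] limcone_lcone[OF L'] by (simp_all add: lcone_def)
 obtain f where f: "f \<in> Mor C" "dom1 C f = P" "cod1 C f = P'"
  and f0: "!!j x. [|j \<in> Obj J; x \<in> Ob (fun0 W j)|] ==> cmp1 C (p0' j x) f = p0 j x"
  and f1: "!!j a. [|j \<in> Obj J; a \<in> Ar (fun0 W j)|] ==> whr C (p1' j a) f = p1 j a"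
  using limcone_ex1[OF L' limcone_lcone[OF L]] by blast
 obtain g where g: "g \<in> Mor C" "dom1 C g = P'" "cod1 C g = P"
  and g0: "!!j x. [|j \<in> Obj J; x \<in> Ob (fun0 W j)|] ==> cmp1 C (p0 j x) g = p0' j x"
  and g1: "!!j a. [|j \<in> Obj J; a \<in> Ar (fun0 W j)|] ==> whr C (p1 j a) g = p1' j a"
  using limcone_ex1[OF L limcone_lcone[OF L']] by blast
 note [simp] = f g
 have h0: "cmp1 C (p0 j x) (cmp1 C g f) = p0 j x" "cmp1 C (p0' j x) (cmp1 C f g) = p0' j x" if jx: "j \<in> Obj J" "x \<in> Ob (fun0 W j)" for j x
 proof -
  have "cmp1 C (p0 j x) (cmp1 C g f) = cmp1 C (cmp1 C (p0 j x) g) f" "cmp1 C (p0' j x) (cmp1 C f g) = cmp1 C (cmp1 C (p0' j x) f) g"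
   using jx by simp_all
  then show "cmp1 C (p0 j x) (cmp1 C g f) = p0 j x" "cmp1 C (p0' j x) (cmp1 C f g) = p0' j x"
   unfolding f0[OF jx] g0[OF jx] .
 qed
 have h1: "whr C (p1 j a) (cmp1 C g f) = p1 j a" "whr C (p1' j a) (cmp1 C f g) = p1' j a" if ja: "j \<in> Obj J" "a \<in> Ar (fun0 W j)" for j a
 proof -
  have "whr C (p1 j a) (cmp1 C g f) = whr C (whr C (p1 j a) g) f"
   "whr C (p1' j a) (cmp1 C f g) = whr C (whr C (p1' j a) f) g"
   using ja by simp_all
  then show "whr C (p1 j a) (cmp1 C g f) = p1 j a" "whr C (p1' j a) (cmp1 C f g) = p1' j a"
   unfolding f1[OF ja] g1[OF ja] .
 qed
 show ?thesis
 proof (rule that[of f g])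
  show "f \<in> Tight C" by (rule limcone_detect[OF L' f(1,3)]) (simp add: f0 limcone_Tight[OF L])
  show "g \<in> Tight C" by (rule limcone_detect[OF L g(1,3)]) (simp add: g0 limcone_Tight[OF L'])
  show "cmp1 C g f = id1 C P" by (rule limcone_eq1[OF L]) (simp_all add: h0 h1)
  show "cmp1 C f g = id1 C P'" by (rule limcone_eq1[OF L']) (simp_all add: h0 h1)
 qed (fact f g f0 f1)+
qed

text \<open>Mediating cells for the given limit cone are composed with \<open>g\<close>. Uniqueness
  and detection are carried over by composing with \<open>f\<close> and cancelling \<open>g\<close>
  after \<open>f\<close>.\<close>

lemma limcone_iso:
 assumes L: "limcone C J W D P' p0' p1'" and l: "lcone C J W D P p0 p1"
  and f: "f \<in> Tight C" "dom1 C f = P" "cod1 C f = P'" and g: "g \<in> Tight C" "dom1 C g = P'" "cod1 C g = P"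
  and gf: "cmp1 C g f = id1 C P" and fg: "cmp1 C f g = id1 C P'"
  and f0: "!!j x. [|j \<in> Obj J; x \<in> Ob (fun0 W j)|] ==> cmp1 C (p0' j x) f = p0 j x"
  and f1: "!!j a. [|j \<in> Obj J; a \<in> Ar (fun0 W j)|] ==> whr C (p1' j a) f = p1 j a"
 shows "limcone C J W D P p0 p1"
proof -
 note p [simp] = limcone_p[OF l] limcone_p[OF limcone_lcone[OF L]]
 have P [simp]: "P \<in> Obj C" "P' \<in> Obj C" using l limcone_lcone[OF L] by (simp_all add: lcone_def)
 have fM [simp]: "f \<in> Mor C" "g \<in> Mor C" using f g by simp_all
 note [simp] = f g
 have e0: "cmp1 C (p0' j x) (cmp1 C f h) = cmp1 C (p0 j x) h" if jx: "j \<in> Obj J" "x \<in> Ob (fun0 W j)" and h: "h \<in> Mor C" "cod1 C h = P" for j x h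
 proof -
  have "cmp1 C (p0' j x) (cmp1 C f h) = cmp1 C (cmp1 C (p0' j x) f) h" using jx h by simp
  then show ?thesis unfolding f0[OF jx] .
 qed
 have e1: "whr C (p1' j a) (cmp1 C f h) = whr C (p1 j a) h" if ja: "j \<in> Obj J" "a \<in> Ar (fun0 W j)" and h: "h \<in> Mor C" "cod1 C h = P" for j a h
 proof -
  have "whr C (p1' j a) (cmp1 C f h) = whr C (whr C (p1' j a) f) h" using ja h by simp
  then show ?thesis unfolding f1[OF ja] .
 qed
 have e2: "whl C (p0' j x) (whl C f n) = whl C (p0 j x) n" if jx: "j \<in> Obj J" "x \<in> Ob (fun0 W j)" and a: "n \<in> Cell C" "cod1 C (dom2 C n) = P" for j x n
 proof -
  have "whl C (p0' j x) (whl C f n) = whl C (cmp1 C (p0' j x) f) n" using jx a by simp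
  then show ?thesis unfolding f0[OF jx] .
 qed
 have c: "cmp1 C g (cmp1 C f h) = h" if "h \<in> Mor C" "cod1 C h = P" for h
 proof -
  have "cmp1 C g (cmp1 C f h) = cmp1 C (cmp1 C g f) h" using that by simp
  then show ?thesis unfolding gf using that by simp
 qed
 have c': "cmp1 C f (cmp1 C g h) = h" if "h \<in> Mor C" "cod1 C h = P'" for h
 proof -
  have "cmp1 C f (cmp1 C g h) = cmp1 C (cmp1 C f g) h" using that by simp
  then show ?thesis unfolding fg using that by simp
 qed
 have d: "whl C g (whl C f n) = n" if "n \<in> Cell C" "cod1 C (dom2 C n) = P" for n
 proof -
  have "whl C g (whl C f n) = whl C (cmp1 C g f) n" using that by simp
  then show ?thesis unfolding gf using that by simp
 qed
 have d': "whl C f (whl C g n) = n" if "n \<in> Cell C" "cod1 C (dom2 C n) = P'" for n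
 proof -
  have "whl C f (whl C g n) = whl C (cmp1 C f g) n" using that by simp
  then show ?thesis unfolding fg using that by simp
 qed
 show ?thesis
 proof (rule limconeI[OF l])
  show "p0 j x \<in> Tight C" if jx: "j \<in> Obj J" "x \<in> Ob (fun0 W j)" for j x
   unfolding f0[OF jx, symmetric] by (rule C.Tight_cmp1[OF f(1) limcone_Tight[OF L jx]]) (use jx in simp)
 next
  fix Y c0 c1 assume "lcone C J W D Y c0 c1"
  from limcone_ex1[OF L this] obtain h where h: "h \<in> Mor C" "dom1 C h = Y" "cod1 C h = P'"
   "!!j x. [|j \<in> Obj J; x \<in> Ob (fun0 W j)|] ==> cmp1 C (p0' j x) h = c0 j x"
   "!!j a. [|j \<in> Obj J; a \<in> Ar (fun0 W j)|] ==> whr C (p1' j a) h = c1 j a" by blast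
  have gh: "cmp1 C g h \<in> Mor C" "cod1 C (cmp1 C g h) = P" "dom1 C (cmp1 C g h) = Y" using h by simp_all
  show "\<exists>f\<in>Mor C. dom1 C f = Y & cod1 C f = P & (\<forall>j\<in>Obj J. \<forall>x\<in>Ob (fun0 W j). cmp1 C (p0 j x) f = c0 j x) &
    (\<forall>j\<in>Obj J. \<forall>a\<in>Ar (fun0 W j). whr C (p1 j a) f = c1 j a)"
  proof (intro bexI[of _ "cmp1 C g h"] conjI ballI gh)
   fix j x assume jx: "j \<in> Obj J" "x \<in> Ob (fun0 W j)"
   show "cmp1 C (p0 j x) (cmp1 C g h) = c0 j x"
    unfolding e0[OF jx gh(1,2), symmetric] c'[OF h(1,3)] by (rule h(4)[OF jx])
  next
   fix j a assume ja: "j \<in> Obj J" "a \<in> Ar (fun0 W j)"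
   show "whr C (p1 j a) (cmp1 C g h) = c1 j a"
    unfolding e1[OF ja gh(1,2), symmetric] c'[OF h(1,3)] by (rule h(5)[OF ja])
  qed
 next
  fix h k assume hk: "h \<in> Mor C" "k \<in> Mor C" "dom1 C h = dom1 C k" "cod1 C h = P" "cod1 C k = P"
   and a: "!!j x. [|j \<in> Obj J; x \<in> Ob (fun0 W j)|] ==> cmp1 C (p0 j x) h = cmp1 C (p0 j x) k"
   "!!j a. [|j \<in> Obj J; a \<in> Ar (fun0 W j)|] ==> whr C (p1 j a) h = whr C (p1 j a) k"
  have "cmp1 C f h = cmp1 C f k"
  proof (rule limcone_eq1[OF L])
   show "cmp1 C (p0' j x) (cmp1 C f h) = cmp1 C (p0' j x) (cmp1 C f k)" if "j \<in> Obj J" "x \<in> Ob (fun0 W j)" for j x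
    unfolding e0[OF that hk(1,4)] e0[OF that hk(2,5)] by (rule a(1)[OF that])
   show "whr C (p1' j a) (cmp1 C f h) = whr C (p1' j a) (cmp1 C f k)" if "j \<in> Obj J" "a \<in> Ar (fun0 W j)" for j a
    unfolding e1[OF that hk(1,4)] e1[OF that hk(2,5)] by (rule a(2)[OF that])
  qed (use hk in simp_all)
  then have "cmp1 C g (cmp1 C f h) = cmp1 C g (cmp1 C f k)" by (rule arg_cong)
  then show "h = k" unfolding c[OF hk(1,4)] c[OF hk(2,5)] .
 next
  fix h k m assume hk: "h \<in> Mor C" "k \<in> Mor C" "dom1 C h = dom1 C k" "cod1 C h = P" "cod1 C k = P"
   and m: "lmod C J W D (%j x. cmp1 C (p0 j x) h) (%j a. whr C (p1 j a) h) (%j x. cmp1 C (p0 j x) k) (%j a. whr C (p1 j a) k) m"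
  have m': "lmod C J W D (%j x. cmp1 C (p0' j x) (cmp1 C f h)) (%j a. whr C (p1' j a) (cmp1 C f h)) (%j x. cmp1 C (p0' j x) (cmp1 C f k)) (%j a. whr C (p1' j a) (cmp1 C f k)) m"
   by (rule lmod_cong[OF J.two_category_axioms W, THEN iffD1, OF _ _ _ _ _ m]) (simp_all only: e0[OF _ _ hk(1,4)] e0[OF _ _ hk(2,5)] e1[OF _ _ hk(1,4)] e1[OF _ _ hk(2,5)])
  have fh: "cmp1 C f h \<in> Mor C" "cmp1 C f k \<in> Mor C" "dom1 C (cmp1 C f h) = dom1 C (cmp1 C f k)" "cod1 C (cmp1 C f h) = P'" "cod1 C (cmp1 C f k) = P'" using hk by simp_all
  obtain n where a: "n \<in> Cell C" "dom2 C n = cmp1 C f h" "cod2 C n = cmp1 C f k" "!!j x. [|j \<in> Obj J; x \<in> Ob (fun0 W j)|] ==> whl C (p0' j x) n = m j x"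
   using limcone_ex2[OF L fh m'] by blast
  have ca: "cod1 C (dom2 C n) = P'" by (simp only: a fh)
  have b: "whl C g n \<in> Cell C" "dom2 C (whl C g n) = h" "cod2 C (whl C g n) = k"
   using a(1-3) ca c[OF hk(1,4)] c[OF hk(2,5)] by simp_all
  have cb: "cod1 C (dom2 C (whl C g n)) = P" by (simp only: b hk)
  show "\<exists>n\<in>Cell C. dom2 C n = h & cod2 C n = k & (\<forall>j\<in>Obj J. \<forall>x\<in>Ob (fun0 W j). whl C (p0 j x) n = m j x)"
  proof (intro bexI[of _ "whl C g n"] conjI ballI b)
   fix j x assume jx: "j \<in> Obj J" "x \<in> Ob (fun0 W j)"
   show "whl C (p0 j x) (whl C g n) = m j x"
    unfolding e2[OF jx b(1) cb, symmetric] d'[OF a(1) ca] by (rule a(4)[OF jx])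
  qed
 next
  fix n \<beta> assume a: "n \<in> Cell C" "\<beta> \<in> Cell C" "dom2 C n = dom2 C \<beta>" "cod2 C n = cod2 C \<beta>" "cod1 C (dom2 C n) = P"
   and e: "!!j x. [|j \<in> Obj J; x \<in> Ob (fun0 W j)|] ==> whl C (p0 j x) n = whl C (p0 j x) \<beta>"
  have b: "cod1 C (dom2 C \<beta>) = P" using a by simp
  have "whl C f n = whl C f \<beta>"
  proof (rule limcone_eq2[OF L])
   show "whl C (p0' j x) (whl C f n) = whl C (p0' j x) (whl C f \<beta>)" if "j \<in> Obj J" "x \<in> Ob (fun0 W j)" for j x
    unfolding e2[OF that a(1,5)] e2[OF that a(2) b] by (rule e[OF that])
  qed (use a in simp_all)
  then have "whl C g (whl C f n) = whl C g (whl C f \<beta>)" by (rule arg_cong)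
  then show "n = \<beta>" unfolding d[OF a(1,5)] d[OF a(2) b] .
 next
  fix h assume h: "h \<in> Mor C" "cod1 C h = P" and t: "!!j x. [|j \<in> Obj J; x \<in> Ob (fun0 W j)|] ==> cmp1 C (p0 j x) h \<in> Tight C"
  have "cmp1 C f h \<in> Tight C"
   by (rule limcone_detect[OF L]) (use h t e0[OF _ _ h] in simp_all)
  then have "cmp1 C g (cmp1 C f h) \<in> Tight C" by (rule C.Tight_cmp1[OF _ g(1)]) (use h in simp)
  then show "h \<in> Tight C" unfolding c[OF h] .
 qed
qed

end

section \<open>Categories of models\<close>

lemma is_ffunctor_full_subfcat:
 assumes A: "fcategory A" and F: "fcategory F"
 shows "is_ffunctor A (full_subfcat F Q) D \<longleftrightarrow> is_ffunctor A F D & (\<forall>X\<in>Obj A. fun0 D X \<in> Q)"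
proof
 assume "is_ffunctor A (full_subfcat F Q) D"
 then interpret D: ffunctor A "full_subfcat F Q" D by (intro ffunctorI A fcategory_full_subfcat F)
 note d = D.fun0_Obj D.fun1_Mor D.fun2_Cell D.fun1_Tight D.dom1_fun1 D.cod1_fun1
 have "is_two_functor A F D"
  by (rule is_two_functorI[OF fcategory_two[OF A] fcategory_two[OF F]])
   (use d D.fun0_ext D.fun1_ext D.fun2_ext D.dom2_fun2 D.cod2_fun2 D.fun1_id1 D.fun2_id2 D.fun1_cmp1 D.fun2_vcmp D.fun2_hcmp in \<open>simp_all add: PiE_iff\<close>)
 then show "is_ffunctor A F D & (\<forall>X\<in>Obj A. fun0 D X \<in> Q)"
  using d by (simp add: is_ffunctor_def)
next
 assume a: "is_ffunctor A F D & (\<forall>X\<in>Obj A. fun0 D X \<in> Q)"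
 then interpret D: ffunctor A F D by (intro ffunctorI A F) simp
 have "is_two_functor A (full_subfcat F Q) D"
  by (rule is_two_functorI[OF fcategory_two[OF A] fcategory_two[OF fcategory_full_subfcat[OF F]]])
   (use a D.fun0_ext D.fun1_ext D.fun2_ext in \<open>simp_all add: PiE_iff\<close>)
 then show "is_ffunctor A (full_subfcat F Q) D" using a by (simp add: is_ffunctor_def)
qed

lemma ground_limit_cone_sketch [simp]: "ground (limit_cone_sketch C) = C"
 by (simp add: limit_cone_sketch_def)

abbreviation "models S C \<equiv> {M. sketch_morphism S (limit_cone_sketch C) M}"

lemma Mod_eq: "Mod w S (limit_cone_sketch C) = full_subfcat (Fun w (ground S) C) (models S C)"
 by (simp add: Mod_def)

lemma model_iff: "sketch_morphism S (limit_cone_sketch C) M \<longleftrightarrow>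
  is_ffunctor (ground S) C M & (\<forall>c\<in>cones S. limit_cone C (image_cone M c))"
 by (simp add: sketch_morphism_def limit_cone_sketch_def)

lemma shape_plus_weight [simp]: "shape (plus_weight J W) = chordate J"
 by (simp add: plus_weight_def)

lemma weighted_cone_dgm: "weighted_cone C c ==> is_ffunctor (shape (wgt c)) C (dgm c)"
 by (simp add: weighted_cone_def)

text \<open>\<open>image_cone\<close> cuts its legs down to the carriers, so the extensionality half
  of \<open>limit_cone_iff\<close> is automatic and preservation of a specified cone becomes a
  purely elementary condition.\<close>

lemma image_limit_iff:
 assumes S: "fcategory S" and C: "fcategory C" and cw: "cat_weight K V" and w: "wgt c = plus_weight K V"
  and c: "weighted_cone S c" and M: "is_ffunctor S C M"
 shows "limit_cone C (image_cone M c) \<longleftrightarrow> limcone C K V (comp_ffunctor (chordate K) M (dgm c)) (fun0 M (apex c))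
   (%k v. fun1 M (on_ob (legs c k) v)) (%k b. fun2 M (on_ar (legs c k) b))"
proof -
 interpret cat_weight K V by (rule cw)
 have d: "is_ffunctor (chordate K) S (dgm c)" using weighted_cone_dgm[OF c] by (simp add: w)
 interpret I: cone_data K V C "comp_ffunctor (chordate K) M (dgm c)"
  by (rule cone_dataI[OF cw C is_ffunctor_comp[OF fcategory_chordate[OF J.two_category_axioms] S C d M]])
 have i: "wgt (image_cone M c) = plus_weight K V" "dgm (image_cone M c) = comp_ffunctor (chordate K) M (dgm c)" "apex (image_cone M c) = fun0 M (apex c)"
  by (simp_all add: image_cone_def w)
 have l: "legs (image_cone M c) = (\<lambda>k\<in>Obj K. comp_functor (fun0 V k) \<lparr>on_ob = fun1 M, on_ar = fun2 M\<rparr> (legs c k))"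
  by (simp add: image_cone_def w cong: restrict_cong)
 have ext: "legs_ext K V (legs (image_cone M c))"
  unfolding l by (simp add: legs_ext_def comp_functor_def)
 have e: "on_ob (legs (image_cone M c) k) v = fun1 M (on_ob (legs c k) v)" if "k \<in> Obj K" "v \<in> Ob (fun0 V k)" for k v
  using that by (simp add: l comp_functor_def compose_def)
 have e': "on_ar (legs (image_cone M c) k) b = fun2 M (on_ar (legs c k) b)" if "k \<in> Obj K" "b \<in> Ar (fun0 V k)" for k b
  using that by (simp add: l comp_functor_def compose_def)
 show ?thesis
  unfolding I.limit_cone_iff[OF i(1,2)] i(3)
 proof
  assume "legs_ext K V (legs (image_cone M c)) &
   limcone C K V (comp_ffunctor (chordate K) M (dgm c)) (fun0 M (apex c)) (%j. on_ob (legs (image_cone M c) j)) (%j. on_ar (legs (image_cone M c) j))"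
  then show "limcone C K V (comp_ffunctor (chordate K) M (dgm c)) (fun0 M (apex c)) (%k v. fun1 M (on_ob (legs c k) v)) (%k b. fun2 M (on_ar (legs c k) b))"
   by (elim conjE) (rule limcone_cong[OF J.two_category_axioms W e e'])
 next
  assume L: "limcone C K V (comp_ffunctor (chordate K) M (dgm c)) (fun0 M (apex c)) (%k v. fun1 M (on_ob (legs c k) v)) (%k b. fun2 M (on_ar (legs c k) b))"
  show "legs_ext K V (legs (image_cone M c)) &
   limcone C K V (comp_ffunctor (chordate K) M (dgm c)) (fun0 M (apex c)) (%j. on_ob (legs (image_cone M c) j)) (%j. on_ar (legs (image_cone M c) j))"
   by (rule conjI[OF ext limcone_cong[OF J.two_category_axioms W e[symmetric] e'[symmetric] L]])
 qed
qed

lemma tight_limit_weightE: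
 assumes "tight_limit_weight \<omega>"
 obtains J W where "cat_weight J W" "\<omega> = plus_weight J W"
 using assms by (auto simp: tight_limit_weight_def cat_weight_def cat_weight_axioms_def)

locale model_setting =
 fixes w :: weakness
  and \<Psi> :: "('oj, 'mj, 'cj, 'x, 'y) weight set"
  and S :: "('oj, 'mj, 'cj, 'x, 'y, 'os, 'ms, 'cs) sketch"
  and C :: "('o, 'm, 'c) fcat"
 assumes tight: "!!\<omega>. \<omega> \<in> \<Psi> ==> tight_limit_weight \<omega>"
  and sketch: "limit_sketch \<Psi> S"
  and complete: "complete_fcat \<Psi> C"
begin

abbreviation "\<M> \<equiv> Mod w S (limit_cone_sketch C)"
abbreviation "\<F> \<equiv> Fun w (ground S) C"

lemma fS: "fcategory (ground S)" using sketch by (simp add: limit_sketch_def is_sketch_def)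
lemma fC: "fcategory C" using complete by (simp add: complete_fcat_def)
lemma fF: "fcategory \<F>" by (rule fcategory_Fun[OF fS fC])
lemma fM: "fcategory \<M>" unfolding Mod_eq by (rule fcategory_full_subfcat[OF fF])

lemma sketch_cone:
 assumes "c \<in> cones S"
 obtains K V where "cat_weight K V" "wgt c = plus_weight K V" "weighted_cone (ground S) c" "plus_weight K V \<in> \<Psi>"
proof -
 have "wgt c \<in> \<Psi>" "weighted_cone (ground S) c" using sketch assms by (simp_all add: limit_sketch_def is_sketch_def)
 then show ?thesis using that tight tight_limit_weightE by metis
qed

lemma diagram:
 assumes cw: "cat_weight J W" and D: "is_ffunctor (chordate J) \<M> D"
 shows "is_ffunctor (chordate J) \<F> D" "!!j. j \<in> Obj J ==> fun0 D j \<in> models S C" "Fun_cone (ground S) C J W w D"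
proof -
 interpret cat_weight J W by (rule cw)
 note f = is_ffunctor_full_subfcat[OF fcategory_chordate[OF J.two_category_axioms] fF, of "models S C" D]
 show 1: "is_ffunctor (chordate J) \<F> D" and "!!j. j \<in> Obj J ==> fun0 D j \<in> models S C"
  using D unfolding Mod_eq f chordate_simps by blast+
 show "Fun_cone (ground S) C J W w D"
  using fS fC cw 1 by (simp add: Fun_cone_def Fun_cone_axioms_def)
qed

text \<open>The pointwise description is returned together with the limit, because
  \<open>Mod_limit_pointwise\<close> compares an arbitrary limit cone with this one.\<close>

lemma pointwise_limit:
 assumes cw: "cat_weight J W" and D: "is_ffunctor (chordate J) \<M> D" and \<omega>: "plus_weight J W \<in> \<Psi>"
 obtains P p0 p1 where "Fun_pointwise (ground S) C J W w D P p0 p1" "P \<in> models S C" "limcone \<M> J W D P p0 p1"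
proof -
 note d = diagram[OF cw D]
 interpret FC: Fun_cone "ground S" C J W w D by (rule d(3))
 define \<kappa> where "\<kappa> X = (SOME \<kappa>. limit_cone C \<kappa> & wgt \<kappa> = plus_weight J W & dgm \<kappa> = FC.DX X)" for X
 have \<kappa>: "limit_cone C (\<kappa> X)" "wgt (\<kappa> X) = plus_weight J W" "dgm (\<kappa> X) = FC.DX X" if X: "X \<in> Obj (ground S)" for X
 proof -
  have "\<exists>\<kappa>. limit_cone C \<kappa> & wgt \<kappa> = plus_weight J W & dgm \<kappa> = FC.DX X"
   using complete \<omega> FC.is_ffunctor_DX[OF X] unfolding complete_fcat_def by (metis shape_plus_weight)
  from someI_ex[OF this, folded \<kappa>_def]
  show "limit_cone C (\<kappa> X)" "wgt (\<kappa> X) = plus_weight J W" "dgm (\<kappa> X) = FC.DX X" by blast+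
 qed
 have L0: "limcone C J W (FC.DX X) (apex (\<kappa> X)) (%j. on_ob (legs (\<kappa> X) j)) (%j. on_ar (legs (\<kappa> X) j))" if X: "X \<in> Obj (ground S)" for X
  using \<kappa>[OF X] cone_data.limit_cone_iff[OF FC.cone_data_DX[OF X] \<kappa>(2,3)[OF X]] by blast
 interpret FL: Fun_limits "ground S" C J W w D "%X. apex (\<kappa> X)" "%X j. on_ob (legs (\<kappa> X) j)" "%X j. on_ar (legs (\<kappa> X) j)"
  by unfold_locales (rule L0)
 interpret FP: Fun_pointwise "ground S" C J W w D FL.P FL.pl0 FL.pl1 by (rule FL.Fun_pointwise_pl)
 have "limit_cone C (image_cone FL.P \<kappa>')" if k: "\<kappa>' \<in> cones S" for \<kappa>'
 proof -
  obtain K V where KV: "cat_weight K V" "wgt \<kappa>' = plus_weight K V" "weighted_cone (ground S) \<kappa>'" by (rule sketch_cone[OF k])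
  interpret KV: cat_weight K V by (rule KV(1))
  have E: "is_ffunctor (chordate K) (ground S) (dgm \<kappa>')" using weighted_cone_dgm[OF KV(3)] by (simp add: KV(2))
  interpret CS: cone_data K V "ground S" "dgm \<kappa>'" by (rule cone_dataI[OF KV(1) fS E])
  have wc: "legs_ext K V (legs \<kappa>') & lcone (ground S) K V (dgm \<kappa>') (apex \<kappa>') (%j. on_ob (legs \<kappa>' j)) (%j. on_ar (legs \<kappa>' j)) &
    (\<forall>j\<in>Obj K. \<forall>x\<in>Ob (fun0 V j). on_ob (legs \<kappa>' j) x \<in> Tight (ground S))"
   using KV(3) unfolding CS.weighted_cone_iff[OF KV(2) refl] .
  have H: "limcone C K V (comp_ffunctor (chordate K) (fun0 D j) (dgm \<kappa>')) (fun0 (fun0 D j) (apex \<kappa>'))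
    (%k v. fun1 (fun0 D j) (on_ob (legs \<kappa>' k) v)) (%k b. fun2 (fun0 D j) (on_ar (legs \<kappa>' k) b))" if j: "j \<in> Obj J" for j
  proof -
   have "is_ffunctor (ground S) C (fun0 D j)" "limit_cone C (image_cone (fun0 D j) \<kappa>')"
    using d(2)[OF j] k by (simp_all add: model_iff)
   then show ?thesis using image_limit_iff[OF fS fC KV] by blast
  qed
  \<comment> \<open>The outer limit is the one being constructed, the inner one the specified cone,
    which every \<open>D j\<close> preserves because it is a model.\<close>
  interpret CL: commuting_limits "ground S" C J W w D FL.P FL.pl0 FL.pl1 K V "dgm \<kappa>'" "apex \<kappa>'" "%j. on_ob (legs \<kappa>' j)" "%j. on_ar (legs \<kappa>' j)"
   by unfold_locales (use E wc H in blast)+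
  show ?thesis unfolding image_limit_iff[OF fS fC KV FP.ffP] by (rule CL.limcone_commute)
 qed
 then have P: "FL.P \<in> models S C" using FP.ffP by (simp add: model_iff)
 have "limcone \<M> J W D FL.P FL.pl0 FL.pl1"
  unfolding Mod_eq by (rule limcone_full_subfcat[OF fF cw d(2) P FP.limcone_Fun])
 then show ?thesis using that[OF FP.Fun_pointwise_axioms P] by blast
qed

theorem complete_Mod: "complete_fcat \<Psi> \<M>"
proof -
 have "\<exists>c. limit_cone \<M> c & wgt c = \<omega> & dgm c = D" if \<omega>: "\<omega> \<in> \<Psi>" and D: "is_ffunctor (shape \<omega>) \<M> D" for \<omega> D
 proof -
  obtain J W where cw: "cat_weight J W" and \<omega>e: "\<omega> = plus_weight J W" using tight_limit_weightE[OF tight[OF \<omega>]] by blast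
  interpret cat_weight J W by (rule cw)
  have D': "is_ffunctor (chordate J) \<M> D" using D by (simp add: \<omega>e)
  obtain P p0 p1 where L: "limcone \<M> J W D P p0 p1" using pointwise_limit[OF cw D' \<omega>[unfolded \<omega>e]] by blast
  interpret CD: cone_data J W \<M> D by (rule cone_dataI[OF cw fM D'])
  \<comment> \<open>\<open>limcone\<close> determines the legs only on the carriers; a cone needs
    them extensional.\<close>
  let ?l = "\<lambda>j\<in>Obj J. \<lparr>on_ob = restrict (p0 j) (Ob (fun0 W j)), on_ar = restrict (p1 j) (Ar (fun0 W j))\<rparr>"
  let ?c = "\<lparr>wgt = plus_weight J W, dgm = D, apex = P, legs = ?l\<rparr>"
  have "limcone \<M> J W D P (%j. on_ob (?l j)) (%j. on_ar (?l j))"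
   by (rule limcone_cong[OF J.two_category_axioms W _ _ L]) simp_all
  moreover have "legs_ext J W ?l" by (simp add: legs_ext_def)
  ultimately have "limit_cone \<M> ?c" by (subst CD.limit_cone_iff) simp_all
  then show ?thesis by (intro exI[of _ ?c]) (simp add: \<omega>e)
 qed
 then show ?thesis using fM by (simp add: complete_fcat_def)
qed

text \<open>A pointwise limit cone is a limit cone by \<open>limcone_Fun\<close>. Conversely, a
  limit cone is isomorphic, by a tight isomorphism, to the one of \<open>pointwise_limit\<close>,
  and evaluating the isomorphism at \<open>X\<close> transports the limit property in
  \<open>C\<close>.\<close>

theorem Mod_limit_pointwise:
 assumes cw: "cat_weight J W" and D: "is_ffunctor (chordate J) \<M> D" and \<omega>: "plus_weight J W \<in> \<Psi>"
  and l: "lcone \<M> J W D P p0 p1" and t: "!!j x. [|j \<in> Obj J; x \<in> Ob (fun0 W j)|] ==> p0 j x \<in> Tight \<M>"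
 shows "limcone \<M> J W D P p0 p1 \<longleftrightarrow> (\<forall>X\<in>Obj (ground S).
   limcone C J W (comp_ffunctor (chordate J) (ev w (ground S) C X) D) (fun0 P X) (%j x. at_ob (amap (p0 j x)) X) (%j a. amap (p1 j a) X))"
proof -
 note d = diagram[OF cw D]
 interpret FC: Fun_cone "ground S" C J W w D by (rule d(3))
 have "P \<in> models S C & lcone \<F> J W D P p0 p1"
  by (rule iffD1[OF lcone_full_subfcat[OF cw] l[unfolded Mod_eq]]) (rule d(2))
 then have l': "P \<in> models S C" "lcone \<F> J W D P p0 p1" by (rule conjunct1, rule conjunct2)
 show ?thesis unfolding FC.DX_def[symmetric]
 proof (intro iffI ballI)
  assume a: "\<forall>X\<in>Obj (ground S). limcone C J W (FC.DX X) (fun0 P X) (%j x. at_ob (amap (p0 j x)) X) (%j a. amap (p1 j a) X)"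
  have t': "p0 j x \<in> Tight \<F>" if "j \<in> Obj J" "x \<in> Ob (fun0 W j)" for j x using t[OF that] by (simp add: Mod_eq)
  interpret FP: Fun_pointwise "ground S" C J W w D P p0 p1
   by unfold_locales (use l'(2) t' a in blast)+
  show "limcone \<M> J W D P p0 p1"
   unfolding Mod_eq by (rule limcone_full_subfcat[OF fF cw d(2) l'(1) FP.limcone_Fun])
 next
  fix X assume L: "limcone \<M> J W D P p0 p1" and X: "X \<in> Obj (ground S)"
  obtain P' p0' p1' where FP': "Fun_pointwise (ground S) C J W w D P' p0' p1'" and L': "limcone \<M> J W D P' p0' p1'"
   by (rule pointwise_limit[OF cw D \<omega>])
  interpret FP: Fun_pointwise "ground S" C J W w D P' p0' p1' by (rule FP')
  interpret CD: cone_data J W \<M> D by (rule cone_dataI[OF cw fM D])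
  obtain f g where fg: "f \<in> Tight \<M>" "dom1 \<M> f = P" "cod1 \<M> f = P'" "g \<in> Tight \<M>" "dom1 \<M> g = P'" "cod1 \<M> g = P"
   "cmp1 \<M> g f = id1 \<M> P" "cmp1 \<M> f g = id1 \<M> P'"
   "!!j x. [|j \<in> Obj J; x \<in> Ob (fun0 W j)|] ==> cmp1 \<M> (p0' j x) f = p0 j x"
   "!!j a. [|j \<in> Obj J; a \<in> Ar (fun0 W j)|] ==> whr \<M> (p1' j a) f = p1 j a"
   using CD.limcone_unique[OF L L'] by blast
  have fM: "f \<in> Tight \<F>" "g \<in> Tight \<F>" "f \<in> Mor \<F>" "g \<in> Mor \<F>" "adom f = P" "acod f = P'" "adom g = P'" "acod g = P"
   using fg(1-6) by (simp_all add: Mod_eq Tight_Fun)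
  note ff = Mor_Fun_simps(4,5)[OF fS fC fM(3) X, unfolded fM] and gg = Mor_Fun_simps(4,5)[OF fS fC fM(4) X, unfolded fM]
  have tX: "at_ob (amap f) X \<in> Tight C" "at_ob (amap g) X \<in> Tight C" using fM(1,2) X by (simp_all add: Tight_Fun)
  show "limcone C J W (FC.DX X) (fun0 P X) (%j x. at_ob (amap (p0 j x)) X) (%j a. amap (p1 j a) X)"
  proof (rule cone_data.limcone_iso[OF FC.cone_data_DX[OF X] FP.L[OF X] FC.lcone_ev[OF l'(2) X] tX(1) ff tX(2) gg])
   show "cmp1 C (at_ob (amap g) X) (at_ob (amap f) X) = id1 C (fun0 P X)"
    using arg_cong[OF fg(7), of "%z. at_ob (amap z) X"] X by (simp add: Mod_eq comp_transf_def id_transf_def)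
   show "cmp1 C (at_ob (amap f) X) (at_ob (amap g) X) = id1 C (fun0 P' X)"
    using arg_cong[OF fg(8), of "%z. at_ob (amap z) X"] X by (simp add: Mod_eq comp_transf_def id_transf_def)
   show "cmp1 C (at_ob (amap (p0' j x)) X) (at_ob (amap f) X) = at_ob (amap (p0 j x)) X" if "j \<in> Obj J" "x \<in> Ob (fun0 W j)" for j x
    using arg_cong[OF fg(9)[OF that], of "%z. at_ob (amap z) X"] X by (simp add: Mod_eq comp_transf_def)
   show "whr C (amap (p1' j a) X) (at_ob (amap f) X) = amap (p1 j a) X" if "j \<in> Obj J" "a \<in> Ar (fun0 W j)" for j a
    using arg_cong[OF fg(10)[OF that], of "%z. amap z X"] X by (simp add: Mod_eq)
  qed
 qed
qed

end

section \<open>Transposition\<close>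

lemma dual_simps [simp]:
 "dual (dual w) = w" "dual w = Pseudo \<longleftrightarrow> w = Pseudo" "dual w = Strict \<longleftrightarrow> w = Strict"
 "dual w = Colax \<longleftrightarrow> w = Lax" "dual w = Lax \<longleftrightarrow> w = Colax"
 by (cases w; simp)+

text \<open>A \<open>w\<close>-cell depends on its square only through the two composites
  \<open>a\<close> (right after top) and \<open>b\<close> (bottom after left). Recording just these
  allows such cells to be whiskered and pasted without naming sides.\<close>

definition wcell :: "weakness => ('o, 'm, 'c) fcat => 'm => 'm => 'c => bool" where
 "wcell w C a b \<alpha> \<longleftrightarrow> wgood w C \<alpha> & \<alpha> \<in> Cell C &
   dom2 C \<alpha> = (if w = Colax then b else a) & cod2 C \<alpha> = (if w = Colax then a else b)"

lemma w_cell_iff: "w_cell w C f g h k a \<longleftrightarrow> wcell w C (cmp1 C h f) (cmp1 C k g) a"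
 by (cases w) (auto simp: wcell_def wgood_def cell_between_def)

text \<open>Transposing a square exchanges its two composites, so that a \<open>w\<close>-cell becomes a
 \<open>dual w\<close>-cell; only in the pseudo case the 2-cell itself has to be inverted.\<close>

definition flip :: "weakness => ('o, 'm, 'c) fcat => 'c => 'c" where
 "flip w C \<alpha> = (if w = Pseudo then SOME \<beta>. \<beta> \<in> Cell C & dom2 C \<beta> = cod2 C \<alpha> & cod2 C \<beta> = dom2 C \<alpha> &
   vcmp C \<beta> \<alpha> = id2 C (dom2 C \<alpha>) & vcmp C \<alpha> \<beta> = id2 C (cod2 C \<alpha>) else \<alpha>)"

lemma flip_not_Pseudo: "w \<noteq> Pseudo ==> flip w C a = a"
 by (simp add: flip_def)

lemma flip_dual [simp]: "flip (dual w) = flip w"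
 by (simp add: flip_def fun_eq_iff)

lemma wgood_dual [simp]: "wgood (dual w) = wgood w"
 by (simp add: wgood_def fun_eq_iff)

context fcategory
begin

lemma flip_Pseudo:
 assumes "invertible_cell C a"
 shows "flip Pseudo C a \<in> Cell C" "dom2 C (flip Pseudo C a) = cod2 C a" "cod2 C (flip Pseudo C a) = dom2 C a"
  "vcmp C (flip Pseudo C a) a = id2 C (dom2 C a)" "vcmp C a (flip Pseudo C a) = id2 C (cod2 C a)"
proof -
 have "\<exists>b. b \<in> Cell C & dom2 C b = cod2 C a & cod2 C b = dom2 C a &
   vcmp C b a = id2 C (dom2 C a) & vcmp C a b = id2 C (cod2 C a)"
  using assms unfolding invertible_cell_def by blast
 from someI_ex[OF this] have "flip Pseudo C a \<in> Cell C & dom2 C (flip Pseudo C a) = cod2 C a & cod2 C (flip Pseudo C a) = dom2 C a &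
  vcmp C (flip Pseudo C a) a = id2 C (dom2 C a) & vcmp C a (flip Pseudo C a) = id2 C (cod2 C a)"
  by (simp add: flip_def)
 then show "flip Pseudo C a \<in> Cell C" "dom2 C (flip Pseudo C a) = cod2 C a" "cod2 C (flip Pseudo C a) = dom2 C a"
  "vcmp C (flip Pseudo C a) a = id2 C (dom2 C a)" "vcmp C a (flip Pseudo C a) = id2 C (cod2 C a)"
  by blast+
qed

lemma flip_unique:
 assumes "a \<in> Cell C" "b \<in> Cell C" "dom2 C b = cod2 C a" "cod2 C b = dom2 C a"
  "vcmp C b a = id2 C (dom2 C a)" "vcmp C a b = id2 C (cod2 C a)"
 shows "flip Pseudo C a = b"
proof -
 have "invertible_cell C a" unfolding invertible_cell_def using assms by blast
 note f = flip_Pseudo[OF this]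
 show ?thesis by (rule inverse_unique[OF assms(1) f(1) assms(2) refl refl f(2) assms(4) f(3) assms(3) f(4) assms(6)])
qed

lemma flip_identity: "identity_cell C a ==> flip w C a = a"
 by (cases "w = Pseudo") (auto simp: identity_cell_def flip_not_Pseudo intro!: flip_unique)

lemma flip_id2 [simp]: "f \<in> Mor C ==> flip w C (id2 C f) = id2 C f"
 by (rule flip_identity) simp

lemma wcell_flip:
 assumes "wcell (dual w) C a b e" shows "wcell w C b a (flip w C e)"
proof (cases "w = Pseudo")
 case True
 then have i: "invertible_cell C e" and t: "e \<in> Cell C" "dom2 C e = a" "cod2 C e = b" using assms by (simp_all add: wcell_def wgood_def)
 note f = flip_Pseudo[OF i]
 have "invertible_cell C (flip Pseudo C e)" unfolding invertible_cell_def using f t(1) by (intro bexI[of _ e]) simp_all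
 then show ?thesis using f t by (simp add: True wcell_def wgood_def)
next
 case False
 then show ?thesis using assms
  by (cases w) (auto simp: wcell_def wgood_def flip_not_Pseudo dest: identity_cell_eq)
qed

lemma flip_flip:
 assumes "wcell w C a b e" shows "flip w C (flip w C e) = e"
proof (cases "w = Pseudo")
 case True
 then have i: "invertible_cell C e" and t: "e \<in> Cell C" using assms by (simp_all add: wcell_def wgood_def)
 note f = flip_Pseudo[OF i]
 show ?thesis unfolding True by (rule flip_unique) (use f t in simp_all)
qed (simp add: flip_not_Pseudo)

text \<open>For lax and colax cells the two readings are the same equation, for strict cells both
  say that \<nu> and \<mu> agree, and for pseudo cells the square is inverted by
  \<open>square_inverse\<close>.\<close>

lemma slides_flip:
 assumes \<phi>: "wcell (dual w) C a b \<phi>" and q: "wcell (dual w) C a' b' q"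
  and \<nu>: "\<nu> \<in> Cell C" "dom2 C \<nu> = a" "cod2 C \<nu> = a'" and \<mu>: "\<mu> \<in> Cell C" "dom2 C \<mu> = b" "cod2 C \<mu> = b'"
  and sl: "slides (dual w) C \<phi> q \<nu> \<mu>"
 shows "slides w C (flip w C \<phi>) (flip w C q) \<mu> \<nu>"
proof (cases w)
 case Pseudo
 then have i: "invertible_cell C \<phi>" "invertible_cell C q"
  and t: "\<phi> \<in> Cell C" "dom2 C \<phi> = a" "cod2 C \<phi> = b" "q \<in> Cell C" "dom2 C q = a'" "cod2 C q = b'"
  using \<phi> q by (simp_all add: wcell_def wgood_def)
 note f = flip_Pseudo[OF i(1), unfolded t] flip_Pseudo[OF i(2), unfolded t]
 have "vcmp C \<nu> (flip Pseudo C \<phi>) = vcmp C (flip Pseudo C q) \<mu>"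
  by (rule square_inverse[OF t(1-3) f(1-3) t(4-6) f(6-8) \<nu> \<mu> f(5) f(9)]) (use sl Pseudo in \<open>simp add: slides_def\<close>)
 then show ?thesis by (simp add: slides_def Pseudo)
next
 case Strict
 then have i: "identity_cell C \<phi>" "identity_cell C q"
  and t: "\<phi> \<in> Cell C" "dom2 C \<phi> = a" "cod2 C \<phi> = b" "q \<in> Cell C" "dom2 C q = a'" "cod2 C q = b'"
  using \<phi> q by (simp_all add: wcell_def wgood_def)
 have e: "\<phi> = id2 C a" "b = a" "q = id2 C a'" "b' = a'" using identity_cell_eq[OF i(1)] identity_cell_eq[OF i(2)] t by simp_all
 show ?thesis using sl \<nu> \<mu> by (simp add: slides_def Strict flip_not_Pseudo e)
qed (use sl in \<open>simp_all add: slides_def flip_not_Pseudo\<close>)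

lemma wcell_vpaste:
 "[|wcell w C a b e; wcell w C b c n|] ==> wcell w C a c (vpaste w C n e)"
 by (auto simp: wcell_def vpaste_def intro!: wgood_vcmp)

text \<open>Inverting a pseudo composite reverses its factors. For lax and colax the reversal is
  already built into \<open>vpaste\<close>, whose order changes with the weakness.\<close>

lemma flip_vpaste:
 assumes m: "wcell (dual w) C a b m" and n: "wcell (dual w) C b c n"
 shows "flip w C (vpaste (dual w) C n m) = vpaste w C (flip w C m) (flip w C n)"
proof (cases w)
 case Pseudo
 then have i: "invertible_cell C m" "invertible_cell C n"
  and t: "m \<in> Cell C" "dom2 C m = a" "cod2 C m = b" "n \<in> Cell C" "dom2 C n = b" "cod2 C n = c"
  using m n by (simp_all add: wcell_def wgood_def)
 note f = flip_Pseudo[OF i(1), unfolded t] flip_Pseudo[OF i(2), unfolded t]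
 let ?a = "flip Pseudo C m" and ?b = "flip Pseudo C n"
 have "vcmp C (vcmp C ?a ?b) (vcmp C n m) = vcmp C ?a (vcmp C (vcmp C ?b n) m)"
  using f(1-3,6-8) t by simp
 also have "\<dots> = id2 C a" using f t by (simp del: vcmp_assoc)
 finally have 1: "vcmp C (vcmp C ?a ?b) (vcmp C n m) = id2 C a" .
 have "vcmp C (vcmp C n m) (vcmp C ?a ?b) = vcmp C n (vcmp C (vcmp C m ?a) ?b)"
  using f(1-3,6-8) t by simp
 also have "\<dots> = id2 C c" using f t by (simp del: vcmp_assoc)
 finally have 2: "vcmp C (vcmp C n m) (vcmp C ?a ?b) = id2 C c" .
 have "flip Pseudo C (vcmp C n m) = vcmp C ?a ?b"
  by (rule flip_unique) (use 1 2 f(1-3,6-8) t in \<open>simp_all del: vcmp_assoc\<close>)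
 then show ?thesis by (simp add: Pseudo vpaste_def)
next
 case Strict
 then have i: "identity_cell C m" "identity_cell C n"
  and t: "dom2 C m = a" "cod2 C m = b" "dom2 C n = b"
  using m n by (simp_all add: wcell_def wgood_def)
 have e: "m = id2 C a" "b = a" "n = id2 C a" using identity_cell_eq[OF i(1)] identity_cell_eq[OF i(2)] t by simp_all
 show ?thesis by (simp add: vpaste_def Strict flip_not_Pseudo e)
qed (simp_all add: vpaste_def flip_not_Pseudo)

text \<open>Whiskering preserves inverses, and outside the pseudo case \<open>flip\<close> is the
  identity. The disjunction on \<open>w'\<close> guarantees that \<open>e\<close> is invertible when
  \<open>w\<close> is \<open>Pseudo\<close>.\<close>

lemma flip_hcmp_left:
 assumes e: "wcell w' C a b e" "w' = w \<or> w' = dual w" and f: "f \<in> Mor C" "cod1 C (dom2 C e) = dom1 C f"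
 shows "flip w C (whl C f e) = whl C f (flip w C e)"
proof (cases "w = Pseudo")
 case True
 then have i: "invertible_cell C e" and t: "e \<in> Cell C"
  using e by (auto simp: wcell_def wgood_def)
 note p = flip_Pseudo[OF i]
 have t': "dom1 C f = cod1 C (dom2 C e)" using f by simp
 show ?thesis unfolding True
  by (rule flip_unique; (subst hcmp_vcmp_left[symmetric])?; simp add: t t' f(1) p)
qed (simp add: flip_not_Pseudo)

lemma flip_hcmp_right:
 assumes e: "wcell w' C a b e" "w' = w \<or> w' = dual w" and f: "f \<in> Mor C" "cod1 C f = dom1 C (dom2 C e)"
 shows "flip w C (whr C e f) = whr C (flip w C e) f"
proof (cases "w = Pseudo")
 case True
 then have i: "invertible_cell C e" and t: "e \<in> Cell C"
  using e by (auto simp: wcell_def wgood_def)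
 note p = flip_Pseudo[OF i]
 show ?thesis unfolding True
  by (rule flip_unique; (subst hcmp_vcmp_right[symmetric])?; simp add: t f p)
qed (simp add: flip_not_Pseudo)

lemma wcell_hcmp_left:
 assumes "wcell w C a b e" "f \<in> Mor C" "cod1 C (dom2 C e) = dom1 C f"
 shows "wcell w C (cmp1 C f a) (cmp1 C f b) (whl C f e)"
 using assms by (auto simp: wcell_def intro!: wgood_hcmp)

lemma wcell_hcmp_right:
 assumes "wcell w C a b e" "f \<in> Mor C" "cod1 C f = dom1 C (dom2 C e)"
 shows "wcell w C (cmp1 C a f) (cmp1 C b f) (whr C e f)"
 using assms by (auto simp: wcell_def intro!: wgood_hcmp)

text \<open>The six faces of a cube: \<open>p\<close>, \<open>q\<close>, \<open>u\<close>, \<open>r\<close> are \<open>dual w\<close>-cells and \<open>v\<close>, \<open>x\<close> are \<open>w\<close>-cells.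
 Read in one direction the cube is a modification axiom for \<open>w\<close>-natural transformations with values
 in \<open>dual w\<close>-natural ones; read in the other direction it is one for the transposed data.\<close>

lemma cube_flip:
 assumes p: "wcell (dual w) C e0 e1 p" and q: "wcell (dual w) C e1 e2 q"
  and u: "wcell (dual w) C f0 f1 u" and r: "wcell (dual w) C f1 f2 r"
  and v: "wcell w C e0 f0 v" and x: "wcell w C e2 f2 x"
  and H: "if w = Colax then slides (dual w) C (vpaste (dual w) C r u) (vpaste (dual w) C q p) v x
   else slides (dual w) C (vpaste (dual w) C q p) (vpaste (dual w) C r u) v x"
 shows "if dual w = Colax then slides w C (vpaste w C (flip w C r) x) (vpaste w C v (flip w C p)) q u
   else slides w C (vpaste w C v (flip w C p)) (vpaste w C (flip w C r) x) q u"
proof (cases w)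
 case Pseudo
 then have i: "invertible_cell C p" "invertible_cell C r"
  and t: "p \<in> Cell C" "dom2 C p = e0" "cod2 C p = e1" "r \<in> Cell C" "dom2 C r = f1" "cod2 C r = f2"
   "q \<in> Cell C" "dom2 C q = e1" "cod2 C q = e2" "u \<in> Cell C" "dom2 C u = f0" "cod2 C u = f1"
   "v \<in> Cell C" "dom2 C v = e0" "cod2 C v = f0" "x \<in> Cell C" "dom2 C x = e2" "cod2 C x = f2"
  using p q u r v x by (simp_all add: wcell_def wgood_def)
 note f = flip_Pseudo[OF i(1), unfolded t] flip_Pseudo[OF i(2), unfolded t]
 \<comment> \<open>The hexagon is regarded as a square with opposite sides \<open>p\<close> and
   \<open>r\<close>, the two cells to be inverted.\<close>
 have "vcmp C (vcmp C x q) p = vcmp C r (vcmp C u v)" using H t by (simp add: Pseudo slides_def vpaste_def)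
 from square_inverse[OF t(1-3) f(1-3) t(4-6) f(6-8) _ _ _ _ _ _ f(5) f(9) this]
 have "vcmp C (vcmp C u v) (flip Pseudo C p) = vcmp C (flip Pseudo C r) (vcmp C x q)" using t by simp
 then show ?thesis using t f(1-3,6-8) by (simp add: Pseudo slides_def vpaste_def)
next
 case Strict
 then have "identity_cell C p" "identity_cell C q" "identity_cell C u" "identity_cell C r" "identity_cell C v" "identity_cell C x"
  and t: "dom2 C p = e0" "cod2 C p = e1" "dom2 C r = f1" "cod2 C r = f2"
   "dom2 C q = e1" "cod2 C q = e2" "dom2 C u = f0" "cod2 C u = f1"
   "dom2 C v = e0" "cod2 C v = f0" "dom2 C x = e2" "cod2 C x = f2"
  using p q u r v x by (simp_all add: wcell_def wgood_def)
 note this(1-6)[THEN identity_cell_eq]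
 then have "p = id2 C e0" "q = id2 C e0" "u = id2 C e0" "r = id2 C e0" "v = id2 C e0" "x = id2 C e0" unfolding t by simp_all
 moreover have "e0 \<in> Mor C" using p dom2_Mor by (auto simp: wcell_def Strict)
 ultimately show ?thesis by (simp add: Strict slides_def vpaste_def flip_not_Pseudo)
next
 case Lax
 then show ?thesis using p q u r v x H by (simp add: slides_def vpaste_def flip_not_Pseudo wcell_def)
next
 case Colax
 then show ?thesis using p q u r v x H by (simp add: slides_def vpaste_def flip_not_Pseudo wcell_def)
qed

end

lemma (in w_nat) at_mor_wcell:
 "s \<in> Mor S ==> wcell w C (cmp1 C (fun1 N s) (at_ob \<phi> (dom1 S s))) (cmp1 C (at_ob \<phi> (cod1 S s)) (fun1 M s)) (at_mor \<phi> s)"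
 using w_natural by (simp add: w_natural_def w_cell_iff)

section \<open>Identity and invertible 2-cells of a functor category\<close>

context
 fixes S :: "('os, 'ms, 'cs) fcat" and C :: "('o, 'm, 'c) fcat" and w :: weakness
 assumes S: "fcategory S" and C: "fcategory C"
begin

interpretation S: fcategory S by (rule S)
interpretation C: fcategory C by (rule C)
interpretation B: fcategory "Fun w S C" by (rule fcategory_Fun[OF S C])

lemma identity_cell_FunD:
 assumes "identity_cell (Fun w S C) a" "X \<in> Obj S" shows "identity_cell C (amap a X)"
 using assms Mor_Fun_simps(3)[OF S C] by (auto simp: identity_cell_def[of "Fun w S C"])

lemma invertible_cell_FunD:
 assumes i: "invertible_cell (Fun w S C) a" and a: "a \<in> Cell (Fun w S C)" and X: "X \<in> Obj S"
 shows "invertible_cell C (amap a X)"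
proof -
 obtain n where b: "n \<in> Cell (Fun w S C)" "adom n = acod a" "acod n = adom a"
  and e: "vcmp (Fun w S C) n a = id2 (Fun w S C) (adom a)" "vcmp (Fun w S C) a n = id2 (Fun w S C) (acod a)"
  using i by (auto simp: invertible_cell_def[of "Fun w S C"])
 note c = Cell_FunD(5-7)[OF a X] Cell_FunD(5-7)[OF b(1) X]
 show ?thesis unfolding invertible_cell_def
  using c b(2,3) arg_cong[OF e(1), of "%z. amap z X"] arg_cong[OF e(2), of "%z. amap z X"] X
  by (intro bexI[of _ "amap n X"]) simp_all
qed

lemma wgood_FunD:
 "[|wgood w' (Fun w S C) a; a \<in> Cell (Fun w S C); X \<in> Obj S|] ==> wgood w' C (amap a X)"
 by (simp add: wgood_def identity_cell_FunD invertible_cell_FunD)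

text \<open>With identity components the modification axiom says that the structure cells of the two
  ends are equal. Hence the ends themselves are equal, and the cell is the identity on them.\<close>

lemma identity_cell_FunI:
 assumes n: "n \<in> Cell (Fun w S C)" and i: "!!X. X \<in> Obj S ==> identity_cell C (amap n X)"
 shows "identity_cell (Fun w S C) n"
proof -
 note c = Cell_FunD[OF n]
 have e: "amap n X = id2 C (at_ob (amap (adom n)) X)" "at_ob (amap (acod n)) X = at_ob (amap (adom n)) X" if "X \<in> Obj S" for X
  using C.identity_cell_eq[OF i[OF that]] c(6,7)[OF that] by simp_all
 interpret f: w_nat S C "adom (adom n)" "acod (adom n)" w "amap (adom n)" by (rule Mor_FunD[OF S C c(1)])
 interpret g: w_nat S C "adom (adom n)" "acod (adom n)" w "amap (acod n)" using Mor_FunD[OF S C c(2)] by (simp add: c)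
 have m: "modification w S C (adom (adom n)) (acod (adom n)) (amap (adom n)) (amap (acod n)) (amap n)"
  using n by (simp add: Cell_Fun)
 have "at_mor (amap (adom n)) s = at_mor (amap (acod n)) s" if s: "s \<in> Mor S" for s
  using modificationD[OF m s] s e
  by (cases "w = Colax")
   (simp_all add: slides_def f.dom2_at_mor f.cod2_at_mor g.dom2_at_mor g.cod2_at_mor f.dom2_at_mor' f.cod2_at_mor' g.dom2_at_mor' g.cod2_at_mor')
 then have a: "acod n = adom n" by (intro Mor_Fun_eqI[OF c(2,1,3,4)]) (simp_all add: e)
 have "n = id2 (Fun w S C) (adom n)"
  by (rule Cell_Fun_eqI[OF n]) (use id_Cell_Fun[OF S C c(1)] a e in simp_all)
 then show ?thesis unfolding identity_cell_def using c(1) by blast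
qed

text \<open>The componentwise inverses, chosen by \<open>flip Pseudo\<close>, satisfy the
  modification axiom because it is the axiom of \<open>a\<close> with two opposite sides
  inverted.\<close>

lemma invertible_cell_FunI:
 assumes a: "a \<in> Cell (Fun w S C)" and i: "!!X. X \<in> Obj S ==> invertible_cell C (amap a X)"
 shows "invertible_cell (Fun w S C) a"
proof -
 note c = Cell_FunD[OF a]
 interpret f: w_nat S C "adom (adom a)" "acod (adom a)" w "amap (adom a)" by (rule Mor_FunD[OF S C c(1)])
 interpret g: w_nat S C "adom (adom a)" "acod (adom a)" w "amap (acod a)" using Mor_FunD[OF S C c(2)] by (simp add: c)
 let ?M = "adom (adom a)" and ?N = "acod (adom a)" and ?f = "amap (adom a)" and ?g = "amap (acod a)"
 let ?b = "%X. flip Pseudo C (amap a X)"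
 note b = C.flip_Pseudo[OF i]
 have m: "modification w S C ?M ?N ?f ?g (amap a)" using a by (simp add: Cell_Fun)
 have "slides w C (at_mor ?g s) (at_mor ?f s) (whl C (fun1 ?N s) (?b (dom1 S s))) (whr C (?b (cod1 S s)) (fun1 ?M s))"
  if s: "s \<in> Mor S" for s
 proof -
  have X: "dom1 S s \<in> Obj S" "cod1 S s \<in> Obj S" using s by simp_all
  let ?\<nu> = "whl C (fun1 ?N s) (amap a (dom1 S s))" and ?\<mu> = "whr C (amap a (cod1 S s)) (fun1 ?M s)"
  let ?\<nu>' = "whl C (fun1 ?N s) (?b (dom1 S s))" and ?\<mu>' = "whr C (?b (cod1 S s)) (fun1 ?M s)"
  note t = c(5-7)[OF X(1)] c(5-7)[OF X(2)] b(1-3)[OF X(1)] b(1-3)[OF X(2)] s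
  note bb = b(4,5)[OF X(1)] b(4,5)[OF X(2)]
  have i: "vcmp C ?\<nu> ?\<nu>' = id2 C (cod2 C ?\<nu>)" "vcmp C ?\<nu>' ?\<nu> = id2 C (dom2 C ?\<nu>)"
   by (subst C.hcmp_vcmp_left[symmetric]; simp add: t bb)+
  have i': "vcmp C ?\<mu> ?\<mu>' = id2 C (cod2 C ?\<mu>)" "vcmp C ?\<mu>' ?\<mu> = id2 C (dom2 C ?\<mu>)"
   by (subst C.hcmp_vcmp_right[symmetric]; simp add: t bb)+
  have ty: "?\<nu> \<in> Cell C" "?\<nu>' \<in> Cell C" "dom2 C ?\<nu>' = cod2 C ?\<nu>" "cod2 C ?\<nu>' = dom2 C ?\<nu>"
   "?\<mu> \<in> Cell C" "?\<mu>' \<in> Cell C" "dom2 C ?\<mu>' = cod2 C ?\<mu>" "cod2 C ?\<mu>' = dom2 C ?\<mu>"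
   using t by simp_all
  have tt: "at_mor ?f s \<in> Cell C" "at_mor ?g s \<in> Cell C" using s by simp_all
  show ?thesis
  proof (cases "w = Colax")
   case True
   have d: "dom2 C (at_mor ?f s) = dom2 C ?\<mu>" "cod2 C (at_mor ?f s) = dom2 C ?\<nu>" "dom2 C (at_mor ?g s) = cod2 C ?\<mu>" "cod2 C (at_mor ?g s) = cod2 C ?\<nu>"
    using t by (simp_all add: True f.dom2_at_mor' f.cod2_at_mor' g.dom2_at_mor' g.cod2_at_mor')
   have "vcmp C (at_mor ?g s) ?\<mu> = vcmp C ?\<nu> (at_mor ?f s)"
    using modificationD[OF m s] by (simp add: slides_Colax[OF True])
   from C.square_inverse[OF ty(5) refl refl ty(6-8) ty(1) refl refl ty(2-4) tt(1) d(1,2) tt(2) d(3,4) i'(1) i(2) this]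
   show ?thesis by (simp add: slides_Colax[OF True])
  next
   case False
   have d: "dom2 C (at_mor ?f s) = dom2 C ?\<nu>" "cod2 C (at_mor ?f s) = dom2 C ?\<mu>" "dom2 C (at_mor ?g s) = cod2 C ?\<nu>" "cod2 C (at_mor ?g s) = cod2 C ?\<mu>"
    using t False by (simp_all add: f.dom2_at_mor f.cod2_at_mor g.dom2_at_mor g.cod2_at_mor)
   have "vcmp C (at_mor ?g s) ?\<nu> = vcmp C ?\<mu> (at_mor ?f s)"
    using modificationD[OF m s] by (simp add: slides_not_Colax[OF False])
   from C.square_inverse[OF ty(1) refl refl ty(2-4) ty(5) refl refl ty(6-8) tt(1) d(1,2) tt(2) d(3,4) i(1) i'(2) this]
   show ?thesis by (simp add: slides_not_Colax[OF False])
  qed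
 qed
 then have n: "modification w S C ?M ?N ?g ?f (restrict ?b (Obj S))"
  unfolding modification_def cell_between_def using b(1-3) c(6,7) by simp
 let ?\<beta> = "Arr (acod a) (adom a) (restrict ?b (Obj S))"
 have \<beta>: "?\<beta> \<in> Cell (Fun w S C)" using n c(1-4) by (simp add: Cell_Fun)
 have "vcmp (Fun w S C) ?\<beta> a = id2 (Fun w S C) (adom a)" "vcmp (Fun w S C) a ?\<beta> = id2 (Fun w S C) (acod a)"
  using b(4,5) c(6,7) by (simp_all cong: restrict_cong)
 then show ?thesis unfolding invertible_cell_def using \<beta> by (intro bexI[of _ ?\<beta>]) simp_all
qed

lemma wgood_FunI:
 "[|a \<in> Cell (Fun w S C); !!X. X \<in> Obj S ==> wgood w' C (amap a X)|] ==> wgood w' (Fun w S C) a"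
 by (simp add: wgood_def identity_cell_FunI invertible_cell_FunI)

end

section \<open>Transposition of objects\<close>

locale swapping = S: fcategory S + T: fcategory T + C: fcategory C
 for S :: "('os, 'ms, 'cs) fcat" and T :: "('ot, 'mt, 'ct) fcat" and C :: "('o, 'm, 'c) fcat" +
 fixes w :: weakness
begin

abbreviation "\<A> \<equiv> Fun (dual w) T C"
abbreviation "\<B> \<equiv> Fun w S C"

lemma fA: "fcategory \<A>" and fB: "fcategory \<B>"
 by (rule fcategory_Fun; rule S.fcat T.fcat C.fcat)+

sublocale A: fcategory \<A> by (rule fA)
sublocale B: fcategory \<B> by (rule fB)

text \<open>The partial functor \<open>F (-) Y\<close>. As a composite with an evaluation it is an
  \<open>F\<close>-functor without further work.\<close>

definition "pt F Y = comp_ffunctor S (ev (dual w) T C Y) F"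

definition "swt F t = Arr (pt F (dom1 T t)) (pt F (cod1 T t))
 \<lparr>at_ob = \<lambda>X\<in>Obj S. fun1 (fun0 F X) t, at_mor = \<lambda>s\<in>Mor S. flip w C (at_mor (amap (fun1 F s)) t)\<rparr>"

definition "swc F \<tau> = Arr (swt F (dom2 T \<tau>)) (swt F (cod2 T \<tau>)) (\<lambda>X\<in>Obj S. fun2 (fun0 F X) \<tau>)"

definition "swap0 F = \<lparr>fun0 = \<lambda>Y\<in>Obj T. pt F Y, fun1 = \<lambda>t\<in>Mor T. swt F t, fun2 = \<lambda>\<tau>\<in>Cell T. swc F \<tau>\<rparr>"

lemma swap0_simps [simp]:
 "Y \<in> Obj T ==> fun0 (swap0 F) Y = pt F Y"
 "t \<in> Mor T ==> fun1 (swap0 F) t = swt F t"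
 "\<tau> \<in> Cell T ==> fun2 (swap0 F) \<tau> = swc F \<tau>"
 by (simp_all add: swap0_def)

lemma swt_simps [simp]:
 "adom (swt F t) = pt F (dom1 T t)" "acod (swt F t) = pt F (cod1 T t)"
 "X \<in> Obj S ==> at_ob (amap (swt F t)) X = fun1 (fun0 F X) t"
 "s \<in> Mor S ==> at_mor (amap (swt F t)) s = flip w C (at_mor (amap (fun1 F s)) t)"
 by (simp_all add: swt_def)

lemma swc_simps [simp]:
 "adom (swc F \<tau>) = swt F (dom2 T \<tau>)" "acod (swc F \<tau>) = swt F (cod2 T \<tau>)"
 "X \<in> Obj S ==> amap (swc F \<tau>) X = fun2 (fun0 F X) \<tau>"
 by (simp_all add: swc_def)

end

locale swap_object = swapping +
 fixes F assumes F: "is_ffunctor S \<A> F"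

sublocale swap_object \<subseteq> F: ffunctor S \<A> F
 using F by unfold_locales

context swap_object
begin

lemma FX: "X \<in> Obj S ==> ffunctor T C (fun0 F X)"
 using F.fun0_Obj[of X] by (intro ffunctorI T.fcat C.fcat) simp

lemma Fs: "s \<in> Mor S ==> w_nat T C (fun0 F (dom1 S s)) (fun0 F (cod1 S s)) (dual w) (amap (fun1 F s))"
 using Mor_FunD[OF T.fcat C.fcat F.fun1_Mor[of s]] F.dom1_fun1[of s] F.cod1_fun1[of s] by simp

lemma F\<sigma>: "\<sigma> \<in> Cell S ==> modification (dual w) T C (fun0 F (dom1 S (dom2 S \<sigma>))) (fun0 F (cod1 S (dom2 S \<sigma>)))
  (amap (fun1 F (dom2 S \<sigma>))) (amap (fun1 F (cod2 S \<sigma>))) (amap (fun2 F \<sigma>))"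
 using F.fun2_Cell[of \<sigma>] F.dom2_fun2[of \<sigma>] F.cod2_fun2[of \<sigma>] F.dom1_fun1[of "dom2 S \<sigma>"] F.cod1_fun1[of "dom2 S \<sigma>"]
 by (simp add: Cell_Fun)

lemma pt: "Y \<in> Obj T ==> is_ffunctor S C (pt F Y)"
 unfolding pt_def
 by (rule is_ffunctor_comp[OF S.fcat fA C.fcat F is_ffunctor_ev[OF T.fcat C.fcat]])

lemma pt_simps [simp]:
 "X \<in> Obj S ==> fun0 (pt F Y) X = fun0 (fun0 F X) Y"
 "s \<in> Mor S ==> fun1 (pt F Y) s = at_ob (amap (fun1 F s)) Y"
 "z \<in> Cell S ==> fun2 (pt F Y) z = amap (fun2 F z) Y"
 using F.fun0_Obj F.fun1_Mor F.fun2_Cell by (simp_all add: pt_def ev_def)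

lemma flip_wcell:
 assumes s: "s \<in> Mor S" and t: "t \<in> Mor T"
 shows "wcell w C (cmp1 C (at_ob (amap (fun1 F s)) (cod1 T t)) (fun1 (fun0 F (dom1 S s)) t))
  (cmp1 C (fun1 (fun0 F (cod1 S s)) t) (at_ob (amap (fun1 F s)) (dom1 T t)))
  (flip w C (at_mor (amap (fun1 F s)) t))"
 by (rule C.wcell_flip[OF w_nat.at_mor_wcell[OF Fs[OF s] t]])

text \<open>Naturality at a 2-cell \<sigma> of \<open>S\<close> is the modification axiom of
  \<open>fun2 F \<sigma>\<close> at \<open>t\<close>. The composition axiom in \<open>s\<close> is
  the formula for the structure cells of a composite transformation, with the order of the factors
  reversed by \<open>flip\<close>. At tight \<open>s\<close> the cells are identities because
  \<open>fun1 F s\<close> is tight.\<close>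

lemma swt_Mor:
 assumes t: "t \<in> Mor T" shows "swt F t \<in> Mor \<B>"
proof -
 let ?Y = "dom1 T t" and ?Y' = "cod1 T t"
 let ?\<phi> = "%s. flip w C (at_mor (amap (fun1 F s)) t)"
 have Y: "?Y \<in> Obj T" "?Y' \<in> Obj T" using t by simp_all
 have "w_natural w S C (pt F ?Y) (pt F ?Y') (amap (swt F t))"
  unfolding w_natural_def w_cell_iff
 proof (intro conjI ballI impI)
  show "at_ob (amap (swt F t)) \<in> extensional (Obj S)" "at_mor (amap (swt F t)) \<in> extensional (Mor S)"
   by (simp_all add: swt_def)
 next
  fix X assume X: "X \<in> Obj S"
  interpret X: ffunctor T C "fun0 F X" by (rule FX[OF X])
  show "at_ob (amap (swt F t)) X \<in> Mor C" "dom1 C (at_ob (amap (swt F t)) X) = fun0 (pt F ?Y) X"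
   "cod1 C (at_ob (amap (swt F t)) X) = fun0 (pt F ?Y') X"
   using X t by simp_all
  have i: "fun1 F (id1 S X) = id1 \<A> (fun0 F X)" using X by (rule F.fun1_id1)
  show "at_mor (amap (swt F t)) (id1 S X) = id2 C (at_ob (amap (swt F t)) X)"
   using X t by (simp add: i id_transf_def)
 next
  fix s assume s: "s \<in> Mor S"
  show "wcell w C (cmp1 C (fun1 (pt F ?Y') s) (at_ob (amap (swt F t)) (dom1 S s)))
     (cmp1 C (at_ob (amap (swt F t)) (cod1 S s)) (fun1 (pt F ?Y) s)) (at_mor (amap (swt F t)) s)"
   using flip_wcell[OF s t] s by simp
 next
  fix s assume s: "s \<in> Tight S"
  then have s': "s \<in> Mor S" by simp
  have "fun1 F s \<in> Tight \<A>" using s by simp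
  then have "identity_cell C (at_mor (amap (fun1 F s)) t)" using t by (simp add: Tight_Fun)
  then show "identity_cell C (at_mor (amap (swt F t)) s)" using s' by (simp add: C.flip_identity)
 next
  fix s s' assume s: "s \<in> Mor S" "s' \<in> Mor S" "cod1 S s = dom1 S s'"
  interpret f: w_nat T C "fun0 F (dom1 S s)" "fun0 F (cod1 S s)" "dual w" "amap (fun1 F s)" by (rule Fs[OF s(1)])
  interpret g: w_nat T C "fun0 F (cod1 S s)" "fun0 F (cod1 S s')" "dual w" "amap (fun1 F s')" using Fs[OF s(2)] by (simp add: s(3))
  have c: "fun1 F (cmp1 S s' s) = cmp1 \<A> (fun1 F s') (fun1 F s)" using s by (rule F.fun1_cmp1)
  have "at_mor (amap (fun1 F (cmp1 S s' s))) t = vpaste (dual w) C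
    (whl C (at_ob (amap (fun1 F s')) ?Y') (at_mor (amap (fun1 F s)) t))
    (whr C (at_mor (amap (fun1 F s')) t) (at_ob (amap (fun1 F s)) ?Y))"
   using t by (simp add: c comp_transf_def)
  moreover have "wcell (dual w) C (cmp1 C (cmp1 C (fun1 (fun0 F (cod1 S s')) t) (at_ob (amap (fun1 F s')) ?Y)) (at_ob (amap (fun1 F s)) ?Y))
   (cmp1 C (cmp1 C (at_ob (amap (fun1 F s')) ?Y') (fun1 (fun0 F (cod1 S s)) t)) (at_ob (amap (fun1 F s)) ?Y))
   (whr C (at_mor (amap (fun1 F s')) t) (at_ob (amap (fun1 F s)) ?Y))"
   using t by (intro C.wcell_hcmp_right g.at_mor_wcell) simp_all
  moreover have "wcell (dual w) C (cmp1 C (at_ob (amap (fun1 F s')) ?Y') (cmp1 C (fun1 (fun0 F (cod1 S s)) t) (at_ob (amap (fun1 F s)) ?Y)))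
   (cmp1 C (at_ob (amap (fun1 F s')) ?Y') (cmp1 C (at_ob (amap (fun1 F s)) ?Y') (fun1 (fun0 F (dom1 S s)) t)))
   (whl C (at_ob (amap (fun1 F s')) ?Y') (at_mor (amap (fun1 F s)) t))"
   using t by (intro C.wcell_hcmp_left f.at_mor_wcell) simp_all
  ultimately have "?\<phi> (cmp1 S s' s) = vpaste w C
    (flip w C (whr C (at_mor (amap (fun1 F s')) t) (at_ob (amap (fun1 F s)) ?Y)))
    (flip w C (whl C (at_ob (amap (fun1 F s')) ?Y') (at_mor (amap (fun1 F s)) t)))"
   using C.flip_vpaste t by simp
  also have "flip w C (whr C (at_mor (amap (fun1 F s')) t) (at_ob (amap (fun1 F s)) ?Y)) = whr C (?\<phi> s') (at_ob (amap (fun1 F s)) ?Y)"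
   using t by (intro C.flip_hcmp_right[OF g.at_mor_wcell[OF t]]) simp_all
  also have "flip w C (whl C (at_ob (amap (fun1 F s')) ?Y') (at_mor (amap (fun1 F s)) t)) = whl C (at_ob (amap (fun1 F s')) ?Y') (?\<phi> s)"
   using t by (intro C.flip_hcmp_left[OF f.at_mor_wcell[OF t]]) simp_all
  finally show "at_mor (amap (swt F t)) (cmp1 S s' s) = vpaste w C
     (whr C (at_mor (amap (swt F t)) s') (fun1 (pt F ?Y) s))
     (whl C (fun1 (pt F ?Y') s') (at_mor (amap (swt F t)) s))"
   using s by simp
 next
  fix \<sigma> assume \<sigma>: "\<sigma> \<in> Cell S"
  let ?s = "dom2 S \<sigma>" and ?s' = "cod2 S \<sigma>"
  let ?X = "dom1 S ?s" and ?X' = "cod1 S ?s"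
  have s: "?s \<in> Mor S" "?s' \<in> Mor S" "dom1 S ?s' = ?X" "cod1 S ?s' = ?X'" and X: "?X \<in> Obj S" "?X' \<in> Obj S" using \<sigma> by simp_all
  interpret X: ffunctor T C "fun0 F ?X" by (rule FX[OF X(1)])
  interpret X': ffunctor T C "fun0 F ?X'" by (rule FX[OF X(2)])
  interpret f: w_nat T C "fun0 F ?X" "fun0 F ?X'" "dual w" "amap (fun1 F ?s)" by (rule Fs[OF s(1)])
  interpret g: w_nat T C "fun0 F ?X" "fun0 F ?X'" "dual w" "amap (fun1 F ?s')" using Fs[OF s(2)] by (simp only: s)
  note m = F\<sigma>[OF \<sigma>]
  have c: "amap (fun2 F \<sigma>) Y \<in> Cell C" "dom2 C (amap (fun2 F \<sigma>) Y) = at_ob (amap (fun1 F ?s)) Y"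
   "cod2 C (amap (fun2 F \<sigma>) Y) = at_ob (amap (fun1 F ?s')) Y" if "Y \<in> Obj T" for Y
   using m that by (simp_all add: modification_def cell_between_def)
  have "slides w C (?\<phi> ?s) (?\<phi> ?s') (whr C (amap (fun2 F \<sigma>) ?Y') (fun1 (fun0 F ?X) t))
   (whl C (fun1 (fun0 F ?X') t) (amap (fun2 F \<sigma>) ?Y))"
   by (rule C.slides_flip[OF f.at_mor_wcell[OF t] g.at_mor_wcell[OF t] _ _ _ _ _ _ modificationD[OF m t]])
    (use t c[OF Y(1)] c[OF Y(2)] in simp_all)
  then show "slides w C (at_mor (amap (swt F t)) ?s) (at_mor (amap (swt F t)) ?s')
   (whr C (fun2 (pt F ?Y') \<sigma>) (at_ob (amap (swt F t)) ?X))
   (whl C (at_ob (amap (swt F t)) ?X') (fun2 (pt F ?Y) \<sigma>))"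
   using \<sigma> s X by simp
 qed
 then show ?thesis using pt Y by (simp add: Mor_Fun)
qed

text \<open>The modification axiom at \<open>s\<close> is the naturality of \<open>fun1 F s\<close>
  at the 2-cell \<tau>.\<close>

lemma swc_Cell:
 assumes \<tau>: "\<tau> \<in> Cell T" shows "swc F \<tau> \<in> Cell \<B>"
proof -
 let ?t = "dom2 T \<tau>" and ?t' = "cod2 T \<tau>"
 let ?Y = "dom1 T ?t" and ?Y' = "cod1 T ?t"
 have t: "?t \<in> Mor T" "?t' \<in> Mor T" "dom1 T ?t' = ?Y" "cod1 T ?t' = ?Y'" and Y: "?Y \<in> Obj T" "?Y' \<in> Obj T" using \<tau> by simp_all
 have "modification w S C (pt F ?Y) (pt F ?Y') (amap (swt F ?t)) (amap (swt F ?t')) (amap (swc F \<tau>))"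
  unfolding modification_def cell_between_def
 proof (intro conjI ballI)
  show "amap (swc F \<tau>) \<in> extensional (Obj S)" by (simp add: swc_def)
 next
  fix X assume X: "X \<in> Obj S"
  interpret X: ffunctor T C "fun0 F X" by (rule FX[OF X])
  show "amap (swc F \<tau>) X \<in> Cell C" "dom2 C (amap (swc F \<tau>) X) = at_ob (amap (swt F ?t)) X" "cod2 C (amap (swc F \<tau>) X) = at_ob (amap (swt F ?t')) X"
   using X \<tau> by simp_all
 next
  fix s assume s: "s \<in> Mor S"
  let ?X = "dom1 S s" and ?X' = "cod1 S s"
  have X: "?X \<in> Obj S" "?X' \<in> Obj S" using s by simp_all
  interpret f: w_nat T C "fun0 F ?X" "fun0 F ?X'" "dual w" "amap (fun1 F s)" by (rule Fs[OF s(1)])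
  have "slides w C (flip w C (at_mor (amap (fun1 F s)) ?t)) (flip w C (at_mor (amap (fun1 F s)) ?t'))
   (whl C (at_ob (amap (fun1 F s)) ?Y') (fun2 (fun0 F ?X) \<tau>)) (whr C (fun2 (fun0 F ?X') \<tau>) (at_ob (amap (fun1 F s)) ?Y))"
   by (rule C.slides_flip[OF f.at_mor_wcell[OF t(1)] f.at_mor_wcell[OF t(2)] _ _ _ _ _ _ f.at_mor_slides[OF \<tau>]])
    (use t \<tau> Y in simp_all)
  then show "slides w C (at_mor (amap (swt F ?t)) s) (at_mor (amap (swt F ?t')) s)
   (whl C (fun1 (pt F ?Y') s) (amap (swc F \<tau>) ?X))
   (whr C (amap (swc F \<tau>) ?X') (fun1 (pt F ?Y) s))"
   using s X by simp
 qed
 then show ?thesis using swt_Mor[OF t(1)] swt_Mor[OF t(2)] by (simp add: Cell_Fun t)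
qed

lemma swt_id1:
 assumes Y: "Y \<in> Obj T" shows "swt F (id1 T Y) = id1 \<B> (pt F Y)"
proof (rule Mor_Fun_eqI)
 show "swt F (id1 T Y) \<in> Mor \<B>" "id1 \<B> (pt F Y) \<in> Mor \<B>" using swt_Mor[of "id1 T Y"] pt[OF Y] Y B.id1_Mor by simp_all
 show "at_ob (amap (swt F (id1 T Y))) X = at_ob (amap (id1 \<B> (pt F Y))) X" if X: "X \<in> Obj S" for X
 proof -
  interpret X: ffunctor T C "fun0 F X" by (rule FX[OF X])
  show ?thesis using X Y by (simp add: id_transf_def)
 qed
 show "at_mor (amap (swt F (id1 T Y))) s = at_mor (amap (id1 \<B> (pt F Y))) s" if s: "s \<in> Mor S" for s
 proof -
  interpret f: w_nat T C "fun0 F (dom1 S s)" "fun0 F (cod1 S s)" "dual w" "amap (fun1 F s)" by (rule Fs[OF s])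
  show ?thesis using s Y by (simp add: id_transf_def)
 qed
qed (use Y in simp_all)

text \<open>On structure cells this is the composition axiom of \<open>fun1 F s\<close> in
  \<open>t\<close>, which after flipping takes the shape of a composite of transformations.\<close>

lemma swt_cmp1:
 assumes t: "t \<in> Mor T" "t' \<in> Mor T" "cod1 T t = dom1 T t'" shows "swt F (cmp1 T t' t) = cmp1 \<B> (swt F t') (swt F t)"
proof (rule Mor_Fun_eqI)
 have tt: "cmp1 T t' t \<in> Mor T" using t by simp
 show "swt F (cmp1 T t' t) \<in> Mor \<B>" by (rule swt_Mor[OF tt])
 show "cmp1 \<B> (swt F t') (swt F t) \<in> Mor \<B>"
  by (rule B.cmp1_Mor[OF swt_Mor[OF t(1)] swt_Mor[OF t(2)]]) (simp add: t)
 show "adom (swt F (cmp1 T t' t)) = adom (cmp1 \<B> (swt F t') (swt F t))" "acod (swt F (cmp1 T t' t)) = acod (cmp1 \<B> (swt F t') (swt F t))"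
  using t by simp_all
 show "at_ob (amap (swt F (cmp1 T t' t))) X = at_ob (amap (cmp1 \<B> (swt F t') (swt F t))) X" if X: "X \<in> Obj S" for X
 proof -
  interpret X: ffunctor T C "fun0 F X" by (rule FX[OF X])
  show ?thesis using X t by (simp add: comp_transf_def)
 qed
 show "at_mor (amap (swt F (cmp1 T t' t))) s = at_mor (amap (cmp1 \<B> (swt F t') (swt F t))) s" if s: "s \<in> Mor S" for s
 proof -
  let ?M = "fun0 F (dom1 S s)" and ?N = "fun0 F (cod1 S s)"
  interpret f: w_nat T C ?M ?N "dual w" "amap (fun1 F s)" by (rule Fs[OF s])
  let ?\<phi> = "at_mor (amap (fun1 F s))" and ?f = "at_ob (amap (fun1 F s))"
  have h1: "wcell (dual w) C (cmp1 C (fun1 ?N t') (cmp1 C (fun1 ?N t) (?f (dom1 T t)))) (cmp1 C (fun1 ?N t') (cmp1 C (?f (cod1 T t)) (fun1 ?M t)))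
   (whl C (fun1 ?N t') (?\<phi> t))"
   using t by (intro C.wcell_hcmp_left f.at_mor_wcell) simp_all
  have h2: "wcell (dual w) C (cmp1 C (cmp1 C (fun1 ?N t') (?f (dom1 T t'))) (fun1 ?M t)) (cmp1 C (cmp1 C (?f (cod1 T t')) (fun1 ?M t')) (fun1 ?M t))
   (whr C (?\<phi> t') (fun1 ?M t))"
   using t by (intro C.wcell_hcmp_right f.at_mor_wcell) simp_all
  have h2': "wcell (dual w) C (cmp1 C (fun1 ?N t') (cmp1 C (?f (cod1 T t)) (fun1 ?M t))) (cmp1 C (cmp1 C (?f (cod1 T t')) (fun1 ?M t')) (fun1 ?M t))
   (whr C (?\<phi> t') (fun1 ?M t))"
   using h2 t by simp
  have "flip w C (?\<phi> (cmp1 T t' t)) = vpaste w C (flip w C (whl C (fun1 ?N t') (?\<phi> t))) (flip w C (whr C (?\<phi> t') (fun1 ?M t)))"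
   unfolding f.at_mor_cmp1[OF t] by (rule C.flip_vpaste[OF h1 h2'])
  also have "flip w C (whl C (fun1 ?N t') (?\<phi> t)) = whl C (fun1 ?N t') (flip w C (?\<phi> t))"
   using t by (intro C.flip_hcmp_left[OF f.at_mor_wcell[OF t(1)]]) simp_all
  also have "flip w C (whr C (?\<phi> t') (fun1 ?M t)) = whr C (flip w C (?\<phi> t')) (fun1 ?M t)"
   using t by (intro C.flip_hcmp_right[OF f.at_mor_wcell[OF t(2)]]) simp_all
  finally show ?thesis using s by (simp add: comp_transf_def)
 qed
qed

lemma swap0: "is_ffunctor T \<B> (swap0 F)"
proof -
 have "is_two_functor T \<B> (swap0 F)"
 proof (rule is_two_functorI[OF T.two_category_axioms B.two_category_axioms], goal_cases)
  case 1 then show ?case by (simp add: swap0_def pt PiE_iff)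
 next
  case 2 then show ?case by (simp add: swap0_def swt_Mor PiE_iff)
 next
  case 3 then show ?case by (simp add: swap0_def swc_Cell PiE_iff)
 next
  case (4 f) then show ?case by simp
 next
  case (5 a) then show ?case by simp
 next
  case (6 Y) then show ?case using swt_id1[of Y] by simp
 next
  case (7 f)
  have "swc F (id2 T f) = id2 \<B> (swt F f)"
  proof (rule Cell_Fun_eqI)
   show "swc F (id2 T f) \<in> Cell \<B>" using 7 by (intro swc_Cell) simp
   show "id2 \<B> (swt F f) \<in> Cell \<B>" by (rule B.id2_Cell[OF swt_Mor[OF 7]])
   show "amap (swc F (id2 T f)) X = amap (id2 \<B> (swt F f)) X" if X: "X \<in> Obj S" for X
   proof -
    interpret X: ffunctor T C "fun0 F X" by (rule FX[OF X])
    show ?thesis using X 7 by simp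
   qed
  qed (use 7 in simp_all)
  then show ?case using 7 T.id2_Cell[OF 7] by (simp only: swap0_simps)
 next
  case (8 f g) then show ?case using swt_cmp1[of f g] T.cmp1_Mor[of f g] by (simp only: swap0_simps)
 next
  case (9 a b)
  have c: "vcmp T b a \<in> Cell T" using 9 by simp
  have "swc F (vcmp T b a) = vcmp \<B> (swc F b) (swc F a)"
  proof (rule Cell_Fun_eqI)
   show "swc F (vcmp T b a) \<in> Cell \<B>" by (rule swc_Cell[OF c])
   show "vcmp \<B> (swc F b) (swc F a) \<in> Cell \<B>" by (rule B.vcmp_Cell[OF swc_Cell[OF 9(1)] swc_Cell[OF 9(2)]]) (simp add: 9)
   show "amap (swc F (vcmp T b a)) X = amap (vcmp \<B> (swc F b) (swc F a)) X" if X: "X \<in> Obj S" for X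
   proof -
    interpret X: ffunctor T C "fun0 F X" by (rule FX[OF X])
    show ?thesis using X 9 by simp
   qed
  qed (use 9 in simp_all)
  then show ?case using 9 c by (simp only: swap0_simps)
 next
  case (10 a b)
  have c: "hcmp T b a \<in> Cell T" using 10 by simp
  have m: "dom2 T a \<in> Mor T" "dom2 T b \<in> Mor T" "cod2 T a \<in> Mor T" "cod2 T b \<in> Mor T" "cod1 T (cod2 T a) = dom1 T (cod2 T b)" using 10 by simp_all
  have ty: "swc F a \<in> Cell \<B>" "swc F b \<in> Cell \<B>" "cod1 \<B> (dom2 \<B> (swc F a)) = dom1 \<B> (dom2 \<B> (swc F b))"
   using swc_Cell 10 by simp_all
  have "swc F (hcmp T b a) = hcmp \<B> (swc F b) (swc F a)"
  proof (rule Cell_Fun_eqI)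
   show "swc F (hcmp T b a) \<in> Cell \<B>" by (rule swc_Cell[OF c])
   show "hcmp \<B> (swc F b) (swc F a) \<in> Cell \<B>" by (rule B.hcmp_Cell[OF ty])
   have "adom (swc F (hcmp T b a)) = cmp1 \<B> (swt F (dom2 T b)) (swt F (dom2 T a))"
    using swt_cmp1[OF m(1,2) 10(3)] 10 by (simp only: swc_simps T.dom2_hcmp)
   also have "\<dots> = adom (hcmp \<B> (swc F b) (swc F a))" by simp
   finally show "adom (swc F (hcmp T b a)) = adom (hcmp \<B> (swc F b) (swc F a))" .
   have "acod (swc F (hcmp T b a)) = cmp1 \<B> (swt F (cod2 T b)) (swt F (cod2 T a))"
    using swt_cmp1[OF m(3,4,5)] 10 by (simp only: swc_simps T.cod2_hcmp)
   also have "\<dots> = acod (hcmp \<B> (swc F b) (swc F a))" using 10 by simp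
   finally show "acod (swc F (hcmp T b a)) = acod (hcmp \<B> (swc F b) (swc F a))" .
   show "amap (swc F (hcmp T b a)) X = amap (hcmp \<B> (swc F b) (swc F a)) X" if X: "X \<in> Obj S" for X
   proof -
    interpret X: ffunctor T C "fun0 F X" by (rule FX[OF X])
    show ?thesis using X 10 by simp
   qed
  qed
  then show ?case using 10 c by (simp only: swap0_simps)
 qed
 \<comment> \<open>The components are tight since each \<open>fun0 F X\<close> preserves tightness;
   the structure cells are identities since \<open>fun1 F s\<close> is strict at tight
   \<open>t\<close>.\<close>
 moreover have "swt F t \<in> Tight \<B>" if t: "t \<in> Tight T" for t
 proof -
  have t': "t \<in> Mor T" using t by simp
  have "fun1 (fun0 F X) t \<in> Tight C" if X: "X \<in> Obj S" for X
  proof -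
   interpret X: ffunctor T C "fun0 F X" by (rule FX[OF X])
   show ?thesis using t by simp
  qed
  moreover have "identity_cell C (flip w C (at_mor (amap (fun1 F s)) t))" if s: "s \<in> Mor S" for s
   using w_nat.at_mor_Tight[OF Fs[OF s] t] by (simp add: C.flip_identity)
  ultimately show ?thesis using swt_Mor[OF t'] by (simp add: Tight_Fun)
 qed
 ultimately show ?thesis by (auto simp: is_ffunctor_def)
qed

end

section \<open>Transposition of 1-cells and 2-cells\<close>

context swapping
begin

abbreviation "\<E> \<equiv> Fun w S \<A>"
abbreviation "\<D> \<equiv> Fun (dual w) T \<B>"

lemma fE: "fcategory \<E>" and fD: "fcategory \<D>"
 by (rule fcategory_Fun; rule fA fB S.fcat T.fcat)+

sublocale E: fcategory \<E> by (rule fE)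
sublocale D: fcategory \<D> by (rule fD)

text \<open>The transformation \<open>h (-) Y\<close> between the partial functors.\<close>

definition "row h Y = Arr (pt (adom h) Y) (pt (acod h) Y)
 \<lparr>at_ob = \<lambda>X\<in>Obj S. at_ob (amap (at_ob (amap h) X)) Y, at_mor = \<lambda>s\<in>Mor S. amap (at_mor (amap h) s) Y\<rparr>"

definition "rowr h t = cmp1 \<B> (swt (acod h) t) (row h (dom1 T t))"
definition "rowl h t = cmp1 \<B> (row h (cod1 T t)) (swt (adom h) t)"

text \<open>The structure cell of the transpose at \<open>t\<close>. Its components come from the
  \<open>dual w\<close>-natural component of \<open>h\<close> at \<open>X\<close>, which already has
  the direction required, so they are not flipped; flips occur only in the structure cells of the
  ends.\<close>

definition "face h t = Arr (if dual w = Colax then rowl h t else rowr h t) (if dual w = Colax then rowr h t else rowl h t)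
  (\<lambda>X\<in>Obj S. at_mor (amap (at_ob (amap h) X)) t)"

definition "swap1 h = Arr (swap0 (adom h)) (swap0 (acod h)) \<lparr>at_ob = \<lambda>Y\<in>Obj T. row h Y, at_mor = \<lambda>t\<in>Mor T. face h t\<rparr>"

definition "rowc m Y = Arr (row (adom m) Y) (row (acod m) Y) (\<lambda>X\<in>Obj S. amap (amap m X) Y)"

definition "swap2 m = Arr (swap1 (adom m)) (swap1 (acod m)) (\<lambda>Y\<in>Obj T. rowc m Y)"

lemma row_simps [simp]:
 "adom (row h Y) = pt (adom h) Y" "acod (row h Y) = pt (acod h) Y"
 "X \<in> Obj S ==> at_ob (amap (row h Y)) X = at_ob (amap (at_ob (amap h) X)) Y"
 "s \<in> Mor S ==> at_mor (amap (row h Y)) s = amap (at_mor (amap h) s) Y"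
 by (simp_all add: row_def)

lemma amap_face [simp]: "X \<in> Obj S ==> amap (face h t) X = at_mor (amap (at_ob (amap h) X)) t"
 by (simp add: face_def)

lemma swap1_simps [simp]:
 "adom (swap1 h) = swap0 (adom h)" "acod (swap1 h) = swap0 (acod h)"
 "Y \<in> Obj T ==> at_ob (amap (swap1 h)) Y = row h Y"
 "t \<in> Mor T ==> at_mor (amap (swap1 h)) t = face h t"
 by (simp_all add: swap1_def)

lemma rowc_simps [simp]:
 "adom (rowc m Y) = row (adom m) Y" "acod (rowc m Y) = row (acod m) Y"
 "X \<in> Obj S ==> amap (rowc m Y) X = amap (amap m X) Y"
 by (simp_all add: rowc_def)

lemma swap2_simps [simp]:
 "adom (swap2 m) = swap1 (adom m)" "acod (swap2 m) = swap1 (acod m)"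
 "Y \<in> Obj T ==> amap (swap2 m) Y = rowc m Y"
 by (simp_all add: swap2_def)

end

locale swap_morphism = swapping +
 fixes h assumes h: "h \<in> Mor (Fun w S (Fun (dual w) T C))"
begin

abbreviation "F \<equiv> adom h"
abbreviation "G \<equiv> acod h"

lemma swap_objects: "swap_object S T C w F" "swap_object S T C w G"
 using h by (simp_all add: swap_object_def swap_object_axioms_def swapping_axioms Mor_Fun)

lemma w_nat_h: "w_nat S \<A> F G w (amap h)"
 by (rule Mor_FunD[OF S.fcat fA h])

end

sublocale swap_morphism \<subseteq> F: swap_object S T C w F by (rule swap_objects)
sublocale swap_morphism \<subseteq> G: swap_object S T C w G by (rule swap_objects)

context swap_morphism
begin

abbreviation "hX X \<equiv> amap (at_ob (amap h) X)"

lemma hX: "X \<in> Obj S ==> w_nat T C (fun0 F X) (fun0 G X) (dual w) (hX X)"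
 using Mor_FunD[OF T.fcat C.fcat w_nat.at_ob_Mor[OF w_nat_h, of X]]
  w_nat.dom1_at_ob[OF w_nat_h, of X] w_nat.cod1_at_ob[OF w_nat_h, of X] by simp

text \<open>A structure cell of \<open>h\<close> is a 2-cell of \<open>\<A>\<close>, hence a
  modification between two composites of \<open>dual w\<close>-natural transformations. Its
  direction depends on \<open>w\<close>, which the conditionals record.\<close>

lemma h_mor:
 assumes s: "s \<in> Mor S"
 defines "P \<equiv> comp_transf (dual w) T C (amap (fun1 G s)) (hX (dom1 S s))"
  and "Q \<equiv> comp_transf (dual w) T C (hX (cod1 S s)) (amap (fun1 F s))"
 shows "modification (dual w) T C (fun0 F (dom1 S s)) (fun0 G (cod1 S s)) (if w = Colax then Q else P) (if w = Colax then P else Q) (amap (at_mor (amap h) s))"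
proof -
 interpret h: w_nat S \<A> F G w "amap h" by (rule w_nat_h)
 have X: "dom1 S s \<in> Obj S" "cod1 S s \<in> Obj S" using s by simp_all
 have c: "at_mor (amap h) s \<in> Cell \<A>" using s by simp
 have o: "adom (fun1 F s) = fun0 F (dom1 S s)" "acod (fun1 G s) = fun0 G (cod1 S s)"
  using F.F.dom1_fun1[OF s] G.F.cod1_fun1[OF s] by simp_all
 have o': "adom (at_ob (amap h) (dom1 S s)) = fun0 F (dom1 S s)" "acod (at_ob (amap h) (cod1 S s)) = fun0 G (cod1 S s)"
  using h.dom1_at_ob[OF X(1)] h.cod1_at_ob[OF X(2)] by simp_all
 show ?thesis
 proof (cases "w = Colax")
  case True
  have "adom (at_mor (amap h) s) = Arr (fun0 F (dom1 S s)) (fun0 G (cod1 S s)) Q" "acod (at_mor (amap h) s) = Arr (fun0 F (dom1 S s)) (fun0 G (cod1 S s)) P"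
   using h.dom2_at_mor'[OF s True] h.cod2_at_mor'[OF s True] by (simp_all add: P_def Q_def o o')
  then show ?thesis using c by (simp add: Cell_Fun True)
 next
  case False
  have "acod (at_mor (amap h) s) = Arr (fun0 F (dom1 S s)) (fun0 G (cod1 S s)) Q" "adom (at_mor (amap h) s) = Arr (fun0 F (dom1 S s)) (fun0 G (cod1 S s)) P"
   using h.dom2_at_mor[OF s False] h.cod2_at_mor[OF s False] by (simp_all add: P_def Q_def o o')
  then show ?thesis using c by (simp add: Cell_Fun False)
 qed
qed

lemma hs_wcell:
 assumes s: "s \<in> Mor S" and Y: "Y \<in> Obj T"
 shows "wcell w C (cmp1 C (at_ob (amap (fun1 G s)) Y) (at_ob (hX (dom1 S s)) Y))
  (cmp1 C (at_ob (hX (cod1 S s)) Y) (at_ob (amap (fun1 F s)) Y)) (amap (at_mor (amap h) s) Y)"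
proof -
 interpret h: w_nat S \<A> F G w "amap h" by (rule w_nat_h)
 have "wgood w C (amap (at_mor (amap h) s) Y)"
  by (rule wgood_FunD[OF T.fcat C.fcat h.at_mor_wgood[OF s] h.at_mor_Cell[OF s] Y])
 then show ?thesis
  using h_mor[OF s] Y by (simp add: wcell_def modification_def cell_between_def comp_transf_def split: if_splits)
qed

text \<open>Composition of 2-cells in \<open>\<A>\<close> is componentwise, so each axiom is the
  corresponding axiom of \<open>h\<close> evaluated at \<open>Y\<close>.\<close>

lemma row_Mor:
 assumes Y: "Y \<in> Obj T" shows "row h Y \<in> Mor \<B>"
proof -
 interpret h: w_nat S \<A> F G w "amap h" by (rule w_nat_h)
 have "w_natural w S C (pt F Y) (pt G Y) (amap (row h Y))"
  unfolding w_natural_def w_cell_iff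
 proof (intro conjI ballI impI)
  show "at_ob (amap (row h Y)) \<in> extensional (Obj S)" "at_mor (amap (row h Y)) \<in> extensional (Mor S)"
   by (simp_all add: row_def)
 next
  fix X assume X: "X \<in> Obj S"
  interpret hX: w_nat T C "fun0 F X" "fun0 G X" "dual w" "hX X" by (rule hX[OF X])
  show "at_ob (amap (row h Y)) X \<in> Mor C" "dom1 C (at_ob (amap (row h Y)) X) = fun0 (pt F Y) X"
   "cod1 C (at_ob (amap (row h Y)) X) = fun0 (pt G Y) X"
   using X Y by simp_all
  have "at_mor (amap h) (id1 S X) = id2 \<A> (at_ob (amap h) X)" by (rule h.at_mor_id1[OF X])
  then show "at_mor (amap (row h Y)) (id1 S X) = id2 C (at_ob (amap (row h Y)) X)" using X Y by simp
 next
  fix s assume s: "s \<in> Mor S"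
  show "wcell w C (cmp1 C (fun1 (pt G Y) s) (at_ob (amap (row h Y)) (dom1 S s)))
     (cmp1 C (at_ob (amap (row h Y)) (cod1 S s)) (fun1 (pt F Y) s)) (at_mor (amap (row h Y)) s)"
   using hs_wcell[OF s Y] s by simp
 next
  fix s assume s: "s \<in> Tight S"
  then have s': "s \<in> Mor S" by simp
  show "identity_cell C (at_mor (amap (row h Y)) s)"
   using identity_cell_FunD[OF T.fcat C.fcat h.at_mor_Tight[OF s] Y] s' by simp
 next
  fix s s' assume s: "s \<in> Mor S" "s' \<in> Mor S" "cod1 S s = dom1 S s'"
  have "amap (at_mor (amap h) (cmp1 S s' s)) Y = amap (vpaste w \<A> (whr \<A> (at_mor (amap h) s') (fun1 F s))
    (whl \<A> (fun1 G s') (at_mor (amap h) s))) Y"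
   using h.at_mor_cmp1[OF s] by (rule arg_cong)
  then show "at_mor (amap (row h Y)) (cmp1 S s' s) = vpaste w C
     (whr C (at_mor (amap (row h Y)) s') (fun1 (pt F Y) s))
     (whl C (fun1 (pt G Y) s') (at_mor (amap (row h Y)) s))"
   using s Y by (simp add: vpaste_def split: if_splits)
 next
  fix y assume y: "y \<in> Cell S"
  have s: "dom2 S y \<in> Mor S" "cod2 S y \<in> Mor S" "dom1 S (dom2 S y) \<in> Obj S" "cod1 S (dom2 S y) \<in> Obj S" using y by simp_all
  show "slides w C (at_mor (amap (row h Y)) (dom2 S y)) (at_mor (amap (row h Y)) (cod2 S y))
   (whr C (fun2 (pt G Y) y) (at_ob (amap (row h Y)) (dom1 S (dom2 S y))))
   (whl C (at_ob (amap (row h Y)) (cod1 S (dom2 S y))) (fun2 (pt F Y) y))"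
  proof (cases "w = Colax")
   case True
   show ?thesis using arg_cong[OF iffD1[OF slides_Colax[OF True] h.at_mor_slides[OF y]], of "%z. amap z Y"] s y Y
    by (simp add: slides_Colax[OF True])
  next
   case False
   show ?thesis using arg_cong[OF iffD1[OF slides_not_Colax[OF False] h.at_mor_slides[OF y]], of "%z. amap z Y"] s y Y
    by (simp add: slides_not_Colax[OF False])
  qed
 qed
 then show ?thesis using F.pt[OF Y] G.pt[OF Y] by (simp add: Mor_Fun)
qed

lemma rowl_rowr:
 assumes t: "t \<in> Mor T"
 shows "rowl h t \<in> Mor \<B>" "rowr h t \<in> Mor \<B>" "adom (rowl h t) = pt F (dom1 T t)" "adom (rowr h t) = pt F (dom1 T t)"
  "acod (rowl h t) = pt G (cod1 T t)" "acod (rowr h t) = pt G (cod1 T t)"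
  "!!X. X \<in> Obj S ==> at_ob (amap (rowl h t)) X = cmp1 C (at_ob (hX X) (cod1 T t)) (fun1 (fun0 F X) t)"
  "!!X. X \<in> Obj S ==> at_ob (amap (rowr h t)) X = cmp1 C (fun1 (fun0 G X) t) (at_ob (hX X) (dom1 T t))"
  "!!s. s \<in> Mor S ==> at_mor (amap (rowl h t)) s = vpaste w C
    (whl C (at_ob (hX (cod1 S s)) (cod1 T t)) (flip w C (at_mor (amap (fun1 F s)) t)))
    (whr C (amap (at_mor (amap h) s) (cod1 T t)) (fun1 (fun0 F (dom1 S s)) t))"
  "!!s. s \<in> Mor S ==> at_mor (amap (rowr h t)) s = vpaste w C
    (whl C (fun1 (fun0 G (cod1 S s)) t) (amap (at_mor (amap h) s) (dom1 T t)))
    (whr C (flip w C (at_mor (amap (fun1 G s)) t)) (at_ob (hX (dom1 S s)) (dom1 T t)))"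
proof -
 have Y: "dom1 T t \<in> Obj T" "cod1 T t \<in> Obj T" using t by simp_all
 show "rowl h t \<in> Mor \<B>" unfolding rowl_def by (rule B.cmp1_Mor[OF F.swt_Mor[OF t] row_Mor[OF Y(2)]]) simp
 show "rowr h t \<in> Mor \<B>" unfolding rowr_def by (rule B.cmp1_Mor[OF row_Mor[OF Y(1)] G.swt_Mor[OF t]]) simp
qed (simp_all add: rowl_def rowr_def comp_transf_def)

text \<open>The modification axiom of the face at \<open>s\<close> and the axiom of
  \<open>h_mor\<close> for \<open>s\<close> at \<open>t\<close> describe one cube, indexed by the
  pair of \<open>s\<close> and \<open>t\<close>. \<open>cube_flip\<close> passes from one reading to
  the other.\<close>

lemma face_Cell:
 assumes t: "t \<in> Mor T" shows "face h t \<in> Cell \<B>"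
proof -
 let ?Y = "dom1 T t" and ?Y' = "cod1 T t"
 have Y: "?Y \<in> Obj T" "?Y' \<in> Obj T" using t by simp_all
 define L R where LR: "L = rowl h t" "R = rowr h t"
 note r = rowl_rowr[OF t, folded LR]
 have "modification w S C (pt F ?Y) (pt G ?Y') (amap (if dual w = Colax then L else R)) (amap (if dual w = Colax then R else L))
   (\<lambda>X\<in>Obj S. at_mor (hX X) t)"
  unfolding modification_def cell_between_def
 proof (intro conjI ballI)
  fix X assume X: "X \<in> Obj S"
  interpret hX: w_nat T C "fun0 F X" "fun0 G X" "dual w" "hX X" by (rule hX[OF X])
  show "(\<lambda>X\<in>Obj S. at_mor (hX X) t) X \<in> Cell C"
   "dom2 C ((\<lambda>X\<in>Obj S. at_mor (hX X) t) X) = at_ob (amap (if dual w = Colax then L else R)) X"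
   "cod2 C ((\<lambda>X\<in>Obj S. at_mor (hX X) t) X) = at_ob (amap (if dual w = Colax then R else L)) X"
   using hX.at_mor_wcell[OF t] X by (simp_all add: wcell_def r)
 next
  fix s assume s: "s \<in> Mor S"
  let ?X = "dom1 S s" and ?X' = "cod1 S s"
  have X: "?X \<in> Obj S" "?X' \<in> Obj S" using s by simp_all
  interpret hX: w_nat T C "fun0 F ?X" "fun0 G ?X" "dual w" "hX ?X" by (rule hX[OF X(1)])
  interpret hX': w_nat T C "fun0 F ?X'" "fun0 G ?X'" "dual w" "hX ?X'" by (rule hX[OF X(2)])
  interpret f: w_nat T C "fun0 F ?X" "fun0 F ?X'" "dual w" "amap (fun1 F s)" by (rule F.Fs[OF s])
  interpret g: w_nat T C "fun0 G ?X" "fun0 G ?X'" "dual w" "amap (fun1 G s)" by (rule G.Fs[OF s])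
  let ?f = "at_ob (amap (fun1 F s))" and ?g = "at_ob (amap (fun1 G s))" and ?k = "at_ob (hX ?X)" and ?k' = "at_ob (hX ?X')"
  \<comment> \<open>The faces \<open>?p\<close> and \<open>?r\<close> come from the two functors,
    \<open>?q\<close> and \<open>?u\<close> from the components of \<open>h\<close> at the ends of
    \<open>s\<close>, and \<open>?v\<close> and \<open>?x\<close> from the structure cell of
    \<open>h\<close> at \<open>s\<close>.\<close>
  let ?p = "whr C (at_mor (amap (fun1 G s)) t) (?k ?Y)"
  let ?q = "whl C (?g ?Y') (at_mor (hX ?X) t)"
  let ?u = "whr C (at_mor (hX ?X') t) (?f ?Y)"
  let ?r = "whl C (?k' ?Y') (at_mor (amap (fun1 F s)) t)"
  let ?v = "whl C (fun1 (fun0 G ?X') t) (amap (at_mor (amap h) s) ?Y)"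
  let ?x = "whr C (amap (at_mor (amap h) s) ?Y') (fun1 (fun0 F ?X) t)"
  note hs = hs_wcell[OF s Y(1)] hs_wcell[OF s Y(2)]
  have hd: "dom1 C (dom2 C (amap (at_mor (amap h) s) ?Y')) = fun0 (fun0 F ?X) ?Y'" "cod1 C (dom2 C (amap (at_mor (amap h) s) ?Y)) = fun0 (fun0 G ?X') ?Y"
   using hs Y by (simp_all add: wcell_def split: if_splits)
  have p: "wcell (dual w) C (cmp1 C (fun1 (fun0 G ?X') t) (cmp1 C (?g ?Y) (?k ?Y))) (cmp1 C (?g ?Y') (cmp1 C (fun1 (fun0 G ?X) t) (?k ?Y))) ?p"
   using C.wcell_hcmp_right[OF g.at_mor_wcell[OF t], of "?k ?Y"] t by simp
  have q: "wcell (dual w) C (cmp1 C (?g ?Y') (cmp1 C (fun1 (fun0 G ?X) t) (?k ?Y))) (cmp1 C (?g ?Y') (cmp1 C (?k ?Y') (fun1 (fun0 F ?X) t))) ?q"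
   using C.wcell_hcmp_left[OF hX.at_mor_wcell[OF t], of "?g ?Y'"] t by simp
  have u: "wcell (dual w) C (cmp1 C (fun1 (fun0 G ?X') t) (cmp1 C (?k' ?Y) (?f ?Y))) (cmp1 C (?k' ?Y') (cmp1 C (fun1 (fun0 F ?X') t) (?f ?Y))) ?u"
   using C.wcell_hcmp_right[OF hX'.at_mor_wcell[OF t], of "?f ?Y"] t by simp
  have r': "wcell (dual w) C (cmp1 C (?k' ?Y') (cmp1 C (fun1 (fun0 F ?X') t) (?f ?Y))) (cmp1 C (?k' ?Y') (cmp1 C (?f ?Y') (fun1 (fun0 F ?X) t))) ?r"
   using C.wcell_hcmp_left[OF f.at_mor_wcell[OF t], of "?k' ?Y'"] t by simp
  have v: "wcell w C (cmp1 C (fun1 (fun0 G ?X') t) (cmp1 C (?g ?Y) (?k ?Y))) (cmp1 C (fun1 (fun0 G ?X') t) (cmp1 C (?k' ?Y) (?f ?Y))) ?v"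
   using C.wcell_hcmp_left[OF hs(1), of "fun1 (fun0 G ?X') t"] t hd by simp
  have x: "wcell w C (cmp1 C (?g ?Y') (cmp1 C (?k ?Y') (fun1 (fun0 F ?X) t))) (cmp1 C (?k' ?Y') (cmp1 C (?f ?Y') (fun1 (fun0 F ?X) t))) ?x"
   using C.wcell_hcmp_right[OF hs(2), of "fun1 (fun0 F ?X) t"] t hd by simp
  have H: "if w = Colax then slides (dual w) C (vpaste (dual w) C ?r ?u) (vpaste (dual w) C ?q ?p) ?v ?x
   else slides (dual w) C (vpaste (dual w) C ?q ?p) (vpaste (dual w) C ?r ?u) ?v ?x"
   using modificationD[OF h_mor[OF s] t] t by (simp add: comp_transf_def split: if_splits)
  have e: "flip w C ?p = whr C (flip w C (at_mor (amap (fun1 G s)) t)) (?k ?Y)" "flip w C ?r = whl C (?k' ?Y') (flip w C (at_mor (amap (fun1 F s)) t))"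
   using C.flip_hcmp_right[OF g.at_mor_wcell[OF t], of w "?k ?Y"] C.flip_hcmp_left[OF f.at_mor_wcell[OF t], of w "?k' ?Y'"] t by simp_all
  show "slides w C (at_mor (amap (if dual w = Colax then L else R)) s) (at_mor (amap (if dual w = Colax then R else L)) s)
   (whl C (fun1 (pt G ?Y') s) ((\<lambda>X\<in>Obj S. at_mor (hX X) t) ?X))
   (whr C ((\<lambda>X\<in>Obj S. at_mor (hX X) t) ?X') (fun1 (pt F ?Y) s))"
   using C.cube_flip[OF p q u r' v x H, unfolded e] s X by (simp add: r(9,10) split: if_splits)
 qed simp
 moreover have "face h t = Arr (if dual w = Colax then L else R) (if dual w = Colax then R else L) (\<lambda>X\<in>Obj S. at_mor (hX X) t)"
  by (simp only: face_def LR)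
 ultimately show ?thesis using r(1-6) by (simp add: Cell_Fun split: if_splits)
qed

lemma face_wcell:
 assumes t: "t \<in> Mor T"
 shows "wcell (dual w) \<B> (cmp1 \<B> (swt G t) (row h (dom1 T t))) (cmp1 \<B> (row h (cod1 T t)) (swt F t)) (face h t)"
proof -
 have "wgood w C (amap (face h t) X)" if X: "X \<in> Obj S" for X
  using w_nat.at_mor_wgood[OF hX[OF X] t] X by simp
 then have "wgood w \<B> (face h t)" by (rule wgood_FunI[OF S.fcat C.fcat face_Cell[OF t]])
 moreover have "dom2 \<B> (face h t) = (if dual w = Colax then rowl h t else rowr h t)" "cod2 \<B> (face h t) = (if dual w = Colax then rowr h t else rowl h t)"
  by (simp_all add: face_def)
 ultimately show ?thesis using face_Cell[OF t] unfolding wcell_def rowl_def[symmetric] rowr_def[symmetric] wgood_dual by blast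
qed

end

text \<open>\<open>wcell\<close> fixes both ends of a cell, so an equation between structure cells
  in a functor category is left to be checked on components.\<close>

lemma wcell_Fun_eqI:
 assumes "wcell w' (Fun w S C) a b e" "wcell w' (Fun w S C) a b n" "!!X. X \<in> Obj S ==> amap e X = amap n X"
 shows "e = n"
 by (rule Cell_Fun_eqI[of _ w S C]) (use assms in \<open>simp_all add: wcell_def\<close>)

lemma (in fcategory) wcell_id2: "f \<in> Mor C ==> wcell w C f f (id2 C f)"
 by (simp add: wcell_def)

lemma amap_vpaste_Fun [simp]:
 "X \<in> Obj S ==> amap (vpaste w' (Fun w S C) b a) X = vpaste w' C (amap b X) (amap a X)"
 by (simp add: vpaste_def)

lemma at_mor_cmp1_Fun:
 "s \<in> Mor S ==> at_mor (amap (cmp1 (Fun w S C) g f)) s = vpaste w C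
   (whl C (at_ob (amap g) (cod1 S s)) (at_mor (amap f) s)) (whr C (at_mor (amap g) s) (at_ob (amap f) (dom1 S s)))"
 by (simp add: comp_transf_def)

lemma (in swapping) face_Colax:
 assumes "dual w = Colax" shows "adom (face h t) = rowl h t" "acod (face h t) = rowr h t"
 by (simp_all only: face_def assms if_True simp_thms arr.sel)

lemma (in swapping) face_not_Colax:
 assumes "dual w \<noteq> Colax" shows "adom (face h t) = rowr h t" "acod (face h t) = rowl h t"
 by (simp_all only: face_def assms if_False simp_thms arr.sel)

context swap_morphism
begin

lemma face_ends:
 assumes t: "t \<in> Mor T" shows "adom (adom (face h t)) = pt F (dom1 T t)" "acod (adom (face h t)) = pt G (cod1 T t)"
proof -
 have "adom (adom (face h t)) = pt F (dom1 T t) & acod (adom (face h t)) = pt G (cod1 T t)"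
 proof (cases "dual w = Colax")
  case True show ?thesis unfolding face_Colax[OF True] rowl_rowr[OF t] by (intro conjI refl)
 next
  case False show ?thesis unfolding face_not_Colax[OF False] rowl_rowr[OF t] by (intro conjI refl)
 qed
 then show "adom (adom (face h t)) = pt F (dom1 T t)" "acod (adom (face h t)) = pt G (cod1 T t)" by (rule conjunct1, rule conjunct2)
qed

lemma face_slides:
 assumes \<tau>: "\<tau> \<in> Cell T"
 shows "slides (dual w) \<B> (face h (dom2 T \<tau>)) (face h (cod2 T \<tau>))
   (whr \<B> (swc G \<tau>) (row h (dom1 T (dom2 T \<tau>))))
   (whl \<B> (row h (cod1 T (dom2 T \<tau>))) (swc F \<tau>))"
proof (cases "dual w = Colax")
 case True
 have t: "dom2 T \<tau> \<in> Mor T" "cod2 T \<tau> \<in> Mor T" using \<tau> by simp_all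
 have "vcmp C (whr C (fun2 (fun0 G X) \<tau>) (at_ob (hX X) (dom1 T (dom2 T \<tau>)))) (at_mor (hX X) (dom2 T \<tau>)) =
   vcmp C (at_mor (hX X) (cod2 T \<tau>)) (whl C (at_ob (hX X) (cod1 T (dom2 T \<tau>))) (fun2 (fun0 F X) \<tau>))" if X: "X \<in> Obj S" for X
  using w_nat.at_mor_slides[OF hX[OF X] \<tau>] by (simp only: slides_Colax[OF True])
 then show ?thesis unfolding slides_Colax[OF True] using \<tau>
  by (simp add: face_Colax[OF True] rowl_def rowr_def cong: restrict_cong)
next
 case False
 have t: "dom2 T \<tau> \<in> Mor T" "cod2 T \<tau> \<in> Mor T" using \<tau> by simp_all
 have "vcmp C (whl C (at_ob (hX X) (cod1 T (dom2 T \<tau>))) (fun2 (fun0 F X) \<tau>)) (at_mor (hX X) (dom2 T \<tau>)) =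
   vcmp C (at_mor (hX X) (cod2 T \<tau>)) (whr C (fun2 (fun0 G X) \<tau>) (at_ob (hX X) (dom1 T (dom2 T \<tau>))))" if X: "X \<in> Obj S" for X
  using w_nat.at_mor_slides[OF hX[OF X] \<tau>] by (simp only: slides_not_Colax[OF False])
 then show ?thesis unfolding slides_not_Colax[OF False] using \<tau>
  by (simp add: face_not_Colax[OF False] rowl_def rowr_def cong: restrict_cong)
qed

lemma face_id1:
 assumes Y: "Y \<in> Obj T" shows "face h (id1 T Y) = id2 \<B> (row h Y)"
proof -
 have i: "id1 T Y \<in> Mor T" using Y by simp
 have e: "cmp1 \<B> (id1 \<B> (pt G Y)) (row h Y) = row h Y" "cmp1 \<B> (row h Y) (id1 \<B> (pt F Y)) = row h Y"
  by (rule B.cmp1_id_left[OF row_Mor[OF Y]] B.cmp1_id_right[OF row_Mor[OF Y]]; simp)+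
 have "wcell (dual w) \<B> (row h Y) (row h Y) (face h (id1 T Y))"
  using face_wcell[OF i] unfolding F.swt_id1[OF Y] G.swt_id1[OF Y] T.dom1_id1[OF Y] T.cod1_id1[OF Y] e .
 from wcell_Fun_eqI[OF this B.wcell_id2[OF row_Mor[OF Y]]] show ?thesis
  using w_nat.at_mor_id1[OF hX Y] by simp
qed

text \<open>After reassociation both sides have the same ends; on the component at \<open>X\<close>
  the equation is the composition axiom of the component of \<open>h\<close> at
  \<open>X\<close>.\<close>

lemma face_cmp1:
 assumes t: "t \<in> Mor T" "t' \<in> Mor T" "cod1 T t = dom1 T t'"
 shows "face h (cmp1 T t' t) = vpaste (dual w) \<B> (whr \<B> (face h t') (swt F t)) (whl \<B> (swt G t') (face h t))"
proof -
 let ?Y = "dom1 T t" and ?Y' = "cod1 T t" and ?Y'' = "cod1 T t'"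
 have Y: "?Y \<in> Obj T" "?Y' \<in> Obj T" "?Y'' \<in> Obj T" using t by simp_all
 have tt: "cmp1 T t' t \<in> Mor T" "dom1 T (cmp1 T t' t) = ?Y" "cod1 T (cmp1 T t' t) = ?Y''" using t by simp_all
 note M = F.swt_Mor[OF t(1)] F.swt_Mor[OF t(2)] G.swt_Mor[OF t(1)] G.swt_Mor[OF t(2)] row_Mor[OF Y(1)] row_Mor[OF Y(2)] row_Mor[OF Y(3)]
 have f': "wcell (dual w) \<B> (cmp1 \<B> (swt G t') (row h ?Y')) (cmp1 \<B> (row h ?Y'') (swt F t')) (face h t')"
  using face_wcell[OF t(2)] unfolding t(3) .
 have d: "face h t \<in> Cell \<B>" "face h t' \<in> Cell \<B>" "adom (adom (face h t')) = pt F ?Y'" "acod (adom (face h t)) = pt G ?Y'"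
  using face_Cell[OF t(1)] face_Cell[OF t(2)] face_ends[OF t(1)] face_ends[OF t(2)] by (simp_all add: t(3))
 have 1: "wcell (dual w) \<B> (cmp1 \<B> (cmp1 \<B> (swt G t') (row h ?Y')) (swt F t)) (cmp1 \<B> (cmp1 \<B> (row h ?Y'') (swt F t')) (swt F t)) (whr \<B> (face h t') (swt F t))"
  by (rule B.wcell_hcmp_right[OF f' M(1)]) (simp add: d)
 have 2: "wcell (dual w) \<B> (cmp1 \<B> (swt G t') (cmp1 \<B> (swt G t) (row h ?Y))) (cmp1 \<B> (swt G t') (cmp1 \<B> (row h ?Y') (swt F t))) (whl \<B> (swt G t') (face h t))"
  by (rule B.wcell_hcmp_left[OF face_wcell[OF t(1)] M(4)]) (simp add: d t(3))
 have a1: "cmp1 \<B> (cmp1 \<B> (swt G t') (row h ?Y')) (swt F t) = cmp1 \<B> (swt G t') (cmp1 \<B> (row h ?Y') (swt F t))"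
  by (rule B.cmp1_assoc[OF M(1,6,4)]) (simp_all add: t(3))
 have a2: "cmp1 \<B> (swt G t') (cmp1 \<B> (swt G t) (row h ?Y)) = cmp1 \<B> (swt G (cmp1 T t' t)) (row h ?Y)"
  unfolding G.swt_cmp1[OF t] by (rule B.cmp1_assoc[symmetric, OF M(5,3,4)]) (simp_all add: t(3))
 have a3: "cmp1 \<B> (cmp1 \<B> (row h ?Y'') (swt F t')) (swt F t) = cmp1 \<B> (row h ?Y'') (swt F (cmp1 T t' t))"
  unfolding F.swt_cmp1[OF t] by (rule B.cmp1_assoc[OF M(1,2,7)]) (simp_all add: t(3))
 show ?thesis
 proof (rule wcell_Fun_eqI[OF face_wcell[OF tt(1), unfolded tt(2,3)] B.wcell_vpaste[OF 2[unfolded a2] 1[unfolded a1 a3]]])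
  fix X assume X: "X \<in> Obj S"
  show "amap (face h (cmp1 T t' t)) X = amap (vpaste (dual w) \<B> (whr \<B> (face h t') (swt F t)) (whl \<B> (swt G t') (face h t))) X"
   using w_nat.at_mor_cmp1[OF hX[OF X] t] X by simp
 qed
qed

lemma swap1_Mor: "swap1 h \<in> Mor \<D>"
proof -
 have "w_natural (dual w) T \<B> (swap0 F) (swap0 G) (amap (swap1 h))"
  unfolding w_natural_def w_cell_iff
 proof (intro conjI ballI impI)
  show "at_ob (amap (swap1 h)) \<in> extensional (Obj T)" "at_mor (amap (swap1 h)) \<in> extensional (Mor T)"
   by (simp_all add: swap1_def)
 next
  fix Y assume Y: "Y \<in> Obj T"
  show "at_ob (amap (swap1 h)) Y \<in> Mor \<B>" "dom1 \<B> (at_ob (amap (swap1 h)) Y) = fun0 (swap0 F) Y" "cod1 \<B> (at_ob (amap (swap1 h)) Y) = fun0 (swap0 G) Y"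
   using Y row_Mor[OF Y] by simp_all
  show "at_mor (amap (swap1 h)) (id1 T Y) = id2 \<B> (at_ob (amap (swap1 h)) Y)"
   using face_id1[OF Y] T.id1_Mor[OF Y] Y by (simp only: swap1_simps)
 next
  fix t assume t: "t \<in> Mor T"
  show "wcell (dual w) \<B> (cmp1 \<B> (fun1 (swap0 G) t) (at_ob (amap (swap1 h)) (dom1 T t)))
     (cmp1 \<B> (at_ob (amap (swap1 h)) (cod1 T t)) (fun1 (swap0 F) t)) (at_mor (amap (swap1 h)) t)"
   using face_wcell[OF t] t T.dom1_Obj[OF t] T.cod1_Obj[OF t] by (simp only: swap1_simps swap0_simps)
 next
  fix t assume t: "t \<in> Tight T"
  then have t': "t \<in> Mor T" by simp
  have "identity_cell C (amap (face h t) X)" if X: "X \<in> Obj S" for X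
   using w_nat.at_mor_Tight[OF hX[OF X] t] X by simp
  from identity_cell_FunI[OF S.fcat C.fcat face_Cell[OF t'] this]
  show "identity_cell \<B> (at_mor (amap (swap1 h)) t)" using t' by simp
 next
  fix t t' assume t: "t \<in> Mor T" "t' \<in> Mor T" "cod1 T t = dom1 T t'"
  show "at_mor (amap (swap1 h)) (cmp1 T t' t) = vpaste (dual w) \<B>
    (whr \<B> (at_mor (amap (swap1 h)) t') (fun1 (swap0 F) t))
    (whl \<B> (fun1 (swap0 G) t') (at_mor (amap (swap1 h)) t))"
   using face_cmp1[OF t] t(1,2) T.cmp1_Mor[OF t] by (simp only: swap1_simps swap0_simps)
 next
  fix \<tau> assume \<tau>: "\<tau> \<in> Cell T"
  have t: "dom2 T \<tau> \<in> Mor T" "cod2 T \<tau> \<in> Mor T" "dom1 T (dom2 T \<tau>) \<in> Obj T" "cod1 T (dom2 T \<tau>) \<in> Obj T" using \<tau> by simp_all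
  show "slides (dual w) \<B> (at_mor (amap (swap1 h)) (dom2 T \<tau>)) (at_mor (amap (swap1 h)) (cod2 T \<tau>))
   (whr \<B> (fun2 (swap0 G) \<tau>) (at_ob (amap (swap1 h)) (dom1 T (dom2 T \<tau>))))
   (whl \<B> (at_ob (amap (swap1 h)) (cod1 T (dom2 T \<tau>))) (fun2 (swap0 F) \<tau>))"
   using face_slides[OF \<tau>] t \<tau> by (simp only: swap1_simps swap0_simps)
 qed
 then show ?thesis using F.swap0 G.swap0 by (simp add: Mor_Fun)
qed

end

section \<open>Functoriality of transposition\<close>

context swapping
begin

lemma swap_morphismI: "h \<in> Mor \<E> ==> swap_morphism S T C w h"
 by (simp add: swap_morphism_def swap_morphism_axioms_def swapping_axioms)

lemma swap_objectI: "is_ffunctor S \<A> F ==> swap_object S T C w F"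
 by (simp add: swap_object_def swap_object_axioms_def swapping_axioms)

text \<open>The axiom for \<open>rowc m Y\<close> at \<open>s\<close> is that of \<open>m\<close> at
  \<open>s\<close>, evaluated at \<open>Y\<close>. The axiom for \<open>swap2 m\<close> at
  \<open>t\<close> is, on the component at \<open>X\<close>, that of the modification
  \<open>amap m X\<close> at \<open>t\<close>.\<close>

lemma swap2_Cell:
 assumes m: "m \<in> Cell \<E>"
 shows rowc_Cell: "!!Y. Y \<in> Obj T ==> rowc m Y \<in> Cell \<B>" and "swap2 m \<in> Cell \<D>"
proof -
 note c = Cell_FunD[OF m]
 interpret f: swap_morphism S T C w "adom m" by (rule swap_morphismI[OF c(1)])
 interpret g: swap_morphism S T C w "acod m" by (rule swap_morphismI[OF c(2)])
 let ?F = "adom (adom m)" and ?G = "acod (adom m)"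
 have md: "modification w S \<A> ?F ?G (amap (adom m)) (amap (acod m)) (amap m)" using m by (simp add: Cell_Fun)
 have mX: "modification (dual w) T C (fun0 ?F X) (fun0 ?G X) (f.hX X) (g.hX X) (amap (amap m X))" if X: "X \<in> Obj S" for X
  using c(5-7)[OF X] w_nat.dom1_at_ob[OF f.w_nat_h X] w_nat.cod1_at_ob[OF f.w_nat_h X] by (simp add: Cell_Fun)
 have mXY: "amap (amap m X) Y \<in> Cell C" "dom2 C (amap (amap m X) Y) = at_ob (f.hX X) Y" "cod2 C (amap (amap m X) Y) = at_ob (g.hX X) Y"
  if "X \<in> Obj S" "Y \<in> Obj T" for X Y using mX[OF that(1)] that(2) by (simp_all add: modification_def cell_between_def)
 show rc: "rowc m Y \<in> Cell \<B>" if Y: "Y \<in> Obj T" for Y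
 proof -
  have "modification w S C (pt ?F Y) (pt ?G Y) (amap (row (adom m) Y)) (amap (row (acod m) Y)) (amap (rowc m Y))"
   unfolding modification_def cell_between_def
  proof (intro conjI ballI)
   show "amap (rowc m Y) \<in> extensional (Obj S)" by (simp add: rowc_def)
  next
   fix X assume X: "X \<in> Obj S"
   show "amap (rowc m Y) X \<in> Cell C" "dom2 C (amap (rowc m Y) X) = at_ob (amap (row (adom m) Y)) X" "cod2 C (amap (rowc m Y) X) = at_ob (amap (row (acod m) Y)) X"
    using mXY[OF X Y] X by simp_all
  next
   fix s assume s: "s \<in> Mor S"
   have X: "dom1 S s \<in> Obj S" "cod1 S s \<in> Obj S" using s by simp_all
   show "slides w C (at_mor (amap (row (adom m) Y)) s) (at_mor (amap (row (acod m) Y)) s)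
    (whl C (fun1 (pt ?G Y) s) (amap (rowc m Y) (dom1 S s))) (whr C (amap (rowc m Y) (cod1 S s)) (fun1 (pt ?F Y) s))"
   proof (cases "w = Colax")
    case True
    show ?thesis using arg_cong[OF iffD1[OF slides_Colax[OF True] modificationD[OF md s]], of "%z. amap z Y"] s X Y
     by (simp add: slides_Colax[OF True])
   next
    case False
    show ?thesis using arg_cong[OF iffD1[OF slides_not_Colax[OF False] modificationD[OF md s]], of "%z. amap z Y"] s X Y
     by (simp add: slides_not_Colax[OF False])
   qed
  qed
  then show ?thesis using f.row_Mor[OF Y] g.row_Mor[OF Y] by (simp add: Cell_Fun c)
 qed
 have "modification (dual w) T \<B> (swap0 ?F) (swap0 ?G) (amap (swap1 (adom m))) (amap (swap1 (acod m))) (amap (swap2 m))"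
  unfolding modification_def cell_between_def
 proof (intro conjI ballI)
  show "amap (swap2 m) \<in> extensional (Obj T)" by (simp add: swap2_def)
 next
  fix Y assume Y: "Y \<in> Obj T"
  show "amap (swap2 m) Y \<in> Cell \<B>" "dom2 \<B> (amap (swap2 m) Y) = at_ob (amap (swap1 (adom m))) Y" "cod2 \<B> (amap (swap2 m) Y) = at_ob (amap (swap1 (acod m))) Y"
   using rc[OF Y] Y by simp_all
 next
  fix t assume t: "t \<in> Mor T"
  have Y: "dom1 T t \<in> Obj T" "cod1 T t \<in> Obj T" using t by simp_all
  have "slides (dual w) \<B> (face (adom m) t) (face (acod m) t)
    (whl \<B> (swt ?G t) (rowc m (dom1 T t))) (whr \<B> (rowc m (cod1 T t)) (swt ?F t))"
  proof (cases "dual w = Colax")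
   case True
   have "vcmp C (whl C (fun1 (fun0 ?G X) t) (amap (amap m X) (dom1 T t))) (at_mor (f.hX X) t) =
    vcmp C (at_mor (g.hX X) t) (whr C (amap (amap m X) (cod1 T t)) (fun1 (fun0 ?F X) t))" if X: "X \<in> Obj S" for X
    using modificationD[OF mX[OF X] t] by (simp only: slides_Colax[OF True])
   then show ?thesis unfolding slides_Colax[OF True] using t
    by (simp add: face_Colax[OF True] rowl_def rowr_def c cong: restrict_cong)
  next
   case False
   have "vcmp C (whr C (amap (amap m X) (cod1 T t)) (fun1 (fun0 ?F X) t)) (at_mor (f.hX X) t) =
    vcmp C (at_mor (g.hX X) t) (whl C (fun1 (fun0 ?G X) t) (amap (amap m X) (dom1 T t)))" if X: "X \<in> Obj S" for X
    using modificationD[OF mX[OF X] t] by (simp only: slides_not_Colax[OF False])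
   then show ?thesis unfolding slides_not_Colax[OF False] using t
    by (simp add: face_not_Colax[OF False] rowl_def rowr_def c cong: restrict_cong)
  qed
  then show "slides (dual w) \<B> (at_mor (amap (swap1 (adom m))) t) (at_mor (amap (swap1 (acod m))) t)
    (whl \<B> (fun1 (swap0 ?G) t) (amap (swap2 m) (dom1 T t))) (whr \<B> (amap (swap2 m) (cod1 T t)) (fun1 (swap0 ?F) t))"
   using t Y by (simp only: swap1_simps swap0_simps swap2_simps)
 qed
 then show "swap2 m \<in> Cell \<D>" using f.swap1_Mor g.swap1_Mor by (simp add: Cell_Fun c)
qed

lemma row_id1:
 assumes F: "is_ffunctor S \<A> F" and Y: "Y \<in> Obj T" shows "row (id1 \<E> F) Y = id1 \<B> (pt F Y)"
proof -
 interpret f: swap_object S T C w F by (rule swap_objectI[OF F])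
 have i: "id1 \<E> F \<in> Mor \<E>" using F by (intro E.id1_Mor) simp
 show ?thesis
 proof (rule Mor_Fun_eqI)
  show "row (id1 \<E> F) Y \<in> Mor \<B>" by (rule swap_morphism.row_Mor[OF swap_morphismI[OF i] Y])
  show "id1 \<B> (pt F Y) \<in> Mor \<B>" using f.pt[OF Y] by (intro B.id1_Mor) simp
 qed (use Y f.F.fun0_Obj f.F.fun1_Mor in \<open>simp_all add: id_transf_def\<close>)
qed

lemma swap1_id1:
 assumes F: "is_ffunctor S \<A> F" shows "swap1 (id1 \<E> F) = id1 \<D> (swap0 F)"
proof -
 interpret f: swap_object S T C w F by (rule swap_objectI[OF F])
 have i: "id1 \<E> F \<in> Mor \<E>" using F by (intro E.id1_Mor) simp
 interpret h: swap_morphism S T C w "id1 \<E> F" by (rule swap_morphismI[OF i])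
 have face: "face (id1 \<E> F) t = id2 \<B> (swt F t)" if t: "t \<in> Mor T" for t
 proof -
  have Y: "dom1 T t \<in> Obj T" "cod1 T t \<in> Obj T" using t by simp_all
  have e: "cmp1 \<B> (swt F t) (id1 \<B> (pt F (dom1 T t))) = swt F t" "cmp1 \<B> (id1 \<B> (pt F (cod1 T t))) (swt F t) = swt F t"
   by (rule B.cmp1_id_left[OF f.swt_Mor[OF t]] B.cmp1_id_right[OF f.swt_Mor[OF t]]; simp)+
  have a: "adom (id1 \<E> F) = F" "acod (id1 \<E> F) = F" by simp_all
  have "wcell (dual w) \<B> (swt F t) (swt F t) (face (id1 \<E> F) t)"
   using h.face_wcell[OF t] unfolding row_id1[OF F Y(1)] row_id1[OF F Y(2)] a e .
  from wcell_Fun_eqI[OF this B.wcell_id2[OF f.swt_Mor[OF t]]] show ?thesis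
   using t by (simp add: id_transf_def)
 qed
 show ?thesis
 proof (rule Mor_Fun_eqI)
  show "swap1 (id1 \<E> F) \<in> Mor \<D>" by (rule h.swap1_Mor)
  show "id1 \<D> (swap0 F) \<in> Mor \<D>" using f.swap0 by (intro D.id1_Mor) simp
  show "at_ob (amap (swap1 (id1 \<E> F))) Y = at_ob (amap (id1 \<D> (swap0 F))) Y" if "Y \<in> Obj T" for Y
   using row_id1[OF F that] that by (simp add: id_transf_def)
  show "at_mor (amap (swap1 (id1 \<E> F))) t = at_mor (amap (id1 \<D> (swap0 F))) t" if "t \<in> Mor T" for t
   using face[OF that] that by (simp add: id_transf_def)
 qed simp_all
qed

lemma row_cmp1:
 assumes f: "f \<in> Mor \<E>" and g: "g \<in> Mor \<E>" and fg: "acod f = adom g" and Y: "Y \<in> Obj T"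
 shows "row (cmp1 \<E> g f) Y = cmp1 \<B> (row g Y) (row f Y)"
proof -
 have i: "cmp1 \<E> g f \<in> Mor \<E>" by (rule E.cmp1_Mor[OF f g]) (simp add: fg)
 show ?thesis
 proof (rule Mor_Fun_eqI)
  show "row (cmp1 \<E> g f) Y \<in> Mor \<B>" by (rule swap_morphism.row_Mor[OF swap_morphismI[OF i] Y])
  show "cmp1 \<B> (row g Y) (row f Y) \<in> Mor \<B>"
   by (rule B.cmp1_Mor[OF swap_morphism.row_Mor[OF swap_morphismI[OF f] Y] swap_morphism.row_Mor[OF swap_morphismI[OF g] Y]]) (simp add: fg)
  show "at_ob (amap (row (cmp1 \<E> g f) Y)) X = at_ob (amap (cmp1 \<B> (row g Y) (row f Y))) X" if "X \<in> Obj S" for X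
   using that Y by (simp add: comp_transf_def)
  show "at_mor (amap (row (cmp1 \<E> g f) Y)) s = at_mor (amap (cmp1 \<B> (row g Y) (row f Y))) s" if "s \<in> Mor S" for s
   using that Y by (simp add: comp_transf_def)
 qed simp_all
qed

text \<open>The components of both sides at a pair of \<open>X\<close> and \<open>t\<close> are the
  same pasting of the cells of \<open>f\<close> and \<open>g\<close>. The work lies in aligning the
  ends of the faces by associativity in \<open>\<B>\<close>.\<close>

lemma swap1_cmp1:
 assumes f: "f \<in> Mor \<E>" and g: "g \<in> Mor \<E>" and fg: "acod f = adom g"
 shows "swap1 (cmp1 \<E> g f) = cmp1 \<D> (swap1 g) (swap1 f)"
proof -
 have i: "cmp1 \<E> g f \<in> Mor \<E>" by (rule E.cmp1_Mor[OF f g]) (simp add: fg)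
 interpret f: swap_morphism S T C w f by (rule swap_morphismI[OF f])
 interpret g: swap_morphism S T C w g by (rule swap_morphismI[OF g])
 interpret h: swap_morphism S T C w "cmp1 \<E> g f" by (rule swap_morphismI[OF i])
 have face: "face (cmp1 \<E> g f) t = vpaste (dual w) \<B> (whl \<B> (row g (cod1 T t)) (face f t)) (whr \<B> (face g t) (row f (dom1 T t)))"
  if t: "t \<in> Mor T" for t
 proof -
  let ?Y = "dom1 T t" and ?Y' = "cod1 T t"
  have Y: "?Y \<in> Obj T" "?Y' \<in> Obj T" using t by simp_all
  note M = f.F.swt_Mor[OF t] f.G.swt_Mor[OF t] g.G.swt_Mor[OF t] f.row_Mor[OF Y(1)] f.row_Mor[OF Y(2)] g.row_Mor[OF Y(1)] g.row_Mor[OF Y(2)]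
  have d: "adom (adom (face g t)) = pt (adom g) ?Y" "acod (adom (face f t)) = pt (acod f) ?Y'"
   by (rule g.face_ends[OF t] f.face_ends[OF t])+
  have 1: "wcell (dual w) \<B> (cmp1 \<B> (cmp1 \<B> (swt (acod g) t) (row g ?Y)) (row f ?Y)) (cmp1 \<B> (cmp1 \<B> (row g ?Y') (swt (adom g) t)) (row f ?Y))
    (whr \<B> (face g t) (row f ?Y))"
   by (rule B.wcell_hcmp_right[OF g.face_wcell[OF t] M(4)]) (simp add: d fg)
  have 2: "wcell (dual w) \<B> (cmp1 \<B> (row g ?Y') (cmp1 \<B> (swt (acod f) t) (row f ?Y))) (cmp1 \<B> (row g ?Y') (cmp1 \<B> (row f ?Y') (swt (adom f) t)))
    (whl \<B> (row g ?Y') (face f t))"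
   by (rule B.wcell_hcmp_left[OF f.face_wcell[OF t] M(7)]) (simp add: d fg)
  have a: "adom (cmp1 \<E> g f) = adom f" "acod (cmp1 \<E> g f) = acod g" by simp_all
  have a1: "cmp1 \<B> (cmp1 \<B> (row g ?Y') (swt (adom g) t)) (row f ?Y) = cmp1 \<B> (row g ?Y') (cmp1 \<B> (swt (acod f) t) (row f ?Y))"
   unfolding fg by (rule B.cmp1_assoc[OF M(4) M(2)[unfolded fg] M(7)]) (simp_all add: fg)
  have a2: "cmp1 \<B> (cmp1 \<B> (swt (acod g) t) (row g ?Y)) (row f ?Y) = cmp1 \<B> (swt (acod g) t) (cmp1 \<B> (row g ?Y) (row f ?Y))"
   by (rule B.cmp1_assoc[OF M(4,6,3)]) (simp_all add: fg)
  have a3: "cmp1 \<B> (row g ?Y') (cmp1 \<B> (row f ?Y') (swt (adom f) t)) = cmp1 \<B> (cmp1 \<B> (row g ?Y') (row f ?Y')) (swt (adom f) t)"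
   by (rule B.cmp1_assoc[symmetric, OF M(1,5,7)]) (simp_all add: fg)
  have 3: "wcell (dual w) \<B> (cmp1 \<B> (swt (acod g) t) (cmp1 \<B> (row g ?Y) (row f ?Y))) (cmp1 \<B> (cmp1 \<B> (row g ?Y') (row f ?Y')) (swt (adom f) t)) (face (cmp1 \<E> g f) t)"
   using h.face_wcell[OF t] unfolding row_cmp1[OF f g fg Y(1)] row_cmp1[OF f g fg Y(2)] a .
  show ?thesis
  proof (rule wcell_Fun_eqI[OF 3 B.wcell_vpaste[OF 1[unfolded a1 a2] 2[unfolded a3]]])
   fix X assume X: "X \<in> Obj S"
   show "amap (face (cmp1 \<E> g f) t) X = amap (vpaste (dual w) \<B> (whl \<B> (row g ?Y') (face f t)) (whr \<B> (face g t) (row f ?Y))) X"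
    using X t by (simp add: comp_transf_def)
  qed
 qed
 show ?thesis
 proof (rule Mor_Fun_eqI)
  show "swap1 (cmp1 \<E> g f) \<in> Mor \<D>" by (rule h.swap1_Mor)
  show "cmp1 \<D> (swap1 g) (swap1 f) \<in> Mor \<D>" by (rule D.cmp1_Mor[OF f.swap1_Mor g.swap1_Mor]) (simp add: fg)
  show "at_ob (amap (swap1 (cmp1 \<E> g f))) Y = at_ob (amap (cmp1 \<D> (swap1 g) (swap1 f))) Y" if "Y \<in> Obj T" for Y
   using row_cmp1[OF f g fg that] that by (simp add: comp_transf_def)
  show "at_mor (amap (swap1 (cmp1 \<E> g f))) t = at_mor (amap (cmp1 \<D> (swap1 g) (swap1 f))) t" if t: "t \<in> Mor T" for t
  proof -
   have Y: "dom1 T t \<in> Obj T" "cod1 T t \<in> Obj T" using t by simp_all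
   show ?thesis unfolding at_mor_cmp1_Fun[OF t] swap1_simps(3)[OF Y(1)] swap1_simps(3)[OF Y(2)] swap1_simps(4)[OF t] by (rule face[OF t])
  qed
 qed simp_all
qed

end

lemma two_fun_eqI:
 assumes "is_ffunctor A B F" "is_ffunctor A B G" "!!X. X \<in> Obj A ==> fun0 F X = fun0 G X"
  "!!f. f \<in> Mor A ==> fun1 F f = fun1 G f" "!!a. a \<in> Cell A ==> fun2 F a = fun2 G a"
 shows "F = G"
proof -
 have e: "fun0 H \<in> extensional (Obj A)" "fun1 H \<in> extensional (Mor A)" "fun2 H \<in> extensional (Cell A)" if "is_ffunctor A B H" for H
  using that by (auto simp: is_ffunctor_def is_two_functor_def is_functor_def mor_cat_def vert_cat_def PiE_iff)
 show ?thesis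
  by (rule two_fun.equality) (auto intro: extensionalityI[OF e(1)[OF assms(1)] e(1)[OF assms(2)]]
   extensionalityI[OF e(2)[OF assms(1)] e(2)[OF assms(2)]] extensionalityI[OF e(3)[OF assms(1)] e(3)[OF assms(2)]] assms(3-5))
qed

section \<open>The transposition \<open>F\<close>-functor and its inverse\<close>

context swapping
begin

definition "Swap = \<lparr>fun0 = \<lambda>F\<in>Obj \<E>. swap0 F, fun1 = \<lambda>h\<in>Mor \<E>. swap1 h, fun2 = \<lambda>m\<in>Cell \<E>. swap2 m\<rparr>"

lemma Swap_simps:
 "F \<in> Obj \<E> ==> fun0 Swap F = swap0 F" "h \<in> Mor \<E> ==> fun1 Swap h = swap1 h" "m \<in> Cell \<E> ==> fun2 Swap m = swap2 m"
 by (simp_all add: Swap_def del: Obj_Fun)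

lemma swap2_id2: "swap2 (id2 \<E> h) = id2 \<D> (swap1 h)"
 by (simp add: swap2_def rowc_def cong: restrict_cong)

lemma swap2_vcmp: "swap2 (vcmp \<E> n m) = vcmp \<D> (swap2 n) (swap2 m)"
 by (simp add: swap2_def rowc_def cong: restrict_cong)

lemma swap2_hcmp:
 assumes m: "m \<in> Cell \<E>" and n: "n \<in> Cell \<E>" and mn: "acod (adom m) = adom (adom n)"
 shows "swap2 (hcmp \<E> n m) = hcmp \<D> (swap2 n) (swap2 m)"
proof -
 note c = Cell_FunD(1-4)[OF m] Cell_FunD(1-4)[OF n]
 have mn': "acod (acod m) = adom (acod n)" using c mn by simp
 have e: "adom (hcmp \<E> n m) = cmp1 \<E> (adom n) (adom m)" "acod (hcmp \<E> n m) = cmp1 \<E> (acod n) (acod m)"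
  using c by simp_all
 have e': "adom (hcmp \<D> (swap2 n) (swap2 m)) = cmp1 \<D> (swap1 (adom n)) (swap1 (adom m))"
  "acod (hcmp \<D> (swap2 n) (swap2 m)) = cmp1 \<D> (swap1 (acod n)) (swap1 (acod m))"
  using c by simp_all
 have r: "rowc (hcmp \<E> n m) Y = hcmp \<B> (rowc n Y) (rowc m Y)" if Y: "Y \<in> Obj T" for Y
 proof -
  have "adom (rowc (hcmp \<E> n m) Y) = cmp1 \<B> (row (adom n) Y) (row (adom m) Y)"
   unfolding rowc_simps e by (rule row_cmp1[OF c(1,5) mn Y])
  moreover have "acod (rowc (hcmp \<E> n m) Y) = cmp1 \<B> (row (acod n) Y) (row (acod m) Y)"
   unfolding rowc_simps e by (rule row_cmp1[OF c(2,6) mn' Y])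
  ultimately show ?thesis using c Y by (intro arr.expand) (simp add: rowc_def cong: restrict_cong)
 qed
 have "amap (swap2 (hcmp \<E> n m)) = amap (hcmp \<D> (swap2 n) (swap2 m))"
  using r by (simp add: swap2_def cong: restrict_cong)
 then show ?thesis
  by (intro arr.expand) (simp only: swap2_simps e e' swap1_cmp1[OF c(1,5) mn] swap1_cmp1[OF c(2,6) mn'] simp_thms)
qed

text \<open>The conditions redistribute: tight components of \<open>h\<close> give both tight
  1-cells in each row and identity faces, while the identity structure cells of \<open>h\<close>
  give the identity structure cells of the rows.\<close>

lemma swap1_Tight:
 assumes h: "h \<in> Tight \<E>" shows "swap1 h \<in> Tight \<D>"
proof -
 have h': "h \<in> Mor \<E>" and t: "!!X. X \<in> Obj S ==> at_ob (amap h) X \<in> Tight \<A>" and i: "!!s. s \<in> Mor S ==> identity_cell \<A> (at_mor (amap h) s)"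
  using h by (simp_all add: Tight_Fun[of _ w S \<A>])
 interpret h: swap_morphism S T C w h by (rule swap_morphismI[OF h'])
 have "row h Y \<in> Tight \<B>" if Y: "Y \<in> Obj T" for Y
  using h.row_Mor[OF Y] t Y identity_cell_FunD[OF T.fcat C.fcat i Y]
  by (simp add: Tight_Fun)
 moreover have "identity_cell \<B> (face h u)" if u: "u \<in> Mor T" for u
  by (rule identity_cell_FunI[OF S.fcat C.fcat h.face_Cell[OF u]])
   (use t u in \<open>simp add: Tight_Fun\<close>)
 ultimately show ?thesis using h.swap1_Mor by (simp add: Tight_Fun[of _ _ T \<B>])
qed

lemma is_ffunctor_Swap: "is_ffunctor \<E> \<D> Swap"
proof -
 have 0: "swap0 F \<in> Obj \<D>" if "F \<in> Obj \<E>" for F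
  using swap_object.swap0[OF swap_objectI] that by simp
 have "is_two_functor \<E> \<D> Swap"
 proof (rule is_two_functorI[OF E.two_category_axioms D.two_category_axioms], goal_cases)
  case 1 then show ?case using 0 by (simp add: Swap_def PiE_iff del: Obj_Fun)
 next
  case 2 then show ?case using swap_morphism.swap1_Mor[OF swap_morphismI] by (simp add: Swap_def PiE_iff)
 next
  case 3 then show ?case using swap2_Cell(2) by (simp add: Swap_def PiE_iff)
 next
  case (4 f) then show ?case using Swap_simps(1)[OF E.dom1_Obj[OF 4]] Swap_simps(1)[OF E.cod1_Obj[OF 4]] by (simp add: Swap_simps(2))
 next
  case (5 m) then show ?case using Swap_simps(2)[OF E.dom2_Mor[OF 5]] Swap_simps(2)[OF E.cod2_Mor[OF 5]] by (simp add: Swap_simps(3))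
 next
  case (6 F)
  show ?case unfolding Swap_simps(1)[OF 6] Swap_simps(2)[OF E.id1_Mor[OF 6]] using 6 by (intro swap1_id1) simp
 next
  case (7 f)
  show ?case unfolding Swap_simps(2)[OF 7] Swap_simps(3)[OF E.id2_Cell[OF 7]] by (rule swap2_id2)
 next
  case (8 f g)
  show ?case unfolding Swap_simps(2)[OF 8(1)] Swap_simps(2)[OF 8(2)] Swap_simps(2)[OF E.cmp1_Mor[OF 8]]
   by (rule swap1_cmp1[OF 8[unfolded Fun_simps]])
 next
  case (9 m n)
  show ?case unfolding Swap_simps(3)[OF 9(1)] Swap_simps(3)[OF 9(2)] Swap_simps(3)[OF E.vcmp_Cell[OF 9]] by (rule swap2_vcmp)
 next
  case (10 m n)
  show ?case unfolding Swap_simps(3)[OF 10(1)] Swap_simps(3)[OF 10(2)] Swap_simps(3)[OF E.hcmp_Cell[OF 10]]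
   by (rule swap2_hcmp[OF 10[unfolded Fun_simps]])
 qed
 moreover have "fun1 Swap f \<in> Tight \<D>" if f: "f \<in> Tight \<E>" for f
 proof -
  have "f \<in> Mor \<E>" using f E.Tight_Mor by blast
  then show ?thesis using swap1_Tight[OF f] by (simp only: Swap_simps)
 qed
 ultimately show ?thesis by (simp add: is_ffunctor_def)
qed

lemma swapping_reverse: "swapping T S C"
 by (simp add: swapping_def S.fcat T.fcat C.fcat)

text \<open>Since \<open>dual\<close> is an involution, \<open>\<B>\<close> is the category needed
  for the locale with \<open>S\<close> and \<open>T\<close> exchanged and \<open>dual w\<close> for
  \<open>w\<close>. Transposing back is therefore an instance of the construction already
  studied.\<close>

lemma swap_object_reverse: "is_ffunctor T \<B> G ==> swap_object T S C (dual w) G"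
 by (simp add: swap_object_def swap_object_axioms_def swapping_reverse)

lemma swap_morphism_reverse: "h \<in> Mor \<D> ==> swap_morphism T S C (dual w) h"
 by (simp add: swap_morphism_def swap_morphism_axioms_def swapping_reverse)

context
 fixes F assumes F: "is_ffunctor S \<A> F"
begin

interpretation f: swap_object S T C w F by (rule swap_objectI[OF F])
interpretation R: swapping T S C "dual w" by (rule swapping_reverse)
interpretation g: swap_object T S C "dual w" "swap0 F" by (rule swap_object_reverse[OF f.swap0])

lemma pt_swap0:
 assumes X: "X \<in> Obj S" shows "R.pt (swap0 F) X = fun0 F X"
proof (rule two_fun_eqI[OF g.pt[OF X] ffunctor.is_ffunctor[OF f.FX[OF X]]])
qed (simp_all add: X)

text \<open>Components return at once. Structure cells have been flipped twice, and
  \<open>flip_flip\<close> cancels the flips because they are \<open>dual w\<close>-cells.\<close>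

lemma swt_swap0:
 assumes s: "s \<in> Mor S" shows "R.swt (swap0 F) s = fun1 F s"
proof (rule Mor_Fun_eqI)
 have X: "dom1 S s \<in> Obj S" "cod1 S s \<in> Obj S" using s by simp_all
 show "R.swt (swap0 F) s \<in> Mor \<A>" by (rule g.swt_Mor[OF s])
 show "fun1 F s \<in> Mor \<A>" by (rule f.F.fun1_Mor[OF s])
 show "adom (R.swt (swap0 F) s) = adom (fun1 F s)" "acod (R.swt (swap0 F) s) = acod (fun1 F s)"
  using f.F.dom1_fun1[OF s] f.F.cod1_fun1[OF s] X by (simp_all add: pt_swap0)
 show "at_ob (amap (R.swt (swap0 F) s)) Y = at_ob (amap (fun1 F s)) Y" if "Y \<in> Obj T" for Y
  using that s by simp
 show "at_mor (amap (R.swt (swap0 F) s)) t = at_mor (amap (fun1 F s)) t" if t: "t \<in> Mor T" for t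
  using C.flip_flip[OF w_nat.at_mor_wcell[OF f.Fs[OF s] t]] t s by simp
qed

lemma swc_swap0:
 assumes z: "z \<in> Cell S" shows "R.swc (swap0 F) z = fun2 F z"
proof (rule Cell_Fun_eqI)
 show "R.swc (swap0 F) z \<in> Cell \<A>" by (rule g.swc_Cell[OF z])
 show "fun2 F z \<in> Cell \<A>" by (rule f.F.fun2_Cell[OF z])
 show "adom (R.swc (swap0 F) z) = adom (fun2 F z)" "acod (R.swc (swap0 F) z) = acod (fun2 F z)"
  using f.F.dom2_fun2[OF z] f.F.cod2_fun2[OF z] z by (simp_all add: swt_swap0)
 show "amap (R.swc (swap0 F) z) Y = amap (fun2 F z) Y" if "Y \<in> Obj T" for Y
  using that z by simp
qed

lemma swap0_swap0: "R.swap0 (swap0 F) = F"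
proof (rule two_fun_eqI[OF g.swap0 F])
qed (simp_all add: pt_swap0 swt_swap0 swc_swap0)

end

text \<open>Faces and rows exchange their roles: transposing a row gives back a component of
  \<open>h\<close>, and the faces of the transpose are its structure cells, with the same ends once
  the rows have been identified.\<close>

lemma swap1_swap1:
 assumes h: "h \<in> Mor \<E>"
 shows row_swap1: "!!X. X \<in> Obj S ==> swapping.row T S C (dual w) (swap1 h) X = at_ob (amap h) X"
  and "swapping.swap1 T S C (dual w) (swap1 h) = h"
proof -
 interpret h: swap_morphism S T C w h by (rule swap_morphismI[OF h])
 interpret k: swap_morphism T S C "dual w" "swap1 h" by (rule swap_morphism_reverse[OF h.swap1_Mor])
 interpret H: w_nat S \<A> "adom h" "acod h" w "amap h" by (rule h.w_nat_h)
 have F: "is_ffunctor S \<A> (adom h)" "is_ffunctor S \<A> (acod h)" using h by (simp_all add: Mor_Fun)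
 show row: "k.row (swap1 h) X = at_ob (amap h) X" if X: "X \<in> Obj S" for X
 proof (rule Mor_Fun_eqI)
  show "k.row (swap1 h) X \<in> Mor \<A>" by (rule k.row_Mor[OF X])
  show "at_ob (amap h) X \<in> Mor \<A>" by (rule H.at_ob_Mor[OF X])
  show "adom (k.row (swap1 h) X) = adom (at_ob (amap h) X)" "acod (k.row (swap1 h) X) = acod (at_ob (amap h) X)"
   using H.dom1_at_ob[OF X] H.cod1_at_ob[OF X] pt_swap0[OF F(1) X] pt_swap0[OF F(2) X] by simp_all
 qed (use X in simp_all)
 have face: "k.face (swap1 h) s = at_mor (amap h) s" if s: "s \<in> Mor S" for s
 proof -
  have X: "dom1 S s \<in> Obj S" "cod1 S s \<in> Obj S" using s by simp_all
  show ?thesis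
  proof (rule wcell_Fun_eqI[OF _ H.at_mor_wcell[OF s]])
   show "wcell w \<A> (cmp1 \<A> (fun1 (acod h) s) (at_ob (amap h) (dom1 S s))) (cmp1 \<A> (at_ob (amap h) (cod1 S s)) (fun1 (adom h) s)) (k.face (swap1 h) s)"
    using k.face_wcell[OF s] unfolding row[OF X(1)] row[OF X(2)] swap1_simps(1,2) swt_swap0[OF F(1) s] swt_swap0[OF F(2) s] dual_simps(1) .
   show "amap (k.face (swap1 h) s) Y = amap (at_mor (amap h) s) Y" if "Y \<in> Obj T" for Y
    using that s by simp
  qed
 qed
 show "k.swap1 (swap1 h) = h"
 proof (rule Mor_Fun_eqI)
  show "k.swap1 (swap1 h) \<in> Mor \<E>" using k.swap1_Mor by simp
  show "h \<in> Mor \<E>" by (rule h)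
 qed (simp_all add: row face swap0_swap0 F)
qed

lemma swap2_swap2:
 assumes m: "m \<in> Cell \<E>"
 shows "swapping.swap2 T S C (dual w) (swap2 m) = m"
proof -
 interpret R: swapping T S C "dual w" by (rule swapping_reverse)
 have m': "swap2 m \<in> Cell R.\<E>" using swap2_Cell(2)[OF m] by simp
 note c = Cell_FunD[OF m]
 show ?thesis
 proof (rule Cell_Fun_eqI)
  show "R.swap2 (swap2 m) \<in> Cell \<E>" using R.swap2_Cell(2)[OF m'] by simp
  show "m \<in> Cell \<E>" by (rule m)
  show "adom (R.swap2 (swap2 m)) = adom m" "acod (R.swap2 (swap2 m)) = acod m"
   using swap1_swap1(2)[OF c(1)] swap1_swap1(2)[OF c(2)] by simp_all
  show "amap (R.swap2 (swap2 m)) X = amap m X" if X: "X \<in> Obj S" for X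
  proof -
   have "R.rowc (swap2 m) X = amap m X"
   proof (rule Cell_Fun_eqI)
    show "R.rowc (swap2 m) X \<in> Cell \<A>" by (rule R.rowc_Cell[OF m' X])
    show "amap m X \<in> Cell \<A>" by (rule c(5)[OF X])
    show "adom (R.rowc (swap2 m) X) = adom (amap m X)" "acod (R.rowc (swap2 m) X) = acod (amap m X)"
     using c(6,7)[OF X] row_swap1[OF c(1) X] row_swap1[OF c(2) X] by simp_all
    show "amap (R.rowc (swap2 m) X) Y = amap (amap m X) Y" if "Y \<in> Obj T" for Y
     using that X by simp
   qed
   then show ?thesis using X by simp
  qed
 qed
qed

lemma Swap_Swap:
 "F \<in> Obj \<E> ==> fun0 (swapping.Swap T S C (dual w)) (fun0 Swap F) = F"
 "h \<in> Mor \<E> ==> fun1 (swapping.Swap T S C (dual w)) (fun1 Swap h) = h"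
 "m \<in> Cell \<E> ==> fun2 (swapping.Swap T S C (dual w)) (fun2 Swap m) = m"
proof -
 interpret R: swapping T S C "dual w" by (rule swapping_reverse)
 interpret Sw: ffunctor \<E> \<D> Swap by (rule ffunctorI[OF fE fD is_ffunctor_Swap])
 show "fun0 R.Swap (fun0 Swap F) = F" if "F \<in> Obj \<E>"
 proof -
  have "fun0 Swap F \<in> Obj R.\<E>" using Sw.fun0_Obj[OF that] by simp
  then show ?thesis using that swap0_swap0[of F] by (simp only: R.Swap_simps Swap_simps Obj_Fun)
 qed
 show "fun1 R.Swap (fun1 Swap h) = h" if "h \<in> Mor \<E>"
 proof -
  have "fun1 Swap h \<in> Mor R.\<E>" using Sw.fun1_Mor[OF that] by simp
  then show ?thesis using that swap1_swap1(2)[OF that] by (simp only: R.Swap_simps Swap_simps)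
 qed
 show "fun2 R.Swap (fun2 Swap m) = m" if "m \<in> Cell \<E>"
 proof -
  have "fun2 Swap m \<in> Cell R.\<E>" using Sw.fun2_Cell[OF that] by simp
  then show ?thesis using that swap2_swap2[OF that] by (simp only: R.Swap_simps Swap_simps)
 qed
qed

end

section \<open>Restriction to full sub-\<open>F\<close>-categories\<close>

lemma fcat_isomorphic_full_subfcat:
 assumes C: "fcategory C" and D: "fcategory D" and F: "is_ffunctor C D F" and G: "is_ffunctor D C G"
  and GF: "!!X. X \<in> Obj C ==> fun0 G (fun0 F X) = X" "!!f. f \<in> Mor C ==> fun1 G (fun1 F f) = f" "!!a. a \<in> Cell C ==> fun2 G (fun2 F a) = a"
  and FG: "!!X. X \<in> Obj D ==> fun0 F (fun0 G X) = X" "!!f. f \<in> Mor D ==> fun1 F (fun1 G f) = f" "!!a. a \<in> Cell D ==> fun2 F (fun2 G a) = a"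
  and P: "!!X. [|X \<in> Obj C; X \<in> P|] ==> fun0 F X \<in> Q" and Q: "!!X. [|X \<in> Obj D; X \<in> Q|] ==> fun0 G X \<in> P"
 shows "fcat_isomorphic (full_subfcat C P) (full_subfcat D Q)"
proof -
 let ?C = "full_subfcat C P" and ?D = "full_subfcat D Q"
 interpret F: ffunctor C D F by (rule ffunctorI[OF C D F])
 interpret G: ffunctor D C G by (rule ffunctorI[OF D C G])
 \<comment> \<open>The maps are restricted to the smaller carriers because an
   \<open>F\<close>-functor is \<open>undefined\<close> off its domain; the composites can then
   equal the identity \<open>F\<close>-functors.\<close>
 define F' where "F' = \<lparr>fun0 = restrict (fun0 F) (Obj ?C), fun1 = restrict (fun1 F) (Mor ?C), fun2 = restrict (fun2 F) (Cell ?C)\<rparr>"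
 define G' where "G' = \<lparr>fun0 = restrict (fun0 G) (Obj ?D), fun1 = restrict (fun1 G) (Mor ?D), fun2 = restrict (fun2 G) (Cell ?D)\<rparr>"
 have 1: "is_two_functor ?C ?D F'"
  by (rule is_two_functorI[OF fcategory_two[OF fcategory_full_subfcat[OF C]] fcategory_two[OF fcategory_full_subfcat[OF D]]])
   (simp_all add: F'_def P PiE_iff)
 have 2: "is_two_functor ?D ?C G'"
  by (rule is_two_functorI[OF fcategory_two[OF fcategory_full_subfcat[OF D]] fcategory_two[OF fcategory_full_subfcat[OF C]]])
   (simp_all add: G'_def Q PiE_iff)
 have "is_ffunctor ?C ?D F'" "is_ffunctor ?D ?C G'" using 1 2 by (simp_all add: is_ffunctor_def F'_def G'_def P Q)
 moreover have "comp_ffunctor ?C G' F' = id_ffunctor ?C"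
  by (auto simp: comp_ffunctor_def id_ffunctor_def F'_def G'_def compose_def P GF intro!: restrict_ext)
 moreover have "comp_ffunctor ?D F' G' = id_ffunctor ?D"
  by (auto simp: comp_ffunctor_def id_ffunctor_def F'_def G'_def compose_def Q FG intro!: restrict_ext)
 ultimately show ?thesis unfolding fcat_isomorphic_def by blast
qed

text \<open>A cell of \<open>A\<close> with ends in \<open>P\<close> is a cell of the subcategory,
  and so is its inverse, so no condition on transformations or modifications changes. The result is
  an equality of records, which allows categories of models in categories of models to be
  rewritten.\<close>

lemma Fun_full_subfcat:
 assumes S: "fcategory S" and A: "fcategory A"
 shows "Fun w S (full_subfcat A P) = full_subfcat (Fun w S A) {M. \<forall>X\<in>Obj S. fun0 M X \<in> P}"
proof -
 let ?A = "full_subfcat A P" and ?P = "{M. \<forall>X\<in>Obj S. fun0 M X \<in> P}"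
 interpret S: fcategory S by (rule S)
 interpret A: fcategory A by (rule A)
 have ob: "is_ffunctor S ?A M \<longleftrightarrow> is_ffunctor S A M & (\<forall>X\<in>Obj S. fun0 M X \<in> P)" for M
  by (rule is_ffunctor_full_subfcat[OF S A])
 have id: "identity_cell ?A e \<longleftrightarrow> identity_cell A e" if "e \<in> Cell ?A" for e
  using that by (auto simp: identity_cell_def)
 have inv: "invertible_cell ?A e \<longleftrightarrow> invertible_cell A e" if e: "e \<in> Cell ?A" for e
 proof -
  have "n \<in> Cell ?A" if "n \<in> Cell A" "dom2 A n = cod2 A e" for n using that e by simp
  then show ?thesis unfolding invertible_cell_def full_subfcat_simps by auto
 qed
 have good: "wgood w ?A e \<longleftrightarrow> wgood w A e" if "e \<in> Cell ?A" for e using id[OF that] inv[OF that] by (simp add: wgood_def)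
 have wc: "wcell w ?A a b e \<longleftrightarrow> wcell w A a b e" if "dom1 A a \<in> P" "cod1 A a \<in> P" "dom1 A b \<in> P" "cod1 A b \<in> P" for a b e
 proof -
  have "e \<in> Cell ?A" if "e \<in> Cell A" "dom2 A e = a \<or> dom2 A e = b" using that \<open>dom1 A a \<in> P\<close> \<open>cod1 A a \<in> P\<close> \<open>dom1 A b \<in> P\<close> \<open>cod1 A b \<in> P\<close> by auto
  then show ?thesis using good[of e] unfolding wcell_def full_subfcat_simps by (auto split: if_splits)
 qed
 have nat: "w_natural w S ?A M N \<phi> \<longleftrightarrow> w_natural w S A M N \<phi>"
  if M: "is_ffunctor S A M" "\<forall>X\<in>Obj S. fun0 M X \<in> P" and N: "is_ffunctor S A N" "\<forall>X\<in>Obj S. fun0 N X \<in> P" for M N \<phi>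
 proof -
  interpret M: ffunctor S A M by (rule ffunctorI[OF S A M(1)])
  interpret N: ffunctor S A N by (rule ffunctorI[OF S A N(1)])
  have mor: "(at_ob \<phi> X \<in> Mor ?A & dom1 A (at_ob \<phi> X) = fun0 M X & cod1 A (at_ob \<phi> X) = fun0 N X) \<longleftrightarrow>
   (at_ob \<phi> X \<in> Mor A & dom1 A (at_ob \<phi> X) = fun0 M X & cod1 A (at_ob \<phi> X) = fun0 N X)" if "X \<in> Obj S" for X
   using M(2) N(2) that by auto
  show ?thesis
  proof (cases "\<forall>X\<in>Obj S. at_ob \<phi> X \<in> Mor A & dom1 A (at_ob \<phi> X) = fun0 M X & cod1 A (at_ob \<phi> X) = fun0 N X")
   case False
   then show ?thesis using mor unfolding w_natural_def full_subfcat_simps(5,6) by blast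
  next
   case True
   have w: "wcell w ?A (cmp1 A (fun1 N s) (at_ob \<phi> (dom1 S s))) (cmp1 A (at_ob \<phi> (cod1 S s)) (fun1 M s)) e \<longleftrightarrow>
    wcell w A (cmp1 A (fun1 N s) (at_ob \<phi> (dom1 S s))) (cmp1 A (at_ob \<phi> (cod1 S s)) (fun1 M s)) e" if s: "s \<in> Mor S" for s e
    using s M(2) N(2) True by (intro wc) simp_all
   have t: "identity_cell ?A (at_mor \<phi> s) \<longleftrightarrow> identity_cell A (at_mor \<phi> s)"
    if "\<forall>s\<in>Mor S. wcell w A (cmp1 A (fun1 N s) (at_ob \<phi> (dom1 S s))) (cmp1 A (at_ob \<phi> (cod1 S s)) (fun1 M s)) (at_mor \<phi> s)" "s \<in> Tight S" for s
   proof (rule id)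
    have s: "s \<in> Mor S" using that(2) by simp
    from s have "wcell w ?A (cmp1 A (fun1 N s) (at_ob \<phi> (dom1 S s))) (cmp1 A (at_ob \<phi> (cod1 S s)) (fun1 M s)) (at_mor \<phi> s)" using that(1) w[OF s] by blast
    then show "at_mor \<phi> s \<in> Cell ?A" by (simp only: wcell_def)
   qed
   have v: "vpaste w ?A = vpaste w A" "slides w ?A = slides w A" by (simp_all add: vpaste_def slides_def fun_eq_iff)
   have "(\<forall>X\<in>Obj S. at_ob \<phi> X \<in> Mor ?A & dom1 A (at_ob \<phi> X) = fun0 M X & cod1 A (at_ob \<phi> X) = fun0 N X) \<longleftrightarrow>
    (\<forall>X\<in>Obj S. at_ob \<phi> X \<in> Mor A & dom1 A (at_ob \<phi> X) = fun0 M X & cod1 A (at_ob \<phi> X) = fun0 N X)" using mor by blast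
   moreover have "(\<forall>s\<in>Mor S. wcell w ?A (cmp1 A (fun1 N s) (at_ob \<phi> (dom1 S s))) (cmp1 A (at_ob \<phi> (cod1 S s)) (fun1 M s)) (at_mor \<phi> s)) \<longleftrightarrow>
    (\<forall>s\<in>Mor S. wcell w A (cmp1 A (fun1 N s) (at_ob \<phi> (dom1 S s))) (cmp1 A (at_ob \<phi> (cod1 S s)) (fun1 M s)) (at_mor \<phi> s))"
    using w by blast
   ultimately show ?thesis unfolding w_natural_def w_cell_iff full_subfcat_simps(5-) v using t by blast
  qed
 qed
 have md: "modification w S ?A M N \<phi> q m \<longleftrightarrow> modification w S A M N \<phi> q m"
  if M: "\<forall>X\<in>Obj S. fun0 M X \<in> P" and N: "\<forall>X\<in>Obj S. fun0 N X \<in> P" and \<phi>: "w_natural w S A M N \<phi>" for M N \<phi> q m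
 proof -
  have "cell_between ?A (at_ob \<phi> X) (at_ob q X) (m X) \<longleftrightarrow> cell_between A (at_ob \<phi> X) (at_ob q X) (m X)" if X: "X \<in> Obj S" for X
  proof -
   have "dom1 A (at_ob \<phi> X) \<in> P" "cod1 A (at_ob \<phi> X) \<in> P" using \<phi> M N X by (simp_all add: w_natural_def)
   then show ?thesis by (auto simp: cell_between_def)
  qed
  moreover have "slides w ?A = slides w A" by (simp add: slides_def fun_eq_iff)
  ultimately show ?thesis by (simp add: modification_def)
 qed
 have Mor: "f \<in> Mor (Fun w S ?A) \<longleftrightarrow> f \<in> Mor (full_subfcat (Fun w S A) ?P)" for f
  using nat[of "adom f" "acod f" "amap f"] by (auto simp: Mor_Fun ob)
 have ct: "comp_transf w S ?A = comp_transf w S A" by (simp add: comp_transf_def vpaste_def fun_eq_iff)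
 have it: "id_transf S ?A = id_transf S A" by (simp add: id_transf_def fun_eq_iff)
 have Obj: "Obj (Fun w S ?A) = Obj (full_subfcat (Fun w S A) ?P)" by (auto simp: ob)
 have Cell: "Cell (Fun w S ?A) = Cell (full_subfcat (Fun w S A) ?P)"
 proof (rule set_eqI)
  fix e
  have "modification w S ?A (adom (adom e)) (acod (adom e)) (amap (adom e)) (amap (acod e)) (amap e) \<longleftrightarrow>
   modification w S A (adom (adom e)) (acod (adom e)) (amap (adom e)) (amap (acod e)) (amap e)"
   if "adom e \<in> Mor (full_subfcat (Fun w S A) ?P)"
   using that by (intro md) (simp_all add: Mor_Fun)
  then show "e \<in> Cell (Fun w S ?A) \<longleftrightarrow> e \<in> Cell (full_subfcat (Fun w S A) ?P)"
   unfolding Cell_Fun Mor by (auto simp: Cell_Fun)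
 qed
 have Tight: "Tight (Fun w S ?A) = Tight (full_subfcat (Fun w S A) ?P)"
 proof (rule set_eqI)
  fix f
  have "(\<forall>X\<in>Obj S. at_ob (amap f) X \<in> Tight ?A) \<longleftrightarrow> (\<forall>X\<in>Obj S. at_ob (amap f) X \<in> Tight A)"
   "(\<forall>s\<in>Mor S. identity_cell ?A (at_mor (amap f) s)) \<longleftrightarrow> (\<forall>s\<in>Mor S. identity_cell A (at_mor (amap f) s))"
   if f: "f \<in> Mor (full_subfcat (Fun w S A) ?P)"
  proof -
   have f': "f \<in> Mor (Fun w S A)" "\<forall>X\<in>Obj S. fun0 (adom f) X \<in> P" "\<forall>X\<in>Obj S. fun0 (acod f) X \<in> P" using f by simp_all
   note m = Mor_Fun_simps[OF S A f'(1)]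
   show "(\<forall>X\<in>Obj S. at_ob (amap f) X \<in> Tight ?A) \<longleftrightarrow> (\<forall>X\<in>Obj S. at_ob (amap f) X \<in> Tight A)" using m(4,5) f' by auto
   have "at_mor (amap f) s \<in> Cell ?A" if "s \<in> Mor S" for s using m(6-8)[OF that] f' that by simp
   then show "(\<forall>s\<in>Mor S. identity_cell ?A (at_mor (amap f) s)) \<longleftrightarrow> (\<forall>s\<in>Mor S. identity_cell A (at_mor (amap f) s))" using id by blast
  qed
  then show "f \<in> Tight (Fun w S ?A) \<longleftrightarrow> f \<in> Tight (full_subfcat (Fun w S A) ?P)"
   unfolding Tight_Fun Mor by (auto simp: Tight_Fun)
 qed
 show ?thesis
  by (rule fcat.equality) (use Obj Cell Tight Mor in \<open>simp_all only: full_subfcat_simps(5-) set_eq_iff\<close>, simp_all add: Fun_def ct it fun_eq_iff)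
qed

lemma full_subfcat_full_subfcat: "full_subfcat (full_subfcat C P) Q = full_subfcat C (P \<inter> Q)"
 by (simp add: full_subfcat_def Int_assoc conj_ac)

section \<open>Models in categories of models\<close>

locale swap_models = swapping "ground S" "ground T" C w
 for w :: weakness and \<Psi> :: "('oj, 'mj, 'cj, 'x, 'y) weight set"
  and S :: "('oj, 'mj, 'cj, 'x, 'y, 'os, 'ms, 'cs) sketch"
  and T :: "('oj, 'mj, 'cj, 'x, 'y, 'ot, 'mt, 'ct) sketch"
  and C :: "('o, 'm, 'c) fcat" +
 assumes tight: "!!\<omega>. \<omega> \<in> \<Psi> ==> tight_limit_weight \<omega>"
  and S: "limit_sketch \<Psi> S" and T: "limit_sketch \<Psi> T" and complete: "complete_fcat \<Psi> C"
begin

abbreviation "\<M> \<equiv> Mod (dual w) T (limit_cone_sketch C)"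

lemma complete_Mod2: "complete_fcat \<Psi> \<M>" "complete_fcat \<Psi> (Mod w S (limit_cone_sketch \<M>))"
proof -
 show 1: "complete_fcat \<Psi> \<M>"
  by (rule model_setting.complete_Mod, unfold_locales) (fact tight T complete)+
 show "complete_fcat \<Psi> (Mod w S (limit_cone_sketch \<M>))"
  by (rule model_setting.complete_Mod, unfold_locales) (fact tight S 1)+
qed

definition "bimodels = {F. is_ffunctor (ground S) \<A> F & (\<forall>X\<in>Obj (ground S). fun0 F X \<in> models T C) & (\<forall>Y\<in>Obj (ground T). pt F Y \<in> models S C)}"

text \<open>The criterion \<open>Mod_limit_pointwise\<close> is applied to the image under
  \<open>F\<close> of a specified cone. Its evaluation at \<open>Y\<close> is the image of the same
  cone under \<open>pt F Y\<close>, so quantifying over the cones and over \<open>Y\<close> gives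
  the second condition of \<open>bimodels\<close>.\<close>

lemma models_iff: "F \<in> models S \<M> \<longleftrightarrow> F \<in> bimodels"
proof (cases "is_ffunctor (ground S) \<M> F")
 \<comment> \<open>Either side entails that \<open>F\<close> takes its values in models of
   \<open>T\<close>, that is, that it is an \<open>F\<close>-functor into
   \<open>\<M>\<close>.\<close>
 case False
 then show ?thesis unfolding bimodels_def Mod_eq is_ffunctor_full_subfcat[OF S.fcat fA]
  by (auto simp: model_iff Mod_eq is_ffunctor_full_subfcat[OF S.fcat fA])
next
 case True
 have F: "is_ffunctor (ground S) \<A> F" "\<forall>X\<in>Obj (ground S). fun0 F X \<in> models T C"
  using True unfolding Mod_eq is_ffunctor_full_subfcat[OF S.fcat fA] by blast+
 interpret MT: model_setting "dual w" \<Psi> T C by unfold_locales (fact tight T complete)+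
 interpret MS: model_setting w \<Psi> S C by unfold_locales (fact tight S complete)+
 interpret f: swap_object "ground S" "ground T" C w F by (rule swap_objectI[OF F(1)])
 interpret FM: ffunctor "ground S" \<M> F by (rule ffunctorI[OF S.fcat MT.fM True])
 have "limit_cone \<M> (image_cone F c) \<longleftrightarrow> (\<forall>Y\<in>Obj (ground T). limit_cone C (image_cone (pt F Y) c))" if c: "c \<in> cones S" for c
 proof -
  obtain K V where KV: "cat_weight K V" "wgt c = plus_weight K V" "weighted_cone (ground S) c" and \<omega>: "plus_weight K V \<in> \<Psi>"
   by (rule MS.sketch_cone[OF c])
  interpret KV: cat_weight K V by (rule KV(1))
  have fK: "fcategory (chordate K)" by (rule fcategory_chordate[OF KV.J.two_category_axioms])
  have E: "is_ffunctor (chordate K) (ground S) (dgm c)" using weighted_cone_dgm[OF KV(3)] by (simp add: KV(2))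
  interpret E: ffunctor "chordate K" "ground S" "dgm c" by (rule ffunctorI[OF fK S.fcat E])
  interpret CS: cone_data K V "ground S" "dgm c" by (rule cone_dataI[OF KV(1) S.fcat E])
  have wc: "legs_ext K V (legs c) & lcone (ground S) K V (dgm c) (apex c) (%j. on_ob (legs c j)) (%j. on_ar (legs c j)) &
    (\<forall>j\<in>Obj K. \<forall>x\<in>Ob (fun0 V j). on_ob (legs c j) x \<in> Tight (ground S))"
   using KV(3) unfolding CS.weighted_cone_iff[OF KV(2) refl] .
  note lc = wc[THEN conjunct2, THEN conjunct1] and tl = wc[THEN conjunct2, THEN conjunct2]
  note lm = CS.limcone_p[OF lc]
  have apex: "apex c \<in> Obj (ground S)" using lc by (simp add: lcone_def)
  have l: "lcone \<M> K V (comp_ffunctor (chordate K) F (dgm c)) (fun0 F (apex c)) (%k v. fun1 F (on_ob (legs c k) v)) (%k b. fun2 F (on_ar (legs c k) b))"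
   by (rule lcone_image[OF S.fcat MT.fM True KV(1) E lc])
  have D: "is_ffunctor (chordate K) \<M> (comp_ffunctor (chordate K) F (dgm c))"
   by (rule is_ffunctor_comp[OF fK S.fcat MT.fM E True])
  have t: "fun1 F (on_ob (legs c k) v) \<in> Tight \<M>" if "k \<in> Obj K" "v \<in> Ob (fun0 V k)" for k v
   using tl that by (intro FM.fun1_Tight) blast
  have "limcone C K V (comp_ffunctor (chordate K) (ev (dual w) (ground T) C Y) (comp_ffunctor (chordate K) F (dgm c))) (fun0 (fun0 F (apex c)) Y)
     (%k v. at_ob (amap (fun1 F (on_ob (legs c k) v))) Y) (%k b. amap (fun2 F (on_ar (legs c k) b)) Y) \<longleftrightarrow>
    limit_cone C (image_cone (pt F Y) c)" if Y: "Y \<in> Obj (ground T)" for Y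
  proof -
   \<comment> \<open>Composition is associative: evaluating at \<open>Y\<close> after
     \<open>F\<close> is \<open>pt F Y\<close>, so both diagrams are the same.\<close>
   have d: "comp_ffunctor (chordate K) (pt F Y) (dgm c) = comp_ffunctor (chordate K) (ev (dual w) (ground T) C Y) (comp_ffunctor (chordate K) F (dgm c))"
    using E.fun0_Obj E.fun1_Mor E.fun2_Cell by (auto simp: pt_def comp_ffunctor_def compose_def intro!: restrict_ext)
   have e0: "fun1 (pt F Y) (on_ob (legs c k) v) = at_ob (amap (fun1 F (on_ob (legs c k) v))) Y" if "k \<in> Obj K" "v \<in> Ob (fun0 V k)" for k v
    by (rule f.pt_simps(2)[OF lm(1)[OF that]])
   have e1: "fun2 (pt F Y) (on_ar (legs c k) b) = amap (fun2 F (on_ar (legs c k) b)) Y" if "k \<in> Obj K" "b \<in> Ar (fun0 V k)" for k b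
    by (rule f.pt_simps(3)[OF lm(4)[OF that]])
   show ?thesis unfolding image_limit_iff[OF S.fcat C.fcat KV f.pt[OF Y]] d f.pt_simps(1)[OF apex]
   proof
    assume L: "limcone C K V (comp_ffunctor (chordate K) (ev (dual w) (ground T) C Y) (comp_ffunctor (chordate K) F (dgm c))) (fun0 (fun0 F (apex c)) Y)
     (%k v. at_ob (amap (fun1 F (on_ob (legs c k) v))) Y) (%k b. amap (fun2 F (on_ar (legs c k) b)) Y)"
    show "limcone C K V (comp_ffunctor (chordate K) (ev (dual w) (ground T) C Y) (comp_ffunctor (chordate K) F (dgm c))) (fun0 (fun0 F (apex c)) Y)
     (%k v. fun1 (pt F Y) (on_ob (legs c k) v)) (%k b. fun2 (pt F Y) (on_ar (legs c k) b))"
     by (rule limcone_cong[OF KV.J.two_category_axioms KV.W e0[symmetric] e1[symmetric] L])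
   next
    assume L: "limcone C K V (comp_ffunctor (chordate K) (ev (dual w) (ground T) C Y) (comp_ffunctor (chordate K) F (dgm c))) (fun0 (fun0 F (apex c)) Y)
     (%k v. fun1 (pt F Y) (on_ob (legs c k) v)) (%k b. fun2 (pt F Y) (on_ar (legs c k) b))"
    show "limcone C K V (comp_ffunctor (chordate K) (ev (dual w) (ground T) C Y) (comp_ffunctor (chordate K) F (dgm c))) (fun0 (fun0 F (apex c)) Y)
     (%k v. at_ob (amap (fun1 F (on_ob (legs c k) v))) Y) (%k b. amap (fun2 F (on_ar (legs c k) b)) Y)"
     by (rule limcone_cong[OF KV.J.two_category_axioms KV.W e0 e1 L])
   qed
  qed
  note key = this
  show ?thesis
   by (rule trans[OF image_limit_iff[OF S.fcat MT.fM KV True] trans[OF MT.Mod_limit_pointwise[OF KV(1) D \<omega> l t] ball_cong[OF refl key]]])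
 qed
 note key = this
 have "F \<in> models S \<M> \<longleftrightarrow> (\<forall>c\<in>cones S. limit_cone \<M> (image_cone F c))"
  using True by (simp only: model_iff mem_Collect_eq simp_thms)
 also have "\<dots> \<longleftrightarrow> (\<forall>c\<in>cones S. \<forall>Y\<in>Obj (ground T). limit_cone C (image_cone (pt F Y) c))"
  by (rule ball_cong[OF refl key])
 also have "\<dots> \<longleftrightarrow> (\<forall>Y\<in>Obj (ground T). \<forall>c\<in>cones S. limit_cone C (image_cone (pt F Y) c))" by blast
 also have "\<dots> \<longleftrightarrow> (\<forall>Y\<in>Obj (ground T). pt F Y \<in> models S C)"
  using f.pt by (intro ball_cong[OF refl]) (simp only: model_iff mem_Collect_eq simp_thms)
 also have "\<dots> \<longleftrightarrow> F \<in> bimodels"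
  unfolding bimodels_def mem_Collect_eq using F unfolding mem_Collect_eq by (intro iffI conjI) (assumption, assumption, assumption, elim conjE, assumption)
 finally show ?thesis .
qed

lemma Mod_Mod_eq: "Mod w S (limit_cone_sketch \<M>) = full_subfcat \<E> bimodels"
proof -
 have "models S \<M> = bimodels" using models_iff by blast
 then have "Mod w S (limit_cone_sketch \<M>) = full_subfcat (Fun w (ground S) \<M>) bimodels" by (simp add: Mod_eq[of w S \<M>])
 also have "\<dots> = full_subfcat \<E> ({M. \<forall>X\<in>Obj (ground S). fun0 M X \<in> models T C} \<inter> bimodels)"
  unfolding Mod_eq[of "dual w"] Fun_full_subfcat[OF S.fcat fA] full_subfcat_full_subfcat ..
 also have "{M. \<forall>X\<in>Obj (ground S). fun0 M X \<in> models T C} \<inter> bimodels = bimodels" by (auto simp: bimodels_def)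
 finally show ?thesis .
qed

lemma swap_models_reverse: "swap_models \<Psi> T S C"
 unfolding swap_models_def swap_models_axioms_def using swapping_reverse tight S T complete by blast

text \<open>The partial functors of the transpose are the values of \<open>F\<close>, by
  \<open>pt_swap0\<close>, so the two conditions of \<open>bimodels\<close> change places.\<close>

lemma Swap_bimodels:
 assumes "F \<in> bimodels" shows "fun0 Swap F \<in> swap_models.bimodels (dual w) T S C"
proof -
 have F: "is_ffunctor (ground S) \<A> F" "\<forall>X\<in>Obj (ground S). fun0 F X \<in> models T C" "\<forall>Y\<in>Obj (ground T). pt F Y \<in> models S C"
  using assms by (simp_all add: bimodels_def)
 interpret f: swap_object "ground S" "ground T" C w F by (rule swap_objectI[OF F(1)])
 interpret R: swap_models "dual w" \<Psi> T S C by (rule swap_models_reverse)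
 have "fun0 Swap F = swap0 F" using F(1) by (intro Swap_simps) simp
 then show ?thesis using F f.swap0 by (simp add: R.bimodels_def pt_swap0[OF F(1)])
qed

end

theorem theorem7p5:
  fixes w :: weakness
    and \<Psi> :: "('oj, 'mj, 'cj, 'x, 'y) weight set"
    and S :: "('oj, 'mj, 'cj, 'x, 'y, 'os, 'ms, 'cs) sketch"
    and T :: "('oj, 'mj, 'cj, 'x, 'y, 'ot, 'mt, 'ct) sketch"
    and C :: "('o, 'm, 'c) fcat"
  assumes "\<And>\<omega>. \<omega> \<in> \<Psi> \<Longrightarrow> tight_limit_weight \<omega>"
    and "limit_sketch \<Psi> S"
    and "limit_sketch \<Psi> T"
    and "complete_fcat \<Psi> C"
  defines "L \<equiv> Mod w S (limit_cone_sketch (Mod (dual w) T (limit_cone_sketch C)))"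
    and "R \<equiv> Mod (dual w) T (limit_cone_sketch (Mod w S (limit_cone_sketch C)))"
  shows "complete_fcat \<Psi> L \<and> complete_fcat \<Psi> R \<and> fcat_isomorphic L R"
proof -
 have "swapping (ground S) (ground T) C"
  using assms(2-4) by (simp add: swapping_def limit_sketch_def is_sketch_def complete_fcat_def)
 then have M: "swap_models \<Psi> S T C" unfolding swap_models_def swap_models_axioms_def using assms(1-4) by blast
 interpret A: swap_models w \<Psi> S T C by (rule M)
 \<comment> \<open>The mirrored instance describes the other side; \<open>dual (dual w) = w\<close>
   identifies its functor categories with those of \<open>A\<close>.\<close>
 interpret B: swap_models "dual w" \<Psi> T S C by (rule A.swap_models_reverse)
 have L: "L = full_subfcat A.\<E> A.bimodels" unfolding L_def by (rule A.Mod_Mod_eq)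
 have R: "R = full_subfcat A.\<D> B.bimodels" unfolding R_def using B.Mod_Mod_eq by simp
 have "fcat_isomorphic L R" unfolding L R
 proof (rule fcat_isomorphic_full_subfcat[OF A.fE A.fD A.is_ffunctor_Swap])
  show "is_ffunctor A.\<D> A.\<E> B.Swap" using B.is_ffunctor_Swap by simp
  show "fun0 B.Swap (fun0 A.Swap X) = X" if "X \<in> Obj A.\<E>" for X by (rule A.Swap_Swap(1)[OF that])
  show "fun1 B.Swap (fun1 A.Swap X) = X" if "X \<in> Mor A.\<E>" for X by (rule A.Swap_Swap(2)[OF that])
  show "fun2 B.Swap (fun2 A.Swap X) = X" if "X \<in> Cell A.\<E>" for X by (rule A.Swap_Swap(3)[OF that])
  show "fun0 A.Swap (fun0 B.Swap X) = X" if "X \<in> Obj A.\<D>" for X using B.Swap_Swap(1)[of X] that by simp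
  show "fun1 A.Swap (fun1 B.Swap X) = X" if "X \<in> Mor A.\<D>" for X using B.Swap_Swap(2)[of X] that by simp
  show "fun2 A.Swap (fun2 B.Swap X) = X" if "X \<in> Cell A.\<D>" for X using B.Swap_Swap(3)[of X] that by simp
  show "fun0 A.Swap X \<in> B.bimodels" if "X \<in> A.bimodels" for X by (rule A.Swap_bimodels[OF that])
  show "fun0 B.Swap X \<in> A.bimodels" if "X \<in> B.bimodels" for X using B.Swap_bimodels[OF that] by simp
 qed
 moreover have "complete_fcat \<Psi> L" unfolding L_def by (rule A.complete_Mod2(2))
 moreover have "complete_fcat \<Psi> R" unfolding R_def using B.complete_Mod2(2) by simp
 ultimately show ?thesis by blast
qed

end
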